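(* Any stratified submanifold (germ at $0$) $N\in(U_7)$ of the symplectic space $(\mathbb R^{2n},\omega_0=\sum_{i=1}^n dp_i\wedge dq_i)$ with canonical coordinates $(p_1,q_1,\dots,p_n,q_n)$ is symplectically equivalent to one and only one of the following curves $B_1\cup B_2$ (branches written in the coordinates $(p_1,q_1,p_2,q_2,\dots)$; omitted coordinates are $0$), and the indices of isotropy $ind$, $ind_2$ and Lagrangian tangency orders $Lt$, $L_2$ of $N$ are as stated. - $(U_7)^0$ ($2n\ge4$): $B_1:(0,0,t,0,0,\dots)$, $B_2:(t^4,-t^3,t^5,-c_1t^3-c_2t^4,0,\dots)$. $ind=0$, $ind_2=0$, $L_2=4$; $Lt=3$ if $c_1\ne0$ and $Lt=4$ if $c_1=0$. - $(U_7)^1$ ($2n\ge4$): $B_1:(t,0,0,c_1t,0,\dots)$, $B_2:(t^5,\mp t^3,t^4,c_1t^5+\frac{c_2}{2}t^6,0,\dots)$. $ind=0$, $ind_2=0$, $Lt=3$, $L_2=5$. - $(U_7)^2$ ($2n\ge4$): $B_1:(0,t,0,0,0,\dots)$, $B_2:(t^4,t^5,-c_1t^7+\frac{c_2}{2}t^8,-t^3,0,\dots)$. $ind=0$, $ind_2=0$, $Lt=4$, $L_2=5$. - $(U_7)^3$ ($2n\ge6$): $B_1:(0,0,t,0,0,0,0,\dots)$, $B_2:(t^4,-ct^7,t^5,0,-t^3,\pm t^7,0,\dots)$. $ind=1$, $ind_2=1$, $Lt=7$, $L_2=7$. - $(U_7)^4$ ($2n\ge6$): $B_1:(0,0,t,0,0,0,0,\dots)$,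 $B_2:(t^4,-\frac c3t^9,t^5,0,-t^3,-\frac12t^8,0,\dots)$. $ind=1$, $ind_2=1$, $Lt=8$, $L_2=8$. - $(U_7)^5$ ($2n\ge6$): $B_1:(0,0,t,0,0,0,0,\dots)$, $B_2:(t^4,-\frac c2t^{10},t^5,0,-t^3,-t^{10},0,\dots)$. $ind=2$, $ind_2=\infty$, $Lt=10$, $L_2=\infty$. - $(U_7)^6$ ($2n\ge6$): $B_1:(0,0,t,0,0,0,0,\dots)$, $B_2:(t^4,0,t^5,0,-t^3,\pm\frac12t^{11},0,\dots)$. $ind=2$, $ind_2=\infty$, $Lt=11$, $L_2=\infty$. - $(U_7)^7$ ($2n\ge6$): $B_1:(0,0,t,0,0,0,0,\dots)$, $B_2:(t^4,0,t^5,0,-t^3,0,0,\dots)$. $ind=ind_2=Lt=L_2=\infty$.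
   Context: $U_7=\{x\in\mathbb R^{2n}: x_1^2+x_2x_3=x_1x_2+x_3^3=x_{\ge4}=0\}$, $2n\ge4$; $(U_7)$ is the class of germs at $0$ of subsets of the symplectic space $\mathbb R^{2n}$ that are images of $U_7$ under a germ of a diffeomorphism. Such $N$ is a union of a smooth branch $B_1$ and a singular branch $B_2$. Two germs $N_1,N_2$ are symplectically equivalent if a germ of a symplectomorphism maps $N_1$ onto $N_2$. Here $c,c_1,c_2\in\mathbb R$ are parameters; "one and only one" refers to the eight families (indexed by the class $(U_7)^i$). Index of isotropy: $ind(N)$ is the maximal order of vanishing at $0$ of the $2$-forms $\omega|_{TM}$ over all smooth submanifolds $M$ containing $N$ ($\infty$ if $N$ is contained in a smooth Lagrangian submanifold). $ind=ind(N)$, $ind_2=ind(B_2)$. Lagrangian tangency order: if $H_1=\dots=H_n=0$ are regular equations of a smooth Lagrangian submanifold germ $L$, the tangency order $t(f,L)$ of a curve $f$ to $L$ is the minimum of the orders of vanishing at $0$ of $H_1\circ f,\dots,H_n\circ f$. $Lt=\max_L\min\{t(B_1,L),t(B_2,L)\}$ and $L_2=\max_L t(B_2,L)$, the maxima being over all smooth Lagrangian submanifold germs $L$. *)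

theory Defs
  imports "HOL-Analysis.Analysis" "HOL-Library.Extended_Nat"
begin
fun dir_derivs :: "'a list \<Rightarrow> ('a::real_normed_vector \<Rightarrow> 'b::real_normed_vector) \<Rightarrow> 'a \<Rightarrow> 'b" where
  "dir_derivs [] g = g"
| "dir_derivs (v # vs) g = (\<lambda>x. frechet_derivative (dir_derivs vs g) (at x) v)"

primrec Ck_on :: "nat \<Rightarrow> 'a::real_normed_vector set \<Rightarrow> ('a \<Rightarrow> 'b::real_normed_vector) \<Rightarrow> bool" where
  "Ck_on 0 U g \<longleftrightarrow> continuous_on U g"
| "Ck_on (Suc k) U g \<longleftrightarrow>
     (\<forall>x\<in>U. g differentiable (at x)) \<and>
     (\<forall>v. Ck_on k U (\<lambda>x. frechet_derivative g (at x) v))"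

text \<open>Only used for open \<open>U\<close>.\<close>
definition smooth_on :: "'a::real_normed_vector set \<Rightarrow> ('a \<Rightarrow> 'b::real_normed_vector) \<Rightarrow> bool" where
  "smooth_on U g \<longleftrightarrow> (\<forall>k. Ck_on k U g)"

text \<open>
  Order of vanishing at \<open>0\<close> of \<open>g\<close> in the coordinate directions \<open>D\<close>: the least order of a
  nonzero iterated partial derivative (\<open>\<infinity>\<close> if they all vanish).
\<close>
definition vanishing_order :: "'a::real_normed_vector set \<Rightarrow> ('a \<Rightarrow> real) \<Rightarrow> enat" where
  "vanishing_order D g = Inf {enat (length vs) | vs. set vs \<subseteq> D \<and> dir_derivs vs g 0 \<noteq> 0}"

text \<open>A germ at \<open>0\<close> of a subset is represented by any subset having that germ.\<close>
definition germ_eq :: "'a::real_normed_vector set \<Rightarrow> 'a set \<Rightarrow> bool" where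
  "germ_eq A B \<longleftrightarrow> (\<forall>\<^sub>F x in nhds 0. x \<in> A \<longleftrightarrow> x \<in> B)"

definition germ_subset :: "'a::real_normed_vector set \<Rightarrow> 'a set \<Rightarrow> bool" where
  "germ_subset A B \<longleftrightarrow> (\<forall>\<^sub>F x in nhds 0. x \<in> A \<longrightarrow> x \<in> B)"

text \<open>
  \<open>\<Phi>\<close> restricted to \<open>U\<close> represents a germ of a diffeomorphism fixing \<open>0\<close>; its values outside \<open>U\<close>
  are irrelevant, so images are always taken of subsets of \<open>U\<close>.
\<close>
definition diffeo_germ :: "'a::real_normed_vector set \<Rightarrow> ('a \<Rightarrow> 'a) \<Rightarrow> bool" where
  "diffeo_germ U \<Phi> \<longleftrightarrow>
     open U \<and> 0 \<in> U \<and> \<Phi> 0 = 0 \<and> inj_on \<Phi> U \<and> open (\<Phi> ` U) \<and>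
     smooth_on U \<Phi> \<and> smooth_on (\<Phi> ` U) (inv_into U \<Phi>)"

text \<open>
  The space is \<open>real ^ 'm\<close> with \<open>CARD('m) = 2n\<close>. A bijection \<open>e\<close> from \<open>{1..2n}\<close> onto \<open>'m\<close> numbers
  the coordinates: \<open>x\<^sub>k\<close> is \<open>x $ e k\<close>, and the list \<open>(x\<^sub>1, x\<^sub>2, x\<^sub>3, x\<^sub>4, \<dots>)\<close> is the list
  \<open>(p\<^sub>1, q\<^sub>1, p\<^sub>2, q\<^sub>2, \<dots>)\<close> of canonical coordinates.
\<close>

definition coords :: "(nat \<Rightarrow> 'm::finite) \<Rightarrow> real list \<Rightarrow> real ^ 'm" where
  "coords e xs = (\<Sum>k<length xs. (xs ! k) *\<^sub>R axis (e (Suc k)) 1)"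

definition omega :: "(nat \<Rightarrow> 'm::finite) \<Rightarrow> real ^ 'm \<Rightarrow> real ^ 'm \<Rightarrow> real" where
  "omega e u v = (\<Sum>i = 1..CARD('m) div 2.
     u $ e (2*i - 1) * v $ e (2*i) - u $ e (2*i) * v $ e (2*i - 1))"

definition symplecto_germ :: "(nat \<Rightarrow> 'm::finite) \<Rightarrow> (real ^ 'm) set \<Rightarrow> (real ^ 'm \<Rightarrow> real ^ 'm) \<Rightarrow> bool" where
  "symplecto_germ e U \<Phi> \<longleftrightarrow> diffeo_germ U \<Phi> \<and>
     (\<forall>x\<in>U. \<forall>u v. omega e (frechet_derivative \<Phi> (at x) u) (frechet_derivative \<Phi> (at x) v)
                    = omega e u v)"

definition symp_equiv :: "(nat \<Rightarrow> 'm::finite) \<Rightarrow> (real ^ 'm) set \<Rightarrow> (real ^ 'm) set \<Rightarrow> bool" where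
  "symp_equiv e N1 N2 \<longleftrightarrow> (\<exists>U \<Phi>. symplecto_germ e U \<Phi> \<and> germ_eq (\<Phi> ` (N1 \<inter> U)) N2)"

definition coord_subspace :: "'m::finite set \<Rightarrow> (real ^ 'm) set" where
  "coord_subspace S = {x. \<forall>j. j \<notin> S \<longrightarrow> x $ j = 0}"

text \<open>
  A smooth submanifold germ of dimension \<open>card S\<close> is the image of \<open>coord_subspace S\<close> under a germ of
  a diffeomorphism \<open>\<Theta>\<close>; the inverse of \<open>\<Theta>\<close> is a slice chart.
\<close>
definition slice_chart :: "(real ^ 'm) set \<Rightarrow> (real ^ 'm \<Rightarrow> real ^ 'm) \<Rightarrow> 'm::finite set \<Rightarrow> (real ^ 'm) set \<Rightarrow> bool" where
  "slice_chart U \<Theta> S M \<longleftrightarrow> diffeo_germ U \<Theta> \<and> germ_eq M (\<Theta> ` (coord_subspace S \<inter> U))"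

text \<open>
  For \<open>a, b \<in> S\<close> and \<open>y\<close> in \<open>coord_subspace S\<close> this is the coefficient of \<open>\<omega>|\<^bsub>TM\<^esub>\<close>, in the coordinates
  of \<open>M\<close> given by \<open>\<Theta>\<close>, on the coordinate vectors \<open>a\<close> and \<open>b\<close>.
\<close>
definition form_coeff :: "(nat \<Rightarrow> 'm::finite) \<Rightarrow> (real ^ 'm \<Rightarrow> real ^ 'm) \<Rightarrow> 'm \<Rightarrow> 'm \<Rightarrow> real ^ 'm \<Rightarrow> real" where
  "form_coeff e \<Theta> a b y =
     omega e (frechet_derivative \<Theta> (at y) (axis a 1)) (frechet_derivative \<Theta> (at y) (axis b 1))"

definition form_order :: "(nat \<Rightarrow> 'm::finite) \<Rightarrow> (real ^ 'm \<Rightarrow> real ^ 'm) \<Rightarrow> 'm set \<Rightarrow> enat" where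
  "form_order e \<Theta> S =
     (INF a\<in>S. INF b\<in>S. vanishing_order ((\<lambda>j. axis j 1) ` S) (form_coeff e \<Theta> a b))"

definition lagrangian_germ :: "(nat \<Rightarrow> 'm::finite) \<Rightarrow> (real ^ 'm) set \<Rightarrow> bool" where
  "lagrangian_germ e L \<longleftrightarrow> (\<exists>U \<Theta> S. slice_chart U \<Theta> S L \<and> card S = CARD('m) div 2 \<and>
     (\<forall>y \<in> coord_subspace S \<inter> U. \<forall>a\<in>S. \<forall>b\<in>S. form_coeff e \<Theta> a b y = 0))"

definition isotropy_index :: "(nat \<Rightarrow> 'm::finite) \<Rightarrow> (real ^ 'm) set \<Rightarrow> enat" where
  "isotropy_index e N =
     (if \<exists>L. lagrangian_germ e L \<and> germ_subset N L then \<infinity>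
      else (GREATEST k. \<exists>M U \<Theta> S. slice_chart U \<Theta> S M \<and> germ_subset N M \<and> k = form_order e \<Theta> S))"

text \<open>\<open>H 1 = \<dots> = H m = 0\<close> are regular equations of the germ at \<open>0\<close> of \<open>L\<close>.\<close>
definition regular_equations :: "nat \<Rightarrow> (nat \<Rightarrow> 'a::real_normed_vector \<Rightarrow> real) \<Rightarrow> 'a set \<Rightarrow> bool" where
  "regular_equations m H L \<longleftrightarrow>
     (\<exists>U. open U \<and> 0 \<in> U \<and> (\<forall>i\<in>{1..m}. smooth_on U (H i))) \<and>
     germ_eq L {x. \<forall>i\<in>{1..m}. H i x = 0} \<and>
     (\<forall>c :: nat \<Rightarrow> real. (\<forall>v. (\<Sum>i = 1..m. c i * frechet_derivative (H i) (at 0) v) = 0)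
         \<longrightarrow> (\<forall>i\<in>{1..m}. c i = 0))"

definition lagrangian_equations :: "(nat \<Rightarrow> 'm::finite) \<Rightarrow> (nat \<Rightarrow> real ^ 'm \<Rightarrow> real) \<Rightarrow> bool" where
  "lagrangian_equations e H \<longleftrightarrow> (\<exists>L. lagrangian_germ e L \<and> regular_equations (CARD('m) div 2) H L)"

definition tangency_order :: "(real \<Rightarrow> real ^ 'm::finite) \<Rightarrow> (nat \<Rightarrow> real ^ 'm \<Rightarrow> real) \<Rightarrow> enat" where
  "tangency_order f H = (INF i\<in>{1..CARD('m) div 2}. vanishing_order {1} (\<lambda>t. H i (f t)))"

text \<open>
  The tangency order does not depend on the choice of regular equations of a Lagrangian germ, so the
  maxima over Lagrangian germs are taken over systems of regular equations of such germs.
\<close>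
definition Lt_order :: "(nat \<Rightarrow> 'm::finite) \<Rightarrow> (real \<Rightarrow> real ^ 'm) \<Rightarrow> (real \<Rightarrow> real ^ 'm) \<Rightarrow> enat" where
  "Lt_order e f1 f2 =
     (GREATEST k. \<exists>H. lagrangian_equations e H \<and> k = min (tangency_order f1 H) (tangency_order f2 H))"

definition L_order :: "(nat \<Rightarrow> 'm::finite) \<Rightarrow> (real \<Rightarrow> real ^ 'm) \<Rightarrow> enat" where
  "L_order e f = (GREATEST k. \<exists>H. lagrangian_equations e H \<and> k = tangency_order f H)"

definition U7 :: "(nat \<Rightarrow> 'm::finite) \<Rightarrow> (real ^ 'm) set" where
  "U7 e = {x. (x $ e 1)^2 + x $ e 2 * x $ e 3 = 0 \<and> x $ e 1 * x $ e 2 + (x $ e 3)^3 = 0 \<and>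
              (\<forall>k\<in>{4..CARD('m)}. x $ e k = 0)}"

definition in_U7_class :: "(nat \<Rightarrow> 'm::finite) \<Rightarrow> (real ^ 'm) set \<Rightarrow> bool" where
  "in_U7_class e N \<longleftrightarrow> (\<exists>U \<Phi>. diffeo_germ U \<Phi> \<and> germ_eq N (\<Phi> ` (U7 e \<inter> U)))"

text \<open>The smooth and the singular branch of \<open>U7\<close>; see \<open>U7_eq_branches\<close> below.\<close>
definition U7_branch1 :: "(nat \<Rightarrow> 'm::finite) \<Rightarrow> real \<Rightarrow> real ^ 'm" where
  "U7_branch1 e t = coords e [0, t, 0]"

definition U7_branch2 :: "(nat \<Rightarrow> 'm::finite) \<Rightarrow> real \<Rightarrow> real ^ 'm" where
  "U7_branch2 e t = coords e [t^4, t^5, - (t^3)]"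

text \<open>
  \<open>B1\<close>, \<open>B2\<close> are the branches of \<open>N\<close> as set germs and \<open>f1\<close>, \<open>f2\<close> parametrise them. The
  parametrisations are those transported from \<open>U7\<close>: an arbitrary smooth map onto the branch, such as
  \<open>t \<mapsto> f2 (t^3)\<close>, would change tangency orders.
\<close>
definition U7_branches :: "(nat \<Rightarrow> 'm::finite) \<Rightarrow> (real ^ 'm) set \<Rightarrow>
    (real ^ 'm) set \<Rightarrow> (real \<Rightarrow> real ^ 'm) \<Rightarrow> (real ^ 'm) set \<Rightarrow> (real \<Rightarrow> real ^ 'm) \<Rightarrow> bool" where
  "U7_branches e N B1 f1 B2 f2 \<longleftrightarrow> (\<exists>U \<Phi>. diffeo_germ U \<Phi> \<and>
     germ_eq N (\<Phi> ` (U7 e \<inter> U)) \<and>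
     germ_eq B1 (\<Phi> ` (range (U7_branch1 e) \<inter> U)) \<and>
     germ_eq B2 (\<Phi> ` (range (U7_branch2 e) \<inter> U)) \<and>
     (\<forall>\<^sub>F t in nhds 0. f1 t = \<Phi> (U7_branch1 e t)) \<and>
     (\<forall>\<^sub>F t in nhds 0. f2 t = \<Phi> (U7_branch2 e t)))"

lemma coords3_nth:
  assumes "bij_betw e {1..CARD('m)} (UNIV :: 'm::finite set)" "CARD('m) \<ge> 4" "k \<in> {1..CARD('m)}"
  shows "coords e [a, b, c] $ e k = (if k = 1 then a else if k = 2 then b else if k = 3 then c else 0)"
proof -
  have "e i = e k \<longleftrightarrow> i = k" if "i \<in> {1..CARD('m)}" for i
    using assms that by (meson bij_betw_imp_inj_on inj_on_eq_iff)
  from this[of 1] this[of 2] this[of 3] show ?thesis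
    using assms(2) by (auto simp: coords_def axis_def numeral_2_eq_2 numeral_3_eq_3)
qed

lemma U7_eq_branches:
  fixes e :: "nat \<Rightarrow> 'm::finite"
  assumes e: "bij_betw e {1..CARD('m)} UNIV" and card: "CARD('m) \<ge> 4"
  shows "U7 e = range (U7_branch1 e) \<union> range (U7_branch2 e)"
proof -
  have eqI: "x = coords e [x $ e 1, x $ e 2, x $ e 3]" if "\<forall>k\<in>{4..CARD('m)}. x $ e k = 0" for x
  proof (rule vec_eq_iff[THEN iffD2], rule allI)
    fix j
    obtain k where k: "k \<in> {1..CARD('m)}" "j = e k"
      using e by (metis UNIV_I bij_betw_imp_surj_on imageE)
    then show "x $ j = coords e [x $ e 1, x $ e 2, x $ e 3] $ j"
      using that coords3_nth[OF e card k(1), of "x $ e 1" "x $ e 2" "x $ e 3"]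
      by (cases "k = 1"; cases "k = 2"; cases "k = 3") auto
  qed
  have "x \<in> range (U7_branch1 e) \<union> range (U7_branch2 e)" if x: "x \<in> U7 e" for x
  proof -
    define a b c where "a = x $ e 1" and "b = x $ e 2" and "c = x $ e 3"
    have 1: "a^2 + b * c = 0" and 2: "a * b + c^3 = 0" and 3: "x = coords e [a, b, c]"
      using x eqI unfolding U7_def a_def b_def c_def by auto
    show ?thesis
    proof (cases "c = 0")
      case True
      then have "x = U7_branch1 e b" using 1 3 by (simp add: U7_branch1_def)
      then show ?thesis by auto
    next
      case False
      define t where "t = root 3 (- c)"
      have c: "c = - (t^3)" by (simp add: t_def odd_real_root_pow)
      have "t \<noteq> 0" using False c by auto
      have "a^3 * (-1) = - (c^4)" using 1 2 by algebra
      then have "a^3 = (t^4)^3" by (simp add: c power_mult[symmetric])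
      then have a: "a = t^4" using odd_real_root_power_cancel[of 3 a] odd_real_root_power_cancel[of 3 "t^4"] by simp
      have "b * t^3 = t^5 * t^3" using 1 a c by (simp add: power_add[symmetric] power_mult[symmetric])
      then have "b = t^5" using \<open>t \<noteq> 0\<close> by (metis mult_right_cancel power_not_zero)
      then have "x = U7_branch2 e t" using 3 a c by (simp add: U7_branch2_def)
      then show ?thesis by auto
    qed
  qed
  moreover have "U7_branch1 e t \<in> U7 e" "U7_branch2 e t \<in> U7 e" for t
    using card coords3_nth[OF e card]
    by (auto simp: U7_def U7_branch1_def U7_branch2_def power_mult[symmetric] power_add[symmetric])
  ultimately show ?thesis by blast
qed

datatype U7_type = U7_0 | U7_1 | U7_2 | U7_3 | U7_4 | U7_5 | U7_6 | U7_7

text \<open>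
  The least dimension \<open>2n\<close> in which the family is defined; the normal forms below use this many
  coordinates.
\<close>
fun min_dim :: "U7_type \<Rightarrow> nat" where
  "min_dim U7_0 = 4" | "min_dim U7_1 = 4" | "min_dim U7_2 = 4"
| "min_dim U7_3 = 6" | "min_dim U7_4 = 6" | "min_dim U7_5 = 6" | "min_dim U7_6 = 6" | "min_dim U7_7 = 6"

text \<open>
  \<open>s\<close> ranges over \<open>{1, -1}\<close>, the value \<open>1\<close> giving the upper sign of \<open>\<plusminus>\<close> or \<open>\<mp>\<close>. A single parameter
  \<open>c\<close> is \<open>c1\<close>; a family ignores the parameters that it does not have.
\<close>
fun nf_branch1 :: "U7_type \<Rightarrow> real \<Rightarrow> real \<Rightarrow> real \<Rightarrow> real \<Rightarrow> real list" where
  "nf_branch1 U7_0 s c1 c2 t = [0, 0, t, 0]"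
| "nf_branch1 U7_1 s c1 c2 t = [t, 0, 0, c1 * t]"
| "nf_branch1 U7_2 s c1 c2 t = [0, t, 0, 0]"
| "nf_branch1 U7_3 s c1 c2 t = [0, 0, t, 0, 0, 0]"
| "nf_branch1 U7_4 s c1 c2 t = [0, 0, t, 0, 0, 0]"
| "nf_branch1 U7_5 s c1 c2 t = [0, 0, t, 0, 0, 0]"
| "nf_branch1 U7_6 s c1 c2 t = [0, 0, t, 0, 0, 0]"
| "nf_branch1 U7_7 s c1 c2 t = [0, 0, t, 0, 0, 0]"

fun nf_branch2 :: "U7_type \<Rightarrow> real \<Rightarrow> real \<Rightarrow> real \<Rightarrow> real \<Rightarrow> real list" where
  "nf_branch2 U7_0 s c1 c2 t = [t^4, - (t^3), t^5, - c1 * t^3 - c2 * t^4]"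
| "nf_branch2 U7_1 s c1 c2 t = [t^5, - s * t^3, t^4, c1 * t^5 + c2 / 2 * t^6]"
| "nf_branch2 U7_2 s c1 c2 t = [t^4, t^5, - c1 * t^7 + c2 / 2 * t^8, - (t^3)]"
| "nf_branch2 U7_3 s c1 c2 t = [t^4, - c1 * t^7, t^5, 0, - (t^3), s * t^7]"
| "nf_branch2 U7_4 s c1 c2 t = [t^4, - (c1 / 3) * t^9, t^5, 0, - (t^3), - (1/2) * t^8]"
| "nf_branch2 U7_5 s c1 c2 t = [t^4, - (c1 / 2) * t^10, t^5, 0, - (t^3), - (t^10)]"
| "nf_branch2 U7_6 s c1 c2 t = [t^4, 0, t^5, 0, - (t^3), s * (1/2) * t^11]"
| "nf_branch2 U7_7 s c1 c2 t = [t^4, 0, t^5, 0, - (t^3), 0]"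

definition normal_form :: "(nat \<Rightarrow> 'm::finite) \<Rightarrow> U7_type \<Rightarrow> real \<Rightarrow> real \<Rightarrow> real \<Rightarrow> (real ^ 'm) set" where
  "normal_form e i s c1 c2 =
     range (\<lambda>t. coords e (nf_branch1 i s c1 c2 t)) \<union> range (\<lambda>t. coords e (nf_branch2 i s c1 c2 t))"

end

theory Submission
  imports Defs "HOL-Computational_Algebra.Polynomial"
begin

text \<open>
  A germ of the class is the image of the curve \<open>C7\<close> in \<open>\<real>\<^sup>3\<close> under an immersion \<open>j\<close>, and it is studied
  through the primitive \<open>lam j = \<omega>(j, dj) / 2\<close> of \<open>j\<^sup>*\<omega>\<close>. Two germs are symplectically equivalent as soon as
  their primitives differ along \<open>C7\<close> by a gradient: after a linear symplectic correction that gradient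
  gives a generating function of the equivalence, so no flows are needed. With the weights \<open>(4, 5, 3)\<close> the curve is
  quasihomogeneous, and modulo gradients every primitive is a combination of seven contractions of weights
  \<open>7, 8, 9, 10, 11, 13, 14\<close>; the substitutions \<open>x \<mapsto> (l\<^sup>4 x\<^sub>1, l\<^sup>5 x\<^sub>2, l\<^sup>3 x\<^sub>3)\<close> preserve \<open>C7\<close> and bring the seven
  coefficients into one of the eight families.

  Conversely, the Taylor coefficients of a gradient along the two branches satisfy one linear relation for each of
  these weights. If a Lagrangian submanifold is tangent to the branches to high order, or if \<open>\<omega>\<close> vanishes
  to high order on a submanifold containing them, then \<open>lam j\<close> is a gradient up to an error of high order, and the
  coefficients of low weight vanish. This bounds the invariants from above; coordinate planes moved by a shear
  \<open>q \<mapsto> q + A(p)\<close> attain the bounds. The invariants tell the eight families apart.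
\<close>

section \<open>Smooth maps and germs of diffeomorphisms\<close>

text \<open>Primitives are compared at points of the curve but in all directions of R^3: on tangent
  vectors alone the comparison would say nothing, because every 1-form on a parametrized branch is
  exact. The quotient by gradients is finite-dimensional because the equations
  \<open>x1^2 + x2 x3\<close> and \<open>x1 x2 + x3^3\<close>, of weights 8 and 9, act on it: if
  \<open>P\<close> vanishes on the curve, then \<open>h dP = d(h P)\<close> there for every smooth
  \<open>h\<close>. Weight 12 drops out of the list because of \<open>x1^3 - x3^4\<close>, which
  also vanishes on the curve.

  The obstacle in the converse direction is that the invariants belong to the germ and its
  parametrized branches, whereas the coefficients belong to one immersion. Two immersions onto the
  same germ differ by a smooth transition map preserving the curve. It has to be shown that this map
  preserves each branch and changes the parameters at most linearly; only then do orders of contact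
  carry over.

  The coordinates of the singular branch are \<open>O(t^3)\<close>, so an error of order
  \<open>k\<close> in R^3 has order \<open>3 k\<close> on it and only \<open>k\<close> on the smooth
  branch. The invariants are read off from these two scales.\<close>

abbreviation fd :: "('a::real_normed_vector \<Rightarrow> 'b::real_normed_vector) \<Rightarrow> 'a \<Rightarrow> 'a \<Rightarrow> 'b" where
  "fd f x \<equiv> frechet_derivative f (at x)"

lemma fd_eq: "(f has_derivative f') (at x) \<Longrightarrow> fd f x = f'"
  by (rule frechet_derivative_at[symmetric])

lemma fd_works: "f differentiable (at x) \<Longrightarrow> (f has_derivative fd f x) (at x)"
  by (simp add: frechet_derivative_works)

lemma fd_cong_open:
  assumes "open U" "x \<in> U" "\<And>y. y \<in> U \<Longrightarrow> f y = g y"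
  shows "fd f x = fd g x"
proof -
  have "(f has_derivative h) (at x) \<longleftrightarrow> (g has_derivative h) (at x)" for h
    by (metis assms has_derivative_transform_within_open)
  then show ?thesis unfolding frechet_derivative_def by simp
qed

lemma fd_cong_eventually:
  assumes "\<forall>\<^sub>F y in nhds x. f y = g y"
  shows "fd f x = fd g x"
  using assms fd_cong_open unfolding eventually_nhds by metis

lemma differentiable_cong_open:
  assumes "open U" "x \<in> U" "\<And>y. y \<in> U \<Longrightarrow> f y = g y"
  shows "f differentiable (at x) \<longleftrightarrow> g differentiable (at x)"
  unfolding differentiable_def by (metis assms has_derivative_transform_within_open)

lemma Ck_on_cong:
  assumes "open U" "\<And>x. x \<in> U \<Longrightarrow> f x = g x"
  shows "Ck_on k U f \<longleftrightarrow> Ck_on k U g"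
  using assms
proof (induction k arbitrary: f g)
  case 0
  then show ?case by (simp cong: continuous_on_cong)
next
  case (Suc k)
  have "fd f x = fd g x" if "x \<in> U" for x
    by (rule fd_cong_open[OF Suc.prems(1) that Suc.prems(2)])
  then have "Ck_on k U (\<lambda>x. fd f x v) \<longleftrightarrow> Ck_on k U (\<lambda>x. fd g x v)" for v
    using Suc.prems(1) by (intro Suc.IH) auto
  moreover have "f differentiable (at x) \<longleftrightarrow> g differentiable (at x)" if "x \<in> U" for x
    using differentiable_cong_open[OF Suc.prems(1) that] Suc.prems(2) by blast
  ultimately show ?case by simp
qed

lemma smooth_on_cong:
  assumes "open U" "\<And>x. x \<in> U \<Longrightarrow> f x = g x"
  shows "smooth_on U f \<longleftrightarrow> smooth_on U g"
  using Ck_on_cong[OF assms] by (simp add: smooth_on_def)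

lemma Ck_on_subset: "Ck_on k U f \<Longrightarrow> V \<subseteq> U \<Longrightarrow> Ck_on k V f"
  by (induction k arbitrary: f) (auto intro: continuous_on_subset)

lemma smooth_on_subset: "smooth_on U f \<Longrightarrow> V \<subseteq> U \<Longrightarrow> smooth_on V f"
  unfolding smooth_on_def using Ck_on_subset by blast

lemma Ck_on_SucD: "Ck_on (Suc k) U f \<Longrightarrow> Ck_on k U f"
proof (induction k arbitrary: f)
  case 0
  then show ?case
    by (auto intro!: continuous_at_imp_continuous_on differentiable_imp_continuous_within)
next
  case (Suc k)
  then show ?case by (metis Ck_on.simps(2))
qed

text \<open>Removes the index \<open>k\<close>, so that later proofs can take one derivative at a
  time without counting.\<close>

lemma smooth_on_unfold:
  "smooth_on U f \<longleftrightarrow> (\<forall>x\<in>U. f differentiable (at x)) \<and> (\<forall>v. smooth_on U (\<lambda>x. fd f x v))"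
proof -
  have "smooth_on U f \<longleftrightarrow> (\<forall>k. Ck_on (Suc k) U f)"
    unfolding smooth_on_def using Ck_on_SucD by blast
  then show ?thesis by (auto simp: smooth_on_def)
qed

lemma smooth_on_differentiable: "smooth_on U f \<Longrightarrow> x \<in> U \<Longrightarrow> f differentiable (at x)"
  using smooth_on_unfold by blast

lemma smooth_on_fd: "smooth_on U f \<Longrightarrow> smooth_on U (\<lambda>x. fd f x v)"
  using smooth_on_unfold by blast

lemma smooth_on_has_derivative: "smooth_on U f \<Longrightarrow> x \<in> U \<Longrightarrow> (f has_derivative fd f x) (at x)"
  using smooth_on_differentiable fd_works by blast

lemma smooth_on_continuous: "smooth_on U f \<Longrightarrow> continuous_on U f"
  by (metis Ck_on.simps(1) smooth_on_def)

lemma linear_fd: "smooth_on U f \<Longrightarrow> x \<in> U \<Longrightarrow> linear (fd f x)"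
  using smooth_on_differentiable linear_frechet_derivative by blast

section \<open>Algebra and composition of smooth functions\<close>

lemma Ck_on_const [simp]: "Ck_on k U (\<lambda>x. c)"
  by (induction k arbitrary: c) auto

lemma smooth_on_const [simp, intro]: "smooth_on U (\<lambda>x. c)"
  by (simp add: smooth_on_def)

lemma Ck_on_linear_fun:
  assumes "bounded_linear L" shows "Ck_on k U L"
proof (cases k)
  case 0
  then show ?thesis using assms linear_continuous_on by auto
next
  case (Suc k')
  have "fd L x = L" for x using assms bounded_linear_imp_has_derivative fd_eq by blast
  then show ?thesis using Suc assms bounded_linear_imp_differentiable by auto
qed

lemma smooth_on_bounded_linear: "bounded_linear L \<Longrightarrow> smooth_on U L"
  by (simp add: Ck_on_linear_fun smooth_on_def)

lemma Ck_on_bounded_linear_compose: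
  assumes L: "bounded_linear L" and "open U" "Ck_on k U f"
  shows "Ck_on k U (\<lambda>x. L (f x))"
  using assms(3)
proof (induction k arbitrary: f)
  case 0
  then show ?case using L by (simp add: bounded_linear.continuous_on)
next
  case (Suc k)
  have d: "((\<lambda>x. L (f x)) has_derivative (\<lambda>v. L (fd f x v))) (at x)" if "x \<in> U" for x
    using Suc.prems that by (auto intro!: bounded_linear.has_derivative[OF L] fd_works)
  have "Ck_on k U (\<lambda>x. fd (\<lambda>x. L (f x)) x v) \<longleftrightarrow> Ck_on k U (\<lambda>x. L (fd f x v))" for v
    by (rule Ck_on_cong[OF assms(2)]) (simp add: fd_eq[OF d])
  then show ?case using d Suc by (auto simp: differentiable_def)
qed

lemma Ck_on_add:
  assumes "open U" "Ck_on k U f" "Ck_on k U g"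
  shows "Ck_on k U (\<lambda>x. f x + g x)"
  using assms(2,3)
proof (induction k arbitrary: f g)
  case 0
  then show ?case by (simp add: continuous_on_add)
next
  case (Suc k)
  have d: "((\<lambda>x. f x + g x) has_derivative (\<lambda>v. fd f x v + fd g x v)) (at x)" if "x \<in> U" for x
    using Suc.prems that by (auto intro!: has_derivative_add fd_works)
  have "Ck_on k U (\<lambda>x. fd (\<lambda>x. f x + g x) x v) \<longleftrightarrow> Ck_on k U (\<lambda>x. fd f x v + fd g x v)" for v
    by (rule Ck_on_cong[OF assms(1)]) (simp add: fd_eq[OF d])
  then show ?case using d Suc by (auto simp: differentiable_def)
qed

lemma Ck_on_bilinear:
  assumes P: "bounded_bilinear P" and "open U" "Ck_on k U f" "Ck_on k U g"
  shows "Ck_on k U (\<lambda>x. P (f x) (g x))"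
  using assms(3,4)
proof (induction k arbitrary: f g)
  case 0
  then show ?case by (simp add: bounded_bilinear.continuous_on[OF P])
next
  case (Suc k)
  have d: "((\<lambda>x. P (f x) (g x)) has_derivative (\<lambda>v. P (f x) (fd g x v) + P (fd f x v) (g x))) (at x)"
    if "x \<in> U" for x
    using Suc.prems that by (auto intro!: bounded_bilinear.FDERIV[OF P] fd_works)
  have "Ck_on k U (\<lambda>x. fd (\<lambda>x. P (f x) (g x)) x v) \<longleftrightarrow>
        Ck_on k U (\<lambda>x. P (f x) (fd g x v) + P (fd f x v) (g x))" for v
    by (rule Ck_on_cong[OF assms(2)]) (simp add: fd_eq[OF d])
  moreover have "Ck_on k U (\<lambda>x. P (f x) (fd g x v) + P (fd f x v) (g x))" for v
    using Suc.prems Ck_on_SucD[OF Suc.prems(1)] Ck_on_SucD[OF Suc.prems(2)]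
    by (intro Ck_on_add assms(2) Suc.IH) simp_all
  ultimately show ?case using d Suc by (auto simp: differentiable_def)
qed

lemma Ck_on_sum:
  assumes "open U" "\<And>i. i \<in> I \<Longrightarrow> Ck_on k U (f i)"
  shows "Ck_on k U (\<lambda>x. \<Sum>i\<in>I. f i x)"
  using assms(2)
  by (induction I rule: infinite_finite_induct) (auto intro: Ck_on_add assms(1))

lemma fd_basis_expand:
  fixes f :: "'a::euclidean_space \<Rightarrow> 'b::real_normed_vector"
  assumes "f differentiable (at x)"
  shows "fd f x v = (\<Sum>b\<in>Basis. (v \<bullet> b) *\<^sub>R fd f x b)"
proof -
  have "fd f x v = fd f x (\<Sum>b\<in>Basis. (v \<bullet> b) *\<^sub>R b)"
    by (simp add: euclidean_representation)
  also have "\<dots> = (\<Sum>b\<in>Basis. fd f x ((v \<bullet> b) *\<^sub>R b))"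
    by (rule linear_sum[OF linear_frechet_derivative[OF assms]])
  finally show ?thesis by (simp add: linear_scale[OF linear_frechet_derivative[OF assms]])
qed

text \<open>In the chain rule the direction \<open>fd g x v\<close> moves with \<open>x\<close>,
  whereas the induction hypothesis is about fixed directions. Expanding it in \<open>Basis\<close>
  turns the derivative into a finite sum of products of functions of class \<open>k\<close>.\<close>

lemma Ck_on_compose:
  fixes f :: "'b::euclidean_space \<Rightarrow> 'c::real_normed_vector" and g :: "'a::real_normed_vector \<Rightarrow> 'b"
  assumes "open U" "open V" "Ck_on k V f" "Ck_on k U g" "g ` U \<subseteq> V"
  shows "Ck_on k U (\<lambda>x. f (g x))"
  using assms(3,4)
proof (induction k arbitrary: f)
  case 0
  then show ?case using assms(5) by (simp add: continuous_on_compose2[of V f U g])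
next
  case (Suc k)
  have d: "((\<lambda>x. f (g x)) has_derivative (\<lambda>v. fd f (g x) (fd g x v))) (at x)" if "x \<in> U" for x
  proof -
    have "g x \<in> V" using that assms(5) by blast
    then show ?thesis using Suc.prems that by (intro has_derivative_compose[of g _ x UNIV f] fd_works) simp_all
  qed
  have "Ck_on k U (\<lambda>x. fd (\<lambda>x. f (g x)) x v) \<longleftrightarrow>
        Ck_on k U (\<lambda>x. \<Sum>b\<in>Basis. (fd g x v \<bullet> b) *\<^sub>R fd f (g x) b)" for v
  proof (rule Ck_on_cong[OF assms(1)])
    fix x assume x: "x \<in> U"
    then have "g x \<in> V" using assms(5) by blast
    then have "f differentiable (at (g x))" using Suc.prems(1) by simp
    then show "fd (\<lambda>x. f (g x)) x v = (\<Sum>b\<in>Basis. (fd g x v \<bullet> b) *\<^sub>R fd f (g x) b)"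
      unfolding fd_eq[OF d[OF x]] by (rule fd_basis_expand)
  qed
  moreover have "Ck_on k U (\<lambda>x. \<Sum>b\<in>Basis. (fd g x v \<bullet> b) *\<^sub>R fd f (g x) b)" for v
    using Suc.prems Ck_on_SucD[OF Suc.prems(2)]
    by (intro Ck_on_sum assms(1) Ck_on_bilinear[OF bounded_bilinear_scaleR]
        Ck_on_bounded_linear_compose[OF bounded_linear_inner_left] Suc.IH) simp_all
  ultimately show ?case using d Suc by (auto simp: differentiable_def)
qed

lemma smooth_on_bounded_linear_compose:
  "bounded_linear L \<Longrightarrow> open U \<Longrightarrow> smooth_on U f \<Longrightarrow> smooth_on U (\<lambda>x. L (f x))"
  by (simp add: Ck_on_bounded_linear_compose smooth_on_def)

lemma smooth_on_add: "open U \<Longrightarrow> smooth_on U f \<Longrightarrow> smooth_on U g \<Longrightarrow> smooth_on U (\<lambda>x. f x + g x)"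
  by (simp add: Ck_on_add smooth_on_def)

lemma smooth_on_bilinear:
  "bounded_bilinear P \<Longrightarrow> open U \<Longrightarrow> smooth_on U f \<Longrightarrow> smooth_on U g \<Longrightarrow> smooth_on U (\<lambda>x. P (f x) (g x))"
  by (simp add: Ck_on_bilinear smooth_on_def)

lemma smooth_on_sum:
  "open U \<Longrightarrow> (\<And>i. i \<in> I \<Longrightarrow> smooth_on U (f i)) \<Longrightarrow> smooth_on U (\<lambda>x. \<Sum>i\<in>I. f i x)"
  by (simp add: Ck_on_sum smooth_on_def)

lemma smooth_on_compose:
  fixes f :: "'b::euclidean_space \<Rightarrow> 'c::real_normed_vector" and g :: "'a::real_normed_vector \<Rightarrow> 'b"
  assumes "open U" "open V" "smooth_on V f" "smooth_on U g" "g ` U \<subseteq> V"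
  shows "smooth_on U (\<lambda>x. f (g x))"
  using assms unfolding smooth_on_def by (blast intro: Ck_on_compose)

lemma smooth_on_minus: "open U \<Longrightarrow> smooth_on U f \<Longrightarrow> smooth_on U (\<lambda>x. - f x)"
  by (rule smooth_on_bounded_linear_compose[OF bounded_linear_minus[OF bounded_linear_ident]])

lemma smooth_on_diff: "open U \<Longrightarrow> smooth_on U f \<Longrightarrow> smooth_on U g \<Longrightarrow> smooth_on U (\<lambda>x. f x - g x)"
  using smooth_on_add[of U f "\<lambda>x. - g x"] smooth_on_minus by fastforce

lemma smooth_on_mult:
  fixes f g :: "'a::real_normed_vector \<Rightarrow> 'b::real_normed_algebra"
  shows "open U \<Longrightarrow> smooth_on U f \<Longrightarrow> smooth_on U g \<Longrightarrow> smooth_on U (\<lambda>x. f x * g x)"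
  by (rule smooth_on_bilinear[OF bounded_bilinear_mult])

lemma smooth_on_scaleR:
  "open U \<Longrightarrow> smooth_on U f \<Longrightarrow> smooth_on U g \<Longrightarrow> smooth_on U (\<lambda>x. f x *\<^sub>R g x)"
  by (rule smooth_on_bilinear[OF bounded_bilinear_scaleR])

lemma smooth_on_inner:
  "open U \<Longrightarrow> smooth_on U f \<Longrightarrow> smooth_on U g \<Longrightarrow> smooth_on U (\<lambda>x. f x \<bullet> g x)"
  by (rule smooth_on_bilinear[OF bounded_bilinear_inner])

lemma smooth_on_ident: "smooth_on U (\<lambda>x. x)"
  by (simp add: smooth_on_bounded_linear)

lemma smooth_on_power:
  fixes f :: "'a::real_normed_vector \<Rightarrow> 'b::real_normed_algebra_1"
  shows "open U \<Longrightarrow> smooth_on U f \<Longrightarrow> smooth_on U (\<lambda>x. f x ^ n)"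
  by (induction n) (auto intro: smooth_on_mult)

lemma smooth_on_nth: "open U \<Longrightarrow> smooth_on U f \<Longrightarrow> smooth_on U (\<lambda>x. f x $ i)"
  by (rule smooth_on_bounded_linear_compose[OF bounded_linear_vec_nth])

lemma smooth_on_nth_ident: "smooth_on U (\<lambda>x. x $ i)"
  by (rule smooth_on_bounded_linear[OF bounded_linear_vec_nth])

lemma vec_sum_axis: "(v::real^'n) = (\<Sum>i\<in>UNIV. v $ i *\<^sub>R axis i 1)"
  by (simp add: vec_eq_iff axis_def if_distrib[of "\<lambda>x. _ * x"] cong: if_cong)

lemma Ck_on_vec:
  fixes f :: "'a::real_normed_vector \<Rightarrow> real^'n"
  assumes "open U" "\<And>i. Ck_on k U (\<lambda>x. f x $ i)"
  shows "Ck_on k U f"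
proof -
  have "Ck_on k U (\<lambda>x. \<Sum>i\<in>UNIV. f x $ i *\<^sub>R axis i (1::real))"
    by (intro Ck_on_sum assms Ck_on_bilinear[OF bounded_bilinear_scaleR]) auto
  moreover have "(\<lambda>x. \<Sum>i\<in>UNIV. f x $ i *\<^sub>R axis i 1) = f"
    by (rule ext) (rule vec_sum_axis[symmetric])
  ultimately show ?thesis by simp
qed

lemma smooth_on_vec:
  fixes f :: "'a::real_normed_vector \<Rightarrow> real^'n"
  assumes "open U" "\<And>i. smooth_on U (\<lambda>x. f x $ i)"
  shows "smooth_on U f"
  using assms Ck_on_vec unfolding smooth_on_def by blast

section \<open>Smooth inverse functions\<close>

lemma Ck_on_inverse:
  fixes f :: "'a::real_normed_vector \<Rightarrow> real"
  assumes "open U" "Ck_on k U f" "\<And>x. x \<in> U \<Longrightarrow> f x \<noteq> 0"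
  shows "Ck_on k U (\<lambda>x. inverse (f x))"
  using assms(2)
proof (induction k)
  case 0
  then show ?case using assms(3) by (auto intro!: continuous_intros)
next
  case (Suc k)
  have d: "((\<lambda>x. inverse (f x)) has_derivative (\<lambda>v. - (inverse (f x) * fd f x v * inverse (f x)))) (at x)"
    if "x \<in> U" for x
    using Suc.prems that assms(3) by (intro Deriv.has_derivative_inverse fd_works) auto
  have "Ck_on k U (\<lambda>x. fd (\<lambda>x. inverse (f x)) x v) \<longleftrightarrow>
        Ck_on k U (\<lambda>x. - (inverse (f x) * fd f x v * inverse (f x)))" for v
    by (rule Ck_on_cong[OF assms(1)]) (simp add: fd_eq[OF d])
  moreover have "Ck_on k U (\<lambda>x. - (inverse (f x) * fd f x v * inverse (f x)))" for v
    using Suc.prems Suc.IH Ck_on_SucD[OF Suc.prems]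
    by (intro Ck_on_bounded_linear_compose[OF bounded_linear_minus[OF bounded_linear_ident]]
        Ck_on_bilinear[OF bounded_bilinear_mult] assms(1)) simp_all
  ultimately show ?case using d Suc by (auto simp: differentiable_def)
qed

lemma Ck_on_prod:
  fixes f :: "'i \<Rightarrow> 'a::real_normed_vector \<Rightarrow> real"
  assumes "open U" "\<And>i. i \<in> I \<Longrightarrow> Ck_on k U (f i)"
  shows "Ck_on k U (\<lambda>x. \<Prod>i\<in>I. f i x)"
  using assms(2)
  by (induction I rule: infinite_finite_induct)
    (auto intro: Ck_on_bilinear[OF bounded_bilinear_mult assms(1)])

lemma Ck_on_det:
  fixes A :: "'a::real_normed_vector \<Rightarrow> real^'n^'n"
  assumes "open U" "\<And>i j. Ck_on k U (\<lambda>x. A x $ i $ j)"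
  shows "Ck_on k U (\<lambda>x. det (A x))"
  unfolding det_def
  by (intro Ck_on_sum Ck_on_bilinear[OF bounded_bilinear_mult] Ck_on_prod assms) auto

text \<open>Cramer's rule writes the derivative of \<open>g\<close> as a rational function of the
  entries of the Jacobian of \<open>f\<close> at \<open>g y\<close>. These entries are of class
  \<open>k\<close> as soon as \<open>g\<close> is, so each round of the induction gains one
  derivative.\<close>

lemma Ck_on_inverse_function:
  fixes f g :: "real^'n \<Rightarrow> real^'n"
  assumes "open U" "open V" "smooth_on U f" "g ` V \<subseteq> U"
    and der: "\<And>y. y \<in> V \<Longrightarrow> (g has_derivative inv (fd f (g y))) (at y)"
    and bij: "\<And>y. y \<in> V \<Longrightarrow> bij (fd f (g y))"
  shows "Ck_on k V g"
proof (induction k)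
  case 0
  then show ?case
    using der by (auto intro!: continuous_at_imp_continuous_on has_derivative_continuous)
next
  case (Suc k)
  define A where "A y = matrix (fd f (g y))" for y
  have Aij: "Ck_on k V (\<lambda>y. A y $ i $ j)" for i j
  proof -
    have "smooth_on U (\<lambda>x. fd f x (axis j 1) $ i)"
      by (intro smooth_on_nth smooth_on_fd assms(1,3))
    then have "Ck_on k U (\<lambda>x. fd f x (axis j 1) $ i)"
      unfolding smooth_on_def by blast
    from Ck_on_compose[OF assms(2,1) this Suc assms(4)]
    have "Ck_on k V (\<lambda>y. fd f (g y) (axis j 1) $ i)" .
    then show ?thesis by (simp add: A_def matrix_def)
  qed
  have "Ck_on k V (\<lambda>y. fd g y v)" for v
  proof (rule Ck_on_vec[OF assms(2)])
    fix m
    have eq: "fd g y v $ m = det (\<chi> i j. if j = m then v $ i else A y $ i $ j) * inverse (det (A y))"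
      and nz: "det (A y) \<noteq> 0" if y: "y \<in> V" for y
    proof -
      have lin: "linear (fd f (g y))" using assms(3,4) y linear_fd by blast
      have Av: "A y *v w = fd f (g y) w" for w
        unfolding A_def using lin by (simp add: matrix_works)
      show nz: "det (A y) \<noteq> 0"
        using bij[OF y] lin unfolding A_def by (metis bij_is_inj det_nz_iff_inj)
      have "A y *v (inv (fd f (g y)) v) = v"
        using bij[OF y] by (simp add: Av bij_is_surj surj_f_inv_f)
      then have "inv (fd f (g y)) v = (\<chi> k. det (\<chi> i j. if j = k then v $ i else A y $ i $ j) / det (A y))"
        using cramer[OF nz] by blast
      then show "fd g y v $ m = det (\<chi> i j. if j = m then v $ i else A y $ i $ j) * inverse (det (A y))"
        by (simp add: fd_eq[OF der[OF y]] divide_inverse)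
    qed
    have "Ck_on k V (\<lambda>x. if j = m then v $ i else A x $ i $ j)" for i j
      by (cases "j = m") (simp_all add: Aij)
    note ck = this
    have "Ck_on k V (\<lambda>y. det (\<chi> i j. if j = m then v $ i else A y $ i $ j) * inverse (det (A y)))"
    proof (intro Ck_on_bilinear[OF bounded_bilinear_mult] Ck_on_inverse Ck_on_det assms(2))
      show "Ck_on k V (\<lambda>x. (\<chi> i j. if j = m then v $ i else A x $ i $ j) $ i $ j)" for i j
        unfolding vec_lambda_beta by (rule ck)
    qed (use nz in \<open>auto simp: Aij\<close>)
    then show "Ck_on k V (\<lambda>y. fd g y v $ m)"
      using eq by (simp add: Ck_on_cong[OF assms(2), of "\<lambda>y. fd g y v $ m"])
  qed
  then show ?case using der by (auto simp: differentiable_def)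
qed

text \<open>The inverse function theorem for C^1 maps supplies a local inverse together with its
  derivative; \<open>Ck_on_inverse_function\<close> then bootstraps it to all orders.\<close>

lemma smooth_inverse_function:
  fixes f :: "real^'n \<Rightarrow> real^'n"
  assumes "open U" "x0 \<in> U" "smooth_on U f" "inj (fd f x0)"
  obtains U' where "open U'" "U' \<subseteq> U" "x0 \<in> U'" "inj_on f U'" "open (f ` U')"
    "smooth_on (f ` U') (inv_into U' f)"
proof -
  define f' where "f' x = Blinfun (fd f x)" for x
  have lin: "bounded_linear (fd f x)" if "x \<in> U" for x
    using linear_fd[OF assms(3) that] by (simp add: linear_conv_bounded_linear)
  have f': "blinfun_apply (f' x) = fd f x" if "x \<in> U" for x
    using lin[OF that] by (simp add: f'_def bounded_linear_Blinfun_apply)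
  obtain h where h: "linear h" "h \<circ> fd f x0 = id"
    using linear_injective_left_inverse[OF linear_fd[OF assms(3,2)] assms(4)] by blast
  have "blinfun_apply (Blinfun h o\<^sub>L f' x0) i = blinfun_apply id_blinfun i" for i
    using h f'[OF assms(2)] by (simp add: linear_conv_bounded_linear bounded_linear_Blinfun_apply pointfree_idE)
  then have inv: "Blinfun h o\<^sub>L f' x0 = id_blinfun" by (rule blinfun_eqI)
  have "continuous_on U f'"
  proof (rule continuous_on_blinfun_componentwise)
    fix i :: "real^'n"
    have "continuous_on U (\<lambda>x. fd f x i)"
      by (intro smooth_on_continuous smooth_on_fd assms(3))
    then show "continuous_on U (\<lambda>x. blinfun_apply (f' x) i)"
      by (simp add: f' cong: continuous_on_cong)
  qed
  then obtain U' V g g' where *: "open U'" "U' \<subseteq> U" "x0 \<in> U'" "open V" "homeomorphism U' V f g"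
    "\<And>y. y \<in> V \<Longrightarrow> (g has_derivative (g' y)) (at y)"
    "\<And>y. y \<in> V \<Longrightarrow> g' y = inv (blinfun_apply (f'(g y)))"
    "\<And>y. y \<in> V \<Longrightarrow> bij (blinfun_apply (f'(g y)))"
    using inverse_function_theorem[where U=U and f=f and f'=f' and ?x0.0=x0 and invf="Blinfun h"]
      assms(1,2) inv f' smooth_on_has_derivative[OF assms(3)]
    by (smt (verit, del_insts))
  have V: "f ` U' = V" "g ` V = U'" "\<And>x. x \<in> U' \<Longrightarrow> g (f x) = x" "\<And>y. y \<in> V \<Longrightarrow> f (g y) = y"
    using *(5) by (auto simp: homeomorphism_def)
  have inj: "inj_on f U'" using V(3) by (metis inj_onI)
  have gU: "g ` V \<subseteq> U" using V(2) *(2) by blast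
  then have "Ck_on k V g" for k
    using * f' by (intro Ck_on_inverse_function[OF assms(1) *(4) assms(3)]) force+
  then have "smooth_on V g" by (simp add: smooth_on_def)
  moreover have "inv_into U' f y = g y" if "y \<in> V" for y
    using V that inj by (metis image_eqI inv_into_f_f)
  ultimately have "smooth_on V (inv_into U' f)"
    using smooth_on_cong[OF *(4), of "inv_into U' f" g] by blast
  then show thesis using that[OF *(1-3) inj] V(1) *(4) by simp
qed

section \<open>Germs of diffeomorphisms\<close>

lemma diffeo_germI:
  fixes f :: "real^'n \<Rightarrow> real^'n"
  assumes "open U" "0 \<in> U" "smooth_on U f" "f 0 = 0" "inj (fd f 0)"
  obtains U' where "U' \<subseteq> U" "diffeo_germ U' f"
proof -
  from smooth_inverse_function[OF assms(1,2,3,5)] obtain U' where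
    "open U'" "U' \<subseteq> U" "0 \<in> U'" "inj_on f U'" "open (f ` U')" "smooth_on (f ` U') (inv_into U' f)"
    by metis
  then show thesis
    using assms(3,4) smooth_on_subset by (intro that[of U']) (auto simp: diffeo_germ_def)
qed

lemma diffeo_germ_shrink:
  fixes f :: "'a::real_normed_vector \<Rightarrow> 'a"
  assumes "diffeo_germ U f" "open V" "0 \<in> V"
  shows "diffeo_germ (U \<inter> V) f"
proof -
  have U: "open U" "0 \<in> U" "f 0 = 0" "inj_on f U" "open (f ` U)" "smooth_on U f" "smooth_on (f ` U) (inv_into U f)"
    using assms(1) by (auto simp: diffeo_germ_def)
  have inj: "inj_on f (U \<inter> V)" using U(4) by (meson inf_le1 inj_on_subset)
  have eq: "inv_into (U \<inter> V) f y = inv_into U f y" if "y \<in> f ` (U \<inter> V)" for y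
    using that inj U(4) by auto
  have "f ` (U \<inter> V) = inv_into U f -` V \<inter> f ` U"
    using U(4) by auto
  moreover have "open (inv_into U f -` V \<inter> f ` U)"
    using U(5,7) assms(2) smooth_on_continuous
    by (metis continuous_on_open_vimage)
  ultimately have op: "open (f ` (U \<inter> V))" by simp
  have "smooth_on (f ` (U \<inter> V)) (inv_into U f)" using U(7) by (rule smooth_on_subset) auto
  then have "smooth_on (f ` (U \<inter> V)) (inv_into (U \<inter> V) f)"
    using smooth_on_cong[OF op, of "inv_into (U \<inter> V) f" "inv_into U f"] eq by blast
  then show ?thesis using U assms inj op smooth_on_subset[OF U(6)] by (auto simp: diffeo_germ_def)
qed

lemma diffeo_germ_inv:
  fixes f :: "'a::real_normed_vector \<Rightarrow> 'a"
  assumes "diffeo_germ U f"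
  shows "diffeo_germ (f ` U) (inv_into U f)"
proof -
  have U: "open U" "0 \<in> U" "f 0 = 0" "inj_on f U" "open (f ` U)" "smooth_on U f" "smooth_on (f ` U) (inv_into U f)"
    using assms(1) by (auto simp: diffeo_germ_def)
  have im: "inv_into U f ` f ` U = U" using U(4) by simp
  have eq: "inv_into (f ` U) (inv_into U f) x = f x" if "x \<in> U" for x
    using that U(4) by (metis f_inv_into_f image_eqI im inj_on_inv_into inv_into_f_f order_refl)
  have "smooth_on U (inv_into (f ` U) (inv_into U f))"
    using smooth_on_cong[OF U(1), of "inv_into (f ` U) (inv_into U f)" f] eq U(6) by blast
  moreover have "inv_into U f 0 = 0" using U by (metis inv_into_f_f)
  moreover have "0 \<in> f ` U" using U(2,3) by force
  ultimately show ?thesis using U im by (simp add: diffeo_germ_def inj_on_inv_into)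
qed

lemma diffeo_germ_compose:
  fixes f g :: "'a::euclidean_space \<Rightarrow> 'a"
  assumes f: "diffeo_germ U f" and g: "diffeo_germ V g" and UV: "f ` U \<subseteq> V"
  shows "diffeo_germ U (\<lambda>x. g (f x))"
proof -
  have U: "open U" "0 \<in> U" "f 0 = 0" "inj_on f U" "open (f ` U)" "smooth_on U f" "smooth_on (f ` U) (inv_into U f)"
    using f by (auto simp: diffeo_germ_def)
  have "f 0 \<in> f ` U" using U(2) by blast
  then have g': "diffeo_germ (f ` U) g"
    using diffeo_germ_shrink[OF g U(5)] UV U(3) by (simp add: inf.absorb2)
  then have G: "g 0 = 0" "inj_on g (f ` U)" "open (g ` f ` U)" "smooth_on (f ` U) g"
    "smooth_on (g ` f ` U) (inv_into (f ` U) g)"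
    by (auto simp: diffeo_germ_def)
  have im: "(\<lambda>x. g (f x)) ` U = g ` f ` U" by auto
  have inj: "inj_on (\<lambda>x. g (f x)) U" using U(4) G(2) by (simp add: inj_on_def)
  have eq: "inv_into U (\<lambda>x. g (f x)) z = inv_into U f (inv_into (f ` U) g z)" if z: "z \<in> g ` f ` U" for z
  proof -
    obtain x where x: "x \<in> U" "z = g (f x)" using z by blast
    have "inv_into U (\<lambda>x. g (f x)) z = x"
      using inv_into_f_f[OF inj x(1)] x(2) by simp
    moreover have "inv_into (f ` U) g z = f x" using G(2) x by simp
    ultimately show ?thesis using U(4) x by simp
  qed
  have "smooth_on (g ` f ` U) (\<lambda>z. inv_into U f (inv_into (f ` U) g z))"
    by (rule smooth_on_compose[OF G(3) U(5) U(7) G(5)]) (use G(2) in auto)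
  then have "smooth_on (g ` f ` U) (inv_into U (\<lambda>x. g (f x)))"
    using smooth_on_cong[OF G(3), of "inv_into U (\<lambda>x. g (f x))" "\<lambda>z. inv_into U f (inv_into (f ` U) g z)"] eq by blast
  moreover have "smooth_on U (\<lambda>x. g (f x))"
    by (rule smooth_on_compose[OF U(1) U(5) G(4) U(6)]) simp
  ultimately show ?thesis using U G inj im by (simp add: diffeo_germ_def)
qed

section \<open>Hadamard and Poincare lemmas\<close>

lemma Ck_on_continuous: "Ck_on m U f \<Longrightarrow> continuous_on U f"
proof (induction m)
  case (Suc m)
  then show ?case using Ck_on_SucD by blast
qed simp

section \<open>Mean values and symmetry of second derivatives\<close>

lemma mvt_line:
  fixes f :: "'a::real_normed_vector \<Rightarrow> real"
  assumes "h > 0" "\<And>s. 0 \<le> s \<Longrightarrow> s \<le> h \<Longrightarrow> f differentiable (at (a + s *\<^sub>R u))"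
  shows "\<exists>s. 0 < s \<and> s < h \<and> f (a + h *\<^sub>R u) - f a = h * fd f (a + s *\<^sub>R u) u"
proof -
  have d: "((\<lambda>s. f (a + s *\<^sub>R u)) has_real_derivative fd f (a + s *\<^sub>R u) u) (at s)"
    if "0 \<le> s" "s \<le> h" for s
  proof -
    have "((\<lambda>s. f (a + s *\<^sub>R u)) has_derivative (\<lambda>t. fd f (a + s *\<^sub>R u) (t *\<^sub>R u))) (at s)"
      by (rule has_derivative_compose[of _ _ s UNIV f]) (auto intro!: derivative_eq_intros fd_works assms that)
    then show ?thesis
      using linear_scale[OF linear_frechet_derivative[OF assms(2)[OF that]]]
      by (simp add: has_field_derivative_def mult.commute[of "fd f _ _"] mult_commute_abs)
  qed
  from MVT2[OF assms(1) d] show ?thesis by auto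
qed

text \<open>The second difference of \<open>f\<close> over a small parallelogram equals
  \<open>h^2\<close> times the mixed derivative in either order, taken at two nearby points. If the
  mixed derivatives at \<open>x\<close> were different, continuity would keep them different at
  these points.\<close>

lemma symmetric_second_fd:
  fixes f :: "'a::real_normed_vector \<Rightarrow> real"
  assumes U: "open U" "x \<in> U" and f: "smooth_on U f"
  shows "fd (\<lambda>y. fd f y u) x v = fd (\<lambda>y. fd f y v) x u"
proof (rule ccontr)
  define A where "A u v y = fd (\<lambda>y. fd f y u) y v" for u v y
  assume "\<not> ?thesis"
  then have ne: "A u v x \<noteq> A v u x" by (simp add: A_def)
  \<comment> \<open>Half the gap: values within \<open>e\<close> of the two limits cannot
    coincide.\<close>
  define e where "e = \<bar>A u v x - A v u x\<bar> / 2"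
  have "e > 0" using ne by (simp add: e_def)
  have A_at: "\<exists>d>0. \<forall>y. dist y x < d \<longrightarrow> y \<in> U \<and> dist (A u v y) (A u v x) < e" for u v
  proof -
    have "continuous_on U (A u v)"
      unfolding A_def by (intro smooth_on_continuous smooth_on_fd f)
    then have "isCont (A u v) x" using U continuous_on_eq_continuous_at by blast
    then obtain d1 where d1: "d1 > 0" "\<forall>y. dist y x < d1 \<longrightarrow> dist (A u v y) (A u v x) < e"
      using \<open>e > 0\<close> unfolding continuous_at_eps_delta by blast
    obtain d2 where "d2 > 0" "\<forall>y. dist y x < d2 \<longrightarrow> y \<in> U"
      using U open_dist by blast
    then show ?thesis using d1 by (intro exI[of _ "min d1 d2"]) auto
  qed
  obtain d1 d2 where d: "d1 > 0" "\<forall>y. dist y x < d1 \<longrightarrow> y \<in> U \<and> dist (A u v y) (A u v x) < e"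
    "d2 > 0" "\<forall>y. dist y x < d2 \<longrightarrow> y \<in> U \<and> dist (A v u y) (A v u x) < e"
    using A_at by metis
  define m where "m = min d1 d2 / 2"
  define h where "h = m / (norm u + norm v + 1)"
  have "m > 0" using d by (simp add: m_def)
  have nuv: "norm u + norm v + 1 > 0" by (metis add_nonneg_pos norm_ge_zero add_nonneg_nonneg zero_less_one)
  have "h > 0" using \<open>m > 0\<close> nuv by (simp add: h_def)
  have near: "dist (x + s *\<^sub>R a + t *\<^sub>R b) x < d1" "dist (x + s *\<^sub>R a + t *\<^sub>R b) x < d2"
    if "0 \<le> s" "s \<le> h" "0 \<le> t" "t \<le> h" "norm a + norm b = norm u + norm v" for s t a b
  proof -
    have "dist (x + s *\<^sub>R a + t *\<^sub>R b) x \<le> norm (s *\<^sub>R a) + norm (t *\<^sub>R b)"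
      by (simp add: dist_norm add.assoc norm_triangle_ineq del: norm_scaleR)
    also have "\<dots> \<le> h * norm a + h * norm b"
      using that by (auto intro!: add_mono mult_right_mono)
    also have "\<dots> = h * (norm u + norm v)" using that by (simp add: distrib_left[symmetric])
    also have "\<dots> \<le> m" using nuv \<open>m > 0\<close> by (simp add: h_def field_simps)
    finally show "dist (x + s *\<^sub>R a + t *\<^sub>R b) x < d1" "dist (x + s *\<^sub>R a + t *\<^sub>R b) x < d2"
      using d by (auto simp: m_def)
  qed
  \<comment> \<open>The mean value theorem twice: along \<open>a\<close> for the increment in
    direction \<open>b\<close>, then along \<open>b\<close> for the derivative in direction
    \<open>a\<close>.\<close>
  have key: "\<exists>y. dist y x < d1 \<and> dist y x < d2 \<and>
      f (x + h *\<^sub>R b + h *\<^sub>R a) - f (x + h *\<^sub>R a) - f (x + h *\<^sub>R b) + f x = h * (h * A a b y)"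
    if nab: "norm a + norm b = norm u + norm v" for a b
  proof -
    define g where "g y = f (y + h *\<^sub>R b) - f y" for y
    have inU: "x + s *\<^sub>R a + t *\<^sub>R b \<in> U" if "0 \<le> s" "s \<le> h" "0 \<le> t" "t \<le> h" for s t
      using near(1)[OF that nab] d(2) by blast
    have g': "(g has_derivative (\<lambda>w. fd f (y + h *\<^sub>R b) w - fd f y w)) (at y)"
      if "y \<in> U" "y + h *\<^sub>R b \<in> U" for y
      unfolding g_def using that
      by (auto intro!: has_derivative_diff smooth_on_has_derivative[OF f]
          has_derivative_compose[of "\<lambda>y. y + h *\<^sub>R b" "\<lambda>w. w" y UNIV f] derivative_eq_intros)
    have inU': "x + s *\<^sub>R a \<in> U" "x + s *\<^sub>R a + h *\<^sub>R b \<in> U" if "0 \<le> s" "s \<le> h" for s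
      using inU[of s 0] inU[of s h] that \<open>h > 0\<close> by auto
    then obtain s where s: "0 < s" "s < h" "g (x + h *\<^sub>R a) - g x = h * fd g (x + s *\<^sub>R a) a"
      using mvt_line[OF \<open>h > 0\<close>, of g x a] g' unfolding differentiable_def by blast
    have "fd g (x + s *\<^sub>R a) a = fd f (x + s *\<^sub>R a + h *\<^sub>R b) a - fd f (x + s *\<^sub>R a) a"
      using s inU' by (subst fd_eq[OF g']) auto
    moreover obtain t where t: "0 < t" "t < h"
      "fd f (x + s *\<^sub>R a + h *\<^sub>R b) a - fd f (x + s *\<^sub>R a) a = h * A a b (x + s *\<^sub>R a + t *\<^sub>R b)"
      using mvt_line[OF \<open>h > 0\<close>, of "\<lambda>y. fd f y a" "x + s *\<^sub>R a" b] s inU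
        smooth_on_differentiable[OF smooth_on_fd[OF f]] unfolding A_def by (metis less_imp_le)
    ultimately have "g (x + h *\<^sub>R a) - g x = h * (h * A a b (x + s *\<^sub>R a + t *\<^sub>R b))"
      using s(3) by simp
    then show ?thesis
      using near[of s t a b] s t nab unfolding g_def
      by (intro exI[of _ "x + s *\<^sub>R a + t *\<^sub>R b"]) (auto simp: algebra_simps)
  qed
  obtain y z where y: "dist y x < d1" "f (x + h *\<^sub>R v + h *\<^sub>R u) - f (x + h *\<^sub>R u) - f (x + h *\<^sub>R v) + f x = h * (h * A u v y)"
    and z: "dist z x < d2" "f (x + h *\<^sub>R u + h *\<^sub>R v) - f (x + h *\<^sub>R v) - f (x + h *\<^sub>R u) + f x = h * (h * A v u z)"
    using key[of u v] key[of v u] by (auto simp: add.commute)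
  have "x + h *\<^sub>R v + h *\<^sub>R u = x + h *\<^sub>R u + h *\<^sub>R v" by simp
  with y(2) z(2) have "h * (h * A u v y) = h * (h * A v u z)" by (metis add.commute add_diff_eq diff_add_eq diff_diff_eq)
  then have "A u v y = A v u z" using \<open>h > 0\<close> by simp
  moreover have "dist (A u v y) (A u v x) < e" "dist (A v u z) (A v u x) < e" using d y z by auto
  moreover have "\<bar>A u v x - A v u x\<bar> = 2 * e" by (simp add: e_def)
  ultimately show False unfolding dist_real_def by linarith
qed

section \<open>Integration along weighted dilations\<close>

definition dil :: "('n::finite \<Rightarrow> nat) \<Rightarrow> real \<Rightarrow> real^'n \<Rightarrow> real^'n" where
  "dil w s x = (\<chi> i. s ^ w i * x $ i)"

text \<open>The integrals occurring in the homotopy operator. A partial derivative in direction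
  \<open>i\<close> only raises \<open>k\<close> by \<open>w i\<close>, so the class is closed under
  differentiation. Separate weights for the coordinates make the operator contract with a weighted
  Euler field; weights all equal to one give the usual radial operator.\<close>

definition dint :: "('n::finite \<Rightarrow> nat) \<Rightarrow> nat \<Rightarrow> (real^'n \<Rightarrow> real) \<Rightarrow> real^'n \<Rightarrow> real" where
  "dint w k f x = integral {0..1} (\<lambda>s. s ^ k * f (dil w s x))"

lemma dil_nth [simp]: "dil w s x $ i = s ^ w i * x $ i"
  by (simp add: dil_def)

lemma dil_1 [simp]: "dil w 1 x = x"
  by (simp add: vec_eq_iff)

lemma norm_dil_le: "0 \<le> s \<Longrightarrow> s \<le> 1 \<Longrightarrow> norm (dil w s x) \<le> norm x"
  by (rule norm_le_componentwise_cart) (auto simp: abs_mult power_le_one intro!: mult_left_le_one_le)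

lemma dil_in_ball: "0 \<le> s \<Longrightarrow> s \<le> 1 \<Longrightarrow> x \<in> ball 0 r \<Longrightarrow> dil w s x \<in> ball 0 r"
  using norm_dil_le[of s w x] by (simp add: dist_norm)

lemma continuous_on_dint_integrand:
  assumes "continuous_on (ball 0 r) f"
  shows "continuous_on (ball 0 r \<times> {0..1}) (\<lambda>(x, s). s ^ k * f (dil w s x))"
proof -
  have "continuous_on (ball 0 r \<times> {0..1}) (\<lambda>p. f (dil w (snd p) (fst p)))"
    by (rule continuous_on_compose2[OF assms])
      (auto simp: dil_def intro!: continuous_intros dil_in_ball[unfolded dil_def mem_ball dist_0_norm])
  then show ?thesis by (auto simp: split_beta intro!: continuous_intros)
qed

lemma integrable_dint:
  assumes "continuous_on (ball 0 r) f" "x \<in> ball 0 r"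
  shows "(\<lambda>s. s ^ k * f (dil w s x)) integrable_on {0..1}"
proof -
  have "continuous_on {0..1} (\<lambda>s. (\<lambda>(x, s). s ^ k * f (dil w s x)) (x, s))"
    by (rule continuous_on_compose2[OF continuous_on_dint_integrand[OF assms(1)]])
      (use assms(2) in \<open>auto intro!: continuous_intros\<close>)
  then show ?thesis by (simp add: integrable_continuous_interval)
qed

lemma continuous_on_dint:
  assumes "continuous_on (ball 0 r) f"
  shows "continuous_on (ball 0 r) (dint w k f)"
  unfolding dint_def using integral_continuous_on_param[of "ball 0 r" 0 1 "\<lambda>x s. s ^ k * f (dil w s x)"]
    continuous_on_dint_integrand[OF assms] by (simp add: cbox_interval)

lemma abs_dint_le:
  assumes "continuous_on (ball 0 r) f" "x \<in> ball 0 r" "\<And>y. norm y \<le> norm x \<Longrightarrow> \<bar>f y\<bar> \<le> M"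
  shows "\<bar>dint w k f x\<bar> \<le> M"
proof -
  have "norm (integral (cbox 0 1) (\<lambda>s. s ^ k * f (dil w s x))) \<le> M * Henstock_Kurzweil_Integration.content (cbox 0 (1::real))"
  proof (rule integrable_bound)
    show "0 \<le> M" using assms(3)[of 0] by (smt (verit) norm_ge_zero norm_zero)
    show "(\<lambda>s. s ^ k * f (dil w s x)) integrable_on cbox 0 1"
      using integrable_dint[OF assms(1,2)] by (simp add: cbox_interval)
    show "norm (s ^ k * f (dil w s x)) \<le> M" if "s \<in> cbox 0 1" for s
    proof -
      have "\<bar>s ^ k\<bar> \<le> 1" using that by (simp add: power_le_one)
      moreover have "\<bar>f (dil w s x)\<bar> \<le> M" using that norm_dil_le assms(3) by auto
      ultimately show ?thesis using mult_mono[of "\<bar>s ^ k\<bar>" 1 "\<bar>f (dil w s x)\<bar>" M] by (simp add: abs_mult)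
    qed
  qed
  then show ?thesis by (simp add: dint_def cbox_interval)
qed

lemma has_derivative_dil: "(dil w s has_derivative dil w s) (at x)"
proof -
  have "linear (dil w s)" by (auto simp: linear_iff vec_eq_iff algebra_simps)
  then show ?thesis using linear_imp_has_derivative by blast
qed

lemma fd_axis_expand:
  fixes f :: "real^'n \<Rightarrow> 'b::real_normed_vector"
  assumes "f differentiable (at x)"
  shows "fd f x v = (\<Sum>i\<in>UNIV. v $ i *\<^sub>R fd f x (axis i 1))"
proof -
  have "fd f x v = fd f x (\<Sum>i\<in>UNIV. v $ i *\<^sub>R axis i 1)" by (metis vec_sum_axis)
  then show ?thesis
    using linear_frechet_derivative[OF assms] by (simp add: linear_sum linear_scale)
qed

lemma has_derivative_dint:
  fixes f :: "real^'n \<Rightarrow> real"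
  assumes d: "\<And>x. x \<in> ball 0 r \<Longrightarrow> f differentiable (at x)"
    and c: "\<And>v. continuous_on (ball 0 r) (\<lambda>x. fd f x v)" and x: "x \<in> ball 0 r"
  shows "(dint w k f has_derivative (\<lambda>v. \<Sum>i\<in>UNIV. v $ i * dint w (k + w i) (\<lambda>y. fd f y (axis i 1)) x)) (at x)"
proof -
  define e where "e i = Blinfun (\<lambda>v::real^'n. v $ i)" for i
  have e: "blinfun_apply (e i) v = v $ i" for i v
    by (simp add: e_def bounded_linear_Blinfun_apply bounded_linear_vec_nth)
  define g where "g i x s = s ^ (k + w i) * fd f (dil w s x) (axis i 1)" for i x s
  define fx where "fx x s = (\<Sum>i\<in>UNIV. g i x s *\<^sub>R e i)" for x s
  have f: "continuous_on (ball 0 r) f"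
    using d by (auto intro!: continuous_at_imp_continuous_on differentiable_imp_continuous_within)
  have "((\<lambda>x. s ^ k * f (dil w s x)) has_derivative blinfun_apply (fx x s)) (at x)"
    if "x \<in> ball 0 r" "s \<in> cbox 0 1" for x s
  proof -
    have y: "dil w s x \<in> ball 0 r" using that dil_in_ball by auto
    have "((\<lambda>x. f (dil w s x)) has_derivative (\<lambda>v. fd f (dil w s x) (dil w s v))) (at x)"
      by (rule has_derivative_compose[OF has_derivative_dil fd_works[OF d[OF y]]])
    then have "((\<lambda>x. s ^ k * f (dil w s x)) has_derivative (\<lambda>v. s ^ k * fd f (dil w s x) (dil w s v))) (at x)"
      by (rule has_derivative_mult_right)
    moreover have "(\<lambda>v. s ^ k * fd f (dil w s x) (dil w s v)) = blinfun_apply (fx x s)"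
      by (rule ext, subst fd_axis_expand[OF d[OF y]])
        (simp add: fx_def g_def e blinfun.sum_left blinfun.scaleR_left sum_distrib_left power_add mult_ac)
    ultimately show ?thesis by simp
  qed
  then have "((\<lambda>x. integral (cbox 0 1) (\<lambda>s. s ^ k * f (dil w s x))) has_derivative
      blinfun_apply (integral (cbox 0 1) (fx x))) (at x within ball 0 r)"
  proof (intro leibniz_rule)
    show "continuous_on (ball 0 r \<times> cbox 0 1) (\<lambda>(x, t). fx x t)"
    proof -
      have "continuous_on (ball 0 r \<times> {0..1}) (\<lambda>(x, s). g i x s)" for i
        unfolding g_def by (rule continuous_on_dint_integrand[OF c])
      then show ?thesis
        by (auto simp: split_beta fx_def cbox_interval intro!: continuous_intros)
    qed
  qed (use f x integrable_dint in \<open>auto simp: cbox_interval intro: has_derivative_at_withinI\<close>)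
  moreover have "blinfun_apply (integral (cbox 0 1) (fx x)) =
      (\<lambda>v. \<Sum>i\<in>UNIV. v $ i * dint w (k + w i) (\<lambda>y. fd f y (axis i 1)) x)"
  proof -
    have gx: "g i x = (\<lambda>s. s ^ (k + w i) * fd f (dil w s x) (axis i 1))" for i
      by (simp add: g_def fun_eq_iff)
    have gi: "g i x integrable_on cbox 0 1" for i
      using integrable_dint[OF c x] unfolding g_def by (simp add: cbox_interval)
    have "(fx x has_integral (\<Sum>i\<in>UNIV. integral (cbox 0 1) (g i x) *\<^sub>R e i)) (cbox 0 1)"
      unfolding fx_def by (intro has_integral_sum has_integral_scaleR_left integrable_integral gi) auto
    then have "integral (cbox 0 1) (fx x) = (\<Sum>i\<in>UNIV. integral (cbox 0 1) (g i x) *\<^sub>R e i)"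
      by (rule integral_unique)
    then show ?thesis
      by (intro ext) (simp add: blinfun.sum_left blinfun.scaleR_left e dint_def gx cbox_interval mult.commute)
  qed
  ultimately show ?thesis
    using x by (simp add: dint_def[abs_def] cbox_interval at_within_open[OF _ open_ball])
qed

lemma Ck_on_dint:
  fixes f :: "real^'n \<Rightarrow> real"
  shows "Ck_on m (ball 0 r) f \<Longrightarrow> Ck_on m (ball 0 r) (dint w k f)"
proof (induction m arbitrary: f k)
  case 0
  then show ?case by (simp add: continuous_on_dint)
next
  case (Suc m)
  have c: "continuous_on (ball 0 r) (\<lambda>x. fd f x v)" for v
    using Suc.prems by (auto intro: Ck_on_continuous)
  have d: "(dint w k f has_derivative (\<lambda>v. \<Sum>i\<in>UNIV. v $ i * dint w (k + w i) (\<lambda>y. fd f y (axis i 1)) x)) (at x)"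
    if "x \<in> ball 0 r" for x
    using Suc.prems c that by (intro has_derivative_dint) auto
  have "Ck_on m (ball 0 r) (\<lambda>x. \<Sum>i\<in>UNIV. v $ i * dint w (k + w i) (\<lambda>y. fd f y (axis i 1)) x)" for v
    using Suc.prems by (intro Ck_on_sum Ck_on_bilinear[OF bounded_bilinear_mult] Suc.IH) auto
  then have "Ck_on m (ball 0 r) (\<lambda>x. fd (dint w k f) x v)" for v
    by (subst Ck_on_cong[OF open_ball]) (simp_all add: fd_eq[OF d])
  moreover have "dint w k f differentiable (at x)" if "x \<in> ball 0 r" for x
    using d[OF that] by (rule differentiableI)
  ultimately show ?case by simp
qed

lemma smooth_on_dint: "smooth_on (ball 0 r) f \<Longrightarrow> smooth_on (ball 0 r) (dint w k f)"
  by (simp add: smooth_on_def Ck_on_dint)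

lemma fd_dint:
  assumes "smooth_on (ball 0 r) f" "x \<in> ball 0 r"
  shows "fd (dint w k f) x (axis i 1) = dint w (k + w i) (\<lambda>y. fd f y (axis i 1)) x"
proof -
  have "(dint w k f has_derivative (\<lambda>v. \<Sum>i\<in>UNIV. v $ i * dint w (k + w i) (\<lambda>y. fd f y (axis i 1)) x)) (at x)"
    by (intro has_derivative_dint[where r=r] smooth_on_differentiable[OF assms(1)] smooth_on_continuous smooth_on_fd assms)
  from fd_eq[OF this] show ?thesis
    by (simp add: axis_def if_distrib[of "\<lambda>c. c * _"] cong: if_cong)
qed

text \<open>The fundamental theorem of calculus for \<open>s \<mapsto> s ^ k * f (dil w s x)\<close>.\<close>
lemma dint_ftc:
  fixes f :: "real^'n \<Rightarrow> real"
  assumes f: "smooth_on (ball 0 r) f" and x: "x \<in> ball 0 r" and w: "\<And>i. w i \<ge> 1"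
  shows "f x - 0 ^ k * f 0 = real k * dint w (k - 1) f x +
    (\<Sum>i\<in>UNIV. real (w i) * x $ i * dint w (k + w i - 1) (\<lambda>y. fd f y (axis i 1)) x)"
proof -
  define F where "F s = real k * (s ^ (k - 1) * f (dil w s x)) +
    (\<Sum>i\<in>UNIV. real (w i) * x $ i * (s ^ (k + w i - 1) * fd f (dil w s x) (axis i 1)))" for s
  have "((\<lambda>s. s ^ k * f (dil w s x)) has_vector_derivative F s) (at s within {0..1})" if "s \<in> {0..1}" for s
  proof -
    have y: "dil w s x \<in> ball 0 r" using that x dil_in_ball by auto
    define v where "v = (\<chi> i. real (w i) * s ^ (w i - 1) * x $ i)"
    have "((\<lambda>s. dil w s x) has_derivative (\<lambda>t. \<chi> i. t * (real (w i) * s ^ (w i - 1) * x $ i))) (at s)"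
      unfolding dil_def
      by (subst has_derivative_componentwise_within)
        (auto intro!: derivative_eq_intros simp: mult_ac Basis_vec_def inner_axis)
    moreover have "(\<lambda>t. \<chi> i. t * (real (w i) * s ^ (w i - 1) * x $ i)) = (\<lambda>t. t *\<^sub>R v)"
      by (simp add: v_def vec_eq_iff fun_eq_iff)
    ultimately have "((\<lambda>s. f (dil w s x)) has_derivative (\<lambda>t. fd f (dil w s x) (t *\<^sub>R v))) (at s)"
      using has_derivative_compose[of "\<lambda>s. dil w s x" _ s UNIV f] smooth_on_has_derivative[OF f y] by simp
    then have "((\<lambda>s. f (dil w s x)) has_real_derivative fd f (dil w s x) v) (at s)"
      using linear_scale[OF linear_fd[OF f y]] by (simp add: has_field_derivative_def mult_commute_abs)
    then have "((\<lambda>s. s ^ k * f (dil w s x)) has_real_derivative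
        (real k * s ^ (k - 1)) * f (dil w s x) + s ^ k * fd f (dil w s x) v) (at s)"
      by (auto intro!: derivative_eq_intros simp: mult_ac)
    moreover have "s ^ k * fd f (dil w s x) v =
        (\<Sum>i\<in>UNIV. real (w i) * x $ i * (s ^ (k + w i - 1) * fd f (dil w s x) (axis i 1)))"
    proof -
      have *: "s ^ (k + w i - 1) = s ^ k * s ^ (w i - 1)" for i
        using w[of i] by (simp add: power_add[symmetric])
      show ?thesis
        by (subst fd_axis_expand[OF smooth_on_differentiable[OF f y]])
          (simp add: v_def sum_distrib_left *[unfolded One_nat_def] mult_ac)
    qed
    ultimately have "((\<lambda>s. s ^ k * f (dil w s x)) has_real_derivative F s) (at s)"
      by (simp add: F_def mult.assoc)
    then show ?thesis
      using has_field_derivative_at_within has_real_derivative_iff_has_vector_derivative by blast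
  qed
  \<comment> \<open>At \<open>s = 0\<close> the factor \<open>0 ^ k\<close> is 1 for
    \<open>k = 0\<close> and 0 otherwise. The first case gives Hadamard's lemma, the second one the
    Poincare lemma.\<close>
  then have 1: "(F has_integral 1 ^ k * f (dil w 1 x) - 0 ^ k * f (dil w 0 x)) {0..1}"
    by (intro fundamental_theorem_of_calculus) auto
  have 2: "dil w 0 x = 0"
    using w by (metis (no_types, lifting) dil_nth less_one linorder_not_le mult_zero_left power_eq_0_iff vec_eq_iff zero_index zero_less_iff_neq_zero)
  have 3: "(F has_integral real k * dint w (k - 1) f x +
    (\<Sum>i\<in>UNIV. real (w i) * x $ i * dint w (k + w i - 1) (\<lambda>y. fd f y (axis i 1)) x)) {0..1}"
    unfolding F_def dint_def
    by (intro has_integral_add has_integral_sum has_integral_mult_right integrable_integral integrable_dint[OF _ x]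
        smooth_on_continuous smooth_on_fd f) auto
  show ?thesis using has_integral_unique[OF 1 3] by (simp only: 2 dil_1 power_one mult_1)
qed

lemma hadamard:
  fixes f :: "real^'n \<Rightarrow> real"
  assumes "smooth_on (ball 0 r) f"
  obtains h where "\<And>i. smooth_on (ball 0 r) (h i)"
    "\<And>x. x \<in> ball 0 r \<Longrightarrow> f x = f 0 + (\<Sum>i\<in>UNIV. x $ i * h i x)"
proof
  define h where "h i = dint (\<lambda>_. 1) 0 (\<lambda>y. fd f y (axis i 1))" for i
  show "smooth_on (ball 0 r) (h i)" for i
    unfolding h_def by (intro smooth_on_dint smooth_on_fd assms)
  show "f x = f 0 + (\<Sum>i\<in>UNIV. x $ i * h i x)" if "x \<in> ball 0 r" for x
    using dint_ftc[OF assms that, of "\<lambda>_. 1" 0] by (simp add: h_def)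
qed

text \<open>Integrates the derivative in \<open>s\<close> of the pullback of \<open>\<alpha>\<close>
  under the dilations. The contraction of \<open>\<alpha>\<close> with the Euler field contributes
  the potential \<open>S\<close>, the contraction of \<open>d\<alpha>\<close> the remaining sum,
  which therefore vanishes for closed \<open>\<alpha>\<close>.\<close>

lemma poincare:
  fixes \<alpha> :: "real^'n \<Rightarrow> real^'n"
  assumes \<alpha>: "smooth_on (ball 0 r) \<alpha>" and w: "\<And>i. w i \<ge> 1"
  obtains S where "smooth_on (ball 0 r) S" and
    "\<And>x i. x \<in> ball 0 r \<Longrightarrow> \<alpha> x $ i = fd S x (axis i 1) +
      (\<Sum>k\<in>UNIV. real (w k) * x $ k *
        dint w (w i + w k - 1) (\<lambda>y. fd \<alpha> y (axis k 1) $ i - fd \<alpha> y (axis i 1) $ k) x)"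
proof
  define S where "S x = (\<Sum>k\<in>UNIV. real (w k) * x $ k * dint w (w k - 1) (\<lambda>y. \<alpha> y $ k) x)" for x
  have \<alpha>k: "smooth_on (ball 0 r) (\<lambda>y. \<alpha> y $ k)" for k
    by (rule smooth_on_nth[OF open_ball \<alpha>])
  have fdk: "fd (\<lambda>y. \<alpha> y $ k) y v = fd \<alpha> y v $ k" if "y \<in> ball 0 r" for k y v
    using fd_eq[OF bounded_linear.has_derivative[OF bounded_linear_vec_nth smooth_on_has_derivative[OF \<alpha> that]]]
    by simp
  show "smooth_on (ball 0 r) S"
    unfolding S_def by (intro smooth_on_sum smooth_on_mult open_ball smooth_on_const smooth_on_nth_ident smooth_on_dint \<alpha>k)
  fix x :: "real^'n" and i assume x: "x \<in> ball 0 r"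
  have "(S has_derivative (\<lambda>v. \<Sum>k\<in>UNIV. real (w k) * x $ k * fd (dint w (w k - 1) (\<lambda>y. \<alpha> y $ k)) x v
      + real (w k) * v $ k * dint w (w k - 1) (\<lambda>y. \<alpha> y $ k) x)) (at x)"
    unfolding S_def
    by (intro has_derivative_sum has_derivative_mult has_derivative_mult_right
        smooth_on_has_derivative[OF smooth_on_dint[OF \<alpha>k] x] bounded_linear_imp_has_derivative[OF bounded_linear_vec_nth])
  from fd_eq[OF this]
  have S': "fd S x (axis i 1) = (\<Sum>k\<in>UNIV. real (w k) * x $ k * dint w (w k - 1 + w i) (\<lambda>y. fd (\<lambda>y. \<alpha> y $ k) y (axis i 1)) x)
      + real (w i) * dint w (w i - 1) (\<lambda>y. \<alpha> y $ i) x"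
    using fd_dint[OF \<alpha>k x]
    by (simp add: sum.distrib axis_def if_distrib[of "\<lambda>c. c * _"] if_distrib[of "\<lambda>c. _ * c"] cong: if_cong)
  have "\<alpha> x $ i = real (w i) * dint w (w i - 1) (\<lambda>y. \<alpha> y $ i) x +
    (\<Sum>k\<in>UNIV. real (w k) * x $ k * dint w (w i + w k - 1) (\<lambda>y. fd (\<lambda>y. \<alpha> y $ i) y (axis k 1)) x)"
    using dint_ftc[OF \<alpha>k x w, of i "w i"] w[of i] by (simp add: zero_power)
  moreover have "dint w (w i + w k - 1) (\<lambda>y. fd \<alpha> y (axis k 1) $ i - fd \<alpha> y (axis i 1) $ k) x =
      dint w (w i + w k - 1) (\<lambda>y. fd (\<lambda>y. \<alpha> y $ i) y (axis k 1)) x - dint w (w k - 1 + w i) (\<lambda>y. fd (\<lambda>y. \<alpha> y $ k) y (axis i 1)) x" for k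
  proof -
    have e: "w k - 1 + w i = w i + w k - 1" using w[of k] by simp
    have c: "continuous_on (ball 0 r) (\<lambda>y. fd (\<lambda>y. \<alpha> y $ k) y v)" for k v
      by (intro smooth_on_continuous smooth_on_fd \<alpha>k)
    have "dint w (w i + w k - 1) (\<lambda>y. fd \<alpha> y (axis k 1) $ i - fd \<alpha> y (axis i 1) $ k) x =
      integral {0..1} (\<lambda>s. s ^ (w i + w k - 1) * fd (\<lambda>y. \<alpha> y $ i) (dil w s x) (axis k 1)
        - s ^ (w i + w k - 1) * fd (\<lambda>y. \<alpha> y $ k) (dil w s x) (axis i 1))"
      unfolding dint_def using dil_in_ball[OF _ _ x]
      by (intro integral_cong) (auto simp: fdk right_diff_distrib)
    then show ?thesis
      unfolding e dint_def using integrable_dint[OF c x] by (simp add: integral_diff)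
  qed
  ultimately show "\<alpha> x $ i = fd S x (axis i 1) +
      (\<Sum>k\<in>UNIV. real (w k) * x $ k *
        dint w (w i + w k - 1) (\<lambda>y. fd \<alpha> y (axis k 1) $ i - fd \<alpha> y (axis i 1) $ k) x)"
    unfolding S' by (simp add: right_diff_distrib sum_subtractf)
qed

section \<open>One-forms along the curve\<close>

lemma smooth_on_divide_const:
  fixes f :: "'a::real_normed_vector \<Rightarrow> real"
  shows "open U \<Longrightarrow> smooth_on U f \<Longrightarrow> smooth_on U (\<lambda>x. f x / c)"
  using smooth_on_mult[of U f "\<lambda>_. inverse c"] by (simp add: divide_inverse)

lemmas smooth_intros = smooth_on_const smooth_on_ident smooth_on_nth_ident smooth_on_add smooth_on_diff
  smooth_on_minus smooth_on_mult smooth_on_power smooth_on_divide_const smooth_on_sum smooth_on_scaleR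

definition g1 :: "real \<Rightarrow> real^3" where "g1 t = vector [0, t, 0]"

definition g2 :: "real \<Rightarrow> real^3" where "g2 t = vector [t^4, t^5, - (t^3)]"

definition C7 :: "(real^3) set" where "C7 = range g1 \<union> range g2"

definition grad :: "(real^'n \<Rightarrow> real) \<Rightarrow> real^'n \<Rightarrow> real^'n" where
  "grad S x = (\<chi> i. fd S x (axis i 1))"

text \<open>The difference is a covector of R^3, not only a function on tangent vectors of the
  curve. On the ball this amounts to saying that the exterior derivatives of \<open>\<alpha>\<close>
  and \<open>\<beta>\<close> differ by that of a 1-form vanishing at the points of the
  curve.\<close>

definition cohom :: "real \<Rightarrow> (real^3 \<Rightarrow> real^3) \<Rightarrow> (real^3 \<Rightarrow> real^3) \<Rightarrow> bool" where
  "cohom r \<alpha> \<beta> \<longleftrightarrow> (\<exists>S. smooth_on (ball 0 r) S \<and> (\<forall>x\<in>ball 0 r \<inter> C7. \<alpha> x - \<beta> x = grad S x))"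

text \<open>
  The contraction of \<open>a dx\<^sub>1\<and>dx\<^sub>3 + b dx\<^sub>2\<and>dx\<^sub>3 + d dx\<^sub>1\<and>dx\<^sub>2\<close> with the Euler field
  \<open>(4 x\<^sub>1, 5 x\<^sub>2, 3 x\<^sub>3)\<close>.
\<close>
definition iE :: "real \<Rightarrow> real \<Rightarrow> real \<Rightarrow> real^3 \<Rightarrow> real^3" where
  "iE a b d x = vector [- 3 * x$3 * a - 5 * x$2 * d, 4 * x$1 * d - 3 * x$3 * b, 4 * x$1 * a + 5 * x$2 * b]"

lemma has_derivative_nth_ident [derivative_intros]: "((\<lambda>x::real^'n. x $ i) has_derivative (\<lambda>v. v $ i)) (at x)"
  by (rule bounded_linear_imp_has_derivative[OF bounded_linear_vec_nth])

lemma g1_nth [simp]: "g1 t $ 1 = 0" "g1 t $ 2 = t" "g1 t $ 3 = 0"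
  and g2_nth [simp]: "g2 t $ 1 = t^4" "g2 t $ 2 = t^5" "g2 t $ 3 = - (t^3)"
  by (simp_all add: g1_def g2_def)

lemma iE_nth [simp]:
  "iE a b d x $ 1 = - 3 * x$3 * a - 5 * x$2 * d"
  "iE a b d x $ 2 = 4 * x$1 * d - 3 * x$3 * b"
  "iE a b d x $ 3 = 4 * x$1 * a + 5 * x$2 * b"
  by (simp_all add: iE_def)

lemma vec3_eq_iff: "(x::real^3) = y \<longleftrightarrow> x$1 = y$1 \<and> x$2 = y$2 \<and> x$3 = y$3"
  by (auto simp: vec_eq_iff forall_3)

lemma C7_cases: "x \<in> C7 \<Longrightarrow> (\<And>t. x = g1 t \<Longrightarrow> P) \<Longrightarrow> (\<And>t. x = g2 t \<Longrightarrow> P) \<Longrightarrow> P"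
  by (auto simp: C7_def)

lemma iE_0: "iE 0 0 0 x = 0"
  by (simp add: vec3_eq_iff)

lemma iE_scale: "iE (c * a) (c * b) (c * d) x = c *\<^sub>R iE a b d x"
  by (simp add: vec3_eq_iff algebra_simps)

lemma iE_add: "iE (a + a') (b + b') (d + d') x = iE a b d x + iE a' b' d' x"
  by (simp add: vec3_eq_iff algebra_simps)

lemma grad_nth [simp]: "grad S x $ i = fd S x (axis i 1)"
  by (simp add: grad_def)

lemma grad_const [simp]: "grad (\<lambda>x. c) x = 0"
  by (simp add: vec_eq_iff)

lemma grad_add:
  assumes "smooth_on U S" "smooth_on U T" "x \<in> U"
  shows "grad (\<lambda>x. S x + T x) x = grad S x + grad T x"
  using fd_eq[OF has_derivative_add[OF smooth_on_has_derivative[OF assms(1,3)] smooth_on_has_derivative[OF assms(2,3)]]]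
  by (simp add: vec_eq_iff)

lemma grad_cmult:
  assumes "smooth_on U S" "x \<in> U"
  shows "grad (\<lambda>x. c * S x) x = c *\<^sub>R grad S x"
  using fd_eq[OF has_derivative_mult_right[OF smooth_on_has_derivative[OF assms]]]
  by (simp add: vec_eq_iff)

lemma grad_mult:
  assumes "smooth_on U S" "smooth_on U T" "x \<in> U"
  shows "grad (\<lambda>x. S x * T x) x = S x *\<^sub>R grad T x + T x *\<^sub>R grad S x"
  using fd_eq[OF has_derivative_mult[OF smooth_on_has_derivative[OF assms(1,3)] smooth_on_has_derivative[OF assms(2,3)]]]
  by (simp add: vec_eq_iff mult.commute)

lemma cohom_add:
  assumes "cohom r \<alpha> \<beta>" "cohom r \<alpha>' \<beta>'"
  shows "cohom r (\<lambda>x. \<alpha> x + \<alpha>' x) (\<lambda>x. \<beta> x + \<beta>' x)"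
proof -
  obtain S T where S: "smooth_on (ball 0 r) S" "\<And>x. x\<in>ball 0 r \<inter> C7 \<Longrightarrow> \<alpha> x - \<beta> x = grad S x"
    and T: "smooth_on (ball 0 r) T" "\<And>x. x\<in>ball 0 r \<inter> C7 \<Longrightarrow> \<alpha>' x - \<beta>' x = grad T x"
    using assms unfolding cohom_def by blast
  have "\<alpha> x + \<alpha>' x - (\<beta> x + \<beta>' x) = grad (\<lambda>x. S x + T x) x" if "x\<in>ball 0 r \<inter> C7" for x
    using S(2)[OF that] T(2)[OF that] grad_add[OF S(1) T(1), of x] that by (simp add: algebra_simps)
  then show ?thesis
    unfolding cohom_def using smooth_on_add[OF open_ball S(1) T(1)] by blast
qed

lemma cohom_scale:
  assumes "cohom r \<alpha> \<beta>"
  shows "cohom r (\<lambda>x. c *\<^sub>R \<alpha> x) (\<lambda>x. c *\<^sub>R \<beta> x)"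
proof -
  obtain S where S: "smooth_on (ball 0 r) S" "\<And>x. x\<in>ball 0 r \<inter> C7 \<Longrightarrow> \<alpha> x - \<beta> x = grad S x"
    using assms unfolding cohom_def by blast
  have "c *\<^sub>R \<alpha> x - c *\<^sub>R \<beta> x = grad (\<lambda>x. c * S x) x" if "x\<in>ball 0 r \<inter> C7" for x
    using S(2)[OF that] grad_cmult[OF S(1), of x] that by (metis IntD1 scaleR_right_diff_distrib)
  then show ?thesis
    unfolding cohom_def using smooth_on_mult[OF open_ball smooth_on_const S(1)] by blast
qed

lemma cohom_eq: "(\<And>x. x \<in> C7 \<Longrightarrow> norm x < r \<Longrightarrow> \<alpha> x = \<beta> x) \<Longrightarrow> cohom r \<alpha> \<beta>"
  unfolding cohom_def by (rule exI[of _ "\<lambda>_. 0"]) (auto simp: smooth_on_const)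

lemma cohom_refl: "cohom r \<alpha> \<alpha>"
  by (rule cohom_eq) simp

lemma cohom_sym: "cohom r \<alpha> \<beta> \<Longrightarrow> cohom r \<beta> \<alpha>"
  using cohom_add[OF cohom_scale[of r \<alpha> \<beta> "-1"] cohom_refl[of r "\<lambda>x. \<alpha> x + \<beta> x"]] by simp

lemma cohom_trans: "cohom r \<alpha> \<beta> \<Longrightarrow> cohom r \<beta> \<delta> \<Longrightarrow> cohom r \<alpha> \<delta>"
  using cohom_add[OF cohom_add[of r \<alpha> \<beta> \<beta> \<delta>] cohom_refl[of r "\<lambda>x. - \<beta> x"]] by simp

lemma cohom_grad:
  assumes "smooth_on (ball 0 r) P"
  shows "cohom r (grad P) (\<lambda>_. 0)"
  using assms unfolding cohom_def by auto

text \<open>As \<open>P\<close> vanishes on the curve, the term \<open>P dh\<close> of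
  \<open>d(h P)\<close> disappears there. In this way each equation of the curve yields relations
  with arbitrary smooth coefficients.\<close>

lemma cohom_ideal:
  assumes h: "smooth_on (ball 0 r) h" and P: "smooth_on (ball 0 r) P" "\<And>x. x \<in> C7 \<Longrightarrow> P x = 0"
  shows "cohom r (\<lambda>x. h x *\<^sub>R grad P x) (\<lambda>_. 0)"
  unfolding cohom_def using grad_mult[OF h P(1)] P(2)
  by (intro exI[of _ "\<lambda>x. h x * P x"] conjI smooth_on_mult open_ball h P(1)) auto

lemma cohom_iE_add:
  assumes "cohom r (\<lambda>x. iE (a x) (b x) (d x) x) (\<lambda>x. iE (a' x) (b' x) (d' x) x)"
    "cohom r (\<lambda>x. iE (p x) (q x) (s x) x) (\<lambda>x. iE (p' x) (q' x) (s' x) x)"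
    "\<And>x. A x = a x + p x" "\<And>x. B x = b x + q x" "\<And>x. D x = d x + s x"
    "\<And>x. A' x = a' x + p' x" "\<And>x. B' x = b' x + q' x" "\<And>x. D' x = d' x + s' x"
  shows "cohom r (\<lambda>x. iE (A x) (B x) (D x) x) (\<lambda>x. iE (A' x) (B' x) (D' x) x)"
  using cohom_add[OF assms(1,2)] by (simp only: assms(3-) iE_add)

section \<open>Relations between contractions along the curve\<close>

abbreviation exact :: "real \<Rightarrow> (real^3 \<Rightarrow> real^3) \<Rightarrow> bool" where
  "exact r \<alpha> \<equiv> cohom r \<alpha> (\<lambda>x. iE 0 0 0 x)"

text \<open>\<open>?f\<close> and \<open>?g\<close> are the equations of the curve. On the curve the
  differential of \<open>A ?f + B ?g\<close> is \<open>A d?f + B d?g\<close>, and \<open>e\<close>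
  identifies it with a contraction; multiples by \<open>h\<close> stay exact by
  \<open>cohom_ideal\<close>.\<close>

lemma exact_multiple:
  fixes A B a b d :: "real^3 \<Rightarrow> real"
  assumes h: "smooth_on (ball 0 r) h" and A: "smooth_on (ball 0 r) A" and B: "smooth_on (ball 0 r) B"
    and e: "\<And>x. x \<in> C7 \<Longrightarrow> A x * (2 * x$1) + B x * x$2 = iE (a x) (b x) (d x) x $ 1 \<and>
      A x * x$3 + B x * x$1 = iE (a x) (b x) (d x) x $ 2 \<and> A x * x$2 + B x * (3 * x$3^2) = iE (a x) (b x) (d x) x $ 3"
    and m: "\<And>x. a' x = a x * h x" "\<And>x. b' x = b x * h x" "\<And>x. d' x = d x * h x"
  shows "exact r (\<lambda>x. iE (a' x) (b' x) (d' x) x)"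
proof -
  let ?f = "\<lambda>x::real^3. x$1^2 + x$2 * x$3" and ?g = "\<lambda>x::real^3. x$1 * x$2 + x$3^3"
  let ?f1 = "\<lambda>x::real^3. 2 * x$1" and ?f2 = "\<lambda>x::real^3. x$3" and ?f3 = "\<lambda>x::real^3. x$2"
  let ?g1 = "\<lambda>x::real^3. x$2" and ?g2 = "\<lambda>x::real^3. x$1" and ?g3 = "\<lambda>x::real^3. 3 * x$3^2"
  let ?P = "\<lambda>x. A x * ?f x + B x * ?g x"
  have P: "smooth_on (ball 0 r) ?P"
    by (intro smooth_intros A B open_ball)
  have z: "?f x = 0" "?g x = 0" if "x \<in> C7" for x
    using that by (auto simp: C7_def algebra_simps simp flip: power_mult power_add)
  have d: "(?P has_derivative (\<lambda>v. fd A x v * ?f x + A x * (?f1 x * v$1 + ?f2 x * v$2 + ?f3 x * v$3)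
      + fd B x v * ?g x + B x * (?g1 x * v$1 + ?g2 x * v$2 + ?g3 x * v$3))) (at x)" if "x \<in> ball 0 r" for x
    by (rule derivative_eq_intros smooth_on_has_derivative[OF A that] smooth_on_has_derivative[OF B that] refl | simp add: algebra_simps)+
  have "grad ?P x = iE (a x) (b x) (d x) x" if "x \<in> C7" "norm x < r" for x
  proof -
    from that have "x \<in> ball 0 r" by simp
    from fd_eq[OF d[OF this]] show ?thesis
      using z[OF that(1)] e[OF that(1)] by (simp add: vec3_eq_iff axis_def)
  qed
  then have "cohom r (\<lambda>x. iE (a' x) (b' x) (d' x) x) (\<lambda>x. h x *\<^sub>R grad ?P x)"
    by (intro cohom_eq) (simp only: m mult.commute[of _ "h _"] iE_scale)
  moreover have "exact r (\<lambda>x. h x *\<^sub>R grad ?P x)"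
    unfolding iE_0 by (rule cohom_ideal[OF h P]) (use z in auto)
  ultimately show ?thesis by (rule cohom_trans)
qed

text \<open>Each pair \<open>A\<close>, \<open>B\<close> solves
  \<open>A df + B dg = iE a b d\<close> along the curve. Everything is quasihomogeneous: for a
  contraction of weight \<open>w\<close>, \<open>A\<close> has weight \<open>w - 8\<close> and
  \<open>B\<close> weight \<open>w - 9\<close>, so the pairs are found by solving small linear
  systems. The first six relations trade multiples in the second and third entry for multiples in
  the first entry; the last six kill multiples in the first entry.\<close>

lemma cohom_relations:
  assumes h: "smooth_on (ball 0 r) h"
  shows rel_x1_th2: "exact r (\<lambda>x. iE (x$2 * h x) (x$1 * h x) 0 x)"
    and rel_x2_th2: "exact r (\<lambda>x. iE (6 * x$3^2 * h x) (x$2 * h x) 0 x)"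
    and rel_x3_th2: "exact r (\<lambda>x. iE (2 * x$1 * h x) (x$3 * h x) 0 x)"
    and rel_x1_th3: "exact r (\<lambda>x. iE (3 * x$3^2 * h x) 0 (x$1 * h x) x)"
    and rel_x2_th3: "exact r (\<lambda>x. iE (6 * x$1 * x$3 * h x) 0 (x$2 * h x) x)"
    and rel_x3_th3: "exact r (\<lambda>x. iE (x$2 * h x) 0 (x$3 * h x) x)"
    and rel_x2x3: "exact r (\<lambda>x. iE (x$2 * x$3 * h x) 0 0 x)"
    and rel_x1x1: "exact r (\<lambda>x. iE (x$1^2 * h x) 0 0 x)"
    and rel_x3x3x3: "exact r (\<lambda>x. iE (x$3^3 * h x) 0 0 x)"
    and rel_x1x2: "exact r (\<lambda>x. iE (x$1 * x$2 * h x) 0 0 x)"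
    and rel_x1x3x3: "exact r (\<lambda>x. iE (x$1 * x$3^2 * h x) 0 0 x)"
    and rel_x2x2: "exact r (\<lambda>x. iE (x$2^2 * h x) 0 0 x)"
  by (rule exact_multiple[OF h, of "\<lambda>x. 0" "\<lambda>x. -3*x$3" "\<lambda>x. x$2" "\<lambda>x. x$1" "\<lambda>x. 0"]
    exact_multiple[OF h, of "\<lambda>x. 5*x$2" "\<lambda>x. 8*x$1" "\<lambda>x. 6 * x$3^2" "\<lambda>x. x$2" "\<lambda>x. 0"]
    exact_multiple[OF h, of "\<lambda>x. -3*x$3" "\<lambda>x. 0" "\<lambda>x. 2*x$1" "\<lambda>x. x$3" "\<lambda>x. 0"]
    exact_multiple[OF h, of "\<lambda>x. 0" "\<lambda>x. 4*x$1" "\<lambda>x. 3*x$3^2" "\<lambda>x. 0" "\<lambda>x. x$1"]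
    exact_multiple[OF h, of "\<lambda>x. -9*x$3^2" "\<lambda>x. -5*x$2" "\<lambda>x. 6 * x$1 * x$3" "\<lambda>x. 0" "\<lambda>x. x$2"]
    exact_multiple[OF h, of "\<lambda>x. 4*x$1" "\<lambda>x. 0" "\<lambda>x. x$2" "\<lambda>x. 0" "\<lambda>x. x$3"]
    exact_multiple[OF h, of "\<lambda>x. x$1*x$3" "\<lambda>x. -(x$3^2)" "\<lambda>x. x$2*x$3" "\<lambda>x. 0" "\<lambda>x. 0"]
    exact_multiple[OF h, of "\<lambda>x. -(x$1*x$3)" "\<lambda>x. x$3^2" "\<lambda>x. x$1^2" "\<lambda>x. 0" "\<lambda>x. 0"]
    exact_multiple[OF h, of "\<lambda>x. x$2*x$3" "\<lambda>x. x$1*x$3" "\<lambda>x. x$3^3" "\<lambda>x. 0" "\<lambda>x. 0"]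
    exact_multiple[OF h, of "\<lambda>x. -(x$2*x$3)" "\<lambda>x. -(x$1*x$3)" "\<lambda>x. x$1*x$2" "\<lambda>x. 0" "\<lambda>x. 0"]
    exact_multiple[OF h, of "\<lambda>x. -(3/2)*x$3^3-(1/2)*x$1*x$2" "\<lambda>x. -(x$2*x$3)" "\<lambda>x. x$1*x$3^2" "\<lambda>x. 0" "\<lambda>x. 0"]
    exact_multiple[OF h, of "\<lambda>x. x$1*x$2" "\<lambda>x. -(x$2*x$3)" "\<lambda>x. x$2^2" "\<lambda>x. 0" "\<lambda>x. 0"];
    (intro smooth_intros open_ball; fail)?; auto simp: C7_def eval_nat_numeral algebra_simps)+

text \<open>
  The coefficient \<open>c w\<close> belongs to the unique (up to the class of weight \<open>12\<close>, which is exact)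
  restriction of a \<open>2\<close>-form of weight \<open>w\<close>, with \<open>x\<^sub>1, x\<^sub>2, x\<^sub>3\<close> of weights \<open>4, 5, 3\<close>.
\<close>
definition nfK :: "(nat \<Rightarrow> real) \<Rightarrow> real^3 \<Rightarrow> real^3" where
  "nfK c x = iE (c 7 + c 10 * x$3 + c 11 * x$1 + c 13 * x$3^2 + c 14 * x$1 * x$3) (c 8) (c 9) x"

text \<open>The function \<open>x1^3 - x3^4\<close> is \<open>x1\<close> times the first equation of
  the curve minus \<open>x3\<close> times the second, hence zero on the curve, and its differential
  is the contraction of weight 12. For this reason \<open>nfK\<close> has no coefficient of weight
  12.\<close>

lemma rel_x2: "exact r (\<lambda>x. iE (b * x$2) 0 0 x)"
proof -
  let ?P = "\<lambda>x::real^3. b * (x$1^3 - x$3^4)"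
  have d: "(?P has_derivative (\<lambda>v. b * (3 * x$1^2 * v$1 - 4 * x$3^3 * v$3))) (at x)" for x
    by (auto intro!: derivative_eq_intros simp: algebra_simps)
  have "exact r (grad ?P)"
    unfolding iE_0 by (intro cohom_grad smooth_intros open_ball)
  moreover have "cohom r (\<lambda>x. iE (b * x$2) 0 0 x) (grad ?P)"
  proof (rule cohom_eq)
    fix x assume x: "x \<in> C7"
    have "grad ?P x = vector [b * (3 * x$1^2), 0, - (b * (4 * x$3^3))]"
      unfolding grad_def by (simp add: fd_eq[OF d] vec3_eq_iff axis_def)
    moreover have "iE (b * x$2) 0 0 x = vector [b * (3 * x$1^2), 0, - (b * (4 * x$3^3))]"
      by (rule C7_cases[OF x]; hypsubst) (simp_all add: vec3_eq_iff eval_nat_numeral)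
    ultimately show "iE (b * x$2) 0 0 x = grad ?P x" by simp
  qed
  ultimately show ?thesis by (rule cohom_trans[rotated])
qed

text \<open>Hadamard expansion is repeated until every term is a constant times \<open>1\<close>,
  \<open>x3\<close>, \<open>x1\<close>, \<open>x3^2\<close> or \<open>x1 x3\<close>, or a smooth
  multiple of one of the six monomials killed by \<open>cohom_relations\<close>. The only other term
  is a constant times \<open>x2\<close>, which \<open>rel_x2\<close> removes.\<close>

lemma cohom_theta1:
  assumes h: "smooth_on (ball 0 r) h"
  obtains c where "c 8 = 0" "c 9 = 0" "cohom r (\<lambda>x. iE (h x) 0 0 x) (nfK c)"
proof -
  define Z where "Z a \<longleftrightarrow> exact r (\<lambda>x. iE (a x) 0 0 x)" for a
  have Zadd: "Z (\<lambda>x. a x + b x)" if "Z a" "Z b" for a b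
    using that unfolding Z_def by (rule cohom_iE_add) auto
  have had: "\<exists>c a1 a2 a3. smooth_on (ball 0 r) a1 \<and> smooth_on (ball 0 r) a2 \<and> smooth_on (ball 0 r) a3 \<and>
      (\<forall>x\<in>ball 0 r. a x = c + x$1 * a1 x + x$2 * a2 x + x$3 * a3 x)"
    if "smooth_on (ball 0 r) a" for a :: "real^3 \<Rightarrow> real"
  proof -
    obtain k where "\<And>i. smooth_on (ball 0 r) (k i)" "\<And>x. x \<in> ball 0 r \<Longrightarrow> a x = a 0 + (\<Sum>i\<in>UNIV. x $ i * k i x)"
      using hadamard[OF \<open>smooth_on (ball 0 r) a\<close>] by metis
    then show ?thesis
      by (intro exI[of _ "a 0"] exI[of _ "k 1"] exI[of _ "k 2"] exI[of _ "k 3"]) (simp add: sum_3 add.assoc)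
  qed
  obtain h0 h1 h2 h3 where H: "smooth_on (ball 0 r) h1" "smooth_on (ball 0 r) h2" "smooth_on (ball 0 r) h3"
    "\<forall>x\<in>ball 0 r. h x = h0 + x$1 * h1 x + x$2 * h2 x + x$3 * h3 x" using had[OF h] by metis
  obtain a0 a1 a2 a3 where A: "smooth_on (ball 0 r) a1" "smooth_on (ball 0 r) a2" "smooth_on (ball 0 r) a3"
    "\<forall>x\<in>ball 0 r. h1 x = a0 + x$1 * a1 x + x$2 * a2 x + x$3 * a3 x" using had[OF H(1)] by metis
  obtain b0 b1 b2 b3 where B: "smooth_on (ball 0 r) b1" "smooth_on (ball 0 r) b2" "smooth_on (ball 0 r) b3"
    "\<forall>x\<in>ball 0 r. h2 x = b0 + x$1 * b1 x + x$2 * b2 x + x$3 * b3 x" using had[OF H(2)] by metis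
  obtain d0 d1 d2 d3 where D: "smooth_on (ball 0 r) d1" "smooth_on (ball 0 r) d2" "smooth_on (ball 0 r) d3"
    "\<forall>x\<in>ball 0 r. h3 x = d0 + x$1 * d1 x + x$2 * d2 x + x$3 * d3 x" using had[OF H(3)] by metis
  obtain q0 q1 q2 q3 where Q: "smooth_on (ball 0 r) q1" "smooth_on (ball 0 r) q2" "smooth_on (ball 0 r) q3"
    "\<forall>x\<in>ball 0 r. d3 x = q0 + x$1 * q1 x + x$2 * q2 x + x$3 * q3 x" using had[OF D(3)] by metis
  \<comment> \<open>The monomial \<open>x1 x3\<close> arises both from \<open>h1\<close> and from
    \<open>h3\<close>; the two coefficients are added before being expanded once more.\<close>
  have "smooth_on (ball 0 r) (\<lambda>x. a3 x + d1 x)" by (intro smooth_intros open_ball A D)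
  from had[OF this] obtain m0 m1 m2 m3 where M: "smooth_on (ball 0 r) m1" "smooth_on (ball 0 r) m2" "smooth_on (ball 0 r) m3"
    "\<forall>x\<in>ball 0 r. a3 x + d1 x = m0 + x$1 * m1 x + x$2 * m2 x + x$3 * m3 x" by blast
  define z where "z x = x$1^2 * (a1 x + x$3 * m1 x) + x$1 * x$2 * (a2 x + b1 x + x$3 * m2 x)
      + x$1 * x$3^2 * (m3 x + q1 x) + x$2^2 * b2 x + x$2 * x$3 * (b3 x + d2 x + x$3 * q2 x) + x$3^3 * q3 x + b0 * x$2" for x
  define c where "c = (\<lambda>_::nat. 0::real)(7 := h0, 10 := d0, 11 := a0, 13 := q0, 14 := m0)"
  have "Z z"
    unfolding z_def
    by (intro Zadd)
      (unfold Z_def, (intro rel_x1x1 rel_x1x2 rel_x1x3x3 rel_x2x2 rel_x2x3 rel_x3x3x3 rel_x2 smooth_intros A B D Q M open_ball)+)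
  then have "cohom r (\<lambda>x. iE (h0 + d0 * x$3 + a0 * x$1 + q0 * x$3^2 + m0 * x$1 * x$3 + z x) 0 0 x)
      (\<lambda>x. iE (h0 + d0 * x$3 + a0 * x$1 + q0 * x$3^2 + m0 * x$1 * x$3) 0 0 x)"
    unfolding Z_def by (rule cohom_iE_add[OF cohom_refl]) auto
  moreover have "cohom r (\<lambda>x. iE (h x) 0 0 x)
      (\<lambda>x. iE (h0 + d0 * x$3 + a0 * x$1 + q0 * x$3^2 + m0 * x$1 * x$3 + z x) 0 0 x)"
  proof (rule cohom_eq)
    fix x :: "real^3" assume "norm x < r"
    then have x: "x \<in> ball 0 r" by simp
    have "h x = h0 + x$1 * (a0 + x$1 * a1 x + x$2 * a2 x) + x$2 * (b0 + x$1 * b1 x + x$2 * b2 x + x$3 * b3 x)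
        + x$3 * (d0 + x$2 * d2 x + x$3 * (q0 + x$1 * q1 x + x$2 * q2 x + x$3 * q3 x)) + x$1 * x$3 * (a3 x + d1 x)"
      using H(4) A(4) B(4) D(4) Q(4) x by (simp add: algebra_simps)
    also have "\<dots> = h0 + d0 * x$3 + a0 * x$1 + q0 * x$3^2 + m0 * x$1 * x$3 + z x"
      using M(4) x unfolding z_def by (simp add: algebra_simps eval_nat_numeral)
    finally show "iE (h x) 0 0 x = iE (h0 + d0 * x$3 + a0 * x$1 + q0 * x$3^2 + m0 * x$1 * x$3 + z x) 0 0 x"
      by simp
  qed
  ultimately have "cohom r (\<lambda>x. iE (h x) 0 0 x) (nfK c)"
    unfolding nfK_def c_def by (simp add: cohom_trans)
  moreover have "c 8 = 0" "c 9 = 0" by (auto simp: c_def)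
  ultimately show thesis using that by blast
qed

text \<open>The first six relations move the nonconstant parts of \<open>t2\<close> and
  \<open>t3\<close> into the first entry, where \<open>cohom_theta1\<close> takes over.\<close>

lemma cohom_iE_reduce:
  assumes "smooth_on (ball 0 r) t1" "smooth_on (ball 0 r) t2" "smooth_on (ball 0 r) t3"
  obtains c where "cohom r (\<lambda>x. iE (t1 x) (t2 x) (t3 x) x) (nfK c)"
proof -
  obtain k where k: "\<And>i. smooth_on (ball 0 r) (k i)" "\<And>x. x \<in> ball 0 r \<Longrightarrow> t2 x = t2 0 + (\<Sum>i\<in>UNIV. x $ i * k i x)"
    using hadamard[OF assms(2)] by metis
  obtain l where l: "\<And>i. smooth_on (ball 0 r) (l i)" "\<And>x. x \<in> ball 0 r \<Longrightarrow> t3 x = t3 0 + (\<Sum>i\<in>UNIV. x $ i * l i x)"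
    using hadamard[OF assms(3)] by metis
  \<comment> \<open>The signs are negative because the relations are read as replacements: for
    instance \<open>iE 0 (x1 k) 0\<close> becomes \<open>iE (- x2 k) 0 0\<close>.\<close>
  define h where "h x = t1 x - x$2 * k 1 x - 6 * x$3^2 * k 2 x - 2 * x$1 * k 3 x
    - 3 * x$3^2 * l 1 x - 6 * x$1 * x$3 * l 2 x - x$2 * l 3 x" for x
  have "smooth_on (ball 0 r) h" unfolding h_def by (intro smooth_intros open_ball assms k l)
  then obtain c where c: "c 8 = 0" "c 9 = 0" "cohom r (\<lambda>x. iE (h x) 0 0 x) (nfK c)"
    by (rule cohom_theta1)
  have c': "cohom r (\<lambda>x. iE (h x) (t2 0) (t3 0) x) (nfK (c(8 := t2 0, 9 := t3 0)))"
    unfolding nfK_def using c(1,2)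
    by (intro cohom_iE_add[OF c(3)[unfolded nfK_def] cohom_refl[of r "\<lambda>x. iE 0 (t2 0) (t3 0) x"]]) auto
  have e: "exact r (\<lambda>x. iE (t1 x - h x) (t2 x - t2 0) (t3 x - t3 0) x)"
  proof -
    have "exact r (\<lambda>x. iE (x$2 * k 1 x + 6 * x$3^2 * k 2 x + 2 * x$1 * k 3 x + (3 * x$3^2 * l 1 x + 6 * x$1 * x$3 * l 2 x + x$2 * l 3 x))
        (x$1 * k 1 x + x$2 * k 2 x + x$3 * k 3 x) (x$1 * l 1 x + x$2 * l 2 x + x$3 * l 3 x) x)"
      by (rule cohom_iE_add[OF
            cohom_iE_add[OF cohom_iE_add[OF rel_x1_th2[OF k(1)] rel_x2_th2[OF k(1)] refl refl refl refl refl refl] rel_x3_th2[OF k(1)] refl refl refl refl refl refl]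
            cohom_iE_add[OF cohom_iE_add[OF rel_x1_th3[OF l(1)] rel_x2_th3[OF l(1)] refl refl refl refl refl refl] rel_x3_th3[OF l(1)] refl refl refl refl refl refl]])
        auto
    moreover have "cohom r (\<lambda>x. iE (t1 x - h x) (t2 x - t2 0) (t3 x - t3 0) x)
      (\<lambda>x. iE (x$2 * k 1 x + 6 * x$3^2 * k 2 x + 2 * x$1 * k 3 x + (3 * x$3^2 * l 1 x + 6 * x$1 * x$3 * l 2 x + x$2 * l 3 x))
        (x$1 * k 1 x + x$2 * k 2 x + x$3 * k 3 x) (x$1 * l 1 x + x$2 * l 2 x + x$3 * l 3 x) x)"
      by (rule cohom_eq) (simp add: h_def k(2) l(2) sum_3 algebra_simps)
    ultimately show ?thesis by (rule cohom_trans[rotated])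
  qed
  have "cohom r (\<lambda>x. iE (t1 x) (t2 x) (t3 x) x) (\<lambda>x. iE (h x) (t2 0) (t3 0) x)"
    by (rule cohom_iE_add[OF e cohom_refl[of r "\<lambda>x. iE (h x) (t2 0) (t3 0) x"]]) auto
  from cohom_trans[OF this c'] show thesis by (rule that)
qed

text \<open>With the weights \<open>(4, 5, 3)\<close> of the curve, the remainder in the Poincare
  lemma is exactly a contraction with the Euler field, with smooth entries.\<close>

lemma cohom_reduce:
  assumes \<alpha>: "smooth_on (ball 0 r) \<alpha>"
  obtains c where "cohom r \<alpha> (nfK c)"
proof -
  define w where "w = (\<lambda>i::3. if i = 1 then 4 else if i = 2 then 5 else 3::nat)"
  have w: "w i \<ge> 1" "w 1 = 4" "w 2 = 5" "w 3 = 3" for i by (auto simp: w_def)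
  define T where "T i k x = dint w (w i + w k - 1) (\<lambda>y. fd \<alpha> y (axis k 1) $ i - fd \<alpha> y (axis i 1) $ k) x" for i k x
  obtain S where S: "smooth_on (ball 0 r) S"
    "\<And>x i. x \<in> ball 0 r \<Longrightarrow> \<alpha> x $ i = fd S x (axis i 1) + (\<Sum>k\<in>UNIV. real (w k) * x $ k * T i k x)"
    unfolding T_def by (rule poincare[of r \<alpha> w, OF \<alpha> w(1)]) blast
  have Ts: "smooth_on (ball 0 r) (T i k)" for i k
    unfolding T_def by (intro smooth_on_dint smooth_on_diff smooth_on_nth smooth_on_fd \<alpha> open_ball)
  \<comment> \<open>Antisymmetry reduces the nine functions \<open>T i k\<close> to the three
    entries of \<open>iE\<close>.\<close>
  have anti: "T k i x = - T i k x" for i k x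
  proof -
    have "T k i x = integral {0..1} (\<lambda>s. - (s ^ (w i + w k - 1) * (fd \<alpha> (dil w s x) (axis k 1) $ i - fd \<alpha> (dil w s x) (axis i 1) $ k)))"
      unfolding T_def dint_def by (simp add: add.commute algebra_simps)
    then show ?thesis unfolding T_def dint_def by (simp only: integral_neg)
  qed
  have diag: "T i i x = 0" for i x by (simp add: T_def dint_def)
  have "cohom r (grad S) (\<lambda>_. 0)" by (rule cohom_grad[OF S(1)])
  from cohom_add[OF this cohom_refl]
  have 1: "cohom r (\<lambda>x. grad S x + iE (T 3 1 x) (T 3 2 x) (T 2 1 x) x) (\<lambda>x. 0 + iE (T 3 1 x) (T 3 2 x) (T 2 1 x) x)" .
  have 2: "cohom r \<alpha> (\<lambda>x. grad S x + iE (T 3 1 x) (T 3 2 x) (T 2 1 x) x)"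
    using anti[of 1 3] anti[of 2 3] anti[of 1 2]
    by (intro cohom_eq) (simp add: vec3_eq_iff S(2) sum_3 w diag)
  obtain c where "cohom r (\<lambda>x. iE (T 3 1 x) (T 3 2 x) (T 2 1 x) x) (nfK c)"
    using cohom_iE_reduce[OF Ts Ts Ts] .
  with 1 2 have "cohom r \<alpha> (nfK c)" by (auto intro: cohom_trans)
  then show thesis by (rule that)
qed

section \<open>Quasihomogeneous substitutions\<close>

definition pull :: "(real^3 \<Rightarrow> real^3) \<Rightarrow> (real^3 \<Rightarrow> real^3) \<Rightarrow> real^3 \<Rightarrow> real^3" where
  "pull \<Lambda> \<alpha> x = (\<chi> i. \<alpha> (\<Lambda> x) \<bullet> fd \<Lambda> x (axis i 1))"

text \<open>The factor \<open>l\<close> may vary with the point. Each point of a branch is still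
  sent to a point of the same branch, while the nonconstant part of \<open>l\<close> provides the
  freedom to remove coefficients of higher weight.\<close>

definition qscale :: "(real^3 \<Rightarrow> real) \<Rightarrow> real^3 \<Rightarrow> real^3" where
  "qscale l x = vector [l x ^ 4 * x$1, l x ^ 5 * x$2, l x ^ 3 * x$3]"

lemma qscale_nth [simp]:
  "qscale l x $ 1 = l x ^ 4 * x$1" "qscale l x $ 2 = l x ^ 5 * x$2" "qscale l x $ 3 = l x ^ 3 * x$3"
  by (simp_all add: qscale_def)

lemma qscale_0 [simp]: "qscale l 0 = 0"
  by (simp add: vec3_eq_iff)

lemma qscale_g: "qscale l (g1 t) = g1 (l (g1 t) ^ 5 * t)" "qscale l (g2 t) = g2 (l (g2 t) * t)"
  by (simp_all add: vec3_eq_iff power_mult_distrib)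

lemma qscale_C7: "x \<in> C7 \<Longrightarrow> qscale l x \<in> C7"
  by (auto simp: C7_def qscale_g)

lemma vector3_axis: "(vector [a, b, c] :: real^3) = a *\<^sub>R axis 1 1 + b *\<^sub>R axis 2 1 + c *\<^sub>R axis 3 1"
  by (simp add: vec3_eq_iff axis_def)

lemma has_derivative_vector3:
  assumes "(f has_derivative f') (at x)" "(g has_derivative g') (at x)" "(h has_derivative h') (at x)"
  shows "((\<lambda>x. vector [f x, g x, h x] :: real^3) has_derivative (\<lambda>v. vector [f' v, g' v, h' v])) (at x)"
  unfolding vector3_axis by (intro has_derivative_add has_derivative_scaleR_left assms)

lemma smooth_on_vector3:
  assumes "open U" "smooth_on U f" "smooth_on U g" "smooth_on U h"
  shows "smooth_on U (\<lambda>x. vector [f x, g x, h x] :: real^3)"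
  unfolding vector3_axis by (intro smooth_on_add smooth_on_scaleR smooth_on_const assms)

lemma smooth_on_qscale:
  assumes "smooth_on U l" "open U" shows "smooth_on U (qscale l)"
  unfolding qscale_def[abs_def] by (intro smooth_on_vector3 smooth_intros assms)

lemma fd_qscale:
  assumes l: "smooth_on U l" and x: "x \<in> U"
  shows "fd (qscale l) x v = vector [l x ^ 4 * v$1 + 4 * l x ^ 3 * fd l x v * x$1,
    l x ^ 5 * v$2 + 5 * l x ^ 4 * fd l x v * x$2, l x ^ 3 * v$3 + 3 * l x ^ 2 * fd l x v * x$3]"
proof -
  note [derivative_intros] = smooth_on_has_derivative[OF l x]
  have h: "((\<lambda>x. l x ^ n * x $ i) has_derivative (\<lambda>v. l x ^ n * v$i + n * l x ^ (n - 1) * fd l x v * x$i)) (at x)" for n i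
    by (auto intro!: derivative_eq_intros simp: algebra_simps)
  show ?thesis
    unfolding qscale_def[abs_def] fd_eq[OF has_derivative_vector3[OF h h h]] by simp
qed

text \<open>
  The contractions with the Euler field annihilate it, so the derivatives of \<open>l\<close> do not contribute:
  a contraction of weight \<open>w\<close> is multiplied by \<open>l ^ w\<close>.
\<close>
lemma pull_qscale_iE:
  assumes "smooth_on U l" "x \<in> U"
  shows "pull (qscale l) (\<lambda>y. iE (a y) (b y) (d y) y) x =
    iE (l x ^ 7 * a (qscale l x)) (l x ^ 8 * b (qscale l x)) (l x ^ 9 * d (qscale l x)) x"
  by (simp add: pull_def fd_qscale[OF assms] vec3_eq_iff inner_vec_def sum_3 axis_def)
    (simp add: algebra_simps eval_nat_numeral)

text \<open>A gradient pulls back to a gradient, and points of the curve go to points of the curve.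
  The radius has to shrink so that \<open>\<Lambda>\<close> maps the new ball into the old one;
  stating the result for all smaller radii leaves room for further restrictions.\<close>

lemma pull_cohom:
  assumes L: "smooth_on (ball 0 R) \<Lambda>" "R > 0" "\<Lambda> 0 = 0" "\<And>x. x \<in> C7 \<Longrightarrow> \<Lambda> x \<in> C7"
    and c: "cohom r \<alpha> \<beta>" and "r > 0"
  obtains r' where "r' > 0" "r' \<le> R" "\<And>s. s \<le> r' \<Longrightarrow> cohom s (pull \<Lambda> \<alpha>) (pull \<Lambda> \<beta>)"
proof -
  obtain S where S: "smooth_on (ball 0 r) S" "\<And>x. x \<in> ball 0 r \<inter> C7 \<Longrightarrow> \<alpha> x - \<beta> x = grad S x"
    using c unfolding cohom_def by blast
  have "isCont \<Lambda> 0"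
    using smooth_on_continuous[OF L(1)] L(2) by (simp add: continuous_on_eq_continuous_at)
  then obtain d where d: "d > 0" "\<And>x. norm x < d \<Longrightarrow> norm (\<Lambda> x) < r"
    using \<open>r > 0\<close> L(3) unfolding continuous_at_eps_delta by (auto simp: dist_norm)
  define r' where "r' = min d R"
  have sub: "\<Lambda> ` ball 0 s \<subseteq> ball 0 r" "ball 0 s \<subseteq> ball 0 R" if "s \<le> r'" for s
    using d(2) that by (auto simp: r'_def)
  have "cohom s (pull \<Lambda> \<alpha>) (pull \<Lambda> \<beta>)" if "s \<le> r'" for s
    unfolding cohom_def
  proof (intro exI conjI ballI)
    have Ls: "smooth_on (ball 0 s) \<Lambda>" by (rule smooth_on_subset[OF L(1) sub(2)[OF that]])
    show "smooth_on (ball 0 s) (\<lambda>x. S (\<Lambda> x))"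
      by (rule smooth_on_compose[OF open_ball open_ball S(1) Ls sub(1)[OF that]])
    fix x assume x: "x \<in> ball 0 s \<inter> C7"
    then have y: "\<Lambda> x \<in> ball 0 r" "\<Lambda> x \<in> C7" using sub(1)[OF that] L(4) by blast+
    have "((\<lambda>x. S (\<Lambda> x)) has_derivative (\<lambda>v. fd S (\<Lambda> x) (fd \<Lambda> x v))) (at x)"
      using x y by (intro has_derivative_compose[OF smooth_on_has_derivative[OF Ls]] smooth_on_has_derivative[OF S(1)]) auto
    moreover have "fd S (\<Lambda> x) v = grad S (\<Lambda> x) \<bullet> v" for v
      by (subst fd_axis_expand[OF smooth_on_differentiable[OF S(1) y(1)]])
        (simp add: inner_vec_def mult.commute)
    ultimately have e: "fd (\<lambda>x. S (\<Lambda> x)) x v = (\<alpha> (\<Lambda> x) - \<beta> (\<Lambda> x)) \<bullet> fd \<Lambda> x v" for v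
      using S(2)[of "\<Lambda> x"] y by (simp add: fd_eq)
    show "pull \<Lambda> \<alpha> x - pull \<Lambda> \<beta> x = grad (\<lambda>x. S (\<Lambda> x)) x"
      by (rule vec_eq_iff[THEN iffD2]) (simp add: pull_def e inner_diff_left)
  qed
  then show thesis using d(1) L(2) by (intro that[of r']) (auto simp: r'_def)
qed

text \<open>The remainder is kept as a smooth function rather than as an estimate, because it
  becomes a coefficient in the relations along the curve.\<close>

lemma one_plus_power_expand:
  "\<exists>q. smooth_on UNIV q \<and> (\<forall>z::real. (1 + u * z) ^ n = 1 + real n * u * z + real (n choose 2) * u^2 * z^2 + z^3 * q z)"
proof (induction n)
  case 0
  then show ?case by (intro exI[of _ "\<lambda>_. 0"]) (simp add: smooth_on_const)
next
  case (Suc n)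
  then obtain q where q: "smooth_on UNIV q"
    "\<And>z. (1 + u * z) ^ n = 1 + real n * u * z + real (n choose 2) * u^2 * z^2 + z^3 * q z" by blast
  have c: "Suc n choose 2 = n + (n choose 2)" by (simp add: numeral_2_eq_2)
  show ?case
  proof (intro exI[of _ "\<lambda>z. q z + real (n choose 2) * u^3 + u * z * q z"] conjI allI)
    show "smooth_on UNIV (\<lambda>z. q z + real (n choose 2) * u^3 + u * z * q z)"
      by (intro smooth_intros open_UNIV q)
    show "(1 + u * z) ^ Suc n = 1 + real (Suc n) * u * z + real (Suc n choose 2) * u^2 * z^2
        + z^3 * (q z + real (n choose 2) * u^3 + u * z * q z)" for z
      by (simp only: power_Suc q(2) c) (simp add: algebra_simps eval_nat_numeral)
  qed
qed

definition nf_step :: "(nat \<Rightarrow> real) \<Rightarrow> (real^3 \<Rightarrow> real) \<Rightarrow> (nat \<Rightarrow> real) \<Rightarrow> bool" where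
  "nf_step c l c' \<longleftrightarrow> smooth_on UNIV l \<and> l 0 \<noteq> 0 \<and> (\<forall>r. cohom r (pull (qscale l) (nfK c)) (nfK c'))"

lemma pull_nfK:
  assumes "smooth_on UNIV l"
  shows "pull (qscale l) (nfK c) = (\<lambda>x. iE (c 7 * l x ^ 7 + c 10 * x$3 * l x ^ 10 + c 11 * x$1 * l x ^ 11
    + c 13 * x$3^2 * l x ^ 13 + c 14 * x$1 * x$3 * l x ^ 14) (c 8 * l x ^ 8) (c 9 * l x ^ 9) x)"
  by (rule ext, unfold nfK_def[abs_def], subst pull_qscale_iE[OF assms UNIV_I])
    (simp add: algebra_simps power_numeral_reduce)

lemma nf_step_const:
  assumes "l \<noteq> 0"
  shows "nf_step c (\<lambda>_. l) (\<lambda>w. l ^ w * c w)"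
  unfolding nf_step_def pull_nfK[OF smooth_on_const] using assms
  by (auto intro!: cohom_eq simp: nfK_def algebra_simps)

text \<open>The bookkeeping of a substitution. The powers of \<open>l\<close> are expanded into the
  new constants \<open>c'\<close> and remainders: \<open>k1\<close> to \<open>l3\<close> are the
  remainders in the second and third entry, which the relations move to the first entry, while the
  \<open>z\<close> functions and \<open>b0\<close> collect the terms that are exact by
  themselves.\<close>

lemma nf_stepI:
  assumes l: "smooth_on UNIV l" and p: "\<And>n x. l x ^ n = p n x"
    and sm: "smooth_on UNIV k1" "smooth_on UNIV k2" "smooth_on UNIV k3" "smooth_on UNIV l1" "smooth_on UNIV l2" "smooth_on UNIV l3"
      "smooth_on UNIV z11" "smooth_on UNIV z12" "smooth_on UNIV z133" "smooth_on UNIV z22" "smooth_on UNIV z23" "smooth_on UNIV z333"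
    and l0: "l 0 \<noteq> 0"
    and b: "\<And>x. c 8 * p 8 x = c' 8 + (x$1 * k1 x + x$2 * k2 x + x$3 * k3 x)"
    and d: "\<And>x. c 9 * p 9 x = c' 9 + (x$1 * l1 x + x$2 * l2 x + x$3 * l3 x)"
    and a: "\<And>x. c 7 * p 7 x + c 10 * x$3 * p 10 x + c 11 * x$1 * p 11 x + c 13 * x$3^2 * p 13 x + c 14 * x$1 * x$3 * p 14 x
      = (c' 7 + c' 10 * x$3 + c' 11 * x$1 + c' 13 * x$3^2 + c' 14 * x$1 * x$3)
      + ((x$2 * k1 x + 6 * x$3^2 * k2 x + 2 * x$1 * k3 x + (3 * x$3^2 * l1 x + 6 * x$1 * x$3 * l2 x + x$2 * l3 x))
      + (x$1^2 * z11 x + x$1 * x$2 * z12 x + x$1 * x$3^2 * z133 x + x$2^2 * z22 x + x$2 * x$3 * z23 x + x$3^3 * z333 x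
      + b0 * x$2))"
  shows "nf_step c l c'"
proof -
  have "cohom r (pull (qscale l) (nfK c)) (nfK c')" for r
  proof -
    have "smooth_on (ball 0 r) h" if "smooth_on UNIV h" for h :: "real^3 \<Rightarrow> real"
      using smooth_on_subset[OF that] by blast
    note s = sm[THEN this]
    have 1: "exact r (\<lambda>x. iE (x$1^2 * z11 x + x$1 * x$2 * z12 x + x$1 * x$3^2 * z133 x + x$2^2 * z22 x + x$2 * x$3 * z23 x + x$3^3 * z333 x
        + b0 * x$2) 0 0 x)"
      by (rule cohom_iE_add[OF cohom_iE_add[OF cohom_iE_add[OF cohom_iE_add[OF cohom_iE_add[OF
          cohom_iE_add[OF rel_x1x1[OF s(7)] rel_x1x2[OF s(8)] refl refl refl refl refl refl]
          rel_x1x3x3[OF s(9)] refl refl refl refl refl refl] rel_x2x2[OF s(10)] refl refl refl refl refl refl]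
          rel_x2x3[OF s(11)] refl refl refl refl refl refl] rel_x3x3x3[OF s(12)] refl refl refl refl refl refl]
          rel_x2[of r b0]]) auto
    have 2: "exact r (\<lambda>x. iE (x$2 * k1 x + 6 * x$3^2 * k2 x + 2 * x$1 * k3 x + (3 * x$3^2 * l1 x + 6 * x$1 * x$3 * l2 x + x$2 * l3 x))
          (x$1 * k1 x + x$2 * k2 x + x$3 * k3 x) (x$1 * l1 x + x$2 * l2 x + x$3 * l3 x) x)"
      by (rule cohom_iE_add[OF
          cohom_iE_add[OF cohom_iE_add[OF rel_x1_th2[OF s(1)] rel_x2_th2[OF s(2)] refl refl refl refl refl refl] rel_x3_th2[OF s(3)] refl refl refl refl refl refl]
          cohom_iE_add[OF cohom_iE_add[OF rel_x1_th3[OF s(4)] rel_x2_th3[OF s(5)] refl refl refl refl refl refl] rel_x3_th3[OF s(6)] refl refl refl refl refl refl]])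
        auto
    show ?thesis
      unfolding pull_nfK[OF l] p nfK_def[of c'] a b d
      by (rule cohom_iE_add[OF cohom_refl cohom_iE_add[OF 2 1 refl refl refl refl refl refl]]) auto
  qed
  then show ?thesis using l l0 by (simp add: nf_step_def)
qed

lemma one_plus_power_comp:
  fixes m :: "real^3 \<Rightarrow> real"
  assumes "smooth_on UNIV m"
  shows "\<exists>q. (\<forall>n. smooth_on UNIV (q n)) \<and> (\<forall>n x. (1 + u * m x) ^ n = 1 + real n * u * m x + (m x)^2 * q n x)"
    and "\<exists>q. (\<forall>n. smooth_on UNIV (q n)) \<and> (\<forall>n x. (1 + u * m x) ^ n
      = 1 + real n * u * m x + real (n choose 2) * u^2 * (m x)^2 + (m x)^3 * q n x)"
proof -
  have "\<exists>q. \<forall>n. smooth_on UNIV (q n) \<and> (\<forall>z. (1 + u * z) ^ n = 1 + real n * u * z + real (n choose 2) * u^2 * z^2 + z^3 * q n z)"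
    by (intro choice allI one_plus_power_expand)
  then obtain q where q: "\<And>n. smooth_on UNIV (q n)"
    "\<And>n z. (1 + u * z) ^ n = 1 + real n * u * z + real (n choose 2) * u^2 * z^2 + z^3 * q n z"
    by blast
  have s: "smooth_on UNIV (\<lambda>x. q n (m x))" for n
    by (rule smooth_on_compose[OF open_UNIV open_UNIV q(1) assms]) auto
  show "\<exists>q. (\<forall>n. smooth_on UNIV (q n)) \<and> (\<forall>n x. (1 + u * m x) ^ n
      = 1 + real n * u * m x + real (n choose 2) * u^2 * (m x)^2 + (m x)^3 * q n x)"
    using s q(2) by (intro exI[of _ "\<lambda>n x. q n (m x)"]) auto
  show "\<exists>q. (\<forall>n. smooth_on UNIV (q n)) \<and> (\<forall>n x. (1 + u * m x) ^ n = 1 + real n * u * m x + (m x)^2 * q n x)"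
    by (intro exI[of _ "\<lambda>n x. real (n choose 2) * u^2 + m x * q n (m x)"] conjI allI smooth_intros open_UNIV assms s)
      (simp add: q(2) algebra_simps power_numeral_reduce)
qed

text \<open>Up to exact terms, \<open>x3\<close> times the second contraction is
  \<open>- 2 x1\<close> times the first; hence \<open>16 = 2 * 8\<close> and
  \<open>56 = 2 * (8 choose 2)\<close>, whereas \<open>21\<close> is \<open>7 choose 2\<close>. The
  third contraction does not contribute: \<open>x3\<close> times it is \<open>- x2\<close> times the
  first, which is exact.\<close>

lemma nf_step_x3:
  "nf_step c (\<lambda>x. 1 + u * x$3) (c(10 := c 10 + 7 * u * c 7, 11 := c 11 - 16 * u * c 8,
    13 := c 13 + 10 * u * c 10 + 21 * u^2 * c 7, 14 := c 14 + 11 * u * c 11 - 56 * u^2 * c 8))"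
proof -
  obtain q :: "nat \<Rightarrow> real^3 \<Rightarrow> real" where q: "\<And>n. smooth_on UNIV (q n)"
    "\<And>n x. (1 + u * x$3) ^ n = 1 + real n * u * x$3 + real (n choose 2) * u^2 * x$3^2 + x$3^3 * q n x"
    using one_plus_power_comp(2)[OF smooth_on_nth_ident, of u 3] by blast
  show ?thesis
    by (rule nf_stepI[OF _ q(2), where ?k1.0="\<lambda>_. 0" and ?k2.0="\<lambda>_. 0" and ?k3.0="\<lambda>x. c 8 * (8 * u + 28 * u^2 * x$3 + x$3^2 * q 8 x)"
        and ?l1.0="\<lambda>_. 0" and ?l2.0="\<lambda>_. 0" and ?l3.0="\<lambda>x. c 9 * (9 * u + x$3 * (36 * u^2 + x$3 * q 9 x))"
        and ?z11.0="\<lambda>_. 0" and ?z12.0="\<lambda>_. 0" and ?z22.0="\<lambda>_. 0" and ?z23.0="\<lambda>x. - (c 9 * (36 * u^2 + x$3 * q 9 x))"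
        and ?z133.0="\<lambda>x. c 11 * (55 * u^2 + x$3 * q 11 x) + c 14 * (14 * u + x$3 * (91 * u^2 + x$3 * q 14 x)) - 2 * c 8 * q 8 x"
        and ?z333.0="\<lambda>x. c 7 * q 7 x + c 10 * (45 * u^2 + x$3 * q 10 x) + c 13 * (13 * u + x$3 * (78 * u^2 + x$3 * q 13 x))"
        and ?b0.0="- (9 * u * c 9)"])
      ((intro smooth_intros open_UNIV q)+, simp_all add: choose_two algebra_simps power_numeral_reduce)
qed

text \<open>\<open>27 = 3 * 9\<close> comes from trading \<open>x1\<close> times the third
  contraction for \<open>- 3 x3^2\<close> times the first. For the second contraction the trade
  yields a multiple of \<open>x2\<close>, which is exact.\<close>

lemma nf_step_x1:
  "nf_step c (\<lambda>x. 1 + u * x$1) (c(11 := c 11 + 7 * u * c 7, 13 := c 13 - 27 * u * c 9, 14 := c 14 + 10 * u * c 10))"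
proof -
  obtain q :: "nat \<Rightarrow> real^3 \<Rightarrow> real" where q: "\<And>n. smooth_on UNIV (q n)" "\<And>n x. (1 + u * x$1) ^ n = 1 + real n * u * x$1 + (x$1)^2 * q n x"
    using one_plus_power_comp(1)[OF smooth_on_nth_ident, of u 1] by blast
  show ?thesis
    by (rule nf_stepI[OF _ q(2), where ?k1.0="\<lambda>x. c 8 * (8 * u + x$1 * q 8 x)" and ?k2.0="\<lambda>_. 0" and ?k3.0="\<lambda>_. 0"
        and ?l1.0="\<lambda>x. c 9 * (9 * u + x$1 * q 9 x)" and ?l2.0="\<lambda>_. 0" and ?l3.0="\<lambda>_. 0"
        and ?z11.0="\<lambda>x. c 7 * q 7 x + c 10 * x$3 * q 10 x + c 11 * (11 * u + x$1 * q 11 x) + c 14 * x$3 * (14 * u + x$1 * q 14 x)"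
        and ?z12.0="\<lambda>x. - (c 8 * q 8 x)" and ?z22.0="\<lambda>_. 0" and ?z23.0="\<lambda>_. 0"
        and ?z133.0="\<lambda>x. c 13 * (13 * u + x$1 * q 13 x) - 3 * c 9 * q 9 x" and ?z333.0="\<lambda>_. 0" and ?b0.0="- (8 * u * c 8)"])
      ((intro smooth_intros open_UNIV q)+, simp_all add: algebra_simps power_numeral_reduce)
qed

text \<open>The factor \<open>16 = 2 * 8\<close> arises as for \<open>x3\<close>, with one more
  factor \<open>x3\<close>. In this way \<open>c 8\<close> acts on the coefficient of weight 14
  without touching that of weight 11.\<close>

lemma nf_step_x3x3:
  "nf_step c (\<lambda>x. 1 + u * x$3^2) (c(13 := c 13 + 7 * u * c 7, 14 := c 14 - 16 * u * c 8))"
proof -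
  obtain q :: "nat \<Rightarrow> real^3 \<Rightarrow> real" where q: "\<And>n. smooth_on UNIV (q n)" "\<And>n x. (1 + u * x$3^2) ^ n = 1 + real n * u * x$3^2 + (x$3^2)^2 * q n x"
    using one_plus_power_comp(1)[OF smooth_on_power[OF open_UNIV smooth_on_nth_ident], of u 3 2] by blast
  show ?thesis
    by (rule nf_stepI[OF _ q(2), where ?k1.0="\<lambda>_. 0" and ?k2.0="\<lambda>_. 0" and ?k3.0="\<lambda>x. c 8 * (8 * u * x$3 + x$3^3 * q 8 x)"
        and ?l1.0="\<lambda>_. 0" and ?l2.0="\<lambda>_. 0" and ?l3.0="\<lambda>x. c 9 * (9 * u * x$3 + x$3^3 * q 9 x)"
        and ?z11.0="\<lambda>_. 0" and ?z12.0="\<lambda>_. 0" and ?z22.0="\<lambda>_. 0" and ?z23.0="\<lambda>x. - (c 9 * (9 * u + x$3^2 * q 9 x))"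
        and ?z133.0="\<lambda>x. c 11 * (11 * u + x$3^2 * q 11 x) - 2 * x$3 * c 8 * q 8 x + c 14 * (14 * u * x$3 + x$3^3 * q 14 x)"
        and ?z333.0="\<lambda>x. c 7 * x$3 * q 7 x + c 10 * (10 * u + x$3^2 * q 10 x) + c 13 * (13 * u * x$3 + x$3^3 * q 13 x)" and ?b0.0="0"])
      ((intro smooth_intros open_UNIV q)+, simp_all add: algebra_simps power_numeral_reduce)
qed

text \<open>All products of \<open>x1 x3\<close> with the contractions are exact except the one with
  the contraction of weight 7.\<close>

lemma nf_step_x1x3:
  "nf_step c (\<lambda>x. 1 + u * (x$1 * x$3)) (c(14 := c 14 + 7 * u * c 7))"
proof -
  have "smooth_on UNIV (\<lambda>x::real^3. x$1 * x$3)" by (intro smooth_intros open_UNIV)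
  from one_plus_power_comp(1)[OF this, of u] obtain q :: "nat \<Rightarrow> real^3 \<Rightarrow> real" where q: "\<And>n. smooth_on UNIV (q n)"
    "\<And>n x. (1 + u * (x$1 * x$3)) ^ n = 1 + real n * u * (x$1 * x$3) + (x$1 * x$3)^2 * q n x" by blast
  show ?thesis
    by (rule nf_stepI[OF _ q(2), where ?k1.0="\<lambda>_. 0" and ?k2.0="\<lambda>_. 0" and ?k3.0="\<lambda>x. c 8 * (8 * u * x$1 + x$1^2 * x$3 * q 8 x)"
        and ?l1.0="\<lambda>_. 0" and ?l2.0="\<lambda>_. 0" and ?l3.0="\<lambda>x. c 9 * (9 * u * x$1 + x$1^2 * x$3 * q 9 x)"
        and ?z11.0="\<lambda>x. c 7 * x$3^2 * q 7 x + c 11 * (11 * u * x$3 + x$1 * x$3^2 * q 11 x)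
          + c 14 * (14 * u * x$3^2 + x$1 * x$3^3 * q 14 x) - c 8 * (16 * u + 2 * x$1 * x$3 * q 8 x)"
        and ?z12.0="\<lambda>x. - (c 9 * (9 * u + x$1 * x$3 * q 9 x))" and ?z22.0="\<lambda>_. 0" and ?z23.0="\<lambda>_. 0"
        and ?z133.0="\<lambda>x. c 10 * (10 * u + x$1 * x$3 * q 10 x)"
        and ?z333.0="\<lambda>x. c 13 * (13 * u * x$1 + x$1^2 * x$3 * q 13 x)" and ?b0.0="0"])
      ((intro smooth_intros open_UNIV q)+, simp_all add: algebra_simps power_numeral_reduce)
qed

text \<open>\<open>48 = 6 * 8\<close> and \<open>54 = 6 * 9\<close>: multiples by \<open>x2\<close>
  of the second and third contraction become \<open>- 6 x3^2\<close> and \<open>- 6 x1 x3\<close>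
  times the first.\<close>

lemma nf_step_x2:
  "nf_step c (\<lambda>x. 1 + u * x$2) (c(13 := c 13 - 48 * u * c 8, 14 := c 14 - 54 * u * c 9))"
proof -
  obtain q :: "nat \<Rightarrow> real^3 \<Rightarrow> real" where q: "\<And>n. smooth_on UNIV (q n)" "\<And>n x. (1 + u * x$2) ^ n = 1 + real n * u * x$2 + (x$2)^2 * q n x"
    using one_plus_power_comp(1)[OF smooth_on_nth_ident, of u 2] by blast
  show ?thesis
    by (rule nf_stepI[OF _ q(2), where ?k1.0="\<lambda>_. 0" and ?k2.0="\<lambda>x. c 8 * (8 * u + x$2 * q 8 x)" and ?k3.0="\<lambda>_. 0"
        and ?l1.0="\<lambda>_. 0" and ?l2.0="\<lambda>x. c 9 * (9 * u + x$2 * q 9 x)" and ?l3.0="\<lambda>_. 0"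
        and ?z11.0="\<lambda>_. 0" and ?z12.0="\<lambda>x. c 11 * (11 * u + x$2 * q 11 x)" and ?z22.0="\<lambda>x. c 7 * q 7 x"
        and ?z23.0="\<lambda>x. c 10 * (10 * u + x$2 * q 10 x) + c 13 * (13 * u * x$3 + x$2 * x$3 * q 13 x)
          + c 14 * (14 * u * x$1 + x$1 * x$2 * q 14 x) - 6 * x$3 * c 8 * q 8 x - 6 * x$1 * c 9 * q 9 x"
        and ?z133.0="\<lambda>_. 0" and ?z333.0="\<lambda>_. 0" and ?b0.0="7 * u * c 7"])
      ((intro smooth_intros open_UNIV q)+, simp_all add: algebra_simps power_numeral_reduce)
qed

section \<open>Jets of gradients along the branches\<close>

lemma coeff_zero_of_bound:
  fixes p :: "real poly"
  assumes "d > 0" "\<And>t. 0 < \<bar>t\<bar> \<Longrightarrow> \<bar>t\<bar> < d \<Longrightarrow> \<bar>poly p t\<bar> \<le> C * \<bar>t\<bar> ^ m" "k < m"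
  shows "coeff p k = 0"
  using assms(2,3)
proof (induction m arbitrary: p k)
  case 0
  then show ?case by simp
next
  case (Suc m)
  obtain a q where p: "p = pCons a q" by (cases p)
  have "((\<lambda>t. C * \<bar>t\<bar> ^ Suc m) \<longlongrightarrow> C * \<bar>0\<bar> ^ Suc m) (at 0)"
    by (intro tendsto_intros)
  moreover have "\<forall>\<^sub>F t in at 0. norm (poly p t) \<le> C * \<bar>t\<bar> ^ Suc m"
    unfolding eventually_at using Suc.prems(1) assms(1) by (intro exI[of _ d]) (auto simp: dist_real_def)
  ultimately have "((\<lambda>t. poly p t) \<longlongrightarrow> 0) (at 0)"
    by (intro Lim_null_comparison[of "\<lambda>t. poly p t"]) auto
  moreover have "((\<lambda>t. poly p t) \<longlongrightarrow> poly p 0) (at 0)"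
    using isCont_def poly_isCont by blast
  ultimately have a: "a = 0" using tendsto_unique[OF at_neq_bot] p by fastforce
  have "\<bar>poly q t\<bar> \<le> C * \<bar>t\<bar> ^ m" if "0 < \<bar>t\<bar>" "\<bar>t\<bar> < d" for t
    using Suc.prems(1)[OF that] that by (simp add: p a abs_mult mult.left_commute)
  from Suc.IH[OF this] show ?case
    using Suc.prems(2) by (cases k) (auto simp: p a)
qed

definition jet :: "nat \<Rightarrow> (real \<Rightarrow> real) \<Rightarrow> real poly \<Rightarrow> bool" where
  "jet m f p \<longleftrightarrow> (\<exists>d>0. \<exists>C. \<forall>t. 0 < \<bar>t\<bar> \<longrightarrow> \<bar>t\<bar> < d \<longrightarrow> \<bar>f t - poly p t\<bar> \<le> C * \<bar>t\<bar> ^ m)"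

lemma jetI: "d > 0 \<Longrightarrow> (\<And>t. 0 < \<bar>t\<bar> \<Longrightarrow> \<bar>t\<bar> < d \<Longrightarrow> \<bar>f t - poly p t\<bar> \<le> C * \<bar>t\<bar> ^ m) \<Longrightarrow> jet m f p"
  unfolding jet_def by blast

lemma jet_poly: "(\<And>t. f t = poly p t) \<Longrightarrow> jet m f p"
  by (rule jetI[of 1 _ _ 0]) auto

lemma jet_add:
  assumes "jet m f p" "jet m g q"
  shows "jet m (\<lambda>t. f t + g t) (p + q)"
proof -
  obtain d C where f: "d > 0" "\<And>t. 0 < \<bar>t\<bar> \<Longrightarrow> \<bar>t\<bar> < d \<Longrightarrow> \<bar>f t - poly p t\<bar> \<le> C * \<bar>t\<bar> ^ m"
    using assms(1) unfolding jet_def by blast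
  obtain d' C' where g: "d' > 0" "\<And>t. 0 < \<bar>t\<bar> \<Longrightarrow> \<bar>t\<bar> < d' \<Longrightarrow> \<bar>g t - poly q t\<bar> \<le> C' * \<bar>t\<bar> ^ m"
    using assms(2) unfolding jet_def by blast
  show ?thesis
  proof (rule jetI[of "min d d'" _ _ "C + C'"])
    fix t assume "0 < \<bar>t\<bar>" "\<bar>t\<bar> < min d d'"
    with f(2)[of t] g(2)[of t] show "\<bar>f t + g t - poly (p + q) t\<bar> \<le> (C + C') * \<bar>t\<bar> ^ m"
      by (simp add: algebra_simps abs_le_iff)
  qed (use f g in auto)
qed

lemma jet_minus: "jet m f p \<Longrightarrow> jet m (\<lambda>t. - f t) (- p)"
  unfolding jet_def by (simp add: abs_minus_commute)

lemma jet_mono: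
  assumes "jet m f p" "k \<le> m"
  shows "jet k f p"
proof -
  obtain d C where f: "d > 0" "\<And>t. 0 < \<bar>t\<bar> \<Longrightarrow> \<bar>t\<bar> < d \<Longrightarrow> \<bar>f t - poly p t\<bar> \<le> C * \<bar>t\<bar> ^ m"
    using assms(1) unfolding jet_def by blast
  show ?thesis
  proof (rule jetI[of "min d 1" _ _ "\<bar>C\<bar>"])
    fix t :: real assume t: "0 < \<bar>t\<bar>" "\<bar>t\<bar> < min d 1"
    have "\<bar>f t - poly p t\<bar> \<le> \<bar>C\<bar> * \<bar>t\<bar> ^ m"
      using f(2)[of t] t by (smt (verit) abs_ge_self mult_right_mono zero_le_power abs_ge_zero)
    also have "\<dots> \<le> \<bar>C\<bar> * \<bar>t\<bar> ^ k"
      using t assms(2) by (intro mult_left_mono power_decreasing) auto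
    finally show "\<bar>f t - poly p t\<bar> \<le> \<bar>C\<bar> * \<bar>t\<bar> ^ k" .
  qed (use f in auto)
qed

lemma jet_cong: "jet m f p \<Longrightarrow> (\<And>t. \<bar>t\<bar> < d \<Longrightarrow> f t = g t) \<Longrightarrow> d > 0 \<Longrightarrow> jet m g p"
  unfolding jet_def by (metis (mono_tags, lifting) min_less_iff_conj)

lemma jet_unique:
  assumes "jet m f p" "jet m f q" "k < m"
  shows "coeff p k = coeff q k"
proof -
  have "jet m (\<lambda>t. f t + - f t) (p + - q)" using assms by (intro jet_add jet_minus)
  then have "jet m (\<lambda>_. 0) (q - p)" using jet_minus by fastforce
  then obtain d C where d: "d > 0" "\<And>t. 0 < \<bar>t\<bar> \<Longrightarrow> \<bar>t\<bar> < d \<Longrightarrow> \<bar>0 - poly (q - p) t\<bar> \<le> C * \<bar>t\<bar> ^ m"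
    unfolding jet_def by blast
  then have "coeff (q - p) k = 0"
    using assms(3) by (intro coeff_zero_of_bound[of d "q - p" C m]) (auto simp: abs_minus_commute)
  then show ?thesis by simp
qed

text \<open>
  The linear relations satisfied by the Taylor coefficients of the partial derivatives of a function
  along \<open>g2\<close> (\<open>p1, p2, p3\<close>) and along \<open>g1\<close> (\<open>q1, q3\<close>), one for each weight
  \<open>7, 8, 9, 10, 11, 13, 14\<close>; the last two hold because both branches see the same coefficient of \<open>x\<^sub>2\<close>.
\<close>
definition exact_rel :: "real poly \<Rightarrow> real poly \<Rightarrow> real poly \<Rightarrow> real poly \<Rightarrow> real poly \<Rightarrow> bool" where
  "exact_rel p1 p2 p3 q1 q3 \<longleftrightarrow>
    coeff p1 3 + coeff p3 4 = 0 \<and> coeff p2 3 + coeff p3 5 = 0 \<and> coeff p1 5 - coeff p2 4 = 0 \<and>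
    2 * coeff p1 6 + coeff p3 7 = 0 \<and> coeff p1 7 + 4 * coeff p2 6 + 2 * coeff p3 8 = 0 \<and>
    3 * coeff p1 9 - 6 * coeff p2 8 + coeff p3 10 - 13 * coeff q3 2 = 0 \<and>
    coeff p1 10 + 3 * coeff p2 9 + coeff p3 11 - 7 * coeff q1 2 = 0 \<and>
    coeff p3 5 = coeff q3 1 \<and> coeff p1 5 = coeff q1 1"

text \<open>The two orders belong together: a gradient of size \<open>|x|^4\<close> is
  \<open>O(t^12)\<close> along \<open>g2\<close>, whose coordinates are \<open>O(t^3)\<close>, and
  \<open>O(t^4)\<close> along \<open>g1\<close>. Order 12 just reaches coefficient 11, the highest
  one in \<open>exact_rel\<close>.\<close>

definition exact_jets :: "(real^3 \<Rightarrow> real) \<Rightarrow> bool" where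
  "exact_jets S \<longleftrightarrow> (\<exists>p1 p2 p3 q1 q3. exact_rel p1 p2 p3 q1 q3 \<and>
    jet 12 (\<lambda>t. fd S (g2 t) (axis 1 1)) p1 \<and> jet 12 (\<lambda>t. fd S (g2 t) (axis 2 1)) p2 \<and>
    jet 12 (\<lambda>t. fd S (g2 t) (axis 3 1)) p3 \<and>
    jet 4 (\<lambda>t. fd S (g1 t) (axis 1 1)) q1 \<and> jet 4 (\<lambda>t. fd S (g1 t) (axis 3 1)) q3)"

lemma norm_g1 [simp]: "norm (g1 t) = \<bar>t\<bar>"
  by (simp add: norm_vec_def L2_set_def sum_3)

lemma norm_g2_le: "\<bar>t\<bar> \<le> 1 \<Longrightarrow> norm (g2 t) \<le> 3 * \<bar>t\<bar>^3"
proof -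
  assume t: "\<bar>t\<bar> \<le> 1"
  have "norm (g2 t) \<le> (\<Sum>i\<in>UNIV. \<bar>g2 t $ i\<bar>)" by (rule norm_le_l1_cart)
  also have "\<dots> = \<bar>t\<bar>^4 + \<bar>t\<bar>^5 + \<bar>t\<bar>^3" by (simp add: sum_3 power_abs)
  also have "\<dots> \<le> 3 * \<bar>t\<bar>^3"
    using power_decreasing[of 3 4 "\<bar>t\<bar>"] power_decreasing[of 3 5 "\<bar>t\<bar>"] t by simp
  finally show ?thesis .
qed

lemma norm_g2_ge: "\<bar>t\<bar>^3 \<le> norm (g2 t)"
  using component_le_norm_cart[of "g2 t" 3] by (simp add: power_abs)

lemma norm_g2_less: "r > 0 \<Longrightarrow> \<bar>t\<bar> < min 1 (r / 3) \<Longrightarrow> norm (g2 t) < r"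
proof -
  assume r: "r > 0" and t: "\<bar>t\<bar> < min 1 (r / 3)"
  have "norm (g2 t) \<le> 3 * \<bar>t\<bar>^3" using t by (intro norm_g2_le) auto
  also have "\<dots> \<le> 3 * \<bar>t\<bar>" using t power_decreasing[of 1 3 "\<bar>t\<bar>"] by simp
  also have "\<dots> < r" using t by simp
  finally show ?thesis .
qed

lemma exact_jets_add:
  assumes r: "r > 0" and S: "smooth_on (ball 0 r) S" "exact_jets S" and T: "smooth_on (ball 0 r) T" "exact_jets T"
  shows "exact_jets (\<lambda>x. S x + T x)"
proof -
  have e: "fd (\<lambda>x. S x + T x) x v = fd S x v + fd T x v" if "norm x < r" for x v
    using fd_eq[OF has_derivative_add[OF smooth_on_has_derivative[OF S(1)] smooth_on_has_derivative[OF T(1)]]] that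
    by simp
  have 2: "jet m (\<lambda>t. fd (\<lambda>x. S x + T x) (g2 t) v) (p + p')"
    if "jet m (\<lambda>t. fd S (g2 t) v) p" "jet m (\<lambda>t. fd T (g2 t) v) p'" for m p p' v
    by (rule jet_cong[OF jet_add[OF that], of "min 1 (r / 3)"]) (use r norm_g2_less[OF r] in \<open>auto simp: e\<close>)
  have 1: "jet m (\<lambda>t. fd (\<lambda>x. S x + T x) (g1 t) v) (p + p')"
    if "jet m (\<lambda>t. fd S (g1 t) v) p" "jet m (\<lambda>t. fd T (g1 t) v) p'" for m p p' v
    by (rule jet_cong[OF jet_add[OF that], of r]) (use r in \<open>auto simp: e\<close>)
  obtain p1 p2 p3 q1 q3 where p: "exact_rel p1 p2 p3 q1 q3"
    "jet 12 (\<lambda>t. fd S (g2 t) (axis 1 1)) p1" "jet 12 (\<lambda>t. fd S (g2 t) (axis 2 1)) p2"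
    "jet 12 (\<lambda>t. fd S (g2 t) (axis 3 1)) p3"
    "jet 4 (\<lambda>t. fd S (g1 t) (axis 1 1)) q1" "jet 4 (\<lambda>t. fd S (g1 t) (axis 3 1)) q3"
    using S(2) unfolding exact_jets_def by blast
  obtain p1' p2' p3' q1' q3' where p': "exact_rel p1' p2' p3' q1' q3'"
    "jet 12 (\<lambda>t. fd T (g2 t) (axis 1 1)) p1'" "jet 12 (\<lambda>t. fd T (g2 t) (axis 2 1)) p2'"
    "jet 12 (\<lambda>t. fd T (g2 t) (axis 3 1)) p3'"
    "jet 4 (\<lambda>t. fd T (g1 t) (axis 1 1)) q1'" "jet 4 (\<lambda>t. fd T (g1 t) (axis 3 1)) q3'"
    using T(2) unfolding exact_jets_def by blast
  have "exact_rel (p1 + p1') (p2 + p2') (p3 + p3') (q1 + q1') (q3 + q3')"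
    using p(1) p'(1) unfolding exact_rel_def coeff_add by (smt (verit))
  then show ?thesis
    unfolding exact_jets_def using 1 2 p(2-) p'(2-) by blast
qed

lemma exact_jets_cong:
  assumes "r > 0" "exact_jets S" "\<And>x. norm x < r \<Longrightarrow> S x = T x"
  shows "exact_jets T"
proof -
  have e: "fd S x = fd T x" if "norm x < r" for x
    by (rule fd_cong_open[OF open_ball[of 0 r]]) (use that assms(3) in auto)
  have "jet m (\<lambda>t. fd T (g2 t) v) p" if "jet m (\<lambda>t. fd S (g2 t) v) p" for m p v
    by (rule jet_cong[OF that, of "min 1 (r / 3)"]) (use assms(1) norm_g2_less[OF assms(1)] in \<open>auto simp: e\<close>)
  moreover have "jet m (\<lambda>t. fd T (g1 t) v) p" if "jet m (\<lambda>t. fd S (g1 t) v) p" for m p v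
    by (rule jet_cong[OF that, of r]) (use assms(1) in \<open>auto simp: e\<close>)
  ultimately show ?thesis using assms(2) unfolding exact_jets_def by blast
qed

lemma fd_monomial:
  fixes x :: "real^3"
  shows "((\<lambda>x::real^3. k * (x$1^a * x$2^b * x$3^c)) has_derivative (\<lambda>v. k * (a * x$1^(a-1) * x$2^b * x$3^c * v$1
    + b * x$1^a * x$2^(b-1) * x$3^c * v$2 + c * x$1^a * x$2^b * x$3^(c-1) * v$3))) (at x)"
proof -
  show ?thesis by (auto intro!: derivative_eq_intros simp: algebra_simps)
qed

lemma weight_solutions:
  fixes a b c :: nat
  shows "4 * a + 5 * b + 3 * c = 7 \<Longrightarrow> (a, b, c) = (1, 0, 1)"
    and "4 * a + 5 * b + 3 * c = 8 \<Longrightarrow> (a, b, c) = (2, 0, 0) \<or> (a, b, c) = (0, 1, 1)"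
    and "4 * a + 5 * b + 3 * c = 9 \<Longrightarrow> (a, b, c) = (1, 1, 0) \<or> (a, b, c) = (0, 0, 3)"
    and "4 * a + 5 * b + 3 * c = 10 \<Longrightarrow> (a, b, c) = (0, 2, 0) \<or> (a, b, c) = (1, 0, 2)"
    and "4 * a + 5 * b + 3 * c = 11 \<Longrightarrow> (a, b, c) = (2, 0, 1) \<or> (a, b, c) = (0, 1, 2)"
    and "4 * a + 5 * b + 3 * c = 13 \<Longrightarrow> (a, b, c) = (1, 0, 3) \<or> (a, b, c) = (0, 2, 1) \<or> (a, b, c) = (2, 1, 0)"
    and "4 * a + 5 * b + 3 * c = 14 \<Longrightarrow> (a, b, c) = (2, 0, 2) \<or> (a, b, c) = (0, 1, 3) \<or> (a, b, c) = (1, 2, 0)"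
proof -
  have E: "a = 0 \<or> a = 1 \<or> a = 2 \<or> a = 3" "b = 0 \<or> b = 1 \<or> b = 2" "c = 0 \<or> c = 1 \<or> c = 2 \<or> c = 3 \<or> c = 4"
    if "4 * a + 5 * b + 3 * c = W" "W \<le> 14" for W
  proof -
    have "a \<le> 3" "b \<le> 2" "c \<le> 4" using that by linarith+
    then show "a = 0 \<or> a = 1 \<or> a = 2 \<or> a = 3" "b = 0 \<or> b = 1 \<or> b = 2" "c = 0 \<or> c = 1 \<or> c = 2 \<or> c = 3 \<or> c = 4"
      by linarith+
  qed
  show "(a, b, c) = (1, 0, 1)" if "4 * a + 5 * b + 3 * c = 7"
    using that E[OF that, simplified] by (elim disjE; simp)
  show "(a, b, c) = (2, 0, 0) \<or> (a, b, c) = (0, 1, 1)" if "4 * a + 5 * b + 3 * c = 8"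
    using that E[OF that, simplified] by (elim disjE; simp)
  show "(a, b, c) = (1, 1, 0) \<or> (a, b, c) = (0, 0, 3)" if "4 * a + 5 * b + 3 * c = 9"
    using that E[OF that, simplified] by (elim disjE; simp)
  show "(a, b, c) = (0, 2, 0) \<or> (a, b, c) = (1, 0, 2)" if "4 * a + 5 * b + 3 * c = 10"
    using that E[OF that, simplified] by (elim disjE; simp)
  show "(a, b, c) = (2, 0, 1) \<or> (a, b, c) = (0, 1, 2)" if "4 * a + 5 * b + 3 * c = 11"
    using that E[OF that, simplified] by (elim disjE; simp)
  show "(a, b, c) = (1, 0, 3) \<or> (a, b, c) = (0, 2, 1) \<or> (a, b, c) = (2, 1, 0)" if "4 * a + 5 * b + 3 * c = 13"
    using that E[OF that, simplified] by (elim disjE; simp)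
  show "(a, b, c) = (2, 0, 2) \<or> (a, b, c) = (0, 1, 3) \<or> (a, b, c) = (1, 2, 0)" if "4 * a + 5 * b + 3 * c = 14"
    using that E[OF that, simplified] by (elim disjE; simp)
qed

text \<open>The relations are linear, so they can be tested on monomials. A monomial of weight
  \<open>W\<close> contributes only to the coefficients \<open>W - 4\<close>, \<open>W - 5\<close>
  and \<open>W - 3\<close> of its three derivatives along \<open>g2\<close>; hence each relation
  concerns only the few monomials listed in \<open>weight_solutions\<close>.\<close>

lemma exact_jets_monomial:
  "exact_jets (\<lambda>x. k * (x$1^a * x$2^b * x$3^c))"
proof -
  \<comment> \<open>The sign comes from the third coordinate \<open>- (t^3)\<close> of
    \<open>g2\<close>. Differentiation in \<open>x3\<close> removes one such factor, which is why
    \<open>p3\<close> carries the opposite sign.\<close>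
  define s where "s = k * (-1) ^ c"
  define p1 where "p1 = monom (s * a) (4*(a-1) + 5*b + 3*c)"
  define p2 where "p2 = monom (s * b) (4*a + 5*(b-1) + 3*c)"
  define p3 where "p3 = monom (- s * c) (4*a + 5*b + 3*(c-1))"
  define q1 where "q1 = monom (if a = 1 \<and> c = 0 then k else 0) b"
  define q3 where "q3 = monom (if a = 0 \<and> c = 1 then k else 0) b"
  have sgn: "(- (t^3)) ^ n = (-1)^n * t^(3 * n)" for t :: real and n
    by (simp add: power_mult power_minus[of "t^3"])
  have 1: "fd (\<lambda>x. k * (x$1^a * x$2^b * x$3^c)) (g2 t) (axis 1 1) = poly p1 t" for t
    by (simp add: fd_eq[OF fd_monomial] p1_def s_def poly_monom axis_def sgn power_add power_mult)
  have 2: "fd (\<lambda>x. k * (x$1^a * x$2^b * x$3^c)) (g2 t) (axis 2 1) = poly p2 t" for t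
    by (simp add: fd_eq[OF fd_monomial] p2_def s_def poly_monom axis_def sgn power_add power_mult)
  have 3: "fd (\<lambda>x. k * (x$1^a * x$2^b * x$3^c)) (g2 t) (axis 3 1) = poly p3 t" for t
  proof -
    have "fd (\<lambda>x. k * (x$1^a * x$2^b * x$3^c)) (g2 t) (axis 3 1) = k * (c * (t^4)^a * (t^5)^b * (- (t^3))^(c-1))"
      by (simp add: fd_eq[OF fd_monomial] axis_def)
    then show ?thesis by (cases c) (simp_all add: p3_def s_def poly_monom sgn power_add power_mult)
  qed
  have 4: "fd (\<lambda>x. k * (x$1^a * x$2^b * x$3^c)) (g1 t) (axis 1 1) = poly q1 t" for t
    by (simp add: fd_eq[OF fd_monomial] q1_def poly_monom axis_def power_0_left)
  have 5: "fd (\<lambda>x. k * (x$1^a * x$2^b * x$3^c)) (g1 t) (axis 3 1) = poly q3 t" for t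
    by (simp add: fd_eq[OF fd_monomial] q3_def poly_monom axis_def power_0_left)
  define W where "W = 4 * a + 5 * b + 3 * c"
  have P: "coeff p1 n = (if W = n + 4 then s * a else 0)" "coeff p2 n = (if W = n + 5 then s * b else 0)"
    "coeff p3 n = (if W = n + 3 then - s * c else 0)" for n
    unfolding p1_def p2_def p3_def W_def by (cases a; cases b; cases c; simp)+
  have Q: "coeff q1 n = (if b = n \<and> a = 1 \<and> c = 0 then k else 0)" "coeff q3 n = (if b = n \<and> a = 0 \<and> c = 1 then k else 0)" for n
    unfolding q1_def q3_def by simp_all
  have "W = 7 \<Longrightarrow> (a, b, c) = (1, 0, 1)" "W = 8 \<Longrightarrow> (a, b, c) = (2, 0, 0) \<or> (a, b, c) = (0, 1, 1)"
    "W = 9 \<Longrightarrow> (a, b, c) = (1, 1, 0) \<or> (a, b, c) = (0, 0, 3)" "W = 10 \<Longrightarrow> (a, b, c) = (0, 2, 0) \<or> (a, b, c) = (1, 0, 2)"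
    "W = 11 \<Longrightarrow> (a, b, c) = (2, 0, 1) \<or> (a, b, c) = (0, 1, 2)"
    "W = 13 \<Longrightarrow> (a, b, c) = (1, 0, 3) \<or> (a, b, c) = (0, 2, 1) \<or> (a, b, c) = (2, 1, 0)"
    "W = 14 \<Longrightarrow> (a, b, c) = (2, 0, 2) \<or> (a, b, c) = (0, 1, 3) \<or> (a, b, c) = (1, 2, 0)"
    unfolding W_def by (rule weight_solutions; assumption)+
  note sol = this
  have "coeff p1 3 + coeff p3 4 = 0" "coeff p2 3 + coeff p3 5 = 0" "coeff p1 5 - coeff p2 4 = 0"
    "2 * coeff p1 6 + coeff p3 7 = 0" "coeff p1 7 + 4 * coeff p2 6 + 2 * coeff p3 8 = 0"
    unfolding P using sol by (auto simp: s_def)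
  moreover have "3 * coeff p1 9 - 6 * coeff p2 8 + coeff p3 10 - 13 * coeff q3 2 = 0"
    unfolding P Q using sol(6) by (cases "W = 13") (auto simp: s_def W_def)
  moreover have "coeff p1 10 + 3 * coeff p2 9 + coeff p3 11 - 7 * coeff q1 2 = 0"
    unfolding P Q using sol(7) by (cases "W = 14") (auto simp: s_def W_def)
  moreover have "coeff p3 5 = coeff q3 1"
    unfolding P Q using sol(2) by (cases "W = 8") (auto simp: s_def W_def)
  moreover have "coeff p1 5 = coeff q1 1"
    unfolding P Q using sol(3) by (cases "W = 9") (auto simp: s_def W_def)
  ultimately have "exact_rel p1 p2 p3 q1 q3" unfolding exact_rel_def by blast
  then show ?thesis
    unfolding exact_jets_def
    by (intro exI[of _ p1] exI[of _ p2] exI[of _ p3] exI[of _ q1] exI[of _ q3] conjI jet_poly 1 2 3 4 5)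
qed

lemma smooth_local_bound:
  fixes h :: "'a::euclidean_space \<Rightarrow> 'b::real_normed_vector"
  assumes "smooth_on (ball 0 r) h" "r > 0"
  shows "\<exists>M. \<forall>x. norm x \<le> r / 2 \<longrightarrow> norm (h x) \<le> M"
proof -
  have "continuous_on (cball 0 (r/2)) h"
    by (rule continuous_on_subset[OF smooth_on_continuous[OF assms(1)]]) (use assms(2) in auto)
  then have "bounded (h ` cball 0 (r/2))" by (intro compact_imp_bounded compact_continuous_image) auto
  then obtain M where "\<forall>x\<in>cball 0 (r/2). norm (h x) \<le> M" unfolding bounded_iff by blast
  then show ?thesis by (intro exI[of _ M]) simp
qed

text \<open>A remainder of degree 5 has a gradient of size \<open>|x|^4\<close>, which is below the
  resolution of the jets, so all five polynomials can be taken to be zero.\<close>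

lemma exact_jets_high:
  assumes "a + b + c = 5" and h: "smooth_on (ball 0 r) h" and r: "r > 0"
  shows "exact_jets (\<lambda>x. x$1^a * x$2^b * x$3^c * h x)"
proof -
  let ?m = "\<lambda>x::real^3. x$1^a * x$2^b * x$3^c"
  have le: "\<bar>x $ i\<bar> \<le> norm x" for x :: "real^3" and i by (rule component_le_norm_cart)
  have mono: "\<bar>x$1^i * x$2^j * x$3^k\<bar> \<le> norm x ^ (i + j + k)" for x :: "real^3" and i j k
    unfolding abs_mult power_abs power_add by (intro mult_mono power_mono le) auto
  obtain M where M: "\<And>x. norm x \<le> r / 2 \<Longrightarrow> \<bar>h x\<bar> \<le> M" using smooth_local_bound[OF h r] by auto
  have "\<exists>M. \<forall>x. norm x \<le> r / 2 \<longrightarrow> norm (fd h x (axis i 1)) \<le> M" for i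
    by (rule smooth_local_bound[OF smooth_on_fd[OF h] r])
  then obtain M' where M': "\<And>x i. norm x \<le> r / 2 \<Longrightarrow> \<bar>fd h x (axis i 1)\<bar> \<le> M' i" by (metis real_norm_def)
  have "\<exists>B. \<forall>x. norm x < min 1 (r / 2) \<longrightarrow> \<bar>fd (\<lambda>x. ?m x * h x) x (axis i 1)\<bar> \<le> B * norm x ^ 4" for i
  proof (intro exI allI impI)
    fix x :: "real^3" assume x: "norm x < min 1 (r / 2)"
    have x': "x \<in> ball 0 r" "norm x \<le> r / 2" using x r by auto
    have d: "((\<lambda>x. ?m x * h x) has_derivative (\<lambda>v. ?m x * fd h x v + (1 * (a * x$1^(a-1) * x$2^b * x$3^c * v$1
      + b * x$1^a * x$2^(b-1) * x$3^c * v$2 + c * x$1^a * x$2^b * x$3^(c-1) * v$3)) * h x)) (at x)"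
      using has_derivative_mult[OF fd_monomial[of 1 a b c x] smooth_on_has_derivative[OF h x'(1)]] by simp
    have dm: "\<bar>a * x$1^(a-1) * x$2^b * x$3^c * v$1 + b * x$1^a * x$2^(b-1) * x$3^c * v$2 + c * x$1^a * x$2^b * x$3^(c-1) * v$3\<bar>
      \<le> 5 * norm x ^ 4" if "\<And>i. \<bar>v $ i\<bar> \<le> 1" for v :: "real^3"
    proof -
      have "\<bar>real n * (x$1^i * x$2^j * x$3^k * v $ l)\<bar> \<le> real n * norm x ^ 4" if "n \<noteq> 0 \<longrightarrow> i + j + k = 4" for n i j k l
      proof (cases "n = 0")
        case False
        have "\<bar>x$1^i * x$2^j * x$3^k\<bar> * \<bar>v $ l\<bar> \<le> norm x ^ 4 * 1"
          using mono[of x i j k] that False \<open>\<And>i. \<bar>v $ i\<bar> \<le> 1\<close> by (intro mult_mono) auto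
        then show ?thesis by (simp add: abs_mult mult_left_mono)
      qed simp
      from this[of a "a-1" b c 1] this[of b a "b-1" c 2] this[of c a b "c-1" 3]
      have "\<bar>a * (x$1^(a-1) * x$2^b * x$3^c * v$1)\<bar> \<le> real a * norm x ^ 4"
        "\<bar>b * (x$1^a * x$2^(b-1) * x$3^c * v$2)\<bar> \<le> real b * norm x ^ 4"
        "\<bar>c * (x$1^a * x$2^b * x$3^(c-1) * v$3)\<bar> \<le> real c * norm x ^ 4"
        using assms(1) by auto
      moreover have "real a * norm x ^ 4 + real b * norm x ^ 4 + real c * norm x ^ 4 = 5 * norm x ^ 4"
        using assms(1) by (simp flip: distrib_right of_nat_add)
      ultimately show ?thesis by (simp only: mult.assoc abs_le_iff) linarith
    qed
    have "\<bar>fd (\<lambda>x. ?m x * h x) x (axis i 1)\<bar> \<le> \<bar>?m x\<bar> * \<bar>fd h x (axis i 1)\<bar> + 5 * norm x ^ 4 * \<bar>h x\<bar>"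
    proof -
      have "\<bar>(axis i 1 :: real^3) $ j\<bar> \<le> 1" for j by (simp add: axis_def)
      from dm[OF this] have "\<bar>(1 * (a * x$1^(a-1) * x$2^b * x$3^c * axis i 1$1
        + b * x$1^a * x$2^(b-1) * x$3^c * axis i 1$2 + c * x$1^a * x$2^b * x$3^(c-1) * axis i 1$3)) * h x\<bar> \<le> 5 * norm x ^ 4 * \<bar>h x\<bar>"
        by (simp only: abs_mult mult_1) (intro mult_right_mono, auto)
      then show ?thesis
        unfolding fd_eq[OF d] by (intro order_trans[OF abs_triangle_ineq add_mono[OF eq_refl[OF abs_mult]]])
    qed
    also have "\<dots> \<le> norm x ^ 4 * M' i + 5 * norm x ^ 4 * M"
    proof (intro add_mono mult_mono)
      have "\<bar>?m x\<bar> \<le> norm x ^ 5" using mono[of x a b c] assms(1) by simp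
      also have "\<dots> \<le> norm x ^ 4" using x by (intro power_decreasing) auto
      finally show "\<bar>?m x\<bar> \<le> norm x ^ 4" .
    qed (use M M' x' in auto)
    finally show "\<bar>fd (\<lambda>x. ?m x * h x) x (axis i 1)\<bar> \<le> (M' i + 5 * M) * norm x ^ 4" by (simp add: algebra_simps)
  qed
  then have "\<forall>i. \<exists>B. \<forall>x. norm x < min 1 (r / 2) \<longrightarrow> \<bar>fd (\<lambda>x. ?m x * h x) x (axis i 1)\<bar> \<le> B * norm x ^ 4"
    by blast
  from choice[OF this] obtain B where B: "\<And>x i. norm x < min 1 (r / 2) \<Longrightarrow> \<bar>fd (\<lambda>x. ?m x * h x) x (axis i 1)\<bar> \<le> B i * norm x ^ 4"
    by blast
  have "jet 4 (\<lambda>t. fd (\<lambda>x. ?m x * h x) (g1 t) (axis i 1)) 0" for i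
  proof (rule jetI[of "min 1 (r / 2)" _ _ "B i"])
    show "\<bar>fd (\<lambda>x. ?m x * h x) (g1 t) (axis i 1) - poly 0 t\<bar> \<le> B i * \<bar>t\<bar> ^ 4" if "\<bar>t\<bar> < min 1 (r / 2)" for t
      using B[of "g1 t" i] that by simp
  qed (use r in auto)
  moreover have "jet 12 (\<lambda>t. fd (\<lambda>x. ?m x * h x) (g2 t) (axis i 1)) 0" for i
  proof (rule jetI[of "min 1 (min 1 (r / 2) / 3)" _ _ "\<bar>B i\<bar> * 81"])
    fix t :: real assume t: "0 < \<bar>t\<bar>" "\<bar>t\<bar> < min 1 (min 1 (r / 2) / 3)"
    have n: "norm (g2 t) < min 1 (r / 2)" using t r by (intro norm_g2_less) auto
    have "\<bar>fd (\<lambda>x. ?m x * h x) (g2 t) (axis i 1)\<bar> \<le> \<bar>B i\<bar> * norm (g2 t) ^ 4"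
      using B[OF n, of i] by (smt (verit) mult_right_mono zero_le_power norm_ge_zero)
    also have "\<dots> \<le> \<bar>B i\<bar> * (3 * \<bar>t\<bar>^3) ^ 4"
      using t by (intro mult_left_mono power_mono norm_g2_le) auto
    also have "\<dots> = \<bar>B i\<bar> * 81 * \<bar>t\<bar> ^ 12" by (simp add: power_mult_distrib flip: power_mult)
    finally show "\<bar>fd (\<lambda>x. ?m x * h x) (g2 t) (axis i 1) - poly 0 t\<bar> \<le> \<bar>B i\<bar> * 81 * \<bar>t\<bar> ^ 12" by simp
  qed (use r in auto)
  moreover have "exact_rel 0 0 0 0 0" by (simp add: exact_rel_def)
  ultimately show ?thesis unfolding exact_jets_def by blast
qed

text \<open>Hadamard's lemma splits off one monomial with constant coefficient at a time until a
  factor of degree 5 has been collected; \<open>n\<close> counts the degrees still missing.\<close>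

lemma exact_jets_smooth:
  assumes S: "smooth_on (ball 0 r) S" and r: "r > 0"
  shows "exact_jets S"
proof -
  have "exact_jets (\<lambda>x. x$1^a * x$2^b * x$3^c * h x)"
    if "a + b + c + n = 5" "smooth_on (ball 0 r) h" for n a b c h
    using that
  proof (induction n arbitrary: a b c h)
    case 0
    then show ?case using exact_jets_high r by simp
  next
    case (Suc n)
    obtain k where k: "\<And>i. smooth_on (ball 0 r) (k i)" "\<And>x. x \<in> ball 0 r \<Longrightarrow> h x = h 0 + (\<Sum>i\<in>UNIV. x $ i * k i x)"
      using hadamard[OF Suc.prems(2)] by metis
    have m: "smooth_on (ball 0 r) (\<lambda>x. x$1^a * x$2^b * x$3^c * l x)" if "smooth_on (ball 0 r) l" for a b c and l :: "real^3 \<Rightarrow> real"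
      by (intro smooth_intros open_ball that)
    have "exact_jets (\<lambda>x. h 0 * (x$1^a * x$2^b * x$3^c) + (x$1^(Suc a) * x$2^b * x$3^c * k 1 x
        + (x$1^a * x$2^(Suc b) * x$3^c * k 2 x + x$1^a * x$2^b * x$3^(Suc c) * k 3 x)))"
      using Suc.prems(1)
      by (intro exact_jets_add[OF r] exact_jets_monomial Suc.IH k m smooth_on_add[OF open_ball] smooth_intros open_ball) auto
    then show ?case
      by (rule exact_jets_cong[OF r]) (simp add: k(2) sum_3 algebra_simps)
  qed
  from this[of 0 0 0 5 S] S show ?thesis by simp
qed

section \<open>Coefficients recovered from jets\<close>

definition nfK_jets :: "nat \<Rightarrow> (nat \<Rightarrow> real) \<Rightarrow> real poly \<Rightarrow> real poly \<Rightarrow> real poly \<Rightarrow> bool" where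
  "nfK_jets N c p1 p2 p3 \<longleftrightarrow> (\<forall>n<N.
    coeff p1 n = (if n = 3 then 3 * c 7 else if n = 5 then - 5 * c 9 else if n = 6 then - 3 * c 10
      else if n = 7 then 3 * c 11 else if n = 9 then 3 * c 13 else if n = 10 then - 3 * c 14 else 0) \<and>
    coeff p2 n = (if n = 3 then 3 * c 8 else if n = 4 then 4 * c 9 else 0) \<and>
    coeff p3 n = (if n = 4 then 4 * c 7 else if n = 5 then 5 * c 8 else if n = 7 then - 4 * c 10
      else if n = 8 then 4 * c 11 else if n = 10 then 4 * c 13 else if n = 11 then - 4 * c 14 else 0))"

text \<open>
  The linear combinations defining \<open>exact_rel\<close> take the values \<open>7 c\<^sub>7, 8 c\<^sub>8, - 9 c\<^sub>9, - 10 c\<^sub>1\<^sub>0, \<dots>\<close>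
  on \<open>nfK c\<close>, so a normal form that is exact up to an error of high order has vanishing coefficients.
\<close>
lemma nfK_vanish_aux:
  assumes S: "smooth_on (ball 0 r) S" "r > 0" and "d > 0"
    and eq2: "\<And>t. \<bar>t\<bar> < d \<Longrightarrow> nfK c (g2 t) = grad S (g2 t) + \<beta> (g2 t)"
    and b2: "\<And>i. jet m (\<lambda>t. \<beta> (g2 t) $ i) 0"
  obtains p1 p2 p3 q1 q3 where "exact_rel p1 p2 p3 q1 q3"
    "jet 4 (\<lambda>t. fd S (g1 t) (axis 1 1)) q1" "jet 4 (\<lambda>t. fd S (g1 t) (axis 3 1)) q3"
    "nfK_jets (min m 12) c p1 p2 p3"
proof -
  obtain p1 p2 p3 q1 q3 where p: "exact_rel p1 p2 p3 q1 q3"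
    "jet 12 (\<lambda>t. fd S (g2 t) (axis 1 1)) p1" "jet 12 (\<lambda>t. fd S (g2 t) (axis 2 1)) p2"
    "jet 12 (\<lambda>t. fd S (g2 t) (axis 3 1)) p3"
    "jet 4 (\<lambda>t. fd S (g1 t) (axis 1 1)) q1" "jet 4 (\<lambda>t. fd S (g1 t) (axis 3 1)) q3"
    using exact_jets_smooth[OF S] unfolding exact_jets_def by blast
  define P1 where "P1 = monom (3 * c 7) 3 + monom (- 5 * c 9) 5 + monom (- 3 * c 10) 6 + monom (3 * c 11) 7
    + monom (3 * c 13) 9 + monom (- 3 * c 14) 10"
  define P2 where "P2 = monom (3 * c 8) 3 + monom (4 * c 9) 4"
  define P3 where "P3 = monom (4 * c 7) 4 + monom (5 * c 8) 5 + monom (- 4 * c 10) 7 + monom (4 * c 11) 8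
    + monom (4 * c 13) 10 + monom (- 4 * c 14) 11"
  have K: "nfK c (g2 t) $ 1 = poly P1 t" "nfK c (g2 t) $ 2 = poly P2 t" "nfK c (g2 t) $ 3 = poly P3 t" for t
    by (simp_all add: nfK_def P1_def P2_def P3_def poly_monom algebra_simps power_numeral_reduce)
  have J: "jet m (\<lambda>t. fd S (g2 t) (axis i 1)) P" if "\<And>t. nfK c (g2 t) $ i = poly P t" for i P
  proof (rule jet_cong)
    show "jet m (\<lambda>t. nfK c (g2 t) $ i + - \<beta> (g2 t) $ i) P"
      using jet_add[OF jet_poly jet_minus[OF b2], of "\<lambda>t. nfK c (g2 t) $ i" P i] that by simp
    show "nfK c (g2 t) $ i + - \<beta> (g2 t) $ i = fd S (g2 t) (axis i 1)" if "\<bar>t\<bar> < d" for t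
      by (simp add: eq2[OF that])
  qed fact
  have U: "coeff p n = coeff P n" if "jet 12 f p" "jet m f P" "n < min m 12" for f p P n
    using that by (intro jet_unique[of "min m 12" f]) (auto intro: jet_mono)
  have c1: "coeff p1 n = coeff P1 n" and c2: "coeff p2 n = coeff P2 n" and c3: "coeff p3 n = coeff P3 n"
    if "n < min m 12" for n
    using U[OF p(2) J[OF K(1)] that] U[OF p(3) J[OF K(2)] that] U[OF p(4) J[OF K(3)] that] .
  show thesis
    by (rule that[OF p(1,5,6)]) (auto simp: nfK_jets_def c1 c2 c3 P1_def P2_def P3_def)
qed

text \<open>Each threshold is one more than the highest index on \<open>g2\<close> in the relation
  of that weight: 4, 5, 5, 7, 8 for the weights 7 to 11. The relations of weight 13 and 14 involve
  the smooth branch as well and give nothing on \<open>g2\<close> alone.\<close>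

lemma nfK_vanish:
  assumes "smooth_on (ball 0 r) S" "r > 0" "d > 0"
    and "\<And>t. \<bar>t\<bar> < d \<Longrightarrow> nfK c (g2 t) = grad S (g2 t) + \<beta> (g2 t)"
    and "\<And>i. jet m (\<lambda>t. \<beta> (g2 t) $ i) 0"
  shows "m \<ge> 5 \<Longrightarrow> c 7 = 0" "m \<ge> 6 \<Longrightarrow> c 8 = 0" "m \<ge> 6 \<Longrightarrow> c 9 = 0" "m \<ge> 8 \<Longrightarrow> c 10 = 0" "m \<ge> 9 \<Longrightarrow> c 11 = 0"
proof -
  obtain p1 p2 p3 q1 q3 where p1: "exact_rel p1 p2 p3 q1 q3"
    and j: "jet 4 (\<lambda>t. fd S (g1 t) (axis 1 1)) q1" "jet 4 (\<lambda>t. fd S (g1 t) (axis 3 1)) q3"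
    and p: "nfK_jets (min m 12) c p1 p2 p3"
    using nfK_vanish_aux[OF assms] .
  note r = p1[unfolded exact_rel_def]
  show "m \<ge> 5 \<Longrightarrow> c 7 = 0" "m \<ge> 6 \<Longrightarrow> c 8 = 0" "m \<ge> 6 \<Longrightarrow> c 9 = 0" "m \<ge> 8 \<Longrightarrow> c 10 = 0" "m \<ge> 9 \<Longrightarrow> c 11 = 0"
    using r p by (auto simp: nfK_jets_def)
qed

text \<open>For the weights 8 and 9 the highest coefficient on \<open>g2\<close> can be read off
  from the linear term on \<open>g1\<close>, which lowers the thresholds to 4 and 5. The weights 13
  and 14 need the quadratic terms on \<open>g1\<close>, hence \<open>k \<ge> 3\<close>.\<close>

lemma nfK_vanish_both:
  assumes "smooth_on (ball 0 r) S" "r > 0" "d > 0"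
    and "\<And>t. \<bar>t\<bar> < d \<Longrightarrow> nfK c (g2 t) = grad S (g2 t) + \<beta> (g2 t)"
    and "\<And>i. jet m (\<lambda>t. \<beta> (g2 t) $ i) 0"
    and eq1: "\<And>t. \<bar>t\<bar> < d \<Longrightarrow> nfK c (g1 t) = grad S (g1 t) + \<beta> (g1 t)"
    and b1: "\<And>i. jet k (\<lambda>t. \<beta> (g1 t) $ i) 0"
  shows "m \<ge> 4 \<Longrightarrow> k \<ge> 2 \<Longrightarrow> c 8 = 0" "m \<ge> 5 \<Longrightarrow> k \<ge> 2 \<Longrightarrow> c 9 = 0"
    "m \<ge> 11 \<Longrightarrow> k \<ge> 3 \<Longrightarrow> c 13 = 0" "m \<ge> 12 \<Longrightarrow> k \<ge> 3 \<Longrightarrow> c 14 = 0"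
proof -
  obtain p1 p2 p3 q1 q3 where p1: "exact_rel p1 p2 p3 q1 q3"
    and j: "jet 4 (\<lambda>t. fd S (g1 t) (axis 1 1)) q1" "jet 4 (\<lambda>t. fd S (g1 t) (axis 3 1)) q3"
    and p: "nfK_jets (min m 12) c p1 p2 p3"
    using nfK_vanish_aux[OF assms(1-5)] .
  have K: "nfK c (g1 t) $ 1 = poly (monom (- 5 * c 9) 1) t" "nfK c (g1 t) $ 3 = poly (monom (5 * c 8) 1) t" for t
    by (simp_all add: nfK_def poly_monom)
  have J: "jet k (\<lambda>t. fd S (g1 t) (axis i 1)) P" if "\<And>t. nfK c (g1 t) $ i = poly P t" for i P
  proof (rule jet_cong)
    show "jet k (\<lambda>t. nfK c (g1 t) $ i + - \<beta> (g1 t) $ i) P"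
      using jet_add[OF jet_poly jet_minus[OF b1], of "\<lambda>t. nfK c (g1 t) $ i" P i] that by simp
    show "nfK c (g1 t) $ i + - \<beta> (g1 t) $ i = fd S (g1 t) (axis i 1)" if "\<bar>t\<bar> < d" for t
      by (simp add: eq1[OF that])
  qed fact
  have U: "coeff p n = coeff P n" if "jet 4 f p" "jet k f P" "n < min k 4" for f p P n
    using that by (intro jet_unique[of "min k 4" f]) (auto intro: jet_mono)
  have q: "coeff q1 n = (if n = 1 then - 5 * c 9 else 0)" "coeff q3 n = (if n = 1 then 5 * c 8 else 0)" if "n < min k 4" for n
    using U[OF j(1) J[OF K(1)] that] U[OF j(2) J[OF K(2)] that] by auto
  note r = p1[unfolded exact_rel_def]
  show "m \<ge> 4 \<Longrightarrow> k \<ge> 2 \<Longrightarrow> c 8 = 0" "m \<ge> 5 \<Longrightarrow> k \<ge> 2 \<Longrightarrow> c 9 = 0"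
    "m \<ge> 11 \<Longrightarrow> k \<ge> 3 \<Longrightarrow> c 13 = 0" "m \<ge> 12 \<Longrightarrow> k \<ge> 3 \<Longrightarrow> c 14 = 0"
    using r p q by (auto simp: nfK_jets_def)
qed

section \<open>Symplectic coordinates\<close>

lemma onorm_fd_le:
  fixes f :: "real^'n \<Rightarrow> 'b::real_normed_vector"
  assumes "f differentiable (at x)"
  shows "onorm (fd f x) \<le> (\<Sum>i\<in>UNIV. norm (fd f x (axis i 1)))"
proof (rule onorm_le)
  fix v :: "real^'n"
  have "norm (fd f x v) = norm (\<Sum>i\<in>UNIV. v $ i *\<^sub>R fd f x (axis i 1))"
    by (subst fd_axis_expand[OF assms]) simp
  also have "\<dots> \<le> (\<Sum>i\<in>UNIV. \<bar>v $ i\<bar> * norm (fd f x (axis i 1)))"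
    by (rule sum_norm_le) simp
  also have "\<dots> \<le> (\<Sum>i\<in>UNIV. norm v * norm (fd f x (axis i 1)))"
    by (intro sum_mono mult_right_mono component_le_norm_cart) auto
  finally show "norm (fd f x v) \<le> (\<Sum>i\<in>UNIV. norm (fd f x (axis i 1))) * norm v"
    by (simp add: sum_distrib_left mult.commute)
qed

lemma smooth_lipschitz_at_0:
  fixes f :: "real^'n \<Rightarrow> 'b::real_normed_vector"
  assumes f: "smooth_on (ball 0 r) f" and r: "r > 0" 
    and B: "\<And>x i. norm x \<le> r / 2 \<Longrightarrow> norm (fd f x (axis i 1)) \<le> B * norm x ^ k" and "B \<ge> 0"
  shows "norm x \<le> r / 2 \<Longrightarrow> norm (f x - f 0) \<le> real CARD('n) * B * norm x ^ Suc k"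
proof -
  assume x: "norm x \<le> r / 2"
  have "norm (f x - f 0) \<le> (real CARD('n) * (B * norm x ^ k)) * norm (x - 0)"
  proof (rule differentiable_bound[of "cball 0 (norm x)" f "fd f"])
    fix y :: "real^'n" assume y: "y \<in> cball 0 (norm x)"
    then have yr: "y \<in> ball 0 r" "norm y \<le> r / 2" using x r by auto
    show "(f has_derivative fd f y) (at y within cball 0 (norm x))"
      using smooth_on_has_derivative[OF f yr(1)] has_derivative_at_withinI by blast
    have "onorm (fd f y) \<le> (\<Sum>i\<in>UNIV. norm (fd f y (axis i 1)))"
      by (rule onorm_fd_le[OF smooth_on_differentiable[OF f yr(1)]])
    also have "\<dots> \<le> (\<Sum>i\<in>(UNIV::'n set). B * norm x ^ k)"
    proof (rule sum_mono)
      fix i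
      have "norm (fd f y (axis i 1)) \<le> B * norm y ^ k" by (rule B[OF yr(2)])
      also have "\<dots> \<le> B * norm x ^ k" using y \<open>B \<ge> 0\<close> by (intro mult_left_mono power_mono) auto
      finally show "norm (fd f y (axis i 1)) \<le> B * norm x ^ k" .
    qed
    finally show "onorm (fd f y) \<le> real CARD('n) * (B * norm x ^ k)" by simp
  qed auto
  then show ?thesis by (simp add: mult_ac)
qed

lemma uniform_bound_finite:
  fixes F :: "'i::finite \<Rightarrow> 'a \<Rightarrow> real"
  assumes "\<And>i. \<exists>M. \<forall>x. P x \<longrightarrow> F i x \<le> M * N x" "\<And>x. N x \<ge> 0"
  shows "\<exists>M\<ge>0. \<forall>i x. P x \<longrightarrow> F i x \<le> M * N x"
proof -
  have "\<forall>i. \<exists>M. \<forall>x. P x \<longrightarrow> F i x \<le> M * N x" using assms(1) by blast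
  from choice[OF this] obtain M where M: "\<And>i x. P x \<Longrightarrow> F i x \<le> M i * N x" by blast
  have "F i x \<le> (\<Sum>i\<in>UNIV. \<bar>M i\<bar>) * N x" if "P x" for i x
  proof -
    have "M i \<le> (\<Sum>i\<in>UNIV. \<bar>M i\<bar>)"
      using member_le_sum[of i UNIV "\<lambda>i. \<bar>M i\<bar>"] by auto
    then show ?thesis using M[OF that, of i] assms(2)[of x] by (meson mult_right_mono order_trans)
  qed
  then show ?thesis by (intro exI[of _ "\<Sum>i\<in>UNIV. \<bar>M i\<bar>"]) (auto intro: sum_nonneg)
qed

lemma taylor1:
  fixes f :: "real^'n \<Rightarrow> 'b::real_normed_vector"
  assumes f: "smooth_on (ball 0 r) f" and r: "r > 0"
  obtains C where "C \<ge> 0" "\<And>x. norm x \<le> r / 2 \<Longrightarrow> norm (f x - f 0) \<le> C * norm x"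
proof -
  have "\<exists>M\<ge>0. \<forall>i x. norm x \<le> r / 2 \<longrightarrow> norm (fd f x (axis i 1)) \<le> M * 1"
    using smooth_local_bound[OF smooth_on_fd[OF f] r] by (intro uniform_bound_finite) auto
  then obtain M where "M \<ge> 0" "\<And>i x. norm x \<le> r / 2 \<Longrightarrow> norm (fd f x (axis i 1)) \<le> M * norm x ^ 0" by auto
  from smooth_lipschitz_at_0[OF f r this(2,1)] \<open>M \<ge> 0\<close> show thesis by (intro that[of "real CARD('n) * M"]) auto
qed

lemma taylor2:
  fixes f :: "real^'n \<Rightarrow> 'b::real_normed_vector"
  assumes f: "smooth_on (ball 0 r) f" and r: "r > 0" and z: "f 0 = 0" "\<And>i. fd f 0 (axis i 1) = 0"
  obtains C where "C \<ge> 0" "\<And>x. norm x \<le> r / 2 \<Longrightarrow> norm (f x) \<le> C * norm x ^ 2"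
proof -
  have "\<exists>C. \<forall>x. norm x \<le> r / 2 \<longrightarrow> norm (fd f x (axis i 1)) \<le> C * norm x" for i
  proof -
    obtain C where "\<And>x. norm x \<le> r / 2 \<Longrightarrow> norm (fd f x (axis i 1) - fd f 0 (axis i 1)) \<le> C * norm x"
      using taylor1[OF smooth_on_fd[OF f] r] by metis
    then show ?thesis unfolding z(2) diff_zero by blast
  qed
  then have "\<exists>M\<ge>0. \<forall>i x. norm x \<le> r / 2 \<longrightarrow> norm (fd f x (axis i 1)) \<le> M * norm x"
    by (intro uniform_bound_finite) auto
  then obtain M where "M \<ge> 0" "\<And>i x. norm x \<le> r / 2 \<Longrightarrow> norm (fd f x (axis i 1)) \<le> M * norm x ^ 1" by auto
  from smooth_lipschitz_at_0[OF f r this(2,1)] \<open>M \<ge> 0\<close> show thesis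
    by (intro that[of "real CARD('n) * M"]) (auto simp: z numeral_2_eq_2)
qed

text \<open>Along \<open>g2\<close> the order is tripled since its coordinates are
  \<open>O(t^3)\<close>; along \<open>g1\<close> it is unchanged.\<close>

lemma jet_zero_of_bound:
  assumes "d > 0" "\<And>x. norm x < d \<Longrightarrow> norm (\<beta> x :: real^3) \<le> C * norm x ^ k"
  shows "jet k (\<lambda>t. \<beta> (g1 t) $ i) 0" "jet (3 * k) (\<lambda>t. \<beta> (g2 t) $ i) 0"
proof -
  show "jet k (\<lambda>t. \<beta> (g1 t) $ i) 0"
  proof (rule jetI[OF assms(1)])
    show "\<bar>\<beta> (g1 t) $ i - poly 0 t\<bar> \<le> C * \<bar>t\<bar> ^ k" if "\<bar>t\<bar> < d" for t
      using assms(2)[of "g1 t"] component_le_norm_cart[of "\<beta> (g1 t)" i] that by simp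
  qed
  show "jet (3 * k) (\<lambda>t. \<beta> (g2 t) $ i) 0"
  proof (rule jetI[of "min 1 (d / 3)" _ _ "\<bar>C\<bar> * 3 ^ k"])
    fix t :: real assume t: "0 < \<bar>t\<bar>" "\<bar>t\<bar> < min 1 (d / 3)"
    have "\<bar>\<beta> (g2 t) $ i\<bar> \<le> norm (\<beta> (g2 t))" by (rule component_le_norm_cart)
    also have "\<dots> \<le> C * norm (g2 t) ^ k" by (rule assms(2)[OF norm_g2_less[OF assms(1) t(2)]])
    also have "\<dots> \<le> \<bar>C\<bar> * norm (g2 t) ^ k" by (intro mult_right_mono) auto
    also have "\<dots> \<le> \<bar>C\<bar> * (3 * \<bar>t\<bar>^3) ^ k"
      using t by (intro mult_left_mono power_mono norm_g2_le) auto
    also have "\<dots> = \<bar>C\<bar> * 3 ^ k * \<bar>t\<bar> ^ (3 * k)" by (simp add: power_mult_distrib flip: power_mult)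
    finally show "\<bar>\<beta> (g2 t) $ i - poly 0 t\<bar> \<le> \<bar>C\<bar> * 3 ^ k * \<bar>t\<bar> ^ (3 * k)" by simp
  qed (use assms(1) in auto)
qed

section \<open>Linear symplectic algebra\<close>

locale symplectic_coords =
  fixes e :: "nat \<Rightarrow> 'm::finite" and n :: nat
  assumes card_m: "CARD('m) = 2 * n" and n_ge: "n \<ge> 2" and bij_e: "bij_betw e {1..2 * n} UNIV"
begin

abbreviation om :: "real^'m \<Rightarrow> real^'m \<Rightarrow> real" where "om \<equiv> omega e"

lemma e_eq_iff: "i \<in> {1..2*n} \<Longrightarrow> j \<in> {1..2*n} \<Longrightarrow> e i = e j \<longleftrightarrow> i = j"
  using bij_e by (meson bij_betw_imp_inj_on inj_on_eq_iff)

lemma ex_e: "\<exists>i\<in>{1..2*n}. k = e i"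
  using bij_e by (metis UNIV_I bij_betw_imp_surj_on imageE)

lemma ex_e_pair: "\<exists>i\<in>{1..n}. k = e (2*i-1) \<or> k = e (2*i)"
proof -
  obtain j where j: "j \<in> {1..2*n}" "k = e j" using ex_e by blast
  show ?thesis
  proof (cases "even j")
    case True
    then obtain i where "j = 2 * i" by blast
    then show ?thesis using j by (intro bexI[of _ i]) auto
  next
    case False
    then obtain i where "j = 2 * i + 1" using oddE by blast
    then show ?thesis using j by (intro bexI[of _ "Suc i"]) auto
  qed
qed

lemma om_def: "om u v = (\<Sum>i = 1..n. u $ e (2*i - 1) * v $ e (2*i) - u $ e (2*i) * v $ e (2*i - 1))"
  by (simp add: omega_def card_m)

lemma om_bilinear: "bounded_bilinear om"
  unfolding bilinear_conv_bounded_bilinear[symmetric]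
  by (auto simp: bilinear_def linear_iff om_def algebra_simps sum_distrib_left sum.distrib sum_subtractf)

lemmas om_simps = bounded_bilinear.add_left[OF om_bilinear] bounded_bilinear.add_right[OF om_bilinear]
  bounded_bilinear.diff_left[OF om_bilinear] bounded_bilinear.diff_right[OF om_bilinear]
  bounded_bilinear.minus_left[OF om_bilinear] bounded_bilinear.minus_right[OF om_bilinear]
  bounded_bilinear.scaleR_left[OF om_bilinear] bounded_bilinear.scaleR_right[OF om_bilinear]
  bounded_bilinear.zero_left[OF om_bilinear] bounded_bilinear.zero_right[OF om_bilinear]

lemma om_swap: "om u v = - om v u"
  by (simp add: om_def flip: sum_negf) (simp add: algebra_simps)

lemma om_self [simp]: "om u u = 0"
  using om_swap[of u u] by simp

text \<open>The standard complex structure. It turns \<open>om\<close> into the inner product, so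
  that symplectic complements become orthogonal complements.\<close>

definition Jm :: "real^'m \<Rightarrow> real^'m" where "Jm u = (\<chi> k. om u (axis k 1))"

lemma Jm_even: "i \<in> {1..n} \<Longrightarrow> Jm u $ e (2*i) = u $ e (2*i - 1)"
  and Jm_odd: "i \<in> {1..n} \<Longrightarrow> Jm u $ e (2*i - 1) = - u $ e (2*i)"
proof -
  assume i: "i \<in> {1..n}"
  have 1: "e (2*j) = e (2*i) \<longleftrightarrow> j = i" "e (2*j-1) \<noteq> e (2*i)" "e (2*j-1) = e (2*i-1) \<longleftrightarrow> j = i" "e (2*j) \<noteq> e (2*i-1)"
    if "j \<in> {1..n}" for j
  proof -
    have m: "2*j \<in> {1..2*n}" "2*j-1 \<in> {1..2*n}" "2*i \<in> {1..2*n}" "2*i-1 \<in> {1..2*n}" using that i by auto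
    have o: "odd (2*j-1)" "odd (2*i-1)" "2*j-1 = 2*i-1 \<longleftrightarrow> j = i" using that i by auto
    show "e (2*j) = e (2*i) \<longleftrightarrow> j = i" using e_eq_iff[OF m(1,3)] by simp
    show "e (2*j-1) \<noteq> e (2*i)" using e_eq_iff[OF m(2,3)] o(1) by (metis dvd_triv_left)
    show "e (2*j-1) = e (2*i-1) \<longleftrightarrow> j = i" using e_eq_iff[OF m(2,4)] o(3) by simp
    show "e (2*j) \<noteq> e (2*i-1)" using e_eq_iff[OF m(1,4)] o(2) by (metis dvd_triv_left)
  qed
  have "Jm u $ e (2*i) = (\<Sum>j = 1..n. if j = i then u $ e (2*j-1) else 0)"
    unfolding Jm_def om_def vec_lambda_beta by (rule sum.cong) (use 1 in \<open>auto simp: axis_def\<close>)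
  then show "Jm u $ e (2*i) = u $ e (2*i - 1)" using i by simp
  have "Jm u $ e (2*i-1) = (\<Sum>j = 1..n. if j = i then - u $ e (2*j) else 0)"
    unfolding Jm_def om_def vec_lambda_beta by (rule sum.cong) (use 1 in \<open>auto simp: axis_def\<close>)
  then show "Jm u $ e (2*i-1) = - u $ e (2*i)" using i by simp
qed

lemma om_eq_inner: "om u v = Jm u \<bullet> v"
proof -
  have "om u v = om u (\<Sum>i\<in>UNIV. v $ i *\<^sub>R axis i 1)" by (metis vec_sum_axis)
  also have "\<dots> = (\<Sum>i\<in>UNIV. v $ i * om u (axis i 1))"
    by (simp add: bounded_bilinear.sum_right[OF om_bilinear] om_simps)
  finally show ?thesis by (simp add: Jm_def inner_vec_def mult.commute)
qed

lemma linear_Jm: "linear Jm"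
  by (auto simp: linear_iff Jm_def vec_eq_iff om_simps)

lemma Jm_Jm: "Jm (Jm u) = - u"
proof (rule vec_eq_iff[THEN iffD2], rule allI)
  fix k
  obtain i where i: "i \<in> {1..n}" "k = e (2*i-1) \<or> k = e (2*i)" using ex_e_pair by blast
  then show "Jm (Jm u) $ k = (- u) $ k" using Jm_even[OF i(1)] Jm_odd[OF i(1)] by auto
qed

lemma om_nondeg: "(\<And>v. om u v = 0) \<Longrightarrow> u = 0"
proof -
  assume "\<And>v. om u v = 0"
  then have "Jm u = 0" by (simp add: om_eq_inner) (metis inner_eq_zero_iff)
  then show ?thesis using Jm_Jm[of u] linear_0[OF linear_Jm] by simp
qed

lemma om_represent: "\<exists>G. linear G \<and> (\<forall>b v. om (G b) v = b \<bullet> v)"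
proof (intro exI conjI allI)
  show "linear (\<lambda>b. - Jm b)" using linear_Jm by (simp add: linear_iff)
  show "om (- Jm b) v = b \<bullet> v" for b v
    by (simp add: om_eq_inner linear_neg[OF linear_Jm] Jm_Jm)
qed

lemma symplectic_inj:
  assumes "linear T" "\<And>x y. om (T x) (T y) = om x y"
  shows "inj T"
proof (rule linear_injective_0[OF assms(1), THEN iffD2, rule_format])
  fix x assume "T x = 0"
  then have "om x v = 0" for v using assms(2)[of x v] by (simp add: om_simps)
  then show "x = 0" by (rule om_nondeg)
qed

text \<open>The symplectic transvection along \<open>d = b - a\<close>, scaled so that
  \<open>a\<close> goes to \<open>a + d\<close>. It fixes every vector whose pairing with
  \<open>d\<close> is zero.\<close>

lemma transvection:
  assumes "om a b \<noteq> 0"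
  shows "\<exists>R. linear R \<and> (\<forall>x y. om (R x) (R y) = om x y) \<and> R a = b \<and> (\<forall>w. om w a = om w b \<longrightarrow> R w = w)"
proof -
  define d where "d = b - a"
  define c where "c = 1 / om a b"
  let ?R = "\<lambda>x. x + (c * om x d) *\<^sub>R d"
  have "linear ?R" by (auto simp: linear_iff om_simps algebra_simps)
  have "om (?R x) (?R y) = om x y" for x y
    using om_swap[of d y] by (simp add: om_simps)
  have "om a d = om a b" by (simp add: d_def om_simps)
  then have "?R a = b" using assms by (simp add: c_def d_def)
  show ?thesis
  proof (intro exI[of _ ?R] conjI allI impI)
    show "?R w = w" if "om w a = om w b" for w
      using that by (simp add: d_def om_simps)
  qed fact+
qed

text \<open>The component \<open>q\<close> of \<open>Jm a\<close> orthogonal to the image of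
  \<open>W\<close> under \<open>Jm\<close> serves as \<open>y\<close>; it is nonzero because
  \<open>Jm\<close> is injective.\<close>

lemma exists_om_separating:
  assumes "a \<notin> span W"
  shows "\<exists>y. (\<forall>w\<in>W. om w y = 0) \<and> om a y \<noteq> 0"
proof -
  have "Jm a \<notin> span (Jm ` W)"
  proof
    assume "Jm a \<in> span (Jm ` W)"
    then obtain b where b: "b \<in> span W" "Jm a = Jm b"
      using linear_span_image[OF linear_Jm, of W] by auto
    then have "a = b" using Jm_Jm by (metis neg_equal_iff_equal)
    then show False using assms b by simp
  qed
  obtain p q where pq: "p \<in> span (Jm ` W)" "\<And>w. w \<in> span (Jm ` W) \<Longrightarrow> orthogonal q w" "Jm a = p + q"
    using orthogonal_subspace_decomp_exists[of "Jm ` W" "Jm a"] by blast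
  show ?thesis
  proof (intro exI conjI ballI)
    show "om w q = 0" if "w \<in> W" for w
      using pq(2)[of "Jm w"] that by (simp add: om_eq_inner orthogonal_def inner_commute span_base)
    have "Jm a \<bullet> q = q \<bullet> q" using pq(2)[OF pq(1)] by (simp add: pq(3) inner_add_left inner_add_right orthogonal_def inner_commute)
    moreover have "q \<noteq> 0" using pq(1,3) \<open>Jm a \<notin> span (Jm ` W)\<close> by auto
    ultimately show "om a q \<noteq> 0" by (simp add: om_eq_inner)
  qed
qed

text \<open>A single transvection needs \<open>om a b\<close> to be nonzero. Otherwise the way from
  \<open>a\<close> to \<open>b\<close> leads through \<open>a + y\<close>, where \<open>y\<close>
  pairs to zero with \<open>W\<close> but with neither \<open>a\<close> nor \<open>b\<close>; two
  transvections fixing \<open>W\<close> then suffice.\<close>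

lemma witt_step:
  assumes "a \<notin> span W" "b \<notin> span W" "\<And>w. w \<in> W \<Longrightarrow> om w a = om w b"
  shows "\<exists>R. linear R \<and> (\<forall>x y. om (R x) (R y) = om x y) \<and> R a = b \<and> (\<forall>w\<in>W. R w = w)"
proof (cases "om a b = 0")
  case False
  then show ?thesis using transvection[OF False] assms(3) by blast
next
  case True
  obtain y1 where y1: "\<And>w. w \<in> W \<Longrightarrow> om w y1 = 0" "om a y1 \<noteq> 0" using exists_om_separating[OF assms(1)] by blast
  obtain y2 where y2: "\<And>w. w \<in> W \<Longrightarrow> om w y2 = 0" "om b y2 \<noteq> 0" using exists_om_separating[OF assms(2)] by blast
  \<comment> \<open>If neither separating vector serves for both \<open>a\<close> and
    \<open>b\<close>, their sum does.\<close>
  have "\<exists>y. (\<forall>w\<in>W. om w y = 0) \<and> om a y \<noteq> 0 \<and> om b y \<noteq> 0"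
  proof (cases "om b y1 \<noteq> 0 \<or> om a y2 \<noteq> 0")
    case True then show ?thesis using y1 y2 by blast
  next
    case False then show ?thesis using y1 y2 by (intro exI[of _ "y1 + y2"]) (auto simp: om_simps)
  qed
  then obtain y where y: "\<And>w. w \<in> W \<Longrightarrow> om w y = 0" "om a y \<noteq> 0" "om b y \<noteq> 0" by blast
  have "om a (a + y) \<noteq> 0" using y by (simp add: om_simps)
  then obtain R1 where R1: "linear R1" "\<And>x y. om (R1 x) (R1 y) = om x y" "R1 a = a + y"
    "\<And>w. om w a = om w (a + y) \<Longrightarrow> R1 w = w" using transvection[of a "a + y"] by blast
  have "om (a + y) b \<noteq> 0" using y(3) True om_swap[of y b] by (simp add: om_simps)
  then obtain R2 where R2: "linear R2" "\<And>x y. om (R2 x) (R2 y) = om x y" "R2 (a + y) = b"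
    "\<And>w. om w (a + y) = om w b \<Longrightarrow> R2 w = w" using transvection[of "a + y" b] by blast
  show ?thesis
  proof (intro exI[of _ "\<lambda>x. R2 (R1 x)"] conjI allI ballI)
    show "linear (\<lambda>x. R2 (R1 x))" using linear_compose[OF R1(1) R2(1)] by (simp add: o_def)
    show "R2 (R1 w) = w" if "w \<in> W" for w
      using R1(4)[of w] R2(4)[of w] y(1)[OF that] assms(3)[OF that] by (simp add: om_simps)
  qed (simp_all add: R1 R2)
qed

text \<open>Witt's extension theorem for independent lists with equal Gram matrices. The vectors are
  matched one after the other, and each correction fixes the targets already reached.\<close>

lemma witt:
  fixes u v :: "nat \<Rightarrow> real^'m"
  assumes "\<And>i. i < k \<Longrightarrow> u i \<notin> span (u ` {..<i})" "\<And>i. i < k \<Longrightarrow> v i \<notin> span (v ` {..<i})"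
    and "\<And>i j. i < k \<Longrightarrow> j < k \<Longrightarrow> om (u i) (u j) = om (v i) (v j)"
  shows "\<exists>T. linear T \<and> (\<forall>x y. om (T x) (T y) = om x y) \<and> (\<forall>i<k. T (u i) = v i)"
  using assms
proof (induction k)
  case 0
  then show ?case by (intro exI[of _ "\<lambda>x. x"]) (auto simp: linear_iff)
next
  case (Suc k)
  then obtain T where T: "linear T" "\<And>x y. om (T x) (T y) = om x y" "\<And>i. i < k \<Longrightarrow> T (u i) = v i"
    by (metis less_SucI)
  have im: "v ` {..<k} = T ` u ` {..<k}" using T(3) by (auto simp: image_image)
  have "T (u k) \<notin> span (v ` {..<k})"
    unfolding im linear_span_image[OF T(1)]
    using Suc.prems(1)[of k] symplectic_inj[OF T(1,2)] by (auto dest: injD)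
  moreover have "om w (T (u k)) = om w (v k)" if w: "w \<in> v ` {..<k}" for w
    proof -
    obtain i where i: "i < k" "w = v i" using w by blast
    then show ?thesis using T(2)[of "u i" "u k"] T(3)[OF i(1)] Suc.prems(3)[of i k] by simp
  qed
  ultimately obtain R where R: "linear R" "\<And>x y. om (R x) (R y) = om x y" "R (T (u k)) = v k"
    "\<And>w. w \<in> v ` {..<k} \<Longrightarrow> R w = w"
    using witt_step[of "T (u k)" "v ` {..<k}" "v k"] Suc.prems(2)[of k] by blast
  show ?case
  proof (intro exI[of _ "\<lambda>x. R (T x)"] conjI allI impI)
    show "linear (\<lambda>x. R (T x))" using linear_compose[OF T(1) R(1)] by (simp add: o_def)
    show "R (T (u i)) = v i" if "i < Suc k" for i
      using that R(3,4) T(3) by (cases "i = k") auto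
  qed (simp_all add: R T)
qed

section \<open>The primitive of the pulled back form\<close>

definition lam :: "(real^3 \<Rightarrow> real^'m) \<Rightarrow> real^3 \<Rightarrow> real^3" where
  "lam j x = (\<chi> i. om (j x) (fd j x (axis i 1)) / 2)"

lemma smooth_on_om: "open U \<Longrightarrow> smooth_on U f \<Longrightarrow> smooth_on U g \<Longrightarrow> smooth_on U (\<lambda>x. om (f x) (g x))"
  by (rule smooth_on_bilinear[OF om_bilinear])

lemma smooth_on_lam: "open U \<Longrightarrow> smooth_on U j \<Longrightarrow> smooth_on U (lam j)"
  unfolding lam_def by (rule smooth_on_vec) (auto intro!: smooth_on_divide_const smooth_on_om smooth_on_fd)

text \<open>Integration by parts: a difference of primitives is exact up to a term that is small wherever \<open>j - j'\<close> is.\<close>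
lemma lam_diff:
  assumes "smooth_on U j" "smooth_on U j'" "x \<in> U"
  shows "lam j x - lam j' x = (\<chi> i. om (j x - j' x) (fd j x (axis i 1) + fd j' x (axis i 1)) / 2)
    - grad (\<lambda>x. om (j x) (j' x) / 2) x"
proof -
  have "((\<lambda>x. om (j x) (j' x)) has_derivative (\<lambda>v. om (j x) (fd j' x v) + om (fd j x v) (j' x))) (at x)"
    by (rule bounded_bilinear.FDERIV[OF om_bilinear smooth_on_has_derivative[OF assms(1,3)] smooth_on_has_derivative[OF assms(2,3)]])
  then have "((\<lambda>x. om (j x) (j' x) / 2) has_derivative (\<lambda>v. (om (j x) (fd j' x v) + om (fd j x v) (j' x)) / 2)) (at x)"
    by (rule bounded_linear.has_derivative[OF bounded_linear_divide])
  from fd_eq[OF this] show ?thesis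
    using om_swap[of "fd j x _" "j' x"]
    by (simp add: vec_eq_iff lam_def om_simps) (simp add: field_simps)
qed

lemma fd_lam_0:
  assumes j: "smooth_on (ball 0 r) j" "r > 0" "j 0 = 0"
  shows "fd (lam j) 0 v $ i = om (fd j 0 v) (fd j 0 (axis i 1)) / 2"
proof -
  have 0: "0 \<in> ball (0::real^3) r" using j(2) by simp
  have "((\<lambda>x. om (j x) (fd j x (axis i 1)) / 2) has_derivative
      (\<lambda>v. (om (j 0) (fd (\<lambda>x. fd j x (axis i 1)) 0 v) + om (fd j 0 v) (fd j 0 (axis i 1))) / 2)) (at 0)"
    by (intro bounded_linear.has_derivative[OF bounded_linear_divide] bounded_bilinear.FDERIV[OF om_bilinear]
        smooth_on_has_derivative[OF j(1) 0] smooth_on_has_derivative[OF smooth_on_fd[OF j(1)] 0])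
  moreover have "((\<lambda>x. lam j x $ i) has_derivative (\<lambda>v. fd (lam j) 0 v $ i)) (at 0)"
    by (rule bounded_linear.has_derivative[OF bounded_linear_vec_nth smooth_on_has_derivative[OF smooth_on_lam[OF open_ball j(1)] 0]])
  ultimately have "(\<lambda>v. fd (lam j) 0 v $ i) = (\<lambda>v. (om (j 0) (fd (\<lambda>x. fd j x (axis i 1)) 0 v) + om (fd j 0 v) (fd j 0 (axis i 1))) / 2)"
    unfolding lam_def vec_lambda_beta by (rule has_derivative_unique[rotated])
  from fun_cong[OF this, of v] show ?thesis by (simp add: j(3) om_simps)
qed

lemma nfK_diff: "nfK (\<lambda>w. c w - c' w) x = nfK c x - nfK c' x"
  by (simp add: nfK_def vec3_eq_iff algebra_simps)

end

section \<open>Equivalence of germs from primitives\<close>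

context symplectic_coords
begin

text \<open>The primitive differs from its linear part by \<open>O(|x|^2)\<close>, that is by
  \<open>O(t^6)\<close> along \<open>g2\<close>, and the linear part depends only on the Gram matrix
  of the tangent vectors. Order 6 is enough for \<open>nfK_vanish\<close> to identify the
  coefficients of weight 7, 8 and 9.\<close>

lemma gram:
  assumes c: "cohom r (lam j) (nfK c)" and r: "r > 0" and j: "smooth_on (ball 0 r) j" "j 0 = 0"
  shows "om (fd j 0 (axis 1 1)) (fd j 0 (axis 3 1)) = 7 * c 7"
    and "om (fd j 0 (axis 2 1)) (fd j 0 (axis 3 1)) = 8 * c 8"
    and "om (fd j 0 (axis 1 1)) (fd j 0 (axis 2 1)) = 9 * c 9"
proof -
  define w where "w a b = om (fd j 0 (axis a 1)) (fd j 0 (axis b 1))" for a b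
  have w_swap: "w b a = - w a b" for a b
    unfolding w_def by (rule om_swap)
  have w_self: "w a a = 0" for a by (simp add: w_def)
  \<comment> \<open>The division by the weights reflects Cartan's formula: the exterior derivative
    of the Euler contraction of a form of weight \<open>w\<close> is \<open>w\<close> times the
    form.\<close>
  define c' where "c' = (\<lambda>_::nat. 0::real)(7 := w 1 3 / 7, 8 := w 2 3 / 8, 9 := w 1 2 / 9)"
  obtain S where S: "smooth_on (ball 0 r) S" "\<And>x. x \<in> ball 0 r \<inter> C7 \<Longrightarrow> lam j x - nfK c x = grad S x"
    using c unfolding cohom_def by blast
  \<comment> \<open>The linear part \<open>L\<close> is a contraction with the radial field.
    \<open>Q\<close> is the quadratic function whose gradient converts it into the contraction with
    the weighted Euler field.\<close>
  define q1 q2 q3 where "q1 = w 1 2 / 18" and "q2 = w 1 3 / 14" and "q3 = w 2 3 / 8"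
  define Q where "Q x = q1 * x$1 * x$2 - q2 * x$1 * x$3 - q3 * x$2 * x$3" for x :: "real^3"
  have Q': "(Q has_derivative (\<lambda>v. (q1 * x$2 - q2 * x$3) * v$1 + (q1 * x$1 - q3 * x$3) * v$2
      + (- q2 * x$1 - q3 * x$2) * v$3)) (at x)" for x
    unfolding Q_def by (auto intro!: derivative_eq_intros simp: algebra_simps)
  have Qs: "smooth_on U Q" if "open U" for U unfolding Q_def by (intro smooth_intros that)
  define L where "L x = (\<chi> i. om (fd j 0 x) (fd j 0 (axis i 1)) / 2)" for x
  have L: "L x = nfK c' x + grad Q x" for x
  proof -
    have "fd j 0 x = (\<Sum>i\<in>UNIV. x $ i *\<^sub>R fd j 0 (axis i 1))"
      by (rule fd_axis_expand[OF smooth_on_differentiable[OF j(1)]]) (use r in simp)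
    then have "om (fd j 0 x) (fd j 0 (axis i 1)) = x$1 * w 1 i + x$2 * w 2 i + x$3 * w 3 i" for i
      by (simp add: sum_3 om_simps w_def)
    then show ?thesis
      using w_swap[of 1 2] w_swap[of 1 3] w_swap[of 2 3] w_self
      by (simp add: L_def vec3_eq_iff nfK_def c'_def fd_eq[OF Q'] axis_def q1_def q2_def q3_def field_simps)
  qed
  have lin: "bounded_linear L"
  proof -
    have l: "linear (fd j 0)" using linear_fd[OF j(1)] r by simp
    have "linear L" unfolding L_def
      by (rule linearI) (simp_all add: linear_add[OF l] linear_scale[OF l] vec_eq_iff om_simps add_divide_distrib)
    then show ?thesis by (simp add: linear_conv_bounded_linear)
  qed
  define \<beta> where "\<beta> x = lam j x - L x" for x
  have \<beta>s: "smooth_on (ball 0 r) \<beta>"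
    unfolding \<beta>_def by (intro smooth_on_diff open_ball smooth_on_lam j smooth_on_bounded_linear lin)
  have \<beta>': "fd \<beta> 0 v = 0" for v
  proof -
    have "((\<lambda>x. lam j x - L x) has_derivative (\<lambda>v. fd (lam j) 0 v - L v)) (at 0)"
      using r by (intro has_derivative_diff smooth_on_has_derivative[OF smooth_on_lam[OF open_ball j(1)]]
          bounded_linear_imp_has_derivative lin) auto
    from fd_eq[OF this] show ?thesis
      unfolding \<beta>_def by (simp add: vec_eq_iff fd_lam_0[OF j(1) r j(2)] L_def)
  qed
  have "L 0 = 0" using lin by (simp add: linear_0 linear_conv_bounded_linear)
  then have "\<beta> 0 = 0" by (simp add: \<beta>_def lam_def j(2) vec_eq_iff om_simps)
  then obtain C where C: "\<And>x. norm x \<le> r / 2 \<Longrightarrow> norm (\<beta> x) \<le> C * norm x ^ 2"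
    using taylor2[OF \<beta>s r _ \<beta>'] by blast
  have b: "jet 6 (\<lambda>t. \<beta> (g2 t) $ i) 0" for i
    using jet_zero_of_bound(2)[of "r/2" \<beta> C 2] C r by simp
  have eq: "nfK (\<lambda>w. c w - c' w) (g2 t) = grad (\<lambda>x. Q x + - S x) (g2 t) + \<beta> (g2 t)" if "\<bar>t\<bar> < min 1 (r / 3)" for t
  proof -
    have x: "g2 t \<in> ball 0 r" "g2 t \<in> C7" using norm_g2_less[OF r that] by (auto simp: C7_def)
    have "grad (\<lambda>x. Q x + - S x) (g2 t) = grad Q (g2 t) - grad S (g2 t)"
      using fd_eq[OF has_derivative_add[OF Q' has_derivative_minus[OF smooth_on_has_derivative[OF S(1) x(1)]]]] fd_eq[OF Q']
      by (simp add: vec_eq_iff)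
    then show ?thesis
      using S(2)[of "g2 t"] x L[of "g2 t"] by (simp add: nfK_diff \<beta>_def algebra_simps)
  qed
  have QS: "smooth_on (ball 0 r) (\<lambda>x. Q x + - S x)" by (intro smooth_on_add smooth_on_minus open_ball Qs S)
  have d0: "min 1 (r / 3) > 0" using r by simp
  have "c 7 - c' 7 = 0" "c 8 - c' 8 = 0" "c 9 - c' 9 = 0"
    using nfK_vanish[OF QS r d0 eq b] by auto
  then show "om (fd j 0 (axis 1 1)) (fd j 0 (axis 3 1)) = 7 * c 7"
    "om (fd j 0 (axis 2 1)) (fd j 0 (axis 3 1)) = 8 * c 8"
    "om (fd j 0 (axis 1 1)) (fd j 0 (axis 2 1)) = 9 * c 9"
    by (simp_all add: c'_def w_def)
qed

section \<open>Symplectomorphism germs\<close>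

lemma diffeo_germ_inv_fd:
  fixes f :: "real^'k \<Rightarrow> real^'k"
  assumes f: "diffeo_germ U f" and x: "x \<in> U"
  shows "fd (inv_into U f) (f x) (fd f x v) = v" "fd f x (fd (inv_into U f) (f x) w) = w"
proof -
  have U: "open U" "inj_on f U" "open (f ` U)" "smooth_on U f" "smooth_on (f ` U) (inv_into U f)"
    using f by (auto simp: diffeo_germ_def)
  have d: "(f has_derivative fd f x) (at x)" "(inv_into U f has_derivative fd (inv_into U f) (f x)) (at (f x))"
    using smooth_on_has_derivative U(4,5) x by blast+
  have "((\<lambda>y. inv_into U f (f y)) has_derivative (\<lambda>v. fd (inv_into U f) (f x) (fd f x v))) (at x)"
    by (rule has_derivative_compose[OF d])
  then have "((\<lambda>y. y) has_derivative (\<lambda>v. fd (inv_into U f) (f x) (fd f x v))) (at x)"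
    by (rule has_derivative_transform_within_open[OF _ U(1) x]) (use U(2) in simp)
  then have "(\<lambda>v. fd (inv_into U f) (f x) (fd f x v)) = (\<lambda>v. v)"
    by (rule has_derivative_unique[OF _ has_derivative_ident])
  then show a: "fd (inv_into U f) (f x) (fd f x v) = v" for v by metis
  have lin: "linear (fd f x)" "linear (fd (inv_into U f) (f x))"
    using linear_fd U(4,5) x by blast+
  have "inj (fd f x)" using a by (metis injI)
  then have "surj (fd f x)" using lin(1) linear_injective_imp_surjective by blast
  then obtain v where "w = fd f x v" by blast
  then show "fd f x (fd (inv_into U f) (f x) w) = w" using a by simp
qed

lemma symplecto_germ_inv:
  assumes "symplecto_germ e U f"
  shows "symplecto_germ e (f ` U) (inv_into U f)"
proof -
  have f: "diffeo_germ U f" and s: "\<And>x u v. x \<in> U \<Longrightarrow> om (fd f x u) (fd f x v) = om u v"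
    using assms by (auto simp: symplecto_germ_def)
  have "om (fd (inv_into U f) (f x) u) (fd (inv_into U f) (f x) v) = om u v" if "x \<in> U" for x u v
    using s[OF that, of "fd (inv_into U f) (f x) u" "fd (inv_into U f) (f x) v"] diffeo_germ_inv_fd(2)[OF f that] by simp
  then show ?thesis using diffeo_germ_inv[OF f] by (auto simp: symplecto_germ_def)
qed

lemma symplecto_germ_shrink:
  assumes "symplecto_germ e U f" "open V" "0 \<in> V"
  shows "symplecto_germ e (U \<inter> V) f"
  using assms diffeo_germ_shrink by (auto simp: symplecto_germ_def)

lemma symplecto_germ_compose:
  assumes f: "symplecto_germ e U f" and g: "symplecto_germ e V g" and UV: "f ` U \<subseteq> V"
  shows "symplecto_germ e U (\<lambda>x. g (f x))"
proof -
  have d: "diffeo_germ U f" "diffeo_germ V g" using f g by (auto simp: symplecto_germ_def)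
  have "fd (\<lambda>x. g (f x)) x v = fd g (f x) (fd f x v)" if "x \<in> U" for x v
  proof -
    have "f x \<in> V" using that UV by blast
    then have "((\<lambda>x. g (f x)) has_derivative (\<lambda>v. fd g (f x) (fd f x v))) (at x)"
      using d that by (intro has_derivative_compose[OF smooth_on_has_derivative smooth_on_has_derivative]) (auto simp: diffeo_germ_def)
    then show ?thesis by (simp add: fd_eq)
  qed
  then show ?thesis
    using diffeo_germ_compose[OF d UV] f g UV by (auto simp: symplecto_germ_def image_subset_iff)
qed

lemma symplecto_germ_linear:
  assumes T: "linear T" "\<And>x y. om (T x) (T y) = om x y"
  shows "symplecto_germ e UNIV T"
proof -
  have inj: "inj T" by (rule symplectic_inj[OF T])
  have surj: "surj T" using inj T(1) linear_injective_imp_surjective by blast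
  have bl: "bounded_linear T" using T(1) by (simp add: linear_conv_bounded_linear)
  have "linear (inv T)" by (rule inj_linear_imp_inv_linear[OF T(1) inj])
  then have "smooth_on UNIV (inv T)" by (simp add: smooth_on_bounded_linear linear_conv_bounded_linear)
  then show ?thesis
    using inj surj bl T linear_0[OF T(1)] fd_eq[OF bounded_linear_imp_has_derivative[OF bl]]
    by (simp add: symplecto_germ_def diffeo_germ_def smooth_on_bounded_linear)
qed

end

lemma zero_of_linear_bound:
  fixes a :: "'a::real_normed_vector"
  assumes "d > 0" "\<And>t::real. 0 < t \<Longrightarrow> t < d \<Longrightarrow> norm a \<le> C * t"
  shows "a = 0"
proof (rule ccontr)
  assume "a \<noteq> 0"
  then have a: "norm a > 0" by simp
  define t where "t = min (d / 2) (norm a / (2 * (\<bar>C\<bar> + 1)))"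
  have t: "0 < t" "t < d" using assms(1) a by (auto simp: t_def)
  have "C * t \<le> (\<bar>C\<bar> + 1) * t" using t by (intro mult_right_mono) auto
  also have "\<dots> \<le> (\<bar>C\<bar> + 1) * (norm a / (2 * (\<bar>C\<bar> + 1)))" by (intro mult_left_mono) (auto simp: t_def)
  also have "\<dots> = norm a / 2" by (simp add: field_simps)
  finally show False using assms(2)[OF t] a by simp
qed

text \<open>The curve spans the tangent space to first order, so a linear part can be read off on it.\<close>
lemma flat_on_C7:
  fixes v :: "real^3 \<Rightarrow> 'b::real_normed_vector"
  assumes v: "smooth_on (ball 0 r) v" "r > 0" and b: "\<And>x. x \<in> C7 \<Longrightarrow> norm x < d \<Longrightarrow> norm (v x) \<le> C * norm x ^ 2" "d > 0"
  shows "v 0 = 0" "fd v 0 w = 0"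
proof -
  have "0 \<in> C7" unfolding C7_def using rangeI[of g1 0] by (simp add: g1_def vec3_eq_iff)
  from b(1)[OF this] b(2) show v0: "v 0 = 0" by simp
  define L where "L = fd v 0"
  have L: "linear L" unfolding L_def by (rule linear_fd[OF v(1)]) (use v(2) in simp)
  have bl: "bounded_linear L" using L by (simp add: linear_conv_bounded_linear)
  have "smooth_on (ball 0 r) (\<lambda>x. v x - L x)"
    by (intro smooth_on_diff open_ball v smooth_on_bounded_linear bl)
  moreover have "fd (\<lambda>x. v x - L x) 0 = (\<lambda>w. L w - L w)"
    unfolding L_def[symmetric]
    by (rule fd_eq, intro has_derivative_diff bounded_linear_imp_has_derivative[OF bl])
      (use smooth_on_has_derivative[OF v(1)] v(2) in \<open>auto simp: L_def\<close>)
  ultimately obtain C' where C': "C' \<ge> 0" "\<And>x. norm x \<le> r / 2 \<Longrightarrow> norm (v x - L x) \<le> C' * norm x ^ 2"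
    using taylor2[of r "\<lambda>x. v x - L x"] v(2) v0 linear_0[OF L] by auto
  define B where "B = \<bar>C\<bar> + C'"
  have B: "norm (L x) \<le> B * norm x ^ 2" if "x \<in> C7" "norm x < min d (r / 2)" for x
  proof -
    have "norm (L x) \<le> norm (v x) + norm (v x - L x)" by (metis norm_triangle_sub norm_minus_commute)
    also have "\<dots> \<le> C * norm x ^ 2 + C' * norm x ^ 2" using b(1) C'(2) that by (intro add_mono) auto
    also have "\<dots> \<le> B * norm x ^ 2" unfolding B_def distrib_right by (intro add_right_mono mult_right_mono) auto
    finally show ?thesis .
  qed
  have B0: "B \<ge> 0" using C'(1) by (simp add: B_def)
  define q where "q = min d (r / 2)"
  have q: "q > 0" using b(2) v(2) by (simp add: q_def)
  have La: "L x = x$1 *\<^sub>R L (axis 1 1) + x$2 *\<^sub>R L (axis 2 1) + x$3 *\<^sub>R L (axis 3 1)" for x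
  proof -
    have "L x = L (\<Sum>i\<in>UNIV. x $ i *\<^sub>R axis i 1)" by (metis vec_sum_axis)
    then show ?thesis by (simp add: linear_add[OF L] linear_scale[OF L] sum_3)
  qed
  have L2: "L (axis 2 1) = 0"
  proof (rule zero_of_linear_bound[OF q, of _ B])
    fix t :: real assume t: "0 < t" "t < q"
    have "g1 t \<in> C7" by (simp add: C7_def)
    from B[OF this] t have "norm (t *\<^sub>R L (axis 2 1)) \<le> B * t ^ 2"
      by (simp add: La[of "g1 t"] q_def)
    then show "norm (L (axis 2 1)) \<le> B * t" using t by (simp add: power2_eq_square)
  qed
  define q' where "q' = min 1 (q / 3)"
  have q': "q' > 0" using q by (simp add: q'_def)
  \<comment> \<open>On \<open>g2\<close> the third coordinate dominates the first, so
    \<open>L (axis 3 1)\<close> is shown to vanish before \<open>L (axis 1 1)\<close>. Both powers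
    \<open>t^3\<close> and \<open>t^4\<close> dominate the error \<open>t^6\<close>.\<close>
  have g2b: "norm (t^4 *\<^sub>R L (axis 1 1) - t^3 *\<^sub>R L (axis 3 1)) \<le> 9 * B * t ^ 6" if t: "0 < t" "t < q'" for t
  proof -
    have "g2 t \<in> C7" by (simp add: C7_def)
    moreover have "norm (g2 t) < q" using t q by (intro norm_g2_less) (auto simp: q'_def)
    ultimately have "norm (L (g2 t)) \<le> B * norm (g2 t) ^ 2" using B q_def by blast
    also have "\<dots> \<le> B * (3 * \<bar>t\<bar>^3) ^ 2"
      using t by (intro mult_left_mono power_mono norm_g2_le B0) (auto simp: q'_def)
    also have "\<dots> = 9 * B * t ^ 6" using t by (simp add: power_mult_distrib flip: power_mult)
    finally show ?thesis by (simp add: La[of "g2 t"] L2)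
  qed
  have L3: "L (axis 3 1) = 0"
  proof (rule zero_of_linear_bound[OF q', of _ "norm (L (axis 1 1)) + 9 * B"])
    fix t assume t: "0 < t" "t < q'"
    have "norm (t^3 *\<^sub>R L (axis 3 1)) \<le> norm (t^4 *\<^sub>R L (axis 1 1)) + norm (t^4 *\<^sub>R L (axis 1 1) - t^3 *\<^sub>R L (axis 3 1))"
      by (metis norm_minus_commute norm_triangle_sub add.commute)
    also have "\<dots> \<le> t^4 * norm (L (axis 1 1)) + 9 * B * t ^ 6" using g2b[OF t] t by simp
    also have "\<dots> \<le> t^4 * norm (L (axis 1 1)) + 9 * B * t ^ 4"
      using power_decreasing[of 4 6 t] t B0 by (intro add_left_mono mult_left_mono) (auto simp: q'_def)
    finally have "t^3 * norm (L (axis 3 1)) \<le> t^3 * ((norm (L (axis 1 1)) + 9 * B) * t)"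
      using t by (simp add: algebra_simps power_numeral_reduce)
    then show "norm (L (axis 3 1)) \<le> (norm (L (axis 1 1)) + 9 * B) * t" using t by simp
  qed
  have L1: "L (axis 1 1) = 0"
  proof (rule zero_of_linear_bound[OF q', of _ "9 * B"])
    fix t assume t: "0 < t" "t < q'"
    have "t^4 * norm (L (axis 1 1)) \<le> 9 * B * t ^ 6" using g2b[OF t] L3 t by simp
    also have "\<dots> \<le> 9 * B * t ^ 5" using power_decreasing[of 5 6 t] t B0 by (intro mult_left_mono) (auto simp: q'_def)
    finally have "t^4 * norm (L (axis 1 1)) \<le> t^4 * (9 * B * t)" by (simp add: algebra_simps power_numeral_reduce)
    then show "norm (L (axis 1 1)) \<le> 9 * B * t" using t by simp
  qed
  show "fd v 0 w = 0" using La[of w] L1 L2 L3 by (simp add: L_def)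
qed

lemma has_derivative_zero_bilinear:
  assumes P: "bounded_bilinear P" and f: "(f has_derivative f') (at x)" and g: "(g has_derivative g') (at x)"
    and z: "\<And>v. P (f x) (g' v) = 0" "\<And>v. P (f' v) (g x) = 0"
  shows "((\<lambda>x. P (f x) (g x)) has_derivative (\<lambda>v. 0)) (at x)"
  using bounded_bilinear.FDERIV[OF P f g] by (simp add: z)

context symplectic_coords
begin

text \<open>
  The midpoint form of a generating function: \<open>dS\<close> defines the symplectic map
  \<open>u - G u \<mapsto> u + G u\<close>, where \<open>2 G u\<close> is the Hamiltonian vector of \<open>S\<close> at \<open>u\<close>.
\<close>
lemma symplecto_of_generating_function:
  assumes S: "smooth_on V S" and V: "open V" "0 \<in> V"
    and G: "\<And>u v. u \<in> V \<Longrightarrow> om (G u) v = fd S u v / 2" "smooth_on V G"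
    and G0: "G 0 = 0" "\<And>v. fd G 0 v = 0"
  shows "\<exists>U \<Psi> W. symplecto_germ e U \<Psi> \<and> open W \<and> 0 \<in> W \<and> W \<subseteq> V \<and>
    (\<forall>u\<in>W. u - G u \<in> U \<and> \<Psi> (u - G u) = u + G u)"
proof -
  have sm: "smooth_on V (\<lambda>u. u - G u)" "smooth_on V (\<lambda>u. u + G u)"
    by (intro smooth_on_diff smooth_on_add smooth_on_ident V G)+
  have G': "(G has_derivative fd G u) (at u)" if "u \<in> V" for u
    by (rule smooth_on_has_derivative[OF G(2) that])
  have fdm: "fd (\<lambda>u. u - G u) u = (\<lambda>v. v - fd G u v)" and fdp: "fd (\<lambda>u. u + G u) u = (\<lambda>v. v + fd G u v)"
    if "u \<in> V" for u
    by (rule fd_eq, intro has_derivative_diff has_derivative_add has_derivative_ident G' that)+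
  have "inj (fd (\<lambda>u. u - G u) 0)" "inj (fd (\<lambda>u. u + G u) 0)"
    unfolding fdm[OF V(2)] fdp[OF V(2)] by (simp_all add: G0)
  then obtain U1 U2 where U1: "U1 \<subseteq> V" "diffeo_germ U1 (\<lambda>u. u - G u)" and U2: "U2 \<subseteq> V" "diffeo_germ U2 (\<lambda>u. u + G u)"
    using diffeo_germI[OF V sm(1)] diffeo_germI[OF V sm(2)] G0 by (metis (no_types, lifting) add_0 diff_0_right)
  define W where "W = U1 \<inter> U2"
  have o: "open U1" "0 \<in> U1" "open U2" "0 \<in> U2" using U1 U2 by (auto simp: diffeo_germ_def)
  have W1: "diffeo_germ W (\<lambda>u. u - G u)" unfolding W_def by (rule diffeo_germ_shrink[OF U1(2) o(3,4)])
  have W2: "diffeo_germ W (\<lambda>u. u + G u)" unfolding W_def using diffeo_germ_shrink[OF U2(2) o(1,2)] by (simp add: Int_commute)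
  have WV: "W \<subseteq> V" and oW: "open W" "0 \<in> W" using U1(1) o by (auto simp: W_def)
  have inj: "inj_on (\<lambda>u. u - G u) W" using W1 by (simp add: diffeo_germ_def)
  let ?A = "\<lambda>u. u - G u" and ?B = "\<lambda>u. u + G u"
  let ?i = "inv_into W ?A"
  have i: "diffeo_germ (?A ` W) ?i" by (rule diffeo_germ_inv[OF W1])
  have "?i ` ?A ` W \<subseteq> W" using inj by auto
  then have D: "diffeo_germ (?A ` W) (\<lambda>z. ?B (?i z))" by (rule diffeo_germ_compose[OF i W2])
  have "om (fd (\<lambda>z. ?B (?i z)) z a) (fd (\<lambda>z. ?B (?i z)) z b) = om a b" if "z \<in> ?A ` W" for z a b
  proof -
    obtain u where u: "u \<in> W" "z = ?A u" using \<open>z \<in> ?A ` W\<close> by blast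
    have uV: "u \<in> V" using u WV by blast
    have iz: "?i z = u" using inv_into_f_f[OF inj u(1)] u(2) by simp
    have "(?i has_derivative fd ?i z) (at z)"
      using i \<open>z \<in> ?A ` W\<close> by (intro smooth_on_has_derivative) (auto simp: diffeo_germ_def)
    moreover have "(?B has_derivative fd ?B u) (at (?i z))"
      unfolding iz using W2 u(1) by (intro smooth_on_has_derivative) (auto simp: diffeo_germ_def)
    ultimately have "((\<lambda>z. ?B (?i z)) has_derivative (\<lambda>v. fd ?B u (fd ?i z v))) (at z)"
      by (rule has_derivative_compose)
    then have f: "fd (\<lambda>z. ?B (?i z)) z v = fd ?i z v + fd G u (fd ?i z v)" for v
      by (simp add: fd_eq fdp[OF uV])
    have b: "v = fd ?i z v - fd G u (fd ?i z v)" for v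
      using diffeo_germ_inv_fd(2)[OF W1 u(1), of v] by (simp add: fdm[OF uV] u(2))
    \<comment> \<open>Symmetry of the second derivatives of \<open>S\<close> makes
      \<open>fd G u\<close> infinitesimally symplectic. The derivative of the map is its Cayley
      transform, hence symplectic.\<close>
    have sym: "om (fd G u x) y = om (fd G u y) x" for x y
    proof -
      have e: "om (fd G u x) y = fd (\<lambda>u. fd S u y / 2) u x" for x y
      proof -
        have "((\<lambda>u. om (G u) y) has_derivative (\<lambda>x. om (fd G u x) y)) (at u)"
          by (rule bounded_linear.has_derivative[OF bounded_bilinear.bounded_linear_left[OF om_bilinear] G'[OF uV]])
        then have "((\<lambda>u. fd S u y / 2) has_derivative (\<lambda>x. om (fd G u x) y)) (at u)"
          by (rule has_derivative_transform_within_open[OF _ V(1) uV]) (simp add: G(1))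
        then show ?thesis by (simp add: fd_eq)
      qed
      have h: "fd (\<lambda>u. fd S u y / 2) u x = fd (\<lambda>u. fd S u y) u x / 2" for x y
        by (rule fun_cong[OF fd_eq]) (rule bounded_linear.has_derivative[OF bounded_linear_divide smooth_on_has_derivative[OF smooth_on_fd[OF S] uV]])
      show ?thesis unfolding e h using symmetric_second_fd[OF V(1) uV S, of y x] by simp
    qed
    define a' b' where "a' = fd ?i z a" and "b' = fd ?i z b"
    have "om (a' + fd G u a') (b' + fd G u b') = om (a' - fd G u a') (b' - fd G u b')"
      using sym[of a' b'] om_swap[of a' "fd G u b'"] by (simp add: om_simps)
    then show ?thesis using b[of a] b[of b] by (simp add: f a'_def b'_def)
  qed
  then have "symplecto_germ e (?A ` W) (\<lambda>z. ?B (?i z))" using D by (simp add: symplecto_germ_def)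
  moreover have "?i (?A u) = u" if "u \<in> W" for u using inv_into_f_f[OF inj that] .
  ultimately show ?thesis using oW WV by (intro exI[of _ "?A ` W"] exI[of _ "\<lambda>z. ?B (?i z)"] exI[of _ W]) auto
qed

text \<open>Following \<open>m\<close> by a linear left inverse of \<open>fd m 0\<close> gives a map
  of R^3 whose derivative at 0 is the identity; its local inverse composed with the linear map is
  the required \<open>\<rho>\<close>.\<close>

lemma local_left_inverse:
  fixes m :: "real^3 \<Rightarrow> real^'m"
  assumes m: "smooth_on (ball 0 r) m" "r > 0" "m 0 = 0" and inj: "inj (fd m 0)"
  obtains V \<rho> s where "open V" "0 \<in> V" "smooth_on V \<rho>" "\<rho> ` V \<subseteq> ball 0 r" "\<rho> 0 = 0" "s > 0" "s \<le> r"
    "\<And>x. norm x < s \<Longrightarrow> m x \<in> V \<and> \<rho> (m x) = x"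
proof -
  have 0: "0 \<in> ball (0::real^3) r" using m(2) by simp
  obtain Q where Q: "linear Q" "Q \<circ> fd m 0 = id"
    using linear_injective_left_inverse[OF linear_fd[OF m(1) 0] inj] by blast
  have bl: "bounded_linear Q" using Q(1) by (simp add: linear_conv_bounded_linear)
  let ?F = "\<lambda>x. Q (m x)"
  have F: "smooth_on (ball 0 r) ?F" by (rule smooth_on_bounded_linear_compose[OF bl open_ball m(1)])
  have "fd ?F 0 = (\<lambda>v. Q (fd m 0 v))"
    by (rule fd_eq[OF bounded_linear.has_derivative[OF bl smooth_on_has_derivative[OF m(1) 0]]])
  then have "fd ?F 0 = id" using Q(2) by (simp add: fun_eq_iff o_def)
  then obtain U where U: "U \<subseteq> ball 0 r" "diffeo_germ U ?F"
    using diffeo_germI[OF open_ball 0 F] m(3) linear_0[OF Q(1)] by (metis inj_on_id)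
  have U': "open U" "0 \<in> U" "inj_on ?F U" "open (?F ` U)" "smooth_on (?F ` U) (inv_into U ?F)"
    using U(2) by (auto simp: diffeo_germ_def)
  obtain s where s: "s > 0" "ball 0 s \<subseteq> U" using U'(1,2) open_contains_ball by blast
  define V where "V = Q -` (?F ` U)"
  have oV: "open V" unfolding V_def by (rule open_vimage[OF U'(4)]) (rule linear_continuous_on[OF bl])
  have F0: "?F 0 = 0" using m(3) linear_0[OF Q(1)] by simp
  show thesis
  proof (rule that[of V "\<lambda>u. inv_into U ?F (Q u)" "min s r"])
    show "open V" by fact
    show "0 \<in> V" using U'(2) F0 linear_0[OF Q(1)] unfolding V_def by force
    show "smooth_on V (\<lambda>u. inv_into U ?F (Q u))"
      by (rule smooth_on_compose[OF oV U'(4,5) smooth_on_bounded_linear[OF bl]]) (auto simp: V_def)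
    show "(\<lambda>u. inv_into U ?F (Q u)) ` V \<subseteq> ball 0 r"
    proof (rule image_subsetI)
      fix u assume "u \<in> V"
      then have "inv_into U ?F (Q u) \<in> U" by (intro inv_into_into) (simp add: V_def)
      then show "inv_into U ?F (Q u) \<in> ball 0 r" using U(1) by blast
    qed
    have "inv_into U ?F (?F 0) = 0" by (rule inv_into_f_f[OF U'(3,2)])
    then show "inv_into U ?F (Q 0) = 0" using m(3) by simp
    show "m x \<in> V \<and> inv_into U ?F (Q (m x)) = x" if "norm x < min s r" for x
    proof -
      have "x \<in> U" using that s(2) by auto
      then show ?thesis using inv_into_f_f[OF U'(3)] by (auto simp: V_def)
    qed
  qed (use s m(2) in auto)
qed

text \<open>By \<open>symplecto_of_generating_function\<close> it suffices to find \<open>S\<close>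
  whose derivative at the midpoint \<open>m x\<close> of \<open>j0 x\<close> and \<open>j1 x\<close>
  is \<open>om (j1 x - j0 x)\<close>, for \<open>x\<close> on the curve. In the directions tangent
  to the image of \<open>m\<close> this is possible because the primitives differ by a gradient; in
  the transversal directions it is imposed by a linear correction. Equality of the tangent maps
  makes \<open>S\<close> so flat at 0 that both maps \<open>u - G u\<close> and
  \<open>u + G u\<close> have identity derivative there.\<close>

lemma symplecto_of_cohom_tangent:
  assumes j0: "smooth_on (ball 0 r) j0" "j0 0 = 0" and j1: "smooth_on (ball 0 r) j1" "j1 0 = 0" and r: "r > 0"
    and D: "fd j0 0 = fd j1 0" "inj (fd j0 0)"
    and c: "cohom r (lam j1) (lam j0)"
  obtains U \<Psi> s where "symplecto_germ e U \<Psi>" "s > 0"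
    "\<And>x. x \<in> C7 \<Longrightarrow> norm x < s \<Longrightarrow> j0 x \<in> U \<and> \<Psi> (j0 x) = j1 x"
proof -
  have 0: "0 \<in> ball (0::real^3) r" using r by simp
  define m where "m x = (1/2) *\<^sub>R (j0 x + j1 x)" for x
  have ms: "smooth_on (ball 0 r) m"
    unfolding m_def by (intro smooth_on_scaleR smooth_on_add open_ball j0 j1 smooth_on_const)
  have m': "fd m x v = (1/2) *\<^sub>R (fd j0 x v + fd j1 x v)" if "x \<in> ball 0 r" for x v
    unfolding m_def
    by (rule fun_cong[OF fd_eq]) (intro has_derivative_scaleR_right has_derivative_add smooth_on_has_derivative[OF j0(1) that] smooth_on_has_derivative[OF j1(1) that])
  have "fd m 0 = fd j0 0" using m'[OF 0] D(1) by (simp add: fun_eq_iff flip: scaleR_2)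
  moreover have m0: "m 0 = 0" by (simp add: m_def j0 j1)
  ultimately obtain V \<rho> s0 where V: "open V" "0 \<in> V" "smooth_on V \<rho>" "\<rho> ` V \<subseteq> ball 0 r" "\<rho> 0 = 0" "s0 > 0" "s0 \<le> r"
    "\<And>x. norm x < s0 \<Longrightarrow> m x \<in> V \<and> \<rho> (m x) = x"
    using local_left_inverse[OF ms r] D(2) by metis
  obtain S0 where S0: "smooth_on (ball 0 r) S0" "\<And>x. x \<in> ball 0 r \<inter> C7 \<Longrightarrow> lam j1 x - lam j0 x = grad S0 x"
    using c unfolding cohom_def by blast
  define om10 where "om10 x = om (j1 x) (j0 x) / 2" for x
  have om10: "smooth_on (ball 0 r) om10"
    unfolding om10_def by (intro smooth_on_divide_const smooth_on_om open_ball j0 j1)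
  define s where "s x = S0 x + om10 x" for x
  have ss: "smooth_on (ball 0 r) s" unfolding s_def by (intro smooth_on_add open_ball S0 om10)
  \<comment> \<open>The gradient relating the primitives and the boundary term of
    \<open>lam_diff\<close> add up to the prescribed derivative along the midpoints.\<close>
  have s': "fd s x (axis i 1) = om (j1 x - j0 x) (fd m x (axis i 1))" if "x \<in> ball 0 r" "x \<in> C7" for x i
  proof -
    have "grad s x = grad S0 x + grad om10 x"
      unfolding s_def using grad_add[OF S0(1) om10 that(1)] .
    also have "\<dots> = (\<chi> i. om (j1 x - j0 x) (fd j1 x (axis i 1) + fd j0 x (axis i 1)) / 2)"
      using S0(2)[of x] that lam_diff[OF j1(1) j0(1) that(1)] unfolding om10_def by (simp add: algebra_simps)
    finally show ?thesis by (simp add: vec_eq_iff m'[OF that(1)] om_simps add.commute)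
  qed
  define b where "b x = Jm (j1 x - j0 x)" for x
  have blJ: "bounded_linear Jm" using linear_Jm by (simp add: linear_conv_bounded_linear)
  have bs: "smooth_on (ball 0 r) b"
    unfolding b_def by (intro smooth_on_bounded_linear_compose[OF blJ] smooth_on_diff open_ball j0 j1)
  have b0: "b 0 = 0" by (simp add: b_def j0 j1 linear_0[OF linear_Jm])
  have b': "fd b 0 v = 0" for v
  proof -
    have "(b has_derivative (\<lambda>v. Jm (fd j1 0 v - fd j0 0 v))) (at 0)"
      unfolding b_def by (intro bounded_linear.has_derivative[OF blJ] has_derivative_diff
          smooth_on_has_derivative[OF j0(1) 0] smooth_on_has_derivative[OF j1(1) 0])
    from fd_eq[OF this] show ?thesis by (simp add: D(1) linear_0[OF linear_Jm])
  qed
  have bq: "b x \<bullet> v = om (j1 x - j0 x) v" for x v by (simp add: b_def om_eq_inner)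
  \<comment> \<open>The derivative of \<open>s\<close> is controlled only on the curve, where it is
    \<open>O(|x|^2)\<close>. By \<open>flat_on_C7\<close> this already forces its value and first
    derivative at 0 to vanish.\<close>
  have grad_s_flat: "fd s 0 (axis i 1) = 0" "fd (\<lambda>x. fd s x (axis i 1)) 0 w = 0" for i w
  proof -
    have js: "smooth_on (ball 0 r) (\<lambda>x. j1 x - j0 x)" by (intro smooth_on_diff open_ball j0 j1)
    have "fd (\<lambda>x. j1 x - j0 x) 0 v = 0" for v
      using fd_eq[OF has_derivative_diff[OF smooth_on_has_derivative[OF j1(1) 0] smooth_on_has_derivative[OF j0(1) 0]]] D(1) by simp
    then obtain A where A: "A \<ge> 0" "\<And>x. norm x \<le> r / 2 \<Longrightarrow> norm (j1 x - j0 x) \<le> A * norm x ^ 2"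
      using taylor2[OF js r] j0 j1 by (metis diff_self)
    obtain B where B: "\<And>x. norm x \<le> r / 2 \<Longrightarrow> norm (fd m x (axis i 1)) \<le> B"
      using smooth_local_bound[OF smooth_on_fd[OF ms] r] by metis
    obtain K where K: "K \<ge> 0" "\<And>u v. \<bar>om u v\<bar> \<le> norm u * norm v * K"
      using bounded_bilinear.nonneg_bounded[OF om_bilinear] by auto
    have bound: "norm (fd s x (axis i 1)) \<le> (A * \<bar>B\<bar> * K) * norm x ^ 2" if "x \<in> C7" "norm x < r / 2" for x
    proof -
      have "norm (fd s x (axis i 1)) \<le> norm (j1 x - j0 x) * norm (fd m x (axis i 1)) * K"
        using s'[of x i] that r K(2) by simp
      also have "\<dots> \<le> (A * norm x ^ 2) * \<bar>B\<bar> * K"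
        using A B[of x] that K(1) by (intro mult_right_mono mult_mono) auto
      finally show ?thesis by (simp add: mult_ac)
    qed
    have r2: "r / 2 > 0" using r by simp
    show "fd s 0 (axis i 1) = 0" "fd (\<lambda>x. fd s x (axis i 1)) 0 w = 0"
      using flat_on_C7[OF smooth_on_fd[OF ss, of "axis i 1"] r bound r2] by blast+
  qed
  define P where "P u = s (\<rho> u)" for u
  define B where "B u = b (\<rho> u)" for u
  define M where "M u = u - m (\<rho> u)" for u
  \<comment> \<open>\<open>M\<close> vanishes on the image of \<open>m\<close>, so the second
    summand keeps the values of \<open>P\<close> there and prescribes the derivative in the
    transversal directions through \<open>B\<close>.\<close>
  define S where "S u = P u + B u \<bullet> M u" for u
  have Ps: "smooth_on V P" and Bs: "smooth_on V B" and Ms: "smooth_on V M"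
    unfolding P_def B_def M_def
    by (intro smooth_on_diff smooth_on_ident smooth_on_compose[OF V(1) open_ball _ V(3,4)] ss bs ms V(1))+
  have Ss: "smooth_on V S" unfolding S_def by (intro smooth_on_add smooth_on_inner Ps Bs Ms V(1))
  have S': "fd S u v = fd P u v + (B u \<bullet> fd M u v + fd B u v \<bullet> M u)" if "u \<in> V" for u v
    unfolding S_def
    by (rule fun_cong[OF fd_eq])
      (intro has_derivative_add has_derivative_inner smooth_on_has_derivative[OF Ps that]
        smooth_on_has_derivative[OF Bs that] smooth_on_has_derivative[OF Ms that])
  have \<rho>': "(\<rho> has_derivative fd \<rho> u) (at u)" if "u \<in> V" for u by (rule smooth_on_has_derivative[OF V(3) that])
  have \<rho>V: "\<rho> u \<in> ball 0 r" if "u \<in> V" for u using V(4) that by blast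
  have P': "fd P u v = (\<Sum>k\<in>UNIV. fd \<rho> u v $ k * fd s (\<rho> u) (axis k 1))" if "u \<in> V" for u v
  proof -
    have "fd P u v = fd s (\<rho> u) (fd \<rho> u v)"
      unfolding P_def by (rule fun_cong[OF fd_eq[OF has_derivative_compose[OF \<rho>'[OF that] smooth_on_has_derivative[OF ss \<rho>V[OF that]]]]])
    then show ?thesis using fd_axis_expand[OF smooth_on_differentiable[OF ss \<rho>V[OF that]], of "fd \<rho> u v"] by simp
  qed
  have B': "fd B u v = fd b (\<rho> u) (fd \<rho> u v)" if "u \<in> V" for u v
    unfolding B_def by (rule fun_cong[OF fd_eq[OF has_derivative_compose[OF \<rho>'[OF that] smooth_on_has_derivative[OF bs \<rho>V[OF that]]]]])
  have M': "fd M u v = v - fd m (\<rho> u) (fd \<rho> u v)" if "u \<in> V" for u v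
    unfolding M_def by (rule fun_cong[OF fd_eq[OF has_derivative_diff[OF has_derivative_ident
      has_derivative_compose[OF \<rho>'[OF that] smooth_on_has_derivative[OF ms \<rho>V[OF that]]]]]])
  have Z: "B 0 = 0" "fd B 0 v = 0" "M 0 = 0" for v
    using B'[OF V(2)] b' b0 m0 by (simp_all add: B_def M_def V(5))
  have S0: "fd S 0 v = 0" for v
    using S'[OF V(2), of v] P'[OF V(2), of v] by (simp add: Z V(5) grad_s_flat)
  \<comment> \<open>Of the three kinds of products in \<open>fd S\<close>, the first two contain a
    factor that vanishes at 0 together with its derivative, and in the third both factors vanish at
    0.\<close>
  have S00: "fd (\<lambda>u. fd S u v) 0 w = 0" for v w
  proof -
    have "((\<lambda>u. \<Sum>k\<in>UNIV. fd \<rho> u v $ k * fd s (\<rho> u) (axis k 1)) has_derivative (\<lambda>w. \<Sum>k\<in>(UNIV::3 set). 0)) (at 0)"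
    proof (intro has_derivative_sum has_derivative_zero_bilinear[OF bounded_bilinear_mult])
      fix k :: 3
      show "((\<lambda>u. fd \<rho> u v $ k) has_derivative (\<lambda>w. fd (\<lambda>u. fd \<rho> u v) 0 w $ k)) (at 0)"
        by (rule bounded_linear.has_derivative[OF bounded_linear_vec_nth smooth_on_has_derivative[OF smooth_on_fd[OF V(3)] V(2)]])
      have "((\<lambda>x. fd s x (axis k 1)) has_derivative fd (\<lambda>x. fd s x (axis k 1)) 0) (at (\<rho> 0))"
        unfolding V(5) by (rule smooth_on_has_derivative[OF smooth_on_fd[OF ss] 0])
      from has_derivative_compose[OF \<rho>'[OF V(2)] this]
      show "((\<lambda>u. fd s (\<rho> u) (axis k 1)) has_derivative (\<lambda>w. 0)) (at 0)"
        by (simp add: grad_s_flat)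
    qed (simp_all add: V(5) grad_s_flat)
    moreover have "((\<lambda>u. B u \<bullet> fd M u v) has_derivative (\<lambda>w. 0)) (at 0)"
      by (rule has_derivative_zero_bilinear[OF bounded_bilinear_inner smooth_on_has_derivative[OF Bs V(2)]
            smooth_on_has_derivative[OF smooth_on_fd[OF Ms] V(2)]]) (simp_all add: Z)
    moreover have "((\<lambda>u. fd B u v \<bullet> M u) has_derivative (\<lambda>w. 0)) (at 0)"
      by (rule has_derivative_zero_bilinear[OF bounded_bilinear_inner smooth_on_has_derivative[OF smooth_on_fd[OF Bs] V(2)]
            smooth_on_has_derivative[OF Ms V(2)]]) (simp_all add: Z)
    ultimately have "((\<lambda>u. (\<Sum>k\<in>UNIV. fd \<rho> u v $ k * fd s (\<rho> u) (axis k 1)) + (B u \<bullet> fd M u v + fd B u v \<bullet> M u))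
        has_derivative (\<lambda>w. (\<Sum>k\<in>(UNIV::3 set). 0) + (0 + 0))) (at 0)"
      by (intro has_derivative_add)
    then have "((\<lambda>u. fd S u v) has_derivative (\<lambda>w. (\<Sum>k\<in>(UNIV::3 set). 0) + (0 + 0))) (at 0)"
      by (rule has_derivative_transform_within_open[OF _ V(1,2)]) (simp add: S' P')
    from fd_eq[OF this] show ?thesis by simp
  qed
  obtain Gr where Gr: "linear Gr" "\<And>b v. om (Gr b) v = b \<bullet> v" using om_represent by blast
  have blG: "bounded_linear Gr" using Gr(1) by (simp add: linear_conv_bounded_linear)
  define G where "G u = Gr ((1/2) *\<^sub>R grad S u)" for u
  have gS: "grad S u \<bullet> v = fd S u v" if "u \<in> V" for u v
    using fd_axis_expand[OF smooth_on_differentiable[OF Ss that], of v] by (simp add: inner_vec_def mult.commute)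
  have G1: "om (G u) v = fd S u v / 2" if "u \<in> V" for u v
    by (simp add: G_def Gr(2) gS[OF that])
  have gs: "smooth_on V (grad S)" unfolding grad_def by (rule smooth_on_vec[OF V(1)]) (simp add: smooth_on_fd[OF Ss])
  have Gs: "smooth_on V G"
    unfolding G_def by (intro smooth_on_bounded_linear_compose[OF blG V(1)] smooth_on_scaleR V(1) smooth_on_const gs)
  have "grad S 0 = 0" by (simp add: vec_eq_iff S0)
  then have G0: "G 0 = 0" by (simp add: G_def linear_0[OF Gr(1)])
  have "fd (grad S) 0 w = 0" for w
  proof (rule vec_eq_iff[THEN iffD2], rule allI)
    fix i
    have "((\<lambda>u. grad S u $ i) has_derivative (\<lambda>w. fd (grad S) 0 w $ i)) (at 0)"
      by (rule bounded_linear.has_derivative[OF bounded_linear_vec_nth smooth_on_has_derivative[OF gs V(2)]])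
    from fun_cong[OF fd_eq[OF this], of w] show "fd (grad S) 0 w $ i = 0 $ i"
      using S00[of "axis i 1" w] by simp
  qed
  then have G00: "fd G 0 w = 0" for w
    using fd_eq[OF bounded_linear.has_derivative[OF blG has_derivative_scaleR_right[OF smooth_on_has_derivative[OF gs V(2)], of "1/2"]]]
    by (simp add: G_def[abs_def] linear_0[OF Gr(1)])
  obtain U \<Psi> W where W: "symplecto_germ e U \<Psi>" "open W" "0 \<in> W" "W \<subseteq> V"
    "\<And>u. u \<in> W \<Longrightarrow> u - G u \<in> U \<and> \<Psi> (u - G u) = u + G u"
    using symplecto_of_generating_function[OF Ss V(1,2) G1 Gs G0 G00] by blast
  have "isCont m 0" using smooth_on_continuous[OF ms] 0 by (simp add: continuous_on_eq_continuous_at)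
  moreover obtain \<epsilon> where \<epsilon>: "\<epsilon> > 0" "ball 0 \<epsilon> \<subseteq> W" using W(2,3) open_contains_ball by blast
  ultimately obtain s1 where s1: "s1 > 0" "\<And>x. norm x < s1 \<Longrightarrow> norm (m x) < \<epsilon>"
    unfolding continuous_at_eps_delta m0 by (auto simp: dist_norm)
  then have mW: "m x \<in> W" if "norm x < s1" for x using that \<epsilon>(2) by auto
  show thesis
  proof (rule that[OF W(1), of "min s0 s1"])
    show "min s0 s1 > 0" using V(6) s1(1) by simp
    fix x assume x: "x \<in> C7" "norm x < min s0 s1"
    then have xr: "x \<in> ball 0 r" using V(7) by simp
    have mx: "m x \<in> V" "\<rho> (m x) = x" "m x \<in> W" using V(8) mW x by auto
    \<comment> \<open>The contribution of \<open>P\<close> is the pairing with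
      \<open>fd m x ?w\<close>, that of \<open>B\<close> the pairing with
      \<open>v - fd m x ?w\<close>; together they give the pairing with \<open>v\<close>.\<close>
    have "om (G (m x)) v = om ((1/2) *\<^sub>R (j1 x - j0 x)) v" for v
    proof -
      let ?w = "fd \<rho> (m x) v"
      have "fd P (m x) v = (\<Sum>k\<in>UNIV. ?w $ k * om (j1 x - j0 x) (fd m x (axis k 1)))"
        by (simp add: P'[OF mx(1)] mx(2) s'[OF xr x(1)])
      also have "\<dots> = om (j1 x - j0 x) (fd m x ?w)"
        using fd_axis_expand[OF smooth_on_differentiable[OF ms xr], of ?w]
        by (simp add: bounded_bilinear.sum_right[OF om_bilinear] om_simps)
      finally have "fd S (m x) v = om (j1 x - j0 x) v"
        by (simp add: S'[OF mx(1)] B_def M'[OF mx(1)] M_def mx(2) bq om_simps)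
      then show ?thesis by (simp add: G1[OF mx(1)] om_simps)
    qed
    then have "om (G (m x) - (1/2) *\<^sub>R (j1 x - j0 x)) v = 0" for v by (simp add: om_simps)
    then have "G (m x) = (1/2) *\<^sub>R (j1 x - j0 x)" using om_nondeg by (metis eq_iff_diff_eq_0)
    then have "m x - G (m x) = j0 x" "m x + G (m x) = j1 x"
      by (simp_all add: m_def scaleR_right_distrib scaleR_right_diff_distrib flip: scaleR_2)
    then show "j0 x \<in> U \<and> \<Psi> (j0 x) = j1 x" using W(5)[OF mx(3)] by simp
  qed
qed

text \<open>Equal coefficients mean equal Gram matrices by \<open>gram\<close>, so Witt's theorem
  yields a linear symplectic \<open>T\<close> matching the tangent maps. Composition with
  \<open>T\<close> does not change the primitive, and the tangent case applies.\<close>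

lemma symplecto_of_cohom:
  assumes j0: "smooth_on (ball 0 r) j0" "j0 0 = 0" "inj (fd j0 0)" and j1: "smooth_on (ball 0 r) j1" "j1 0 = 0" "inj (fd j1 0)"
    and r: "r > 0" and c: "cohom r (lam j0) (nfK c)" "cohom r (lam j1) (nfK c)"
  shows "\<exists>U \<Psi> s. symplecto_germ e U \<Psi> \<and> s > 0 \<and>
    (\<forall>x\<in>C7. norm x < s \<longrightarrow> j0 x \<in> U \<and> \<Psi> (j0 x) = j1 x)"
proof -
  have 0: "0 \<in> ball (0::real^3) r" using r by simp
  define ix where "ix k = (if k = 0 then 1 else if k = 1 then 2 else 3 :: 3)" for k :: nat
  have ixj: "inj_on ix {..<3}" by (auto simp: inj_on_def ix_def less_Suc_eq numeral_3_eq_3)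
  have indep: "fd j 0 (axis (ix i) 1) \<notin> span ((\<lambda>i. fd j 0 (axis (ix i) 1)) ` {..<i})"
    if "linear (fd j 0)" "inj (fd j 0)" "i < 3" for j :: "real^3 \<Rightarrow> real^'m" and i
  proof
    assume a: "fd j 0 (axis (ix i) 1) \<in> span ((\<lambda>i. fd j 0 (axis (ix i) 1)) ` {..<i})"
    have "(\<lambda>i. fd j 0 (axis (ix i) 1)) ` {..<i} = fd j 0 ` (\<lambda>i. axis (ix i) 1) ` {..<i}" by (simp add: image_image)
    then have "axis (ix i) 1 \<in> span ((\<lambda>i. axis (ix i) 1 :: real^3) ` {..<i})"
      using a that(1,2) by (metis (no_types, lifting) inj_image_mem_iff linear_span_image)
    moreover have "span ((\<lambda>i. axis (ix i) 1 :: real^3) ` {..<i}) \<subseteq> {x. x $ ix i = 0}"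
    proof (rule span_minimal)
      show "subspace {x::real^3. x $ ix i = 0}" by (auto simp: subspace_def)
      show "(\<lambda>i. axis (ix i) 1 :: real^3) ` {..<i} \<subseteq> {x. x $ ix i = 0}"
      proof -
        have "ix i \<noteq> ix k" if "k < i" for k using inj_onD[OF ixj, of i k] that \<open>i < 3\<close> by auto
        then show ?thesis by (auto simp: axis_def)
      qed
    qed
    ultimately show False by (auto simp: axis_def)
  qed
  define u0 u1 where "u0 i = fd j0 0 (axis (ix i) 1)" and "u1 i = fd j1 0 (axis (ix i) 1)" for i
  have l0: "linear (fd j0 0)" and l1: "linear (fd j1 0)" using linear_fd[OF j0(1) 0] linear_fd[OF j1(1) 0] .
  have G: "om (u0 i) (u0 k) = om (u1 i) (u1 k)" if "i < 3" "k < 3" for i k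
  proof -
    note g = gram[OF c(1) r j0(1,2)] gram[OF c(2) r j1(1,2)]
    have "om (fd j0 0 (axis a 1)) (fd j0 0 (axis b 1)) = om (fd j1 0 (axis a 1)) (fd j1 0 (axis b 1))" for a b :: 3
    proof -
      have *: "om (fd j0 0 (axis b 1)) (fd j0 0 (axis a 1)) = om (fd j1 0 (axis b 1)) (fd j1 0 (axis a 1))"
        if "om (fd j0 0 (axis a 1)) (fd j0 0 (axis b 1)) = om (fd j1 0 (axis a 1)) (fd j1 0 (axis b 1))" for a b :: 3
        using that om_swap[of "fd j0 0 (axis b 1)" "fd j0 0 (axis a 1)"] om_swap[of "fd j1 0 (axis b 1)" "fd j1 0 (axis a 1)"] by simp
      show ?thesis using exhaust_3[of a] exhaust_3[of b] g *[of 1 2] *[of 1 3] *[of 2 3] by auto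
    qed
    then show ?thesis by (simp add: u0_def u1_def)
  qed
  have "\<exists>T. linear T \<and> (\<forall>x y. om (T x) (T y) = om x y) \<and> (\<forall>i<3. T (u0 i) = u1 i)"
    by (rule witt) (use indep[OF l0 j0(3)] indep[OF l1 j1(3)] G in \<open>simp_all add: u0_def[abs_def] u1_def[abs_def]\<close>)
  then obtain T where T: "linear T" "\<And>x y. om (T x) (T y) = om x y" "\<And>i. i < 3 \<Longrightarrow> T (u0 i) = u1 i" by blast
  have bl: "bounded_linear T" using T(1) by (simp add: linear_conv_bounded_linear)
  define k0 where "k0 x = T (j0 x)" for x
  have k0s: "smooth_on (ball 0 r) k0" unfolding k0_def by (rule smooth_on_bounded_linear_compose[OF bl open_ball j0(1)])
  have k0': "fd k0 x v = T (fd j0 x v)" if "x \<in> ball 0 r" for x v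
    unfolding k0_def by (rule fun_cong[OF fd_eq[OF bounded_linear.has_derivative[OF bl smooth_on_has_derivative[OF j0(1) that]]]])
  have "fd k0 0 v = fd j1 0 v" for v
  proof -
    have "T (fd j0 0 (axis a 1)) = fd j1 0 (axis a 1)" for a :: 3
      using T(3)[of 0] T(3)[of 1] T(3)[of 2] exhaust_3[of a] by (auto simp: u0_def u1_def ix_def)
    then show ?thesis
      unfolding k0'[OF 0] fd_axis_expand[OF smooth_on_differentiable[OF j0(1) 0], of v]
        fd_axis_expand[OF smooth_on_differentiable[OF j1(1) 0], of v]
      by (simp add: linear_sum[OF T(1)] linear_scale[OF T(1)])
  qed
  then have D: "fd k0 0 = fd j1 0" by auto
  have "cohom r (lam k0) (lam j0)"
    by (rule cohom_eq) (simp add: lam_def vec_eq_iff k0' T(2) k0_def)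
  then have "cohom r (lam j1) (lam k0)"
    using c by (meson cohom_sym cohom_trans)
  then obtain U \<Psi> s where \<Psi>: "symplecto_germ e U \<Psi>" "s > 0"
    "\<And>x. x \<in> C7 \<Longrightarrow> norm x < s \<Longrightarrow> k0 x \<in> U \<and> \<Psi> (k0 x) = j1 x"
    using symplecto_of_cohom_tangent[OF k0s _ j1(1,2) r D] D j1(3) j0(2) linear_0[OF T(1)] unfolding k0_def by metis
  have TU: "symplecto_germ e UNIV T" by (rule symplecto_germ_linear[OF T(1,2)])
  have U: "open U" "0 \<in> U" using \<Psi>(1) by (auto simp: symplecto_germ_def diffeo_germ_def)
  have "open (T -` U)" by (rule open_vimage[OF U(1)]) (rule linear_continuous_on[OF bl])
  then have "symplecto_germ e (T -` U) T"
    using symplecto_germ_shrink[OF TU, of "T -` U"] U(2) linear_0[OF T(1)] by simp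
  then have "symplecto_germ e (T -` U) (\<lambda>x. \<Psi> (T x))"
    by (rule symplecto_germ_compose[OF _ \<Psi>(1)]) auto
  then show ?thesis using \<Psi>(2,3) by (intro exI[of _ "T -` U"] exI[of _ "\<lambda>x. \<Psi> (T x)"] exI[of _ s]) (auto simp: k0_def)
qed

end

section \<open>Normal forms\<close>

lemma dint_zero:
  assumes "smooth_on (ball 0 r) f" "x \<in> ball 0 r" "\<And>y. y \<in> ball 0 r \<Longrightarrow> f y = 0"
  shows "dint w k f x = 0"
proof -
  have "\<bar>dint w k f x\<bar> \<le> 0"
    by (rule abs_dint_le[OF smooth_on_continuous[OF assms(1)] assms(2)]) (use assms(2,3) in auto)
  then show ?thesis by simp
qed

text \<open>The Poincare lemma for the difference, whose curl is zero, so that the homotopy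
  remainder vanishes.\<close>

lemma cohom_of_closed:
  assumes a: "smooth_on (ball 0 r) \<alpha>" and b: "smooth_on (ball 0 r) \<beta>"
    and cl: "\<And>x i k. x \<in> ball 0 r \<Longrightarrow> fd \<alpha> x (axis k 1) $ i - fd \<alpha> x (axis i 1) $ k
      = fd \<beta> x (axis k 1) $ i - fd \<beta> x (axis i 1) $ k"
  shows "cohom r \<alpha> \<beta>"
proof -
  have s: "smooth_on (ball 0 r) (\<lambda>x. \<alpha> x - \<beta> x)" by (intro smooth_on_diff open_ball a b)
  have d: "fd (\<lambda>x. \<alpha> x - \<beta> x) x v = fd \<alpha> x v - fd \<beta> x v" if "x \<in> ball 0 r" for x v
    by (rule fun_cong[OF fd_eq[OF has_derivative_diff[OF smooth_on_has_derivative[OF a that] smooth_on_has_derivative[OF b that]]]])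
  obtain S where S: "smooth_on (ball 0 r) S"
    "\<And>x i. x \<in> ball 0 r \<Longrightarrow> (\<alpha> x - \<beta> x) $ i = fd S x (axis i 1) +
      (\<Sum>k\<in>UNIV. real 1 * x $ k *
        dint (\<lambda>_. 1) (1 + 1 - 1) (\<lambda>y. fd (\<lambda>x. \<alpha> x - \<beta> x) y (axis k 1) $ i - fd (\<lambda>x. \<alpha> x - \<beta> x) y (axis i 1) $ k) x)"
    by (rule poincare[OF s, of "\<lambda>_. 1"]) auto
  have "dint (\<lambda>_. 1) (1 + 1 - 1) (\<lambda>y. fd (\<lambda>x. \<alpha> x - \<beta> x) y (axis k 1) $ i - fd (\<lambda>x. \<alpha> x - \<beta> x) y (axis i 1) $ k) x = 0"
    if "x \<in> ball 0 r" for x i k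
  proof (rule dint_zero[OF _ that])
    show "smooth_on (ball 0 r) (\<lambda>y. fd (\<lambda>x. \<alpha> x - \<beta> x) y (axis k 1) $ i - fd (\<lambda>x. \<alpha> x - \<beta> x) y (axis i 1) $ k)"
      by (intro smooth_on_diff smooth_on_nth smooth_on_fd s open_ball)
    show "fd (\<lambda>x. \<alpha> x - \<beta> x) y (axis k 1) $ i - fd (\<lambda>x. \<alpha> x - \<beta> x) y (axis i 1) $ k = 0" if "y \<in> ball 0 r" for y
      using cl[OF that, of k i] by (simp add: d[OF that])
  qed
  then have "\<alpha> x - \<beta> x = grad S x" if "x \<in> ball 0 r" for x
    using S(2)[OF that] that by (simp add: vec_eq_iff)
  then show ?thesis unfolding cohom_def using S(1) by blast
qed

lemma fd_nfK:
  shows "((\<lambda>x. nfK c x) has_derivative (\<lambda>v.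
    iE (c 7 + c 10 * x$3 + c 11 * x$1 + c 13 * x$3^2 + c 14 * x$1 * x$3) (c 8) (c 9) v
    + iE (c 10 * v$3 + c 11 * v$1 + c 13 * (2 * x$3 * v$3) + c 14 * (v$1 * x$3 + x$1 * v$3)) 0 0 x)) (at x)"
proof -
  have iE_axis: "iE a b d x = (- 3 * x$3 * a - 5 * x$2 * d) *\<^sub>R axis 1 1 + (4 * x$1 * d - 3 * x$3 * b) *\<^sub>R axis 2 1
    + (4 * x$1 * a + 5 * x$2 * b) *\<^sub>R axis 3 1" for a b d x
    by (simp add: vec3_eq_iff axis_def)
  show ?thesis
    unfolding nfK_def iE_axis
    by (rule derivative_eq_intros refl | simp)+ (auto simp: fun_eq_iff vec3_eq_iff axis_def algebra_simps power2_eq_square)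
qed

lemma smooth_on_nfK: "open U \<Longrightarrow> smooth_on U (nfK c)"
proof (rule smooth_on_vec)
  assume U: "open U"
  have "smooth_on U (\<lambda>x. nfK c x $ 1)" "smooth_on U (\<lambda>x. nfK c x $ 2)" "smooth_on U (\<lambda>x. nfK c x $ 3)"
    unfolding nfK_def iE_nth by (intro smooth_intros U)+
  then show "smooth_on U (\<lambda>x. nfK c x $ i)" for i using exhaust_3[of i] by auto
qed

context symplectic_coords
begin

text \<open>The second derivatives of \<open>j\<close> cancel by symmetry; what is left are the two
  halves of the pulled back form.\<close>

lemma lam_curl:
  assumes U: "open U" "x \<in> U" and j: "smooth_on U j"
  shows "fd (lam j) x (axis k 1) $ i - fd (lam j) x (axis i 1) $ k = om (fd j x (axis k 1)) (fd j x (axis i 1))"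
proof -
  have f: "fd (lam j) x v $ i = (om (j x) (fd (\<lambda>y. fd j y (axis i 1)) x v) + om (fd j x v) (fd j x (axis i 1))) / 2" for v i
  proof -
    have "((\<lambda>x. om (j x) (fd j x (axis i 1)) / 2) has_derivative
        (\<lambda>v. (om (j x) (fd (\<lambda>y. fd j y (axis i 1)) x v) + om (fd j x v) (fd j x (axis i 1))) / 2)) (at x)"
      by (intro bounded_linear.has_derivative[OF bounded_linear_divide] bounded_bilinear.FDERIV[OF om_bilinear]
          smooth_on_has_derivative[OF j U(2)] smooth_on_has_derivative[OF smooth_on_fd[OF j] U(2)])
    moreover have "((\<lambda>x. lam j x $ i) has_derivative (\<lambda>v. fd (lam j) x v $ i)) (at x)"
      by (rule bounded_linear.has_derivative[OF bounded_linear_vec_nth smooth_on_has_derivative[OF smooth_on_lam[OF U(1) j] U(2)]])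
    ultimately have "(\<lambda>v. fd (lam j) x v $ i) = (\<lambda>v. (om (j x) (fd (\<lambda>y. fd j y (axis i 1)) x v) + om (fd j x v) (fd j x (axis i 1))) / 2)"
      unfolding lam_def vec_lambda_beta by (rule has_derivative_unique[rotated])
    from fun_cong[OF this, of v] show ?thesis .
  qed
  have sym: "fd (\<lambda>y. fd j y u) x v = fd (\<lambda>y. fd j y v) x u" for u v
  proof (rule vec_eq_iff[THEN iffD2], rule allI)
    fix a
    have n: "fd (\<lambda>y. j y $ a) y u = fd j y u $ a" if "y \<in> U" for y u
      by (rule fun_cong[OF fd_eq[OF bounded_linear.has_derivative[OF bounded_linear_vec_nth smooth_on_has_derivative[OF j that]]]])
    have n2: "fd (\<lambda>y. fd (\<lambda>y. j y $ a) y u) x v = fd (\<lambda>y. fd j y u) x v $ a" for u v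
    proof -
      have "fd (\<lambda>y. fd (\<lambda>y. j y $ a) y u) x = fd (\<lambda>y. fd j y u $ a) x"
        by (rule fd_cong_open[OF U]) (rule n)
      then show ?thesis
        using fun_cong[OF fd_eq[OF bounded_linear.has_derivative[OF bounded_linear_vec_nth smooth_on_has_derivative[OF smooth_on_fd[OF j] U(2)]]]] by metis
    qed
    show "fd (\<lambda>y. fd j y u) x v $ a = fd (\<lambda>y. fd j y v) x u $ a"
      using symmetric_second_fd[OF U smooth_on_nth[OF U(1) j], of a u v] n2 by simp
  qed
  show ?thesis
    using om_swap[of "fd j x (axis i 1)" "fd j x (axis k 1)"] sym[of "axis i 1" "axis k 1"] by (simp add: f field_simps)
qed

text \<open>The factors 7 to 14 are the weights: by Cartan's formula the exterior derivative of
  \<open>nfK c\<close> multiplies each coefficient by its weight.\<close>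

lemma cohom_lam_nfK:
  assumes j: "smooth_on (ball 0 r) j"
    and 1: "\<And>x. x \<in> ball 0 r \<Longrightarrow> om (fd j x (axis 1 1)) (fd j x (axis 3 1))
      = 7 * c 7 + 10 * c 10 * x$3 + 11 * c 11 * x$1 + 13 * c 13 * x$3^2 + 14 * c 14 * x$1 * x$3"
    and 2: "\<And>x. x \<in> ball 0 r \<Longrightarrow> om (fd j x (axis 2 1)) (fd j x (axis 3 1)) = 8 * c 8"
    and 3: "\<And>x. x \<in> ball 0 r \<Longrightarrow> om (fd j x (axis 1 1)) (fd j x (axis 2 1)) = 9 * c 9"
  shows "cohom r (lam j) (nfK c)"
proof (rule cohom_of_closed)
  show "smooth_on (ball 0 r) (lam j)" by (intro smooth_on_lam open_ball j)
  show "smooth_on (ball 0 r) (nfK c)" by (rule smooth_on_nfK[OF open_ball])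
  fix x :: "real^3" and i k :: 3 assume x: "x \<in> ball 0 r"
  have sw: "om (fd j x (axis b 1)) (fd j x (axis a 1)) = - om (fd j x (axis a 1)) (fd j x (axis b 1))" for a b
    by (rule om_swap)
  have "om (fd j x (axis k 1)) (fd j x (axis i 1)) = fd (nfK c) x (axis k 1) $ i - fd (nfK c) x (axis i 1) $ k"
    unfolding fd_eq[OF fd_nfK]
    using exhaust_3[of i] exhaust_3[of k] 1[OF x] 2[OF x] 3[OF x] sw[of 1 3] sw[of 2 3] sw[of 1 2]
    by (elim disjE; hypsubst) (simp_all add: axis_def algebra_simps power2_eq_square)
  then show "fd (lam j) x (axis k 1) $ i - fd (lam j) x (axis i 1) $ k = fd (nfK c) x (axis k 1) $ i - fd (nfK c) x (axis i 1) $ k"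
    by (simp add: lam_curl[OF open_ball x j])
qed

section \<open>Canonical coordinates and the model embeddings\<close>

abbreviation E :: "nat \<Rightarrow> real^'m" where "E k \<equiv> axis (e k) 1"

lemma E_nth: "a \<in> {1..2*n} \<Longrightarrow> b \<in> {1..2*n} \<Longrightarrow> E a $ e b = (if a = b then 1 else 0)"
  using e_eq_iff[of a b] by (auto simp: axis_def)

lemma om_E: "i \<in> {1..n} \<Longrightarrow> om u (E (2*i)) = u $ e (2*i-1)" "i \<in> {1..n} \<Longrightarrow> om u (E (2*i-1)) = - u $ e (2*i)"
  using Jm_even[of i u] Jm_odd[of i u] by (simp_all add: Jm_def)

lemma om_E4: "om u (E 1) = - u $ e 2" "om u (E 2) = u $ e 1" "om u (E 3) = - u $ e 4" "om u (E 4) = u $ e 3"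
  using om_E[of 1 u] om_E[of 2 u] n_ge by (simp_all add: eval_nat_numeral)

lemma om_E6: "n \<ge> 3 \<Longrightarrow> om u (E 5) = - u $ e 6" "n \<ge> 3 \<Longrightarrow> om u (E 6) = u $ e 5"
  using om_E[of 3 u] by (simp_all add: eval_nat_numeral)

lemma E_nth4: "a \<in> {1,2,3,4} \<Longrightarrow> b \<in> {1,2,3,4} \<Longrightarrow> E a $ e b = (if a = b then 1 else 0)"
  using n_ge by (intro E_nth) auto

lemma E_nth6: "n \<ge> 3 \<Longrightarrow> a \<in> {1,2,3,4,5,6} \<Longrightarrow> b \<in> {1,2,3,4,5,6} \<Longrightarrow> E a $ e b = (if a = b then 1 else 0)"
  by (intro E_nth) auto

lemma coords4: "coords e [a, b, c, d] = a *\<^sub>R E 1 + b *\<^sub>R E 2 + c *\<^sub>R E 3 + d *\<^sub>R E 4"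
  by (simp add: coords_def lessThan_Suc eval_nat_numeral algebra_simps)

lemma coords6: "coords e [a, b, c, d, f, g] = a *\<^sub>R E 1 + b *\<^sub>R E 2 + c *\<^sub>R E 3 + d *\<^sub>R E 4 + f *\<^sub>R E 5 + g *\<^sub>R E 6"
  by (simp add: coords_def lessThan_Suc eval_nat_numeral algebra_simps)

lemma coords4_nth:
  "coords e [a, b, c, d] $ e 1 = a" "coords e [a, b, c, d] $ e 2 = b"
  "coords e [a, b, c, d] $ e 3 = c" "coords e [a, b, c, d] $ e 4 = d"
  by (simp_all add: coords4 E_nth4)

lemma coords6_nth:
  assumes "n \<ge> 3"
  shows "coords e [a, b, c, d, f, g] $ e 1 = a" "coords e [a, b, c, d, f, g] $ e 2 = b"
    "coords e [a, b, c, d, f, g] $ e 3 = c" "coords e [a, b, c, d, f, g] $ e 4 = d"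
    "coords e [a, b, c, d, f, g] $ e 5 = f" "coords e [a, b, c, d, f, g] $ e 6 = g"
  by (simp_all add: coords6 E_nth6[OF assms])

lemma om_coords4: "om (coords e [a, b, c, d]) (coords e [a', b', c', d']) = a * b' - b * a' + c * d' - d * c'"
  unfolding coords4[of a' b' c' d'] by (simp add: om_simps om_E4 coords4_nth del: One_nat_def)

lemma om_coords6:
  assumes "n \<ge> 3"
  shows "om (coords e [a, b, c, d, f, g]) (coords e [a', b', c', d', f', g']) = a * b' - b * a' + c * d' - d * c' + f * g' - g * f'"
  unfolding coords6[of a' b' c' d' f' g'] by (simp add: om_simps om_E4 om_E6 coords6_nth assms del: One_nat_def)

end

text \<open>Embeddings of R^3 that extend the normal forms: along \<open>g1\<close> and
  \<open>g2\<close> they give \<open>nf_branch1\<close> and \<open>nf_branch2\<close>. The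
  coordinates of R^3 occur among the entries up to sign, and the other entries are chosen so that
  the pulled back symplectic form has just the coefficients recorded in \<open>nfc\<close>.\<close>

fun nfL :: "U7_type \<Rightarrow> real \<Rightarrow> real \<Rightarrow> real \<Rightarrow> real^3 \<Rightarrow> real list" where
  "nfL U7_0 s c1 c2 x = [x$1, x$3, x$2, c1 * x$3 - c2 * x$1]"
| "nfL U7_1 s c1 c2 x = [x$2, s * x$3, x$1, c1 * x$2 + c2 / 2 * x$3^2]"
| "nfL U7_2 s c1 c2 x = [x$1, x$2, c1 * x$1 * x$3 + c2 / 2 * x$1^2, x$3]"
| "nfL U7_3 s c1 c2 x = [x$1, c1 * x$1 * x$3, x$2, 0, x$3, - s * x$1 * x$3]"
| "nfL U7_4 s c1 c2 x = [x$1, c1 / 3 * x$3^3, x$2, 0, x$3, - (1/2) * x$1^2]"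
| "nfL U7_5 s c1 c2 x = [x$1, - (c1 / 2) * x$1 * x$3^2, x$2, 0, x$3, - x$1 * x$3^2]"
| "nfL U7_6 s c1 c2 x = [x$1, 0, x$2, 0, x$3, - (s / 2) * x$1^2 * x$3]"
| "nfL U7_7 s c1 c2 x = [x$1, 0, x$2, 0, x$3, 0]"

fun nfD :: "U7_type \<Rightarrow> real \<Rightarrow> real \<Rightarrow> real \<Rightarrow> real^3 \<Rightarrow> real^3 \<Rightarrow> real list" where
  "nfD U7_0 s c1 c2 x v = [v$1, v$3, v$2, c1 * v$3 - c2 * v$1]"
| "nfD U7_1 s c1 c2 x v = [v$2, s * v$3, v$1, c1 * v$2 + c2 * x$3 * v$3]"
| "nfD U7_2 s c1 c2 x v = [v$1, v$2, c1 * (v$1 * x$3 + x$1 * v$3) + c2 * x$1 * v$1, v$3]"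
| "nfD U7_3 s c1 c2 x v = [v$1, c1 * (v$1 * x$3 + x$1 * v$3), v$2, 0, v$3, - s * (v$1 * x$3 + x$1 * v$3)]"
| "nfD U7_4 s c1 c2 x v = [v$1, c1 * x$3^2 * v$3, v$2, 0, v$3, - x$1 * v$1]"
| "nfD U7_5 s c1 c2 x v = [v$1, - (c1 / 2) * (v$1 * x$3^2 + 2 * x$1 * x$3 * v$3), v$2, 0, v$3, - (v$1 * x$3^2 + 2 * x$1 * x$3 * v$3)]"
| "nfD U7_6 s c1 c2 x v = [v$1, 0, v$2, 0, v$3, - (s / 2) * (2 * x$1 * v$1 * x$3 + x$1^2 * v$3)]"
| "nfD U7_7 s c1 c2 x v = [v$1, 0, v$2, 0, v$3, 0]"

text \<open>The denominators are the weights, because the pulled back form carries each coefficient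
  multiplied by its weight. In all families but the last, the leading coefficient of the form thus
  becomes 1 or \<open>s\<close>.\<close>

fun nfc :: "U7_type \<Rightarrow> real \<Rightarrow> real \<Rightarrow> real \<Rightarrow> nat \<Rightarrow> real" where
  "nfc U7_0 s c1 c2 = (\<lambda>_. 0)(7 := 1/7, 8 := c1/8, 9 := c2/9)"
| "nfc U7_1 s c1 c2 = (\<lambda>_. 0)(8 := s/8, 9 := c1/9, 10 := c2/10)"
| "nfc U7_2 s c1 c2 = (\<lambda>_. 0)(9 := 1/9, 10 := c1/10, 11 := c2/11)"
| "nfc U7_3 s c1 c2 = (\<lambda>_. 0)(10 := s/10, 11 := c1/11)"
| "nfc U7_4 s c1 c2 = (\<lambda>_. 0)(11 := 1/11, 13 := c1/13)"
| "nfc U7_5 s c1 c2 = (\<lambda>_. 0)(13 := 1/13, 14 := - c1/14)"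
| "nfc U7_6 s c1 c2 = (\<lambda>_. 0)(14 := s/14)"
| "nfc U7_7 s c1 c2 = (\<lambda>_. 0)"

context symplectic_coords
begin

definition nfJ :: "U7_type \<Rightarrow> real \<Rightarrow> real \<Rightarrow> real \<Rightarrow> real^3 \<Rightarrow> real^'m" where
  "nfJ i s c1 c2 x = coords e (nfL i s c1 c2 x)"

lemma nfJ_deriv: "(nfJ i s c1 c2 has_derivative (\<lambda>v. coords e (nfD i s c1 c2 x v))) (at x)"
proof -
  show ?thesis
    unfolding nfJ_def[abs_def]
    by (cases i; simp only: nfL.simps nfD.simps coords4 coords6; intro has_derivative_add has_derivative_scaleR_left;
        auto intro!: derivative_eq_intros simp: fun_eq_iff field_simps power2_eq_square)
qed

lemma smooth_on_nfJ: "open U \<Longrightarrow> smooth_on U (nfJ i s c1 c2)"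
  unfolding nfJ_def[abs_def]
  by (cases i; simp only: nfL.simps coords4 coords6; intro smooth_intros)

lemma fd_nfJ: "fd (nfJ i s c1 c2) x v = coords e (nfD i s c1 c2 x v)"
  using fd_eq[OF nfJ_deriv] by metis

lemma nfJ_0: "nfJ i s c1 c2 0 = 0"
  unfolding nfJ_def by (cases i) (simp_all add: coords4 coords6)

lemma cohom_nfJ:
  assumes "min_dim i \<le> 2 * n"
  shows "cohom r (lam (nfJ i s c1 c2)) (nfK (nfc i s c1 c2))"
proof (rule cohom_lam_nfK)
  fix x :: "real^3"
  show "om (fd (nfJ i s c1 c2) x (axis 1 1)) (fd (nfJ i s c1 c2) x (axis 3 1))
      = 7 * nfc i s c1 c2 7 + 10 * nfc i s c1 c2 10 * x$3 + 11 * nfc i s c1 c2 11 * x$1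
      + 13 * nfc i s c1 c2 13 * x$3^2 + 14 * nfc i s c1 c2 14 * x$1 * x$3"
    "om (fd (nfJ i s c1 c2) x (axis 2 1)) (fd (nfJ i s c1 c2) x (axis 3 1)) = 8 * nfc i s c1 c2 8"
    "om (fd (nfJ i s c1 c2) x (axis 1 1)) (fd (nfJ i s c1 c2) x (axis 2 1)) = 9 * nfc i s c1 c2 9"
    unfolding fd_nfJ using assms
    by (cases i; simp add: om_coords4 om_coords6 axis_def)+
qed (rule smooth_on_nfJ[OF open_ball])

text \<open>Serves as properness: a small value of the model embedding forces a small
  argument.\<close>

lemma nfJ_component:
  assumes "min_dim i \<le> 2 * n" "s = 1 \<or> s = -1"
  shows "\<bar>x $ k\<bar> \<le> norm (nfJ i s c1 c2 x)"
proof -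
  have "\<bar>x$1\<bar> \<in> range (\<lambda>a. \<bar>coords e (nfL i s c1 c2 x) $ a\<bar>)" "\<bar>x$2\<bar> \<in> range (\<lambda>a. \<bar>coords e (nfL i s c1 c2 x) $ a\<bar>)"
    "\<bar>x$3\<bar> \<in> range (\<lambda>a. \<bar>coords e (nfL i s c1 c2 x) $ a\<bar>)"
  proof -
    have r: "\<bar>y $ e a\<bar> \<in> range (\<lambda>k. \<bar>y $ k\<bar>)" for y :: "real^'m" and a by blast
    note r = r[of "coords e (nfL i s c1 c2 x)" 1] r[of "coords e (nfL i s c1 c2 x)" 2] r[of "coords e (nfL i s c1 c2 x)" 3]
      r[of "coords e (nfL i s c1 c2 x)" 4] r[of "coords e (nfL i s c1 c2 x)" 5]
    show "\<bar>x$1\<bar> \<in> range (\<lambda>a. \<bar>coords e (nfL i s c1 c2 x) $ a\<bar>)" "\<bar>x$2\<bar> \<in> range (\<lambda>a. \<bar>coords e (nfL i s c1 c2 x) $ a\<bar>)"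
      "\<bar>x$3\<bar> \<in> range (\<lambda>a. \<bar>coords e (nfL i s c1 c2 x) $ a\<bar>)"
      using r assms by (cases i; simp only: nfL.simps coords4_nth; auto simp: coords6_nth abs_mult simp del: One_nat_def)+
  qed
  then show ?thesis using exhaust_3[of k] component_le_norm_cart[of "coords e (nfL i s c1 c2 x)"] unfolding nfJ_def by auto
qed

end

section \<open>Germs parametrized by the curve\<close>

lemma germ_eq_iff: "germ_eq A B \<longleftrightarrow> (\<exists>d>0. \<forall>z. norm z < d \<longrightarrow> (z \<in> A \<longleftrightarrow> z \<in> B))"
  unfolding germ_eq_def eventually_nhds_metric by simp

lemma diffeo_germ_inv_small:
  fixes f :: "'a::real_normed_vector \<Rightarrow> 'a"
  assumes f: "diffeo_germ U f" and r: "r > 0"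
  shows "\<exists>d>0. \<forall>z. norm z < d \<longrightarrow> z \<in> f ` U \<and> norm (inv_into U f z) < r \<and> f (inv_into U f z) = z"
proof -
  have U: "open (f ` U)" "0 \<in> f ` U" "inv_into U f 0 = 0" "smooth_on (f ` U) (inv_into U f)"
    using diffeo_germ_inv[OF f] f by (auto simp: diffeo_germ_def)
  obtain d1 where d1: "d1 > 0" "ball 0 d1 \<subseteq> f ` U" using U(1,2) open_contains_ball by blast
  have "isCont (inv_into U f) 0"
    using continuous_on_eq_continuous_at[OF U(1)] smooth_on_continuous[OF U(4)] U(2) by blast
  then obtain d2 where d2: "d2 > 0" "\<And>z. norm z < d2 \<Longrightarrow> norm (inv_into U f z) < r"
    using r U(3) unfolding continuous_at_eps_delta by (auto simp: dist_norm)
  show ?thesis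
  proof (intro exI[of _ "min d1 d2"] conjI[of "min d1 d2 > 0"] allI impI)
    fix z :: 'a assume z: "norm z < min d1 d2"
    then have "z \<in> f ` U" using d1(2) by auto
    then show "z \<in> f ` U \<and> norm (inv_into U f z) < r \<and> f (inv_into U f z) = z"
      using d2(2)[of z] z f_inv_into_f[of z f U] by simp
  qed (use d1 d2 in auto)
qed

lemma smooth_small:
  fixes f :: "'a::real_normed_vector \<Rightarrow> 'b::real_normed_vector"
  assumes "smooth_on U f" "open U" "0 \<in> U" "f 0 = 0" "r > 0"
  shows "\<exists>d>0. ball 0 d \<subseteq> U \<and> (\<forall>x. norm x < d \<longrightarrow> norm (f x) < r)"
proof -
  obtain d1 where d1: "d1 > 0" "ball 0 d1 \<subseteq> U" using assms(2,3) open_contains_ball by blast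
  have "isCont f 0"
    using continuous_on_eq_continuous_at[OF assms(2)] smooth_on_continuous[OF assms(1)] assms(3) by blast
  then obtain d2 where d2: "d2 > 0" "\<And>z. norm z < d2 \<Longrightarrow> norm (f z) < r"
    using assms(4,5) unfolding continuous_at_eps_delta by (auto simp: dist_norm)
  show ?thesis by (rule exI[of _ "min d1 d2"]) (use d1 d2 in auto)
qed

text \<open>The second clause asks for preimages near 0 of all points of \<open>N\<close> near 0;
  the first clause alone would allow \<open>N\<close> to be larger than the image.\<close>

definition param :: "(real^3 \<Rightarrow> 'a::real_normed_vector) \<Rightarrow> 'a set \<Rightarrow> bool" where
  "param j N \<longleftrightarrow> (\<exists>d>0. \<forall>x\<in>C7. norm x < d \<longrightarrow> j x \<in> N) \<and>
    (\<forall>r>0. \<exists>d>0. \<forall>z\<in>N. norm z < d \<longrightarrow> (\<exists>x\<in>C7. norm x < r \<and> j x = z))"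

lemma paramD1: "param j N \<Longrightarrow> \<exists>d>0. \<forall>x\<in>C7. norm x < d \<longrightarrow> j x \<in> N"
  by (simp add: param_def)

lemma paramD2: "param j N \<Longrightarrow> r > 0 \<Longrightarrow> \<exists>d>0. \<forall>z\<in>N. norm z < d \<longrightarrow> (\<exists>x\<in>C7. norm x < r \<and> j x = z)"
  by (simp add: param_def)

lemma param_transport:
  fixes j :: "real^3 \<Rightarrow> 'a::real_normed_vector"
  assumes df: "diffeo_germ W \<Gamma>" and N: "germ_eq (\<Gamma> ` (M \<inter> W)) N" and j: "param j M" "j 0 = 0"
    and js: "smooth_on UNIV j"
  shows "param (\<lambda>x. \<Gamma> (j x)) N"
proof -
  note dd = df[unfolded diffeo_germ_def]
  obtain q where q: "q > 0" "\<forall>z. norm z < q \<longrightarrow> (z \<in> \<Gamma> ` (M \<inter> W) \<longleftrightarrow> z \<in> N)" using N unfolding germ_eq_iff by blast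
  from smooth_small[of W \<Gamma>, OF _ _ _ _ q(1)] dd obtain p where p: "p > 0" "ball 0 p \<subseteq> W" "\<forall>z. norm z < p \<longrightarrow> norm (\<Gamma> z) < q" by blast
  from smooth_small[OF js open_UNIV UNIV_I j(2) p(1)] obtain a where a: "a > 0" "\<forall>x. norm x < a \<longrightarrow> norm (j x) < p" by blast
  obtain b where b: "b > 0" "\<forall>x\<in>C7. norm x < b \<longrightarrow> j x \<in> M" using paramD1[OF j(1)] by blast
  show ?thesis
    unfolding param_def
  proof (intro conjI allI impI)
    have "\<Gamma> (j x) \<in> N" if "x \<in> C7" "norm x < min a b" for x
    proof -
      have jx: "norm (j x) < p" "j x \<in> M" using a b that by auto
      then have "\<Gamma> (j x) \<in> \<Gamma> ` (M \<inter> W)" using p(2) by auto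
      then show ?thesis using q(2) p(3) jx by blast
    qed
    then show "\<exists>d>0. \<forall>x\<in>C7. norm x < d \<longrightarrow> \<Gamma> (j x) \<in> N" using a(1) b(1) by (intro exI[of _ "min a b"]) auto
    fix r :: real assume "r > 0"
    from paramD2[OF j(1) this] obtain d where d: "d > 0" "\<forall>z\<in>M. norm z < d \<longrightarrow> (\<exists>x\<in>C7. norm x < r \<and> j x = z)" by blast
    from diffeo_germ_inv_small[OF df d(1)] obtain l where l: "l > 0" "\<forall>z. norm z < l \<longrightarrow> norm (inv_into W \<Gamma> z) < d" by blast
    have "\<exists>x\<in>C7. norm x < r \<and> \<Gamma> (j x) = z" if "z \<in> N" "norm z < min q l" for z
    proof -
      have "norm z < q" using that by simp
      then have zi: "z \<in> \<Gamma> ` (M \<inter> W)" using q(2) that(1) by blast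
      obtain y where y: "y \<in> M" "y \<in> W" "z = \<Gamma> y"  using zi by blast
      have "inv_into W \<Gamma> z = y" using dd y by simp
      then have "norm y < d" using l(2) that by auto
      then show ?thesis using d(2) y by blast
    qed
    then show "\<exists>d>0. \<forall>z\<in>N. norm z < d \<longrightarrow> (\<exists>x\<in>C7. norm x < r \<and> \<Gamma> (j x) = z)" using q(1) l(1) by (intro exI[of _ "min q l"]) auto
  qed
qed

text \<open>The substitution is a local diffeomorphism with \<open>l\<close> nonzero near 0. A point
  of a branch pulls back to the same branch, with its parameter divided by \<open>l ^ 5\<close> or
  \<open>l\<close>.\<close>

lemma param_qscale:
  assumes p: "param j N" and l: "smooth_on UNIV l" "l 0 \<noteq> 0"
  shows "param (\<lambda>x. j (qscale l x)) N"
proof -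
  have qs: "smooth_on UNIV (qscale l)" by (rule smooth_on_qscale[OF l(1) open_UNIV])
  obtain d where d: "d > 0" "\<And>x. x \<in> C7 \<Longrightarrow> norm x < d \<Longrightarrow> j x \<in> N" using paramD1[OF p] by blast
  obtain d' where d': "d' > 0" "\<And>x. norm x < d' \<Longrightarrow> norm (qscale l x) < d"
    using smooth_small[OF qs open_UNIV UNIV_I qscale_0 d(1)] by blast
  have 1: "j (qscale l x) \<in> N" if "x \<in> C7" "norm x < d'" for x
    using d(2)[OF qscale_C7[OF that(1)] d'(2)[OF that(2)]] .
  have "linear (fd (qscale l) 0)" by (rule linear_fd[OF qs UNIV_I])
  moreover have "fd (qscale l) 0 v = 0 \<Longrightarrow> v = 0" for v
    using l(2) by (simp add: fd_qscale[OF l(1)] vec3_eq_iff)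
  ultimately have "inj (fd (qscale l) 0)" using linear_injective_0 by blast
  then obtain U where U: "diffeo_germ U (qscale l)"
    using diffeo_germI[OF open_UNIV UNIV_I qs qscale_0] by blast
  obtain dl where dl: "dl > 0" "\<And>x. norm x < dl \<Longrightarrow> l x \<noteq> 0"
  proof -
    have "isCont l 0" using smooth_on_continuous[OF l(1)] by (simp add: continuous_on_eq_continuous_at)
    then obtain k where "k > 0" "\<And>x. dist 0 x < k \<Longrightarrow> l x \<noteq> 0"
      using continuous_at_avoid[of 0 l 0] l(2) by metis
    then show thesis by (intro that[of k]) auto
  qed
  have 2: "\<exists>d>0. \<forall>z\<in>N. norm z < d \<longrightarrow> (\<exists>x\<in>C7. norm x < r \<and> j (qscale l x) = z)" if r: "r > 0" for r
  proof -
    have "min r dl > 0" using r dl by simp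
    from diffeo_germ_inv_small[OF U this] obtain q where "q > 0" and
      "\<forall>z. norm z < q \<longrightarrow> z \<in> qscale l ` U \<and> norm (inv_into U (qscale l) z) < min r dl \<and> qscale l (inv_into U (qscale l) z) = z"
      by (elim exE conjE)
    then have q: "q > 0" "\<And>y. norm y < q \<Longrightarrow> norm (inv_into U (qscale l) y) < min r dl \<and> qscale l (inv_into U (qscale l) y) = y"
      by simp_all
    obtain d where d: "d > 0" "\<And>z. z \<in> N \<Longrightarrow> norm z < d \<Longrightarrow> \<exists>y\<in>C7. norm y < q \<and> j y = z"
      using paramD2[OF p q(1)] by blast
    have "\<exists>x\<in>C7. norm x < r \<and> j (qscale l x) = z" if z: "z \<in> N" "norm z < d" for z
    proof -
      obtain y where y: "y \<in> C7" "norm y < q" "j y = z" using d(2)[OF z] by blast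
      define x where "x = inv_into U (qscale l) y"
      have x: "norm x < r" "l x \<noteq> 0" "qscale l x = y" using q(2)[OF y(2)] dl(2) by (auto simp: x_def)
      have "x \<in> C7"
        using y(1)
      proof (rule C7_cases)
        fix t assume 1: "y = g1 t"
        have "x = g1 (t / l x ^ 5)" using x(2,3) 1 by (auto simp: vec3_eq_iff field_simps)
        then show ?thesis by (auto simp: C7_def)
      next
        fix t assume 2: "y = g2 t"
        have "x = g2 (t / l x)" using x(2,3) 2 by (auto simp: vec3_eq_iff field_simps)
        then show ?thesis by (auto simp: C7_def)
      qed
      then show ?thesis using x y by auto
    qed
    then show ?thesis using d(1) by blast
  qed
  show ?thesis unfolding param_def using 1 d'(1) 2 by blast
qed

context symplectic_coords
begin

definition emb :: "real^3 \<Rightarrow> real^'m" where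
  "emb x = coords e [x$1, x$2, x$3]"

lemma emb_eq: "emb x = x$1 *\<^sub>R E 1 + x$2 *\<^sub>R E 2 + x$3 *\<^sub>R E 3"
  by (simp add: emb_def coords_def lessThan_Suc eval_nat_numeral algebra_simps)

lemma linear_emb: "linear emb"
  by (auto simp: linear_iff emb_eq algebra_simps)

lemma bounded_linear_emb: "bounded_linear emb"
  using linear_emb by (simp add: linear_conv_bounded_linear)

lemma emb_nth: "emb x $ e 1 = x$1" "emb x $ e 2 = x$2" "emb x $ e 3 = x$3"
  by (simp_all add: emb_eq E_nth4 del: One_nat_def)

lemma norm_le_emb: "norm x \<le> 3 * norm (emb x)"
proof -
  have "norm x \<le> (\<Sum>i\<in>UNIV. \<bar>x $ i\<bar>)" by (rule norm_le_l1_cart)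
  also have "\<dots> \<le> 3 * norm (emb x)"
    using component_le_norm_cart[of "emb x" "e 1"] component_le_norm_cart[of "emb x" "e 2"] component_le_norm_cart[of "emb x" "e 3"]
    by (simp add: sum_3 emb_nth del: One_nat_def)
  finally show ?thesis .
qed

lemma inj_emb: "inj emb"
  using emb_nth by (metis injI vec3_eq_iff)

lemma U7_eq: "U7 e = emb ` C7"
proof -
  have "U7_branch1 e = emb \<circ> g1" "U7_branch2 e = emb \<circ> g2"
    by (simp_all add: fun_eq_iff U7_branch1_def U7_branch2_def emb_def)
  then show ?thesis
    using U7_eq_branches[of e] bij_e n_ge by (simp add: card_m C7_def image_Un image_comp)
qed

lemma param_diffeo:
  assumes f: "diffeo_germ U \<Phi>" and N: "germ_eq N (\<Phi> ` (U7 e \<inter> U))"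
  obtains r where "r > 0" "smooth_on (ball 0 r) (\<lambda>x. \<Phi> (emb x))" "\<Phi> (emb 0) = 0"
    "inj (fd (\<lambda>x. \<Phi> (emb x)) 0)" "param (\<lambda>x. \<Phi> (emb x)) N" "\<And>x. norm x < r \<Longrightarrow> emb x \<in> U"
proof -
  have U: "open U" "0 \<in> U" "\<Phi> 0 = 0" "inj_on \<Phi> U" "smooth_on U \<Phi>" using f by (auto simp: diffeo_germ_def)
  have e0: "emb 0 = 0" by (rule linear_0[OF linear_emb])
  obtain d0 where d0: "d0 > 0" "ball 0 d0 \<subseteq> U" using U(1,2) open_contains_ball by blast
  obtain r where r: "r > 0" "\<And>x. norm x < r \<Longrightarrow> norm (emb x) < d0"
    using smooth_small[OF smooth_on_bounded_linear[OF bounded_linear_emb] open_UNIV UNIV_I e0 d0(1)] by blast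
  have eU: "emb x \<in> U" if "norm x < r" for x using r(2)[OF that] d0(2) by auto
  have sm: "smooth_on (ball 0 r) (\<lambda>x. \<Phi> (emb x))"
    by (rule smooth_on_compose[OF open_ball U(1,5) smooth_on_bounded_linear[OF bounded_linear_emb]]) (use eU in auto)
  have "fd (\<lambda>x. \<Phi> (emb x)) 0 v = fd \<Phi> 0 (emb v)" for v
  proof -
    have "(\<Phi> has_derivative fd \<Phi> 0) (at (emb 0))" unfolding e0 by (rule smooth_on_has_derivative[OF U(5,2)])
    from fun_cong[OF fd_eq[OF has_derivative_compose[OF bounded_linear_imp_has_derivative[OF bounded_linear_emb] this]]]
    show ?thesis .
  qed
  moreover have "inj (fd \<Phi> 0)" using diffeo_germ_inv_fd(1)[OF f U(2)] by (metis injI)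
  ultimately have inj: "inj (fd (\<lambda>x. \<Phi> (emb x)) 0)"
    using inj_emb by (simp add: inj_def)
  have j0: "\<Phi> (emb 0) = 0" by (simp add: e0 U(3))
  have "param emb (U7 e)"
    unfolding param_def U7_eq
  proof (intro conjI allI impI)
    show "\<exists>d>0. \<forall>z\<in>emb ` C7. norm z < d \<longrightarrow> (\<exists>x\<in>C7. norm x < r \<and> emb x = z)" if "r > 0" for r
    proof (intro exI[of _ "r / 3"] conjI ballI impI)
      fix z assume "z \<in> emb ` C7" "norm z < r / 3"
      then obtain x where "x \<in> C7" "z = emb x" "norm (emb x) < r / 3" by blast
      moreover have "norm x < r" using norm_le_emb[of x] calculation(3) by simp
      ultimately show "\<exists>x\<in>C7. norm x < r \<and> emb x = z" by blast
    qed (use that in simp)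
    show "\<exists>d>0. \<forall>x\<in>C7. norm x < d \<longrightarrow> emb x \<in> emb ` C7" using zero_less_one by blast
  qed
  moreover have "germ_eq (\<Phi> ` (U7 e \<inter> U)) N" using N by (simp add: germ_eq_def eq_commute)
  ultimately have "param (\<lambda>x. \<Phi> (emb x)) N"
    using param_transport[OF f] e0 smooth_on_bounded_linear[OF bounded_linear_emb] by blast
  then show thesis using that[OF r(1) sm j0 inj] eU by blast
qed

lemma param_nfJ:
  assumes "min_dim i \<le> 2 * n" "s = 1 \<or> s = -1"
  shows "param (nfJ i s c1 c2) (normal_form e i s c1 c2)"
proof -
  have b: "coords e (nf_branch1 i s c1 c2 t) = nfJ i s c1 c2 (g1 t)" "coords e (nf_branch2 i s c1 c2 t) = nfJ i s c1 c2 (g2 t)" for t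
    unfolding nfJ_def by (cases i; simp add: algebra_simps flip: power_mult power_add)+
  have nf: "normal_form e i s c1 c2 = nfJ i s c1 c2 ` C7"
    unfolding normal_form_def b C7_def by auto
  have n: "norm x \<le> 3 * norm (nfJ i s c1 c2 x)" for x
  proof -
    have "norm x \<le> (\<Sum>k\<in>UNIV. \<bar>x $ k\<bar>)" by (rule norm_le_l1_cart)
    also have "\<dots> \<le> 3 * norm (nfJ i s c1 c2 x)"
    proof -
      have "\<bar>x $ k\<bar> \<le> norm (nfJ i s c1 c2 x)" for k by (rule nfJ_component[OF assms])
      from this[of 1] this[of 2] this[of 3] show ?thesis by (simp add: sum_3)
    qed
    finally show ?thesis .
  qed
  show ?thesis
    unfolding param_def
  proof (intro conjI allI impI)
    show "\<exists>d>0. \<forall>x\<in>C7. norm x < d \<longrightarrow> nfJ i s c1 c2 x \<in> normal_form e i s c1 c2"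
      unfolding nf by (intro exI[of _ 1]) auto
    fix r :: real assume "r > 0"
    have "\<exists>x\<in>C7. norm x < r \<and> nfJ i s c1 c2 x = z" if "z \<in> normal_form e i s c1 c2" "norm z < r / 3" for z
    proof -
      obtain x where "x \<in> C7" "z = nfJ i s c1 c2 x" using \<open>z \<in> normal_form e i s c1 c2\<close> unfolding nf by blast
      then show ?thesis using n[of x] \<open>norm z < r / 3\<close> by (intro bexI[of _ x]) auto
    qed
    then show "\<exists>d>0. \<forall>z\<in>normal_form e i s c1 c2. norm z < d \<longrightarrow> (\<exists>x\<in>C7. norm x < r \<and> nfJ i s c1 c2 x = z)"
      using \<open>r > 0\<close> by (intro exI[of _ "r / 3"]) auto
  qed
qed

lemma inj_fd_nfJ:
  assumes "min_dim i \<le> 2 * n" "s = 1 \<or> s = -1"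
  shows "inj (fd (nfJ i s c1 c2) 0)"
proof -
  have l: "linear (fd (nfJ i s c1 c2) 0)" by (rule linear_fd[OF smooth_on_nfJ[OF open_UNIV] UNIV_I])
  have "v = 0" if "fd (nfJ i s c1 c2) 0 v = 0" for v
  proof -
    have z: "coords e (nfD i s c1 c2 0 v) $ e k = 0" for k using that by (simp add: fd_nfJ)
    note z = z[of 1] z[of 2] z[of 3] z[of 4] z[of 5]
    show ?thesis
      using z assms unfolding vec3_eq_iff
      by (cases i; simp only: nfD.simps coords4_nth; auto simp: coords6_nth simp del: One_nat_def)
  qed
  then show ?thesis using linear_injective_0[OF l] by blast
qed

text \<open>A germ has many coefficient vectors, one for each parametrization and each choice within
  its class. The normalization moves among them by \<open>rep_step\<close> without changing the
  germ.\<close>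

definition rep :: "(real^'m) set \<Rightarrow> (nat \<Rightarrow> real) \<Rightarrow> bool" where
  "rep N c \<longleftrightarrow> (\<exists>r j. r > 0 \<and> smooth_on (ball 0 r) j \<and> j 0 = 0 \<and> inj (fd j 0) \<and> param j N \<and> cohom r (lam j) (nfK c))"

lemma rep_exists:
  assumes "in_U7_class e N"
  shows "\<exists>c. rep N c"
proof -
  obtain U \<Phi> where "diffeo_germ U \<Phi>" "germ_eq N (\<Phi> ` (U7 e \<inter> U))" using assms unfolding in_U7_class_def by blast
  then obtain r where r: "r > 0" "smooth_on (ball 0 r) (\<lambda>x. \<Phi> (emb x))" "\<Phi> (emb 0) = 0"
    "inj (fd (\<lambda>x. \<Phi> (emb x)) 0)" "param (\<lambda>x. \<Phi> (emb x)) N" by (rule param_diffeo)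
  obtain c where "cohom r (lam (\<lambda>x. \<Phi> (emb x))) (nfK c)" by (rule cohom_reduce[OF smooth_on_lam[OF open_ball r(2)]])
  then show ?thesis unfolding rep_def using r by blast
qed

text \<open>Precomposition with the substitution keeps the germ, and it turns the primitive into its
  pullback, which \<open>nf_step\<close> has already reduced to \<open>nfK c'\<close>.\<close>

lemma rep_step:
  assumes "rep N c" "nf_step c l c'"
  shows "rep N c'"
proof -
  obtain r j where j: "r > 0" "smooth_on (ball 0 r) j" "j 0 = 0" "inj (fd j 0)" "param j N" "cohom r (lam j) (nfK c)"
    using assms(1) unfolding rep_def by blast
  have l: "smooth_on UNIV l" "l 0 \<noteq> 0" "\<And>r. cohom r (pull (qscale l) (nfK c)) (nfK c')"
    using assms(2) unfolding nf_step_def by auto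
  have qs: "smooth_on U (qscale l)" if "open U" for U
    using smooth_on_qscale[OF smooth_on_subset[OF l(1)] that] by simp
  obtain r1 where r1: "r1 > 0" "r1 \<le> 1" "\<And>s. s \<le> r1 \<Longrightarrow> cohom s (pull (qscale l) (lam j)) (pull (qscale l) (nfK c))"
    using pull_cohom[OF qs[OF open_ball], of 1 r "lam j" "nfK c", OF _ qscale_0 qscale_C7 j(6) j(1)] by auto
  obtain r2 where r2: "r2 > 0" "\<And>x. norm x < r2 \<Longrightarrow> norm (qscale l x) < r"
    using smooth_small[OF qs[OF open_UNIV] open_UNIV UNIV_I qscale_0 j(1)] by blast
  define r' where "r' = min r1 r2"
  have r': "r' > 0" "r' \<le> r1" using r1 r2 by (auto simp: r'_def)
  have im: "qscale l ` ball 0 r' \<subseteq> ball 0 r" using r2(2) by (auto simp: r'_def)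
  let ?k = "\<lambda>x. j (qscale l x)"
  have ks: "smooth_on (ball 0 r') ?k" by (rule smooth_on_compose[OF open_ball open_ball j(2) qs[OF open_ball] im])
  have kd: "fd ?k x v = fd j (qscale l x) (fd (qscale l) x v)" if "x \<in> ball 0 r'" for x v
  proof -
    have "qscale l x \<in> ball 0 r" using im that by blast
    then show ?thesis
      using fun_cong[OF fd_eq[OF has_derivative_compose[OF smooth_on_has_derivative[OF qs[OF open_UNIV] UNIV_I] smooth_on_has_derivative[OF j(2)]]]]
      by blast
  qed
  have "inj (fd (qscale l) 0)"
  proof -
    have "linear (fd (qscale l) 0)" by (rule linear_fd[OF qs[OF open_UNIV] UNIV_I])
    moreover have "fd (qscale l) 0 v = 0 \<Longrightarrow> v = 0" for v
      using l(2) by (simp add: fd_qscale[OF l(1)] vec3_eq_iff)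
    ultimately show ?thesis using linear_injective_0 by blast
  qed
  then have inj: "inj (fd ?k 0)" using j(4) r'(1) by (simp add: inj_def kd)
  have lk: "lam ?k x = pull (qscale l) (lam j) x" if "x \<in> C7" "norm x < r'" for x
  proof -
    have xb: "x \<in> ball 0 r'" using that by simp
    then have y: "qscale l x \<in> ball 0 r" using im by blast
    have "lam j (qscale l x) \<bullet> v = om (j (qscale l x)) (fd j (qscale l x) v) / 2" for v
    proof -
      have "om (j (qscale l x)) (fd j (qscale l x) v) / 2 = om (j (qscale l x)) (\<Sum>i\<in>UNIV. v $ i *\<^sub>R fd j (qscale l x) (axis i 1)) / 2"
        by (rule arg_cong[OF fd_axis_expand[OF smooth_on_differentiable[OF j(2) y]]])
      then show ?thesis
        by (simp add: lam_def inner_vec_def bounded_bilinear.sum_right[OF om_bilinear] om_simps sum_divide_distrib mult.commute)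
    qed
    then show ?thesis by (simp add: lam_def[of ?k] pull_def vec_eq_iff kd[OF xb])
  qed
  have "cohom r' (lam ?k) (nfK c')"
    using cohom_trans[OF cohom_eq[OF lk] cohom_trans[OF r1(3)[OF r'(2)] l(3)]] .
  then show ?thesis
    unfolding rep_def using r'(1) ks inj param_qscale[OF j(5) l(1,2)] j(3) by (intro exI[of _ r'] exI[of _ ?k]) simp
qed

lemma nfK_cong:
  assumes "\<And>w. w \<in> {7, 8, 9, 10, 11, 13, 14} \<Longrightarrow> c w = c' w"
  shows "nfK c = nfK c'"
  by (rule ext) (simp add: nfK_def assms)

text \<open>The symplectomorphism matches the two parametrizations point by point on the curve. The
  second clause of \<open>param\<close>, used for \<open>N\<close> and for the normal form, upgrades
  this to equality of germs.\<close>

lemma symp_equiv_nf: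
  assumes "rep N (nfc i s c1 c2)" and i: "min_dim i \<le> 2 * n" and s: "s = 1 \<or> s = -1"
  shows "symp_equiv e N (normal_form e i s c1 c2)"
proof -
  obtain r j where j: "r > 0" "smooth_on (ball 0 r) j" "j 0 = 0" "inj (fd j 0)" "param j N" "cohom r (lam j) (nfK (nfc i s c1 c2))"
    using assms(1) unfolding rep_def by blast
  let ?J = "nfJ i s c1 c2" and ?F = "normal_form e i s c1 c2"
  obtain U \<Psi> q where \<Psi>: "symplecto_germ e U \<Psi>" "q > 0" "\<And>x. x \<in> C7 \<Longrightarrow> norm x < q \<Longrightarrow> j x \<in> U \<and> \<Psi> (j x) = ?J x"
    using symplecto_of_cohom[OF j(2-4) smooth_on_nfJ[OF open_ball] nfJ_0 inj_fd_nfJ[OF i s] j(1,6) cohom_nfJ[OF i]] by blast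
  have df: "diffeo_germ U \<Psi>" using \<Psi>(1) by (simp add: symplecto_germ_def)
  have pJ: "param ?J ?F" by (rule param_nfJ[OF i s])
  obtain dN where dN: "dN > 0" "\<And>x. x \<in> C7 \<Longrightarrow> norm x < dN \<Longrightarrow> j x \<in> N" using paramD1[OF j(5)] by blast
  obtain dF where dF: "dF > 0" "\<And>x. x \<in> C7 \<Longrightarrow> norm x < dF \<Longrightarrow> ?J x \<in> ?F" using paramD1[OF pJ] by blast
  have m: "min q dF > 0" "min q dN > 0" using \<Psi>(2) dN(1) dF(1) by auto
  obtain a where a: "a > 0" "\<And>z. z \<in> N \<Longrightarrow> norm z < a \<Longrightarrow> \<exists>x\<in>C7. norm x < min q dF \<and> j x = z"
    using paramD2[OF j(5) m(1)] by blast
  obtain b where b: "b > 0" "\<And>z. z \<in> ?F \<Longrightarrow> norm z < b \<Longrightarrow> \<exists>x\<in>C7. norm x < min q dN \<and> ?J x = z"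
    using paramD2[OF pJ m(2)] by blast
  obtain d where d: "d > 0" "\<And>z. norm z < d \<Longrightarrow> norm (inv_into U \<Psi> z) < a"
    using diffeo_germ_inv_small[OF df a(1)] by blast
  have inj: "inj_on \<Psi> U" using df by (simp add: diffeo_germ_def)
  have "germ_eq (\<Psi> ` (N \<inter> U)) ?F"
    unfolding germ_eq_iff
  proof (intro exI[of _ "min d b"] conjI allI impI iffI)
    fix z :: "real^'m" assume z: "norm z < min d b"
    show "z \<in> ?F" if "z \<in> \<Psi> ` (N \<inter> U)"
    proof -
      obtain y where y: "y \<in> N" "y \<in> U" "z = \<Psi> y" using \<open>z \<in> \<Psi> ` (N \<inter> U)\<close> by blast
      then have "inv_into U \<Psi> z = y" using inj by simp
      then have "norm y < a" using d(2) z by auto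
      then obtain x where "x \<in> C7" "norm x < min q dF" "j x = y" using a(2)[OF y(1)] by blast
      then show ?thesis using \<Psi>(3) dF(2) y(3) by force
    qed
    show "z \<in> \<Psi> ` (N \<inter> U)" if zF: "z \<in> ?F"
    proof -
      obtain x where x: "x \<in> C7" "norm x < min q dN" "?J x = z" using b(2)[OF zF] z by auto
      then have "j x \<in> N \<inter> U" "\<Psi> (j x) = z" using \<Psi>(3)[of x] dN(2)[of x] by auto
      then show ?thesis by blast
    qed
  qed (use d b in auto)
  then show ?thesis unfolding symp_equiv_def using \<Psi>(1) by blast
qed

text \<open>By \<open>gram\<close> the tangent space, of dimension 3, would be isotropic and hence
  orthogonal to its image under \<open>Jm\<close>, so that the two would span 6 dimensions in R^4.
  This is why the last five families start in dimension 6.\<close>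

lemma rep_nonzero_dim4:
  assumes "rep N c" "n = 2" "c 7 = 0" "c 8 = 0" "c 9 = 0"
  shows False
proof -
  obtain r j where j: "r > 0" "smooth_on (ball 0 r) j" "j 0 = 0" "inj (fd j 0)" "cohom r (lam j) (nfK c)"
    using assms(1) unfolding rep_def by blast
  let ?D = "fd j 0"
  have l: "linear ?D" by (rule linear_fd[OF j(2)]) (use j(1) in simp)
  note g = gram[OF j(5,1,2,3), unfolded assms(3-5)]
  have z: "om (?D (axis a 1)) (?D (axis b 1)) = 0" for a b :: 3
    using g om_swap[of "?D (axis a 1)" "?D (axis b 1)"] exhaust_3[of a] exhaust_3[of b] by auto
  have ex: "?D v = (\<Sum>i\<in>UNIV. v $ i *\<^sub>R ?D (axis i 1))" for v
    by (rule fd_axis_expand[OF smooth_on_differentiable[OF j(2)]]) (use j(1) in simp)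
  have iso: "om (?D u) (?D v) = 0" for u v
    unfolding ex[of u] ex[of v]
    by (simp add: bounded_bilinear.sum_left[OF om_bilinear] bounded_bilinear.sum_right[OF om_bilinear] om_simps z)
  let ?A = "range ?D" and ?B = "Jm ` range ?D"
  have sA: "subspace ?A" using linear_subspace_image[OF l subspace_UNIV] .
  have sB: "subspace ?B" using linear_subspace_image[OF linear_Jm sA] .
  have dA: "dim ?A = 3"
    using dim_image_eq[OF l, of UNIV] j(4) by (simp add: dim_UNIV)
  have injJ: "inj Jm"
  proof (rule injI)
    fix a b assume "Jm a = Jm b"
    then show "a = b" using Jm_Jm by (metis neg_equal_iff_equal)
  qed
  have dB: "dim ?B = 3"
    using dim_image_eq[OF linear_Jm, of ?A] injJ dA by (simp add: inj_on_subset)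
  have "?A \<inter> ?B = {0}"
  proof -
    have "x = 0" if x: "x \<in> ?A" "x \<in> ?B" for x
    proof -
      obtain u v where "x = ?D u" "x = Jm (?D v)" using x by blast
      then have "x \<bullet> x = om (?D v) (?D u)" by (simp add: om_eq_inner)
      then show ?thesis by (simp add: iso)
    qed
    then show ?thesis using subspace_0[OF sA] subspace_0[OF sB] by blast
  qed
  then have "dim {x + y |x y. x \<in> ?A \<and> y \<in> ?B} = 6"
    using dim_sums_Int[OF sA sB] dA dB by simp
  moreover have "dim {x + y |x y. x \<in> ?A \<and> y \<in> ?B} \<le> DIM(real^'m)" by (rule dim_subset_UNIV)
  ultimately show False using card_m assms(2) by simp
qed

text \<open>The first nonzero coefficient, of weight \<open>w\<close>, decides the family. The
  substitutions remove those later coefficients that it can reach, in increasing order because a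
  step also disturbs higher weights; the others remain as parameters. Scaling multiplies the leading
  coefficient by \<open>l ^ w\<close>, which normalizes it completely for odd \<open>w\<close> and
  up to a sign for even \<open>w\<close>.\<close>

lemma rep_normalize:
  assumes "rep N c"
  shows "\<exists>i s c1 c2. min_dim i \<le> 2 * n \<and> (s = 1 \<or> s = -1) \<and> rep N (nfc i s c1 c2)"
proof -
  have cong: "rep N c'" if "rep N c" "\<And>w. w \<in> {7, 8, 9, 10, 11, 13, 14} \<Longrightarrow> c w = c' w" for c c'
    using that nfK_cong[of c c'] unfolding rep_def by metis
  have odd_root: "\<exists>l. l \<noteq> 0 \<and> l ^ w * a = 1 / real w" if "a \<noteq> 0" "odd w" for a :: real and w
  proof (intro exI conjI)
    have "w > 0" using that(2) by (auto elim: oddE)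
    show "root w (1 / (real w * a)) ^ w * a = 1 / real w"
      using that by (simp add: odd_real_root_pow)
    show "root w (1 / (real w * a)) \<noteq> 0" using that \<open>w > 0\<close> by simp
  qed
  have even_root: "\<exists>l s. l \<noteq> 0 \<and> (s = 1 \<or> s = -1) \<and> l ^ w * a = s / real w" if "a \<noteq> 0" "w > 0" for a :: real and w
  proof (intro exI conjI)
    have "root w (1 / (real w * \<bar>a\<bar>)) ^ w = 1 / (real w * \<bar>a\<bar>)"
      using that by (intro real_root_pow_pos2) auto
    then show "root w (1 / (real w * \<bar>a\<bar>)) ^ w * a = sgn a / real w"
      using that by (simp add: sgn_if field_simps)
    show "root w (1 / (real w * \<bar>a\<bar>)) \<noteq> 0" using that by simp
    show "sgn a = 1 \<or> sgn a = -1" using that by (auto simp: sgn_if)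
  qed
  have scale: "rep N (\<lambda>w. l ^ w * c w)" if "rep N c" "l \<noteq> 0" for c l
    by (rule rep_step[OF that(1) nf_step_const[OF that(2)]])
  have fin: "\<exists>i s c1 c2. min_dim i \<le> 2 * n \<and> (s = 1 \<or> s = -1) \<and> rep N (nfc i s c1 c2)"
    if "min_dim i \<le> 2 * n" "s = 1 \<or> s = -1" "rep N (nfc i s a b)" for i s a b
    using that by blast
  note steps = rep_step[OF _ nf_step_x3] rep_step[OF _ nf_step_x1] rep_step[OF _ nf_step_x3x3] rep_step[OF _ nf_step_x1x3] rep_step[OF _ nf_step_x2]
  consider "c 7 \<noteq> 0" | "c 7 = 0" "c 8 \<noteq> 0" | "c 7 = 0" "c 8 = 0" "c 9 \<noteq> 0"
    | "c 7 = 0" "c 8 = 0" "c 9 = 0" by blast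
  then show ?thesis
  proof cases
    case 1
    obtain c1 where c1: "rep N c1" "c1 7 \<noteq> 0" "c1 10 = 0"
      by (rule that[OF steps(1)[OF assms, of "- c 10 / (7 * c 7)"]]) (use 1 in auto)
    obtain c2 where c2: "rep N c2" "c2 7 \<noteq> 0" "c2 10 = 0" "c2 11 = 0"
      by (rule that[OF steps(2)[OF c1(1), of "- c1 11 / (7 * c1 7)"]]) (use c1 in auto)
    obtain c3 where c3: "rep N c3" "c3 7 \<noteq> 0" "c3 10 = 0" "c3 11 = 0" "c3 13 = 0"
      by (rule that[OF steps(3)[OF c2(1), of "- c2 13 / (7 * c2 7)"]]) (use c2 in auto)
    obtain c4 where c4: "rep N c4" "c4 7 \<noteq> 0" "c4 10 = 0" "c4 11 = 0" "c4 13 = 0" "c4 14 = 0"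
      by (rule that[OF steps(4)[OF c3(1), of "- c3 14 / (7 * c3 7)"]]) (use c3 in auto)
    obtain l where l: "l \<noteq> 0" "l ^ 7 * c4 7 = 1 / real 7" using odd_root[OF c4(2), of 7] by auto
    have "rep N (nfc U7_0 1 (8 * (l ^ 8 * c4 8)) (9 * (l ^ 9 * c4 9)))"
      by (rule cong[OF scale[OF c4(1) l(1)]]) (use c4 l in auto)
    then show ?thesis by (rule fin[rotated 2]) (use n_ge in auto)
  next
    case 2
    \<comment> \<open>With \<open>c 7 = 0\<close>, only scaling changes the coefficients 9 and 10;
      they become the two parameters.\<close>
    obtain c1 where c1: "rep N c1" "c1 7 = 0" "c1 8 \<noteq> 0" "c1 11 = 0"
      by (rule that[OF steps(1)[OF assms, of "c 11 / (16 * c 8)"]]) (use 2 in auto)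
    obtain c2 where c2: "rep N c2" "c2 7 = 0" "c2 8 \<noteq> 0" "c2 11 = 0" "c2 13 = 0"
      by (rule that[OF steps(5)[OF c1(1), of "c1 13 / (48 * c1 8)"]]) (use c1 in auto)
    obtain c3 where c3: "rep N c3" "c3 7 = 0" "c3 8 \<noteq> 0" "c3 11 = 0" "c3 13 = 0" "c3 14 = 0"
      by (rule that[OF steps(3)[OF c2(1), of "c2 14 / (16 * c2 8)"]]) (use c2 in auto)
    obtain l s where l: "l \<noteq> 0" "s = 1 \<or> s = -1" "l ^ 8 * c3 8 = s / real 8" using even_root[OF c3(3), of 8] by auto
    have "rep N (nfc U7_1 s (9 * (l ^ 9 * c3 9)) (10 * (l ^ 10 * c3 10)))"
      by (rule cong[OF scale[OF c3(1) l(1)]]) (use c3 l in auto)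
    then show ?thesis by (rule fin[rotated 2]) (use n_ge l(2) in auto)
  next
    case 3
    obtain c1 where c1: "rep N c1" "c1 7 = 0" "c1 8 = 0" "c1 9 \<noteq> 0" "c1 13 = 0"
      by (rule that[OF steps(2)[OF assms, of "c 13 / (27 * c 9)"]]) (use 3 in auto)
    obtain c2 where c2: "rep N c2" "c2 7 = 0" "c2 8 = 0" "c2 9 \<noteq> 0" "c2 13 = 0" "c2 14 = 0"
      by (rule that[OF steps(5)[OF c1(1), of "c1 14 / (54 * c1 9)"]]) (use c1 in auto)
    obtain l where l: "l \<noteq> 0" "l ^ 9 * c2 9 = 1 / real 9" using odd_root[OF c2(4), of 9] by auto
    have "rep N (nfc U7_2 1 (10 * (l ^ 10 * c2 10)) (11 * (l ^ 11 * c2 11)))"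
      by (rule cong[OF scale[OF c2(1) l(1)]]) (use c2 l in auto)
    then show ?thesis by (rule fin[rotated 2]) (use n_ge in auto)
  next
    case 4
    have n3: "n \<ge> 3" using rep_nonzero_dim4[OF assms _ 4] n_ge by (cases "n = 2") auto
    consider "c 10 \<noteq> 0" | "c 10 = 0" "c 11 \<noteq> 0" | "c 10 = 0" "c 11 = 0" "c 13 \<noteq> 0"
      | "c 10 = 0" "c 11 = 0" "c 13 = 0" "c 14 \<noteq> 0" | "c 10 = 0" "c 11 = 0" "c 13 = 0" "c 14 = 0" by blast
    then show ?thesis
    proof cases
      case 1
      obtain c1 where c1: "rep N c1" "c1 7 = 0" "c1 8 = 0" "c1 9 = 0" "c1 10 \<noteq> 0" "c1 13 = 0"
        by (rule that[OF steps(1)[OF assms, of "- c 13 / (10 * c 10)"]]) (use 1 4 in auto)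
      obtain c2 where c2: "rep N c2" "c2 7 = 0" "c2 8 = 0" "c2 9 = 0" "c2 10 \<noteq> 0" "c2 13 = 0" "c2 14 = 0"
        by (rule that[OF steps(2)[OF c1(1), of "- c1 14 / (10 * c1 10)"]]) (use c1 in auto)
      obtain l s where l: "l \<noteq> 0" "s = 1 \<or> s = -1" "l ^ 10 * c2 10 = s / real 10" using even_root[OF c2(5), of 10] by auto
      have "rep N (nfc U7_3 s (11 * (l ^ 11 * c2 11)) 0)"
        by (rule cong[OF scale[OF c2(1) l(1)]]) (use c2 l in auto)
      then show ?thesis by (rule fin[rotated 2]) (use n3 l(2) in auto)
    next
      case 2
      obtain c1 where c1: "rep N c1" "c1 7 = 0" "c1 8 = 0" "c1 9 = 0" "c1 10 = 0" "c1 11 \<noteq> 0" "c1 14 = 0"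
        by (rule that[OF steps(1)[OF assms, of "- c 14 / (11 * c 11)"]]) (use 2 4 in auto)
      obtain l where l: "l \<noteq> 0" "l ^ 11 * c1 11 = 1 / real 11" using odd_root[OF c1(6), of 11] by auto
      have "rep N (nfc U7_4 1 (13 * (l ^ 13 * c1 13)) 0)"
        by (rule cong[OF scale[OF c1(1) l(1)]]) (use c1 l in auto)
      then show ?thesis by (rule fin[rotated 2]) (use n3 in auto)
    next
      case 3
      \<comment> \<open>No variable has weight 1, so no substitution leads from weight 13 to weight
        14. Only scaling is available, and coefficient 14 stays as the parameter.\<close>
      obtain l where l: "l \<noteq> 0" "l ^ 13 * c 13 = 1 / real 13" using odd_root[OF 3(3), of 13] by auto
      have "rep N (nfc U7_5 1 (- 14 * (l ^ 14 * c 14)) 0)"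
        by (rule cong[OF scale[OF assms l(1)]]) (use 3 4 l in auto)
      then show ?thesis by (rule fin[rotated 2]) (use n3 in auto)
    next
      case 4
      obtain l s where l: "l \<noteq> 0" "s = 1 \<or> s = -1" "l ^ 14 * c 14 = s / real 14" using even_root[OF 4(4), of 14] by auto
      have "rep N (nfc U7_6 s 0 0)"
        by (rule cong[OF scale[OF assms l(1)]]) (use \<open>c 7 = 0\<close> \<open>c 8 = 0\<close> \<open>c 9 = 0\<close> 4 l in auto)
      then show ?thesis by (rule fin[rotated 2]) (use n3 l(2) in auto)
    next
      case 5
      have "rep N (nfc U7_7 1 0 0)"
        by (rule cong[OF assms]) (use \<open>c 7 = 0\<close> \<open>c 8 = 0\<close> \<open>c 9 = 0\<close> 5 in auto)
      then show ?thesis by (rule fin[rotated 2]) (use n3 in auto)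
    qed
  qed
qed

theorem normal_form_exists:
  assumes "in_U7_class e N"
  shows "\<exists>i s c1 c2. min_dim i \<le> 2 * n \<and> (s = 1 \<or> s = -1) \<and> symp_equiv e N (normal_form e i s c1 c2)"
proof -
  obtain c where "rep N c" using rep_exists[OF assms] by blast
  from rep_normalize[OF this] show ?thesis using symp_equiv_nf by blast
qed

end

section \<open>Upper bounds for the invariants\<close>

lemma dir_derivs_snoc: "dir_derivs (vs @ [b]) f = dir_derivs vs (\<lambda>x. fd f x b)"
  by (induction vs) auto

lemma smooth_on_dir_derivs: "smooth_on U f \<Longrightarrow> smooth_on U (dir_derivs vs f)"
  by (induction vs) (auto intro: smooth_on_fd)

lemma enat_le_vanishing_order_iff:
  "enat k \<le> vanishing_order D f \<longleftrightarrow> (\<forall>vs. set vs \<subseteq> D \<longrightarrow> length vs < k \<longrightarrow> dir_derivs vs f 0 = 0)"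
proof -
  have "enat k \<le> vanishing_order D f \<longleftrightarrow> (\<forall>vs. set vs \<subseteq> D \<longrightarrow> dir_derivs vs f 0 \<noteq> 0 \<longrightarrow> k \<le> length vs)"
    unfolding vanishing_order_def le_Inf_iff by (simp only: Ball_def mem_Collect_eq enat_ord_simps(1)[symmetric]) blast
  then show ?thesis by (auto simp: not_le[symmetric])
qed

text \<open>The segment from 0 to \<open>y\<close> stays in the subspace spanned by
  \<open>D\<close>, so the mean value theorem involves only derivatives in these directions, and
  they inherit the hypothesis with order lowered by one.\<close>

lemma bound_of_vanishing_order:
  fixes f :: "'a::euclidean_space \<Rightarrow> real"
  assumes f: "smooth_on (ball 0 r) f" and r: "r > 0" and D: "D \<subseteq> Basis"
    and k: "enat k \<le> vanishing_order D f"
  shows "\<exists>C\<ge>0. \<forall>y. norm y < r / 2 \<longrightarrow> (\<forall>b\<in>Basis - D. y \<bullet> b = 0) \<longrightarrow> \<bar>f y\<bar> \<le> C * norm y ^ k"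
  using f k
proof (induction k arbitrary: f)
  case 0
  obtain M where M: "\<forall>x. norm x \<le> r / 2 \<longrightarrow> norm (f x) \<le> M" using smooth_local_bound[OF 0(1) r] by blast
  then have "M \<ge> 0" using r by (smt (verit) norm_ge_zero norm_zero divide_nonneg_nonneg)
  then show ?case using M by (intro exI[of _ M]) auto
next
  case (Suc k)
  have f0: "f 0 = 0" using Suc.prems(2) unfolding enat_le_vanishing_order_iff by (metis dir_derivs.simps(1) empty_subsetI list.set(1) list.size(3) zero_less_Suc)
  have "\<exists>C\<ge>0. \<forall>y. norm y < r / 2 \<longrightarrow> (\<forall>b\<in>Basis - D. y \<bullet> b = 0) \<longrightarrow> \<bar>fd f y b\<bar> \<le> C * norm y ^ k" if "b \<in> D" for b
  proof (rule Suc.IH)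
    show "smooth_on (ball 0 r) (\<lambda>y. fd f y b)" by (rule smooth_on_fd[OF Suc.prems(1)])
    show "enat k \<le> vanishing_order D (\<lambda>y. fd f y b)"
      unfolding enat_le_vanishing_order_iff
    proof (intro allI impI)
      fix vs assume "set vs \<subseteq> D" "length vs < k"
      then have "dir_derivs (vs @ [b]) f 0 = 0"
        using Suc.prems(2) that unfolding enat_le_vanishing_order_iff by simp
      then show "dir_derivs vs (\<lambda>y. fd f y b) 0 = 0" by (simp add: dir_derivs_snoc)
    qed
  qed
  then have "\<forall>b\<in>D. \<exists>C\<ge>0. \<forall>y. norm y < r / 2 \<longrightarrow> (\<forall>b\<in>Basis - D. y \<bullet> b = 0) \<longrightarrow> \<bar>fd f y b\<bar> \<le> C * norm y ^ k" by blast
  from bchoice[OF this] obtain C where C: "\<And>b. b \<in> D \<Longrightarrow> C b \<ge> 0"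
    "\<And>b y. b \<in> D \<Longrightarrow> norm y < r / 2 \<Longrightarrow> (\<forall>b\<in>Basis - D. y \<bullet> b = 0) \<Longrightarrow> \<bar>fd f y b\<bar> \<le> C b * norm y ^ k"
    by blast
  have finD: "finite D" using D finite_Basis finite_subset by blast
  have "\<bar>f y\<bar> \<le> (\<Sum>b\<in>D. C b) * norm y ^ Suc k" if y: "norm y < r / 2" "\<forall>b\<in>Basis - D. y \<bullet> b = 0" for y
  proof -
    have "f differentiable (at (0 + s *\<^sub>R y))" if "0 \<le> s" "s \<le> 1" for s
    proof (rule smooth_on_differentiable[OF Suc.prems(1)])
      have "norm (s *\<^sub>R y) \<le> norm y" using that by (simp add: mult_left_le_one_le)
      then show "0 + s *\<^sub>R y \<in> ball 0 r" using y(1) r by simp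
    qed
    from mvt_line[of 1 f 0 y, OF _ this] obtain s where s: "0 < s" "s < 1" "f y - f 0 = fd f (s *\<^sub>R y) y" by auto
    have sy: "norm (s *\<^sub>R y) \<le> norm y" using s by (simp add: mult_left_le_one_le)
    have df: "f differentiable (at (s *\<^sub>R y))"
      using smooth_on_differentiable[OF Suc.prems(1)] sy y(1) r by simp
    have "fd f (s *\<^sub>R y) y = (\<Sum>b\<in>Basis. (y \<bullet> b) *\<^sub>R fd f (s *\<^sub>R y) b)" by (rule fd_basis_expand[OF df])
    also have "\<dots> = (\<Sum>b\<in>D. (y \<bullet> b) *\<^sub>R fd f (s *\<^sub>R y) b)"
      using D y(2) by (intro sum.mono_neutral_right) auto
    finally have e: "f y = (\<Sum>b\<in>D. (y \<bullet> b) * fd f (s *\<^sub>R y) b)" using s(3) f0 by simp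
    have "\<bar>f y\<bar> \<le> (\<Sum>b\<in>D. \<bar>(y \<bullet> b) * fd f (s *\<^sub>R y) b\<bar>)" unfolding e by (rule sum_abs)
    also have "\<dots> \<le> (\<Sum>b\<in>D. norm y * (C b * norm y ^ k))"
    proof (rule sum_mono)
      fix b assume b: "b \<in> D"
      have "\<bar>y \<bullet> b\<bar> \<le> norm y" using Basis_le_norm b D by blast
      moreover have "\<bar>fd f (s *\<^sub>R y) b\<bar> \<le> C b * norm (s *\<^sub>R y) ^ k"
        using C(2)[OF b, of "s *\<^sub>R y"] y sy by simp
      moreover have "C b * norm (s *\<^sub>R y) ^ k \<le> C b * norm y ^ k"
        using C(1)[OF b] sy by (intro mult_left_mono power_mono) auto
      ultimately show "\<bar>(y \<bullet> b) * fd f (s *\<^sub>R y) b\<bar> \<le> norm y * (C b * norm y ^ k)"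
        unfolding abs_mult by (intro mult_mono) auto
    qed
    also have "\<dots> = (\<Sum>b\<in>D. C b) * norm y ^ Suc k" by (simp add: sum_distrib_left sum_distrib_right mult_ac)
    finally show ?thesis .
  qed
  then show ?case using C(1) by (intro exI[of _ "\<Sum>b\<in>D. C b"]) (auto intro: sum_nonneg)
qed

text \<open>Together with \<open>f\<close> its Maclaurin polynomial of degree below \<open>m\<close>
  is \<open>O(t^m)\<close>, which forces all its coefficients to vanish.\<close>

lemma vanishing_order_of_bound:
  fixes f :: "real \<Rightarrow> real"
  assumes f: "smooth_on (ball 0 r) f" and r: "r > 0" and b: "\<And>t. \<bar>t\<bar> < r \<Longrightarrow> \<bar>f t\<bar> \<le> C * \<bar>t\<bar> ^ m"
  shows "enat m \<le> vanishing_order {1} f"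
proof -
  define df where "df k = dir_derivs (replicate k 1) f" for k
  have df_s: "smooth_on (ball 0 r) (df k)" for k unfolding df_def by (rule smooth_on_dir_derivs[OF f])
  have DERIV_df: "DERIV (df k) t :> df (Suc k) t" if "\<bar>t\<bar> < r" for k t
  proof -
    have t: "t \<in> ball 0 r" using that by simp
    have "(df k has_derivative fd (df k) t) (at t)" by (rule smooth_on_has_derivative[OF df_s t])
    moreover have "fd (df k) t h = h * df (Suc k) t" for h
    proof -
      have "fd (df k) t (h *\<^sub>R 1) = h *\<^sub>R fd (df k) t 1" by (rule linear_scale[OF linear_fd[OF df_s t]])
      moreover have "fd (df k) t 1 = df (Suc k) t" by (simp add: df_def)
      ultimately show ?thesis by simp
    qed
    then have "fd (df k) t = (\<lambda>h. h * df (Suc k) t)" by (rule ext)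
    ultimately show ?thesis by (simp add: has_field_derivative_def mult_commute_abs)
  qed
  obtain M where M: "\<forall>t. norm t \<le> r / 2 \<longrightarrow> norm (df m t) \<le> M" using smooth_local_bound[OF df_s r] by blast
  define p where "p = (\<Sum>k<m. monom (df k 0 / fact k) k)"
  have "\<bar>poly p t\<bar> \<le> (\<bar>C\<bar> + M) * \<bar>t\<bar> ^ m" if t: "\<bar>t\<bar> < r / 2" for t
  proof -
    have "\<exists>u. \<bar>u\<bar> \<le> \<bar>t\<bar> \<and> f t = (\<Sum>k<m. df k 0 / fact k * t ^ k) + df m u / fact m * t ^ m"
      by (rule Maclaurin_bi_le) (use DERIV_df t r in \<open>auto simp: df_def\<close>)
    then obtain u where u: "\<bar>u\<bar> \<le> \<bar>t\<bar>" "f t = poly p t + df m u / fact m * t ^ m"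
      by (auto simp: p_def poly_sum poly_monom)
    have "\<bar>df m u / fact m\<bar> \<le> M"
    proof -
      have "\<bar>df m u\<bar> \<le> M" using M u(1) t by simp
      moreover have "\<bar>df m u\<bar> / fact m \<le> \<bar>df m u\<bar> / 1" by (rule divide_left_mono) (auto simp: fact_ge_1)
      ultimately show ?thesis by simp
    qed
    then have "\<bar>df m u / fact m * t ^ m\<bar> \<le> M * \<bar>t\<bar> ^ m" by (simp only: abs_mult power_abs) (intro mult_right_mono, auto)
    moreover have "\<bar>f t\<bar> \<le> \<bar>C\<bar> * \<bar>t\<bar> ^ m"
      using b[of t] t r by (smt (verit) mult_right_mono zero_le_power abs_ge_zero abs_ge_self field_sum_of_halves)
    ultimately show ?thesis unfolding u(2) distrib_right by linarith
  qed
  then have "coeff p k = 0" if "k < m" for k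
    using r that by (intro coeff_zero_of_bound[of "r/2" p "\<bar>C\<bar> + M" m]) auto
  moreover have "coeff p k = df k 0 / fact k" if "k < m" for k
    using that by (simp add: p_def coeff_sum)
  ultimately have z: "df k 0 = 0" if "k < m" for k using that by fastforce
  show ?thesis
    unfolding enat_le_vanishing_order_iff
  proof (intro allI impI)
    fix vs :: "real list" assume "set vs \<subseteq> {1}" "length vs < m"
    moreover from this have "vs = replicate (length vs) 1"
      by (metis replicate_eqI singletonD subset_iff)
    ultimately show "dir_derivs vs f 0 = 0" using z[of "length vs"] by (simp add: df_def)
  qed
qed

text \<open>Orders 1 and 2 are the finite nonzero values of the index of isotropy. They are settled
  by the value and the first derivative at 0, with no Taylor expansion in several variables.\<close>

lemma vanishing_order_of_bound2:
  fixes f :: "real^'n \<Rightarrow> real"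
  assumes "d > 0" "\<And>y. norm y < d \<Longrightarrow> \<bar>f y\<bar> \<le> C * norm y ^ k" "k = 1 \<or> k = 2"
  shows "enat k \<le> vanishing_order D f"
proof -
  have f0: "f 0 = 0" using assms(2)[of 0] assms(1,3) by auto
  have fd0: "fd f 0 v = 0" if "k = 2" for v
  proof -
    have "(f has_derivative (\<lambda>_. 0)) (at 0)"
      unfolding has_derivative_at
    proof
      have "((\<lambda>h. norm (f (0 + h) - f 0 - 0) / norm h) \<longlongrightarrow> 0) (at 0)"
      proof (rule Lim_null_comparison)
        show "\<forall>\<^sub>F h in at 0. norm (norm (f (0 + h) - f 0 - 0) / norm h) \<le> C * norm h"
          unfolding eventually_at
        proof (intro exI[of _ d] conjI ballI impI)
          fix h :: "real^'n" assume h: "h \<noteq> 0 \<and> dist h 0 < d"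
          then have "\<bar>f h\<bar> \<le> (C * norm h) * norm h" using assms(2)[of h] that by (simp add: power2_eq_square mult.assoc)
          then show "norm (norm (f (0 + h) - f 0 - 0) / norm h) \<le> C * norm h" using h f0 by (simp add: divide_le_eq)
        qed fact
        have "((\<lambda>h::real^'n. C * norm h) \<longlongrightarrow> C * norm (0::real^'n)) (at 0)" by (intro tendsto_intros)
        then show "((\<lambda>h::real^'n. C * norm h) \<longlongrightarrow> 0) (at 0)" by simp
      qed
      then show "(\<lambda>h. norm (f (0 + h) - f 0 - 0) / norm h) \<midarrow>0\<rightarrow> 0" .
    qed simp
    then show ?thesis by (simp add: fd_eq)
  qed
  show ?thesis
    unfolding enat_le_vanishing_order_iff
  proof (intro allI impI)
    fix vs :: "(real^'n) list" assume "length vs < k"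
    then consider "vs = []" | v where "vs = [v]" "k = 2" using assms(3) by (cases vs; cases "tl vs") auto
    then show "dir_derivs vs f 0 = 0" by cases (use f0 fd0 in auto)
  qed
qed

text \<open>
  A tangent branch of the other kind would give \<open>\<tau>^4 = t v\<^sub>1 + O(t\<^sup>2)\<close> with \<open>\<bar>\<tau>\<bar>^3\<close> comparable to
  \<open>\<bar>t\<bar>\<close>, which is impossible whether or not \<open>v\<^sub>1 = 0\<close>.
\<close>
lemma smooth_branch_preserved:
  fixes h :: "real^3 \<Rightarrow> real^3"
  assumes h: "smooth_on (ball 0 r) h" "r > 0" "h 0 = 0"
    and m: "\<And>x. x \<in> C7 \<Longrightarrow> norm x < r \<Longrightarrow> h x \<in> C7 \<and> norm (h x) \<le> A * norm x \<and> norm x \<le> B * norm (h x)"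
  shows "\<exists>d>0. \<forall>t. \<bar>t\<bar> < d \<longrightarrow> h (g1 t) \<in> range g1"
proof -
  have 0: "0 \<in> ball (0::real^3) r" using h(2) by simp
  define v where "v = fd h 0 (axis 2 1) $ 1"
  have bl: "bounded_linear (fd h 0)" using linear_fd[OF h(1) 0] by (simp add: linear_conv_bounded_linear)
  have "smooth_on (ball 0 r) (\<lambda>x. h x - fd h 0 x)" by (intro smooth_on_diff open_ball h smooth_on_bounded_linear bl)
  moreover have "fd (\<lambda>x. h x - fd h 0 x) 0 w = 0" for w
    using fun_cong[OF fd_eq[OF has_derivative_diff[OF smooth_on_has_derivative[OF h(1) 0] bounded_linear_imp_has_derivative[OF bl]]]] by simp
  moreover have "h 0 - fd h 0 0 = 0" using h(3) linear_0[OF linear_fd[OF h(1) 0]] by simp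
  ultimately obtain K where K: "K \<ge> 0" "\<And>x. norm x \<le> r / 2 \<Longrightarrow> norm (h x - fd h 0 x) \<le> K * norm x ^ 2"
    using taylor2[of r "\<lambda>x. h x - fd h 0 x"] h(2) by metis
  have g1: "\<bar>h (g1 t) $ 1 - t * v\<bar> \<le> K * t ^ 2" if "\<bar>t\<bar> \<le> r / 2" for t
  proof -
    have "g1 t = t *\<^sub>R axis 2 1" by (simp add: vec3_eq_iff axis_def)
    then have "(h (g1 t) - fd h 0 (g1 t)) $ 1 = h (g1 t) $ 1 - t * v"
      using linear_scale[OF linear_fd[OF h(1) 0]] by (simp add: v_def)
    then show ?thesis using K(2)[of "g1 t"] component_le_norm_cart[of "h (g1 t) - fd h 0 (g1 t)" 1] that by simp
  qed
  define A' B' where "A' = \<bar>A\<bar> + 1" and "B' = \<bar>B\<bar> + 1"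
  have AB: "A' > 0" "B' > 0" by (auto simp: A'_def B'_def)
  \<comment> \<open>The entries keep \<open>\<tau>\<close> below 1 and contradict the two final
    inequalities: for \<open>v = 0\<close> one gets \<open>1 \<le> 9 * K * B'^2 * \<tau>^2\<close>,
    and otherwise \<open>\<bar>v\<bar> \<le> (A' + K) * \<eta>\<close>.\<close>
  define \<eta> where "\<eta> = min (1/2) (min (1 / (9 * K * B'^2 + 1)) (if v = 0 then 1 else \<bar>v\<bar> / (2 * (A' + K))))"
  have AK: "A' + K > 0" using AB K(1) by simp
  have KB: "9 * K * B'^2 \<ge> 0" using K(1) by simp
  have \<eta>: "\<eta> > 0" "\<eta> \<le> 1/2" using AK KB by (auto simp: \<eta>_def add_nonneg_pos)
  have \<eta>1: "9 * K * B'^2 * \<eta> < 1"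
  proof -
    have "\<eta> \<le> 1 / (9 * K * B'^2 + 1)" by (simp add: \<eta>_def)
    then have "9 * K * B'^2 * \<eta> \<le> 9 * K * B'^2 * (1 / (9 * K * B'^2 + 1))" using KB by (rule mult_left_mono)
    also have "\<dots> < 1" using KB by (simp add: divide_less_eq)
    finally show ?thesis .
  qed
  have \<eta>2: "(A' + K) * \<eta> < \<bar>v\<bar>" if "v \<noteq> 0"
  proof -
    have "\<eta> \<le> \<bar>v\<bar> / (2 * (A' + K))" using that by (simp add: \<eta>_def)
    then have "(A' + K) * \<eta> \<le> (A' + K) * (\<bar>v\<bar> / (2 * (A' + K)))" using AK by (intro mult_left_mono) auto
    also have "\<dots> = \<bar>v\<bar> / 2" using AK by (simp add: field_simps)
    finally show ?thesis using that by simp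
  qed
  define d where "d = min (r / 2) (min \<eta> (\<eta>^3 / A'))"
  have d: "d > 0" using h(2) \<eta>(1) AB by (simp add: d_def)
  have "h (g1 t) \<in> range g1" if t: "\<bar>t\<bar> < d" for t
  proof (rule ccontr)
    assume n: "h (g1 t) \<notin> range g1"
    have "h (g1 0) = g1 0" using h(3) by (metis (no_types, lifting) g1_nth vec3_eq_iff zero_index)
    then have t0: "t \<noteq> 0" using n by auto
    have tr: "\<bar>t\<bar> < r / 2" "\<bar>t\<bar> < \<eta>" "\<bar>t\<bar> < \<eta>^3 / A'" using t by (auto simp: d_def)
    have "g1 t \<in> C7" "norm (g1 t) < r" using tr h(2) by (auto simp: C7_def)
    note mt = m[OF this]
    then obtain \<tau> where \<tau>: "h (g1 t) = g2 \<tau>" using n by (auto simp: C7_def)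
    have 1: "\<bar>\<tau>\<bar>^3 \<le> A' * \<bar>t\<bar>"
    proof -
      have "\<bar>\<tau>\<bar>^3 \<le> A * \<bar>t\<bar>" using norm_g2_ge[of \<tau>] mt \<tau> by simp
      also have "\<dots> \<le> A' * \<bar>t\<bar>" by (intro mult_right_mono) (auto simp: A'_def)
      finally show ?thesis .
    qed
    have "\<bar>\<tau>\<bar>^3 < \<eta>^3" using 1 tr(3) AB by (simp add: field_simps)
    then have \<tau>\<eta>: "\<bar>\<tau>\<bar> < \<eta>" using \<eta>(1) by (simp add: power_less_imp_less_base)
    have 2: "\<bar>t\<bar> \<le> 3 * B' * \<bar>\<tau>\<bar>^3"
    proof -
      have "\<bar>t\<bar> \<le> B * norm (g2 \<tau>)" using mt \<tau> by simp
      also have "\<dots> \<le> B' * norm (g2 \<tau>)" by (intro mult_right_mono) (auto simp: B'_def)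
      also have "\<dots> \<le> B' * (3 * \<bar>\<tau>\<bar>^3)" using \<tau>\<eta> \<eta>(2) AB by (intro mult_left_mono norm_g2_le) auto
      finally show ?thesis by simp
    qed
    then have \<tau>0: "\<tau> \<noteq> 0" using t0 by auto
    have 3: "\<bar>\<tau>^4 - t * v\<bar> \<le> K * t^2" using g1[of t] tr(1) \<tau> by simp
    have \<tau>4: "\<tau>^4 = \<bar>\<tau>\<bar> * \<bar>\<tau>\<bar>^3" by (simp add: power_numeral_reduce abs_mult[symmetric])
    show False
    proof (cases "v = 0")
      case True
      have "t^2 \<le> (3 * B' * \<bar>\<tau>\<bar>^3)^2" using 2 AB by (intro power2_le_iff_abs_le[THEN iffD2]) auto
      then have "\<tau>^4 \<le> K * (3 * B' * \<bar>\<tau>\<bar>^3)^2"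
      proof -
        have "\<tau>^4 \<le> K * t^2" using 3 True by simp
        also have "\<dots> \<le> K * (3 * B' * \<bar>\<tau>\<bar>^3)^2" using \<open>t^2 \<le> (3 * B' * \<bar>\<tau>\<bar>^3)^2\<close> K(1) by (rule mult_left_mono)
        finally show ?thesis .
      qed
      also have "\<dots> = \<tau>^4 * (9 * K * B'^2 * \<tau>^2)" by (simp add: power_mult_distrib power_even_abs flip: power_mult power_add)
      finally have "1 \<le> 9 * K * B'^2 * \<tau>^2" using \<tau>0 by (simp add: mult_le_cancel_left1 zero_less_power_eq)
      also have "\<dots> \<le> 9 * K * B'^2 * \<eta>"
      proof (rule mult_left_mono[OF _ KB])
        have "\<tau>^2 = \<bar>\<tau>\<bar> * \<bar>\<tau>\<bar>" by (simp add: power2_eq_square)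
        also have "\<dots> \<le> \<eta> * 1" using \<tau>\<eta> \<eta> by (intro mult_mono) auto
        finally show "\<tau>^2 \<le> \<eta>" by simp
      qed
      finally show False using \<eta>1 by simp
    next
      case False
      have "\<bar>t\<bar> * \<bar>v\<bar> \<le> \<bar>\<tau>\<bar> * \<bar>\<tau>\<bar>^3 + K * \<bar>t\<bar> * \<bar>t\<bar>"

      proof -
        have "\<bar>t\<bar> * \<bar>v\<bar> = \<bar>t * v\<bar>" by (simp add: abs_mult)
        moreover have "K * \<bar>t\<bar> * \<bar>t\<bar> = K * t^2" by (simp add: power2_eq_square)
        moreover have "\<tau>^4 \<ge> 0" by simp
        ultimately show ?thesis using 3 unfolding \<tau>4[symmetric] by linarith
      qed
      also have "\<dots> \<le> \<eta> * (A' * \<bar>t\<bar>) + K * \<bar>t\<bar> * \<eta>"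
        using 1 \<tau>\<eta> \<eta>(1) tr(2) K(1) by (intro add_mono mult_mono) auto
      also have "\<dots> = \<bar>t\<bar> * ((A' + K) * \<eta>)" by (simp add: algebra_simps)
      finally have "\<bar>v\<bar> \<le> (A' + K) * \<eta>" using t0 by simp
      then show False using \<eta>2[OF False] by simp
    qed
  qed
  then show ?thesis using d by blast
qed

section \<open>Comparison of two parametrizations of a germ\<close>

context symplectic_coords
begin

text \<open>The transition map is a left inverse of \<open>k1\<close> applied to \<open>k0\<close>.
  It is smooth on a full neighbourhood in R^3 and not only on the curve, which is what
  \<open>smooth_branch_preserved\<close> exploits.\<close>

lemma transition:
  fixes k0 k1 :: "real^3 \<Rightarrow> real^'m"
  assumes k0: "smooth_on (ball 0 r) k0" "k0 0 = 0" and k1: "smooth_on (ball 0 r) k1" "k1 0 = 0" "inj (fd k1 0)" and r: "r > 0"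
    and p: "param k0 N" "param k1 N"
  shows "\<exists>h q A. q > 0 \<and> smooth_on (ball 0 q) h \<and> h 0 = 0 \<and>
    (\<forall>x\<in>C7. norm x < q \<longrightarrow> h x \<in> C7 \<and> k1 (h x) = k0 x \<and> norm (h x) \<le> A * norm x)"
proof -
  obtain V \<rho> s where V: "open V" "0 \<in> V" "smooth_on V \<rho>" "\<rho> 0 = 0" "s > 0"
    "\<forall>x. norm x < s \<longrightarrow> k1 x \<in> V \<and> \<rho> (k1 x) = x"
    by (rule local_left_inverse[OF k1(1) r k1(2,3)]) blast
  obtain dV where dV: "dV > 0" "ball 0 dV \<subseteq> V" using V(1,2) open_contains_ball by blast
  from paramD2[OF p(2) V(5)] obtain d where d: "d > 0" "\<forall>z\<in>N. norm z < d \<longrightarrow> (\<exists>x\<in>C7. norm x < s \<and> k1 x = z)" by blast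
  from paramD1[OF p(1)] obtain d0 where d0: "d0 > 0" "\<forall>x\<in>C7. norm x < d0 \<longrightarrow> k0 x \<in> N" by blast
  have m: "min dV d > 0" using dV d by simp
  have 0: "(0::real^3) \<in> ball 0 r" using r by simp
  from smooth_small[OF k0(1) open_ball 0 k0(2) m] obtain q0 where "q0 > 0" "ball 0 q0 \<subseteq> ball (0::real^3) r"
    "\<forall>x. norm x < q0 \<longrightarrow> norm (k0 x) < min dV d" by (elim exE conjE)
  note q0 = this
  have im: "k0 ` ball 0 q0 \<subseteq> V" using q0(3) dV(2) by auto
  have hs: "smooth_on (ball 0 q0) (\<lambda>x. \<rho> (k0 x))"
    by (rule smooth_on_compose[OF open_ball V(1,3) smooth_on_subset[OF k0(1) q0(2)] im])
  obtain A where A: "A \<ge> 0" "\<And>x. norm x \<le> q0 / 2 \<Longrightarrow> norm (\<rho> (k0 x) - \<rho> (k0 0)) \<le> A * norm x"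
    using taylor1[OF hs q0(1)] by blast
  have "\<rho> (k0 x) \<in> C7 \<and> k1 (\<rho> (k0 x)) = k0 x \<and> norm (\<rho> (k0 x)) \<le> A * norm x" if x: "x \<in> C7" "norm x < min d0 (q0 / 2)" for x
  proof -
    have "k0 x \<in> N" using d0(2) x by simp
    moreover have "norm (k0 x) < d" using q0(3) x q0(1) by simp
    ultimately obtain y where y: "y \<in> C7" "norm y < s" "k1 y = k0 x" using d(2) by blast
    then have "\<rho> (k0 x) = y" using V(6) by metis
    then show ?thesis using y A(2)[of x] x by (simp add: k0 V(4))
  qed
  then show ?thesis
    using d0(1) q0(1) k0(2) V(4) smooth_on_subset[OF hs, of "ball 0 (min d0 (q0 / 2))"]
    by (intro exI[of _ "\<lambda>x. \<rho> (k0 x)"] exI[of _ "min d0 (q0 / 2)"] exI[of _ A]) (auto simp: subset_ball)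
qed

text \<open>The transitions in the two directions are mutually inverse on the curve and preserve the
  smooth branch, hence also the singular one. On the singular branch norms are comparable to cubes
  of parameters, so a linear bound for norms gives a linear bound for parameters.\<close>

lemma reparametrize:
  fixes k0 k1 :: "real^3 \<Rightarrow> real^'m"
  assumes k0: "smooth_on (ball 0 r) k0" "k0 0 = 0" "inj (fd k0 0)" and k1: "smooth_on (ball 0 r) k1" "k1 0 = 0" "inj (fd k1 0)" and r: "r > 0"
    and p: "param k0 N" "param k1 N"
  shows "\<exists>d>0. \<exists>C\<ge>1. \<forall>t. \<bar>t\<bar> < d \<longrightarrow> (\<exists>t'. \<bar>t'\<bar> \<le> C * \<bar>t\<bar> \<and> k0 (g1 t) = k1 (g1 t')) \<and>
    (\<exists>t'. \<bar>t'\<bar> \<le> C * \<bar>t\<bar> \<and> k0 (g2 t) = k1 (g2 t'))"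
proof -
  from transition[OF k0(1,2) k1 r p] obtain h q A where h: "q > 0" "smooth_on (ball 0 q) h" "h 0 = 0"
    "\<forall>x\<in>C7. norm x < q \<longrightarrow> h x \<in> C7 \<and> k1 (h x) = k0 x \<and> norm (h x) \<le> A * norm x" by blast
  from transition[OF k1(1,2) k0 r p(2,1)] obtain h' q' A' where h': "q' > 0" "smooth_on (ball 0 q') h'" "h' 0 = 0"
    "\<forall>x\<in>C7. norm x < q' \<longrightarrow> h' x \<in> C7 \<and> k0 (h' x) = k1 x \<and> norm (h' x) \<le> A' * norm x" by blast
  have loc_inj: "\<exists>s>0. \<forall>x y. norm x < s \<longrightarrow> norm y < s \<longrightarrow> k x = k y \<longrightarrow> x = y"
    if k: "smooth_on (ball 0 r) k" "k 0 = 0" "inj (fd k 0)" for k :: "real^3 \<Rightarrow> real^'m"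
  proof -
    obtain V \<rho> s where "s > 0" "\<forall>x. norm x < s \<longrightarrow> k x \<in> V \<and> \<rho> (k x) = x"
      by (rule local_left_inverse[OF k(1) r k(2,3)]) blast
    then show ?thesis by metis
  qed
  obtain s0 s1 where s: "s0 > 0" "s1 > 0" "\<forall>x y. norm x < s0 \<longrightarrow> norm y < s0 \<longrightarrow> k0 x = k0 y \<longrightarrow> x = y"
    "\<forall>x y. norm x < s1 \<longrightarrow> norm y < s1 \<longrightarrow> k1 x = k1 y \<longrightarrow> x = y"
    using loc_inj[OF k0] loc_inj[OF k1] by blast
  define M where "M = \<bar>A\<bar> + \<bar>A'\<bar> + 1"
  have M: "M \<ge> 1" "A \<le> M" "A' \<le> M" by (auto simp: M_def)
  define R where "R = min (min q q') (min s0 s1)"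
  have R: "R > 0" "R \<le> q" "R \<le> q'" "R \<le> s0" "R \<le> s1" using h(1) h'(1) s(1,2) by (auto simp: R_def)
  \<comment> \<open>Two successive transitions enlarge norms by at most \<open>M * M\<close>, so
    points within \<open>\<epsilon>\<close> never leave the ball of radius \<open>R\<close> on which
    both parametrizations are injective.\<close>
  define \<epsilon> where "\<epsilon> = R / (M * M)"
  have MM: "M * M \<ge> 1" using M(1) by (metis mult_mono' mult_1 zero_le_one)
  have \<epsilon>: "\<epsilon> > 0" "\<epsilon> \<le> R" using R(1) MM by (auto simp: \<epsilon>_def field_simps)
  have le: "x < R" if "x \<le> M * M * y" "y < \<epsilon>" for x y :: real
  proof -
    have "M * M * y < M * M * \<epsilon>" using that(2) MM by (intro mult_strict_left_mono) auto
    also have "M * M * \<epsilon> = R" using M(1) by (simp add: \<epsilon>_def)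
    finally show ?thesis using that(1) by simp
  qed
  define tr where "tr f k l \<longleftrightarrow> (\<forall>x\<in>C7. norm x < R \<longrightarrow> f x \<in> C7 \<and> l (f x) = k x \<and> norm (f x) \<le> M * norm x)"
    for f :: "real^3 \<Rightarrow> real^3" and k l :: "real^3 \<Rightarrow> real^'m"
  define li where "li k \<longleftrightarrow> (\<forall>x y. norm x < R \<longrightarrow> norm y < R \<longrightarrow> k x = k y \<longrightarrow> x = y)" for k :: "real^3 \<Rightarrow> real^'m"
  have t: "tr h k0 k1" "tr h' k1 k0"
    unfolding tr_def using h(4) h'(4) R mult_right_mono[OF M(2) norm_ge_zero] mult_right_mono[OF M(3) norm_ge_zero]
    by (meson order_less_le_trans order_trans)+
  have i: "li k0" "li k1" unfolding li_def using s(3,4) R by (meson order_less_le_trans)+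
  have H: "f x \<in> C7 \<and> l (f x) = k x \<and> norm (f x) \<le> M * norm x \<and> f' (f x) = x"
    if "tr f k l" "tr f' l k" "li k" and x: "x \<in> C7" "norm x < \<epsilon>" for f f' k l x
  proof -
    have nx: "norm x < R" using x(2) \<epsilon>(2) by simp
    then have a: "f x \<in> C7" "l (f x) = k x" "norm (f x) \<le> M * norm x" using \<open>tr f k l\<close> x(1) by (auto simp: tr_def)
    have "1 * (M * norm x) \<le> M * (M * norm x)" using M by (intro mult_right_mono) auto
    then have "norm (f x) < R" using le[OF _ x(2)] a(3) by (simp add: mult.assoc)
    then have c: "k (f' (f x)) = l (f x)" "norm (f' (f x)) \<le> M * norm (f x)" using \<open>tr f' l k\<close> a(1) by (auto simp: tr_def)
    have "\<dots> \<le> M * (M * norm x)" using a(3) M by (intro mult_left_mono) auto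
    then have "norm (f' (f x)) < R" using le[OF _ x(2)] c(2) by (simp add: mult.assoc)
    then have "f' (f x) = x" using \<open>li k\<close> nx c(1) a(2) by (simp add: li_def)
    then show ?thesis using a by simp
  qed
  define r1 where "r1 = min \<epsilon> (\<epsilon> / M)"
  have r1: "r1 > 0" "r1 \<le> \<epsilon>" "M * r1 \<le> \<epsilon>" using \<epsilon> M(1) by (auto simp: r1_def min_def field_simps)
  have B: "\<exists>d>0. \<forall>t. \<bar>t\<bar> < d \<longrightarrow> f (g1 t) \<in> range g1"
    if "tr f k l" "tr f' l k" "li k" "li l" and f: "smooth_on (ball 0 R) f" "f 0 = 0" for f f' k l
  proof (rule smooth_branch_preserved)
    show "smooth_on (ball 0 r1) f" using smooth_on_subset[OF f(1)] r1(2) \<epsilon>(2) by (simp add: subset_ball)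
    show "f x \<in> C7 \<and> norm (f x) \<le> M * norm x \<and> norm x \<le> M * norm (f x)" if x: "x \<in> C7" "norm x < r1" for x
    proof -
      have a: "f x \<in> C7" "norm (f x) \<le> M * norm x" "f' (f x) = x" using H[OF \<open>tr f k l\<close> \<open>tr f' l k\<close> \<open>li k\<close>, of x] x r1(2) by auto
      have "M * norm x < M * r1" using x(2) M by (intro mult_strict_left_mono) auto
      then have "norm (f x) < \<epsilon>" using a(2) r1(3) by simp
      then show ?thesis using H[OF \<open>tr f' l k\<close> \<open>tr f k l\<close> \<open>li l\<close>, of "f x"] a by simp
    qed
  qed (use r1 f in auto)
  have hs: "smooth_on (ball 0 R) h" "smooth_on (ball 0 R) h'"
    using smooth_on_subset[OF h(2)] smooth_on_subset[OF h'(2)] R by (auto simp: subset_ball)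
  obtain d1 where d1: "d1 > 0" "\<And>t. \<bar>t\<bar> < d1 \<Longrightarrow> h (g1 t) \<in> range g1" using B[OF t i hs(1) h(3)] by blast
  obtain d2 where d2: "d2 > 0" "\<And>t. \<bar>t\<bar> < d2 \<Longrightarrow> h' (g1 t) \<in> range g1" using B[OF t(2,1) i(2,1) hs(2) h'(3)] by blast
  note H = H[OF t i(1)]
  define C where "C = 3 * M"
  have C: "C \<ge> 1" "M \<le> C" using M(1) by (auto simp: C_def)
  define \<delta> where "\<delta> = min (min d1 \<epsilon>) (min 1 (min \<epsilon> (d2 / M) / 3))"
  have \<delta>: "\<delta> > 0" using d1(1) \<epsilon>(1) d2(1) M(1) by (simp add: \<delta>_def)
  have "(\<exists>t'. \<bar>t'\<bar> \<le> C * \<bar>t\<bar> \<and> k0 (g1 t) = k1 (g1 t')) \<and> (\<exists>t'. \<bar>t'\<bar> \<le> C * \<bar>t\<bar> \<and> k0 (g2 t) = k1 (g2 t'))"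
    if t: "\<bar>t\<bar> < \<delta>" for t
  proof
    have g: "g1 t \<in> C7" "g2 t \<in> C7" by (auto simp: C7_def)
    have "\<bar>t\<bar> < d1" "\<bar>t\<bar> < \<epsilon>" using t by (auto simp: \<delta>_def)
    then obtain t' where t': "h (g1 t) = g1 t'" using d1(2) by blast
    have H1: "k1 (g1 t') = k0 (g1 t)" "\<bar>t'\<bar> \<le> M * \<bar>t\<bar>" using H[OF g(1)] \<open>\<bar>t\<bar> < \<epsilon>\<close> by (auto simp: t')
    moreover have "M * \<bar>t\<bar> \<le> C * \<bar>t\<bar>" using C by (intro mult_right_mono) auto
    ultimately show "\<exists>t'. \<bar>t'\<bar> \<le> C * \<bar>t\<bar> \<and> k0 (g1 t) = k1 (g1 t')" by (intro exI[of _ t']) auto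
    have t2: "\<bar>t\<bar> < min 1 (min \<epsilon> (d2 / M) / 3)" using t by (simp add: \<delta>_def)
    have "min \<epsilon> (d2 / M) > 0" using \<epsilon> d2(1) M(1) by simp
    then have n2: "norm (g2 t) < min \<epsilon> (d2 / M)" by (rule norm_g2_less[OF _ t2])
    then have H2: "h (g2 t) \<in> C7" "k1 (h (g2 t)) = k0 (g2 t)" "norm (h (g2 t)) \<le> M * norm (g2 t)" "h' (h (g2 t)) = g2 t"
      using H[OF g(2)] by auto
    \<comment> \<open>Otherwise the inverse transition would carry the point back to the smooth
      branch, but the branches meet only at 0.\<close>
    have "h (g2 t) \<in> range g2"
    proof (rule ccontr)
      assume n: "h (g2 t) \<notin> range g2"
      then obtain u where u: "h (g2 t) = g1 u" using H2(1) by (auto simp: C7_def)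
      have "\<bar>u\<bar> \<le> M * norm (g2 t)" using H2(3) u by simp
      also have "\<dots> < M * (d2 / M)" using n2 M by (intro mult_strict_left_mono) auto
      finally have "\<bar>u\<bar> < d2" using M(1) by simp
      then have "h' (g1 u) \<in> range g1" by (rule d2(2))
      then have "g2 t \<in> range g1" using H2(4) u by simp
      then obtain w where "g2 t = g1 w" by blast
      then have "t = 0" by (simp add: vec3_eq_iff)
      moreover have "g2 0 = 0" by (simp add: vec3_eq_iff)
      ultimately have "h (g2 t) = g2 0" using h(3) by simp
      then show False using n by blast
    qed
    then obtain u where u: "h (g2 t) = g2 u" by blast
    have "\<bar>u\<bar>^3 \<le> norm (g2 u)" by (rule norm_g2_ge)
    also have "\<dots> \<le> M * norm (g2 t)" using H2(3) u by simp
    also have "\<dots> \<le> M * (3 * \<bar>t\<bar>^3)" using t2 M by (intro mult_left_mono norm_g2_le) auto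
    also have "\<dots> \<le> C^3 * \<bar>t\<bar>^3"
    proof -
      have "C^1 \<le> C^3" using C(1) by (intro power_increasing) auto
      then have "C * \<bar>t\<bar>^3 \<le> C^3 * \<bar>t\<bar>^3" by (intro mult_right_mono) auto
      then show ?thesis by (simp add: C_def)
    qed
    also have "\<dots> = (C * \<bar>t\<bar>)^3" by (simp add: power_mult_distrib)
    finally have "\<bar>u\<bar> \<le> C * \<bar>t\<bar>" using C(1) power_mono_iff[of "\<bar>u\<bar>" "C * \<bar>t\<bar>" 3] by simp
    then show "\<exists>t'. \<bar>t'\<bar> \<le> C * \<bar>t\<bar> \<and> k0 (g2 t) = k1 (g2 t')" using H2(2) u by (intro exI[of _ u]) auto
  qed
  then show ?thesis using \<delta> C(1) by blast
qed

end

lemma smooth_lipschitz: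
  fixes f :: "real^'n \<Rightarrow> 'b::real_normed_vector"
  assumes f: "smooth_on (ball 0 r) f" and r: "r > 0"
  shows "\<exists>C\<ge>0. \<forall>x y. norm x < r / 2 \<longrightarrow> norm y < r / 2 \<longrightarrow> norm (f x - f y) \<le> C * norm (x - y)"
proof -
  have "\<exists>M. \<forall>x. norm x \<le> r / 2 \<longrightarrow> norm (fd f x (axis i 1)) \<le> M * 1" for i
    using smooth_local_bound[OF smooth_on_fd[OF f] r] by auto
  from uniform_bound_finite[of "\<lambda>x. norm x \<le> r / 2" "\<lambda>i x. norm (fd f x (axis i 1))" "\<lambda>_. 1", OF this]
  obtain M where M: "M \<ge> 0" "\<forall>i x. norm x \<le> r / 2 \<longrightarrow> norm (fd f x (axis i 1)) \<le> M * 1" by auto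
  have "norm (f x - f y) \<le> (\<Sum>i\<in>(UNIV::'n set). M) * norm (x - y)" if "norm x < r / 2" "norm y < r / 2" for x y
  proof (rule differentiable_bound[of "ball 0 (r / 2)" f "fd f"])
    fix z :: "real^'n" assume z: "z \<in> ball 0 (r / 2)"
    then have zr: "z \<in> ball 0 r" using r by simp
    show "(f has_derivative fd f z) (at z within ball 0 (r / 2))"
      using smooth_on_has_derivative[OF f zr] has_derivative_at_withinI by blast
    have "onorm (fd f z) \<le> (\<Sum>i\<in>UNIV. norm (fd f z (axis i 1)))" by (rule onorm_fd_le[OF smooth_on_differentiable[OF f zr]])
    also have "\<dots> \<le> (\<Sum>i\<in>(UNIV::'n set). M)" using M(2) z by (intro sum_mono) auto
    finally show "onorm (fd f z) \<le> (\<Sum>i\<in>(UNIV::'n set). M)" .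
  qed (use that in auto)
  then show ?thesis using M(1) by (intro exI[of _ "\<Sum>i\<in>(UNIV::'n set). M"] conjI sum_nonneg) auto
qed

lemma dir_derivs_cong_eventually:
  "\<forall>\<^sub>F x in nhds a. f x = g x \<Longrightarrow> \<forall>\<^sub>F x in nhds a. dir_derivs vs f x = dir_derivs vs g x"
proof (induction vs)
  case (Cons v vs)
  then have "\<forall>\<^sub>F x in nhds a. \<forall>\<^sub>F y in nhds x. dir_derivs vs f y = dir_derivs vs g y" by (simp add: eventually_eventually)
  then show ?case by (rule eventually_mono) (auto dest: fd_cong_eventually)
qed simp

lemma vanishing_order_cong: "\<forall>\<^sub>F x in nhds 0. f x = g x \<Longrightarrow> vanishing_order D f = vanishing_order D g"
  unfolding vanishing_order_def using eventually_nhds_x_imp_x[OF dir_derivs_cong_eventually] by metis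

section \<open>Retraction onto a submanifold\<close>

definition cproj :: "'n set \<Rightarrow> real^'n \<Rightarrow> real^'n::finite" where
  "cproj S y = (\<chi> i. if i \<in> S then y $ i else 0)"

lemma cproj_nth [simp]: "cproj S y $ i = (if i \<in> S then y $ i else 0)"
  by (simp add: cproj_def)

lemma cproj_in: "cproj S y \<in> coord_subspace S"
  by (simp add: coord_subspace_def)

lemma cproj_id: "y \<in> coord_subspace S \<Longrightarrow> cproj S y = y"
  by (auto simp: coord_subspace_def vec_eq_iff)

lemma linear_cproj: "linear (cproj S)"
  by (rule linearI) (auto simp: vec_eq_iff)

lemma bounded_linear_cproj: "bounded_linear (cproj S)"
  using linear_cproj by (simp add: linear_conv_bounded_linear)

lemma cproj_0 [simp]: "cproj S 0 = 0"
  by (simp add: vec_eq_iff)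

lemma norm_cproj_le: "norm (cproj S y) \<le> norm y"
  by (rule norm_le_componentwise_cart) auto

text \<open>Collects \<open>nfK_vanish\<close> and \<open>nfK_vanish_both\<close>, with
  \<open>m\<close> and \<open>k\<close> the orders of the error along the singular and the smooth
  branch. All upper bounds for the invariants come from its failure for the coefficients of a
  family.\<close>

definition vanishing_pattern :: "nat \<Rightarrow> nat \<Rightarrow> (nat \<Rightarrow> real) \<Rightarrow> bool" where
  "vanishing_pattern m k c \<longleftrightarrow> (m \<ge> 5 \<longrightarrow> c 7 = 0) \<and> (m \<ge> 6 \<longrightarrow> c 8 = 0) \<and> (m \<ge> 6 \<longrightarrow> c 9 = 0) \<and>
     (m \<ge> 8 \<longrightarrow> c 10 = 0) \<and> (m \<ge> 9 \<longrightarrow> c 11 = 0) \<and> (m \<ge> 4 \<and> k \<ge> 2 \<longrightarrow> c 8 = 0) \<and> (m \<ge> 5 \<and> k \<ge> 2 \<longrightarrow> c 9 = 0) \<and>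
     (m \<ge> 11 \<and> k \<ge> 3 \<longrightarrow> c 13 = 0) \<and> (m \<ge> 12 \<and> k \<ge> 3 \<longrightarrow> c 14 = 0)"

abbreviation retr :: "(real^'m) set \<Rightarrow> (real^'m \<Rightarrow> real^'m) \<Rightarrow> 'm::finite set \<Rightarrow> real^'m \<Rightarrow> real^'m" where
  "retr U \<Theta> S z \<equiv> \<Theta> (cproj S (inv_into U \<Theta> z))"

text \<open>The estimate behind an order of vanishing of at least \<open>k\<close>. It is common to
  submanifolds measured by \<open>form_order\<close> and to Lagrangian ones, which satisfy it for
  every \<open>k\<close>.\<close>

definition form_bound :: "(nat \<Rightarrow> 'm::finite) \<Rightarrow> (real^'m \<Rightarrow> real^'m) \<Rightarrow> 'm set \<Rightarrow> nat \<Rightarrow> bool" where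
  "form_bound e \<Theta> S k \<longleftrightarrow> (\<exists>\<delta>>0. \<exists>C. \<forall>y\<in>coord_subspace S. norm y < \<delta> \<longrightarrow>
     (\<forall>a\<in>S. \<forall>b\<in>S. \<bar>form_coeff e \<Theta> a b y\<bar> \<le> C * norm y ^ k))"

context symplectic_coords
begin

text \<open>Replace \<open>j\<close> by its retraction \<open>j'\<close> to the submanifold. The
  form pulled back by \<open>j'\<close> is \<open>O(|x|^k)\<close>, so by the Poincare lemma its
  primitive is a gradient up to \<open>O(|x|^(k+1))\<close>. Passing from \<open>j\<close> to
  \<open>j'\<close> costs another gradient and, by \<open>lam_diff\<close>, an error of the size of
  \<open>j - j'\<close>.\<close>

lemma slice_core:
  fixes j :: "real^3 \<Rightarrow> real^'m"
  assumes \<Theta>: "diffeo_germ U \<Theta>"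
    and fb: "form_bound e \<Theta> S k"
    and j: "smooth_on (ball 0 r) j" "j 0 = 0" "r > 0" and c: "cohom r (lam j) (nfK c)"
  shows "\<exists>r'>0. \<exists>S' \<beta> C. smooth_on (ball 0 r') S' \<and> C \<ge> 0 \<and> (\<forall>x\<in>C7. norm x < r' \<longrightarrow> nfK c x = grad S' x + \<beta> x \<and>
     (\<forall>i. \<bar>\<beta> x $ i\<bar> \<le> C * (norm (j x - retr U \<Theta> S (j x)) + norm x ^ Suc k)))"
proof -
  note U = \<Theta>[unfolded diffeo_germ_def]
  from fb obtain \<delta> C where fc: "\<delta> > 0" "\<And>y a b. y \<in> coord_subspace S \<Longrightarrow> norm y < \<delta> \<Longrightarrow> a \<in> S \<Longrightarrow> b \<in> S \<Longrightarrow> \<bar>form_coeff e \<Theta> a b y\<bar> \<le> C * norm y ^ k"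
    unfolding form_bound_def by blast
  obtain \<epsilon> where \<epsilon>: "\<epsilon> > 0" "ball 0 \<epsilon> \<subseteq> U" using U open_contains_ball by metis
  have "min \<epsilon> \<delta> > 0" using fc(1) \<epsilon> by simp
  from diffeo_germ_inv_small[OF \<Theta> this] obtain d1 where d1: "d1 > 0"
    "\<forall>z. norm z < d1 \<longrightarrow> z \<in> \<Theta> ` U \<and> norm (inv_into U \<Theta> z) < min \<epsilon> \<delta> \<and> \<Theta> (inv_into U \<Theta> z) = z" by blast
  have "(0::real^3) \<in> ball 0 r" using j by simp
  from smooth_small[OF j(1) open_ball this j(2) d1(1)] obtain r1 where r1: "r1 > 0" "ball 0 r1 \<subseteq> ball (0::real^3) r"
    "\<forall>x. norm x < r1 \<longrightarrow> norm (j x) < d1" by blast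
  define y where "y x = cproj S (inv_into U \<Theta> (j x))" for x
  define j' where "j' x = \<Theta> (y x)" for x
  have sm_j: "smooth_on (ball 0 r1) j" by (rule smooth_on_subset[OF j(1) r1(2)])
  have oU: "open (\<Theta> ` U)" and smi: "smooth_on (\<Theta> ` U) (inv_into U \<Theta>)" and oUU: "open U" and sm\<Theta>: "smooth_on U \<Theta>" using U by auto
  have "smooth_on (ball 0 r1) (\<lambda>x. inv_into U \<Theta> (j x))"
    by (rule smooth_on_compose[OF open_ball oU smi sm_j]) (use r1 d1 in auto)
  then have ys: "smooth_on (ball 0 r1) y"
    unfolding y_def by (rule smooth_on_bounded_linear_compose[OF bounded_linear_cproj open_ball])
  have ysmall: "norm (y x) < min \<epsilon> \<delta>" if "norm x < r1" for x
    using norm_cproj_le[of S "inv_into U \<Theta> (j x)"] d1(2) r1(3) that unfolding y_def by (smt (verit))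
  have yU: "y x \<in> U" if "norm x < r1" for x using ysmall[OF that] \<epsilon>(2) by auto
  have yS: "y x \<in> coord_subspace S" for x unfolding y_def by (rule cproj_in)
  have j's: "smooth_on (ball 0 r1) j'"
    unfolding j'_def by (rule smooth_on_compose[OF open_ball oUU sm\<Theta> ys]) (use yU in auto)
  have i0: "inv_into U \<Theta> 0 = 0" using U by (metis inv_into_f_f)
  have y0: "y 0 = 0" by (simp add: y_def j i0)
  \<comment> \<open>The derivatives of \<open>y\<close> stay in the coordinate subspace, so only the
    entries \<open>form_coeff e \<Theta> a b\<close> with \<open>a\<close> and \<open>b\<close> in
    \<open>S\<close> enter the pulled back form.\<close>
  have fd_yS: "fd y x v \<in> coord_subspace S" if "norm x < r1" for x v
    unfolding coord_subspace_def
  proof (intro CollectI allI impI)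
    fix i assume "i \<notin> S"
    have "((\<lambda>x. y x $ i) has_derivative (\<lambda>v. fd y x v $ i)) (at x)"
      by (rule bounded_linear.has_derivative[OF bounded_linear_vec_nth smooth_on_has_derivative[OF ys]]) (use that in simp)
    moreover have "(\<lambda>x. y x $ i) = (\<lambda>x. 0)" using \<open>i \<notin> S\<close> by (auto simp: y_def)
    ultimately have "((\<lambda>x. 0) has_derivative (\<lambda>v. fd y x v $ i)) (at x)" by simp
    then have "(\<lambda>v. fd y x v $ i) = (\<lambda>v. 0)" using has_derivative_unique has_derivative_const by blast
    then show "fd y x v $ i = 0" by meson
  qed
  have chain: "fd j' x v = fd \<Theta> (y x) (fd y x v)" if "norm x < r1" for x v
  proof -
    have "(j' has_derivative (\<lambda>v. fd \<Theta> (y x) (fd y x v))) (at x)"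
      unfolding j'_def
      by (rule has_derivative_compose[OF smooth_on_has_derivative[OF ys] smooth_on_has_derivative[OF sm\<Theta> yU[OF that]]])
         (use that in simp)
    from fd_eq[OF this] show ?thesis by simp
  qed
  have om_expand: "om (fd \<Theta> p u) (fd \<Theta> p v) = (\<Sum>a\<in>S. \<Sum>b\<in>S. u $ a * v $ b * form_coeff e \<Theta> a b p)"
    if "p \<in> U" "u \<in> coord_subspace S" "v \<in> coord_subspace S" for p u v
  proof -
    have ex: "fd \<Theta> p w = (\<Sum>a\<in>S. w $ a *\<^sub>R fd \<Theta> p (axis a 1))" if "w \<in> coord_subspace S" for w
    proof -
      have "fd \<Theta> p w = (\<Sum>a\<in>UNIV. w $ a *\<^sub>R fd \<Theta> p (axis a 1))"
        by (rule fd_axis_expand[OF smooth_on_differentiable[OF sm\<Theta> \<open>p \<in> U\<close>]])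
      also have "\<dots> = (\<Sum>a\<in>S. w $ a *\<^sub>R fd \<Theta> p (axis a 1))"
        using that by (intro sum.mono_neutral_right) (auto simp: coord_subspace_def)
      finally show ?thesis .
    qed
    interpret ob: bounded_bilinear om by (rule om_bilinear)
    show ?thesis unfolding ex[OF that(2)] ex[OF that(3)]
      by (simp only: ob.sum_left, simp only: ob.sum_right)
        (simp add: ob.scaleR_left ob.scaleR_right form_coeff_def mult_ac)
  qed
  obtain Cy where Cy: "Cy \<ge> 0" "\<And>x. norm x \<le> r1 / 2 \<Longrightarrow> norm (y x - y 0) \<le> Cy * norm x" using taylor1[OF ys r1(1)] by blast
  have "\<exists>M. \<forall>x. norm x \<le> r1 / 2 \<longrightarrow> norm (fd y x (axis i 1)) \<le> M * 1" for i :: 3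
    using smooth_local_bound[OF smooth_on_fd[OF ys] r1(1)] by auto
  from uniform_bound_finite[of "\<lambda>x. norm x \<le> r1 / 2" "\<lambda>i x. norm (fd y x (axis (i::3) 1))" "\<lambda>_. 1", OF this]
  obtain D where D: "D \<ge> 0" "\<forall>i x. norm x \<le> r1 / 2 \<longrightarrow> norm (fd y x (axis (i::3) 1)) \<le> D * 1" by auto
  define K where "K = (\<Sum>a\<in>S. \<Sum>b\<in>S. D * D * (\<bar>C\<bar> * Cy ^ k))"
  have K: "K \<ge> 0" unfolding K_def using D Cy by (intro sum_nonneg mult_nonneg_nonneg) auto
  have curl: "\<bar>om (fd j' x (axis p 1)) (fd j' x (axis q 1))\<bar> \<le> K * norm x ^ k" if x: "norm x \<le> r1 / 2" for x p q
  proof -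
    have xr: "norm x < r1" using x r1(1) by simp
    have cf: "\<bar>form_coeff e \<Theta> a b (y x)\<bar> \<le> \<bar>C\<bar> * Cy ^ k * norm x ^ k" if "a \<in> S" "b \<in> S" for a b
    proof -
      have "\<bar>form_coeff e \<Theta> a b (y x)\<bar> \<le> C * norm (y x) ^ k"
        using fc(2)[OF yS _ that, of x] ysmall[OF xr] by simp
      also have "\<dots> \<le> \<bar>C\<bar> * norm (y x) ^ k" by (intro mult_right_mono) auto
      also have "\<dots> \<le> \<bar>C\<bar> * (Cy * norm x) ^ k"
        using Cy(2)[OF x] by (intro mult_left_mono power_mono) (auto simp: y0)
      finally show ?thesis by (simp add: power_mult_distrib mult.assoc)
    qed
    have cb: "\<bar>fd y x (axis i 1) $ a\<bar> \<le> D" for a i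
      using component_le_norm_cart[of "fd y x (axis i 1)" a] D(2) x by (metis mult.right_neutral order_trans)
    have "\<bar>om (fd j' x (axis p 1)) (fd j' x (axis q 1))\<bar>
      \<le> (\<Sum>a\<in>S. \<bar>\<Sum>b\<in>S. fd y x (axis p 1) $ a * fd y x (axis q 1) $ b * form_coeff e \<Theta> a b (y x)\<bar>)"
      unfolding chain[OF xr] om_expand[OF yU[OF xr] fd_yS[OF xr] fd_yS[OF xr]] by (rule sum_abs)
    also have "\<dots> \<le> (\<Sum>a\<in>S. \<Sum>b\<in>S. \<bar>fd y x (axis p 1) $ a * fd y x (axis q 1) $ b * form_coeff e \<Theta> a b (y x)\<bar>)"
      by (intro sum_mono sum_abs)
    also have "\<dots> \<le> (\<Sum>a\<in>S. \<Sum>b\<in>S. D * D * (\<bar>C\<bar> * Cy ^ k * norm x ^ k))"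
      unfolding abs_mult using D(1) cb cf by (intro sum_mono mult_mono mult_nonneg_nonneg) auto
    also have "\<dots> = K * norm x ^ k" unfolding K_def by (simp add: sum_distrib_right mult.assoc)
    finally show ?thesis .
  qed
  have r1h: "r1 / 2 > 0" using r1(1) by simp
  have sub: "ball (0::real^3) (r1 / 2) \<subseteq> ball 0 r1" using r1(1) by (simp add: subset_ball)
  have j'h: "smooth_on (ball 0 (r1/2)) j'" and jh: "smooth_on (ball 0 (r1/2)) j"
    using smooth_on_subset[OF j's sub] smooth_on_subset[OF sm_j sub] by auto
  obtain T where T: "smooth_on (ball 0 (r1/2)) T" "\<And>x i. x \<in> ball 0 (r1/2) \<Longrightarrow> lam j' x $ i = fd T x (axis i 1) +
      (\<Sum>k\<in>UNIV. real 1 * x $ k * dint (\<lambda>_. 1) (1 + 1 - 1) (\<lambda>y. fd (lam j') y (axis k 1) $ i - fd (lam j') y (axis i 1) $ k) x)"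
    using poincare[OF smooth_on_lam[OF open_ball j'h], of "\<lambda>_. 1"] by auto
  \<comment> \<open>The homotopy integral of the curl; its factor \<open>x\<close> raises the order
    from \<open>k\<close> to \<open>k + 1\<close>.\<close>
  define \<gamma> where "\<gamma> x = (\<chi> i. \<Sum>k\<in>UNIV. x $ k * dint (\<lambda>_. 1) 1 (\<lambda>y. fd (lam j') y (axis k 1) $ i - fd (lam j') y (axis i 1) $ k) x)"
    for x :: "real^3"
  have lam': "lam j' x = grad T x + \<gamma> x" if "x \<in> ball 0 (r1/2)" for x
    using T(2)[OF that] by (simp add: vec_eq_iff \<gamma>_def)
  have \<gamma>: "\<bar>\<gamma> x $ i\<bar> \<le> 3 * K * norm x ^ Suc k" if x: "x \<in> ball 0 (r1/2)" for x i
  proof -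
    have b: "\<bar>dint (\<lambda>_. 1) 1 (\<lambda>y. fd (lam j') y (axis l 1) $ i - fd (lam j') y (axis i 1) $ l) x\<bar> \<le> K * norm x ^ k" for l
    proof (rule abs_dint_le[OF _ x])
      have sl: "smooth_on (ball 0 (r1/2)) (lam j')" by (rule smooth_on_lam[OF open_ball j'h])
      have "smooth_on (ball 0 (r1/2)) (\<lambda>y. fd (lam j') y (axis l 1) $ i - fd (lam j') y (axis i 1) $ l)"
        by (intro smooth_on_diff smooth_on_nth smooth_on_fd open_ball sl)
      then show "continuous_on (ball 0 (r1/2)) (\<lambda>y. fd (lam j') y (axis l 1) $ i - fd (lam j') y (axis i 1) $ l)"
        by (rule smooth_on_continuous)
      fix y :: "real^3" assume y: "norm y \<le> norm x"
      then have yb: "y \<in> ball 0 (r1/2)" using x by simp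
      have "\<bar>om (fd j' y (axis l 1)) (fd j' y (axis i 1))\<bar> \<le> K * norm y ^ k" using yb by (intro curl) simp
      also have "\<dots> \<le> K * norm x ^ k" using y K by (intro mult_left_mono power_mono) auto
      finally show "\<bar>fd (lam j') y (axis l 1) $ i - fd (lam j') y (axis i 1) $ l\<bar> \<le> K * norm x ^ k"
        unfolding lam_curl[OF open_ball yb j'h] .
    qed
    have "\<bar>\<gamma> x $ i\<bar> \<le> (\<Sum>l\<in>(UNIV::3 set). norm x * (K * norm x ^ k))"
      unfolding \<gamma>_def vec_lambda_beta
    proof (rule order_trans[OF sum_abs], rule sum_mono)
      show "\<bar>x $ l * dint (\<lambda>_. 1) 1 (\<lambda>y. fd (lam j') y (axis l 1) $ i - fd (lam j') y (axis i 1) $ l) x\<bar> \<le> norm x * (K * norm x ^ k)" for l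
        unfolding abs_mult by (intro mult_mono component_le_norm_cart b) auto
    qed
    then show ?thesis by (simp add: mult_ac)
  qed
  obtain S0 where S0: "smooth_on (ball 0 r) S0" "\<And>x. x \<in> ball 0 r \<inter> C7 \<Longrightarrow> lam j x - nfK c x = grad S0 x"
    using c unfolding cohom_def by blast
  define om2 where "om2 x = om (j x) (j' x) / 2" for x
  have om2: "smooth_on (ball 0 (r1/2)) om2" unfolding om2_def by (intro smooth_on_divide_const smooth_on_om open_ball jh j'h)
  have subr: "ball (0::real^3) (r1 / 2) \<subseteq> ball 0 r" using sub r1(2) by blast
  have S0': "smooth_on (ball 0 (r1/2)) S0" by (rule smooth_on_subset[OF S0(1) subr])
  define S' where "S' x = T x - (om2 x + S0 x)" for x
  have S's: "smooth_on (ball 0 (r1/2)) S'" unfolding S'_def by (intro smooth_on_diff smooth_on_add open_ball T om2 S0')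
  define \<beta> where "\<beta> x = \<gamma> x + (\<chi> i. om (j x - j' x) (fd j x (axis i 1) + fd j' x (axis i 1)) / 2)" for x
  have gS': "grad S' x = grad T x - grad om2 x - grad S0 x" if "x \<in> ball 0 (r1/2)" for x
  proof -
    have "(S' has_derivative (\<lambda>v. fd T x v - (fd om2 x v + fd S0 x v))) (at x)"
      unfolding S'_def by (intro has_derivative_diff has_derivative_add smooth_on_has_derivative[OF T(1) that]
        smooth_on_has_derivative[OF om2 that] smooth_on_has_derivative[OF S0' that])
    from fd_eq[OF this] show ?thesis by (simp add: vec_eq_iff)
  qed
  have eq: "nfK c x = grad S' x + \<beta> x" if "x \<in> C7" "norm x < r1/2" for x
  proof -
    have x: "x \<in> ball 0 (r1/2)" using that by simp
    have "lam j x - nfK c x = grad S0 x" using S0(2)[of x] subr x that(1) by blast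
    moreover have "lam j x - lam j' x = (\<chi> i. om (j x - j' x) (fd j x (axis i 1) + fd j' x (axis i 1)) / 2) - grad om2 x"
      unfolding om2_def by (rule lam_diff[OF jh j'h x])
    ultimately have "nfK c x = lam j' x + (\<chi> i. om (j x - j' x) (fd j x (axis i 1) + fd j' x (axis i 1)) / 2) - grad om2 x - grad S0 x"
      by (simp add: algebra_simps)
    then show ?thesis unfolding lam'[OF x] gS'[OF x] \<beta>_def by (simp add: algebra_simps)
  qed
  obtain B where B: "B > 0" "\<And>a b. norm (om a b) \<le> norm a * norm b * B" using bounded_bilinear.pos_bounded[OF om_bilinear] by blast
  have "\<exists>M. \<forall>x. norm x \<le> r1 / 2 \<longrightarrow> norm (fd j x (axis i 1) + fd j' x (axis i 1)) \<le> M * 1" for i :: 3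
    using smooth_local_bound[OF smooth_on_add[OF open_ball smooth_on_fd[OF sm_j] smooth_on_fd[OF j's]] r1(1)] by auto
  from uniform_bound_finite[of "\<lambda>x. norm x \<le> r1 / 2" "\<lambda>i x. norm (fd j x (axis (i::3) 1) + fd j' x (axis i 1))" "\<lambda>_. 1", OF this]
  obtain M where M: "M \<ge> 0" "\<forall>i x. norm x \<le> r1 / 2 \<longrightarrow> norm (fd j x (axis (i::3) 1) + fd j' x (axis i 1)) \<le> M * 1" by auto
  have bd: "\<bar>\<beta> x $ i\<bar> \<le> (3 * K + M * B) * (norm (j x - j' x) + norm x ^ Suc k)" if "norm x < r1/2" for x i
  proof -
    have "\<bar>om (j x - j' x) (fd j x (axis i 1) + fd j' x (axis i 1))\<bar> \<le> norm (j x - j' x) * M * B"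
    proof -
      have "norm (om (j x - j' x) (fd j x (axis i 1) + fd j' x (axis i 1))) \<le> norm (j x - j' x) * norm (fd j x (axis i 1) + fd j' x (axis i 1)) * B" by (rule B(2))
      also have "\<dots> \<le> norm (j x - j' x) * M * B" using M that B(1) by (intro mult_right_mono mult_left_mono) auto
      finally show ?thesis by simp
    qed
    moreover have "\<bar>\<gamma> x $ i\<bar> \<le> 3 * K * norm x ^ Suc k" using that by (intro \<gamma>) simp
    moreover have "0 \<le> norm (j x - j' x) * M * B" "0 \<le> 3 * K * norm (j x - j' x)" "0 \<le> M * B * norm x ^ Suc k"
      using M(1) B(1) K by auto
    ultimately show ?thesis unfolding \<beta>_def by (simp add: algebra_simps) 
  qed
  have "(3 * K + M * B) \<ge> 0" using K M B by simp
  then show ?thesis using eq bd S's r1h unfolding j'_def y_def by blast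
qed

text \<open>The error \<open>O(|x|^(k+1))\<close> has order \<open>3 (k + 1)\<close> along the
  singular branch and \<open>k + 1\<close> along the smooth one; these are the caps on
  \<open>m\<close> and \<open>l\<close>.\<close>

lemma pattern_of_core:
  fixes j :: "real^3 \<Rightarrow> real^'m"
  assumes \<Theta>: "diffeo_germ U \<Theta>"
    and fb: "form_bound e \<Theta> S k"
    and j: "smooth_on (ball 0 r) j" "j 0 = 0" "r > 0" and c: "cohom r (lam j) (nfK c)"
    and d: "d > 0" "\<And>t. \<bar>t\<bar> < d \<Longrightarrow> norm (j (g2 t) - retr U \<Theta> S (j (g2 t))) \<le> C2 * \<bar>t\<bar> ^ m"
      "\<And>t. \<bar>t\<bar> < d \<Longrightarrow> norm (j (g1 t) - retr U \<Theta> S (j (g1 t))) \<le> C1 * \<bar>t\<bar> ^ l"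
    and m: "m \<le> 3 * Suc k" "l \<le> Suc k"
  shows "vanishing_pattern m l c"
proof -
  from slice_core[OF \<Theta> fb j c] obtain r' S' \<beta> B where r': "r' > 0" "smooth_on (ball 0 r') S'" "B \<ge> 0"
    "\<forall>x\<in>C7. norm x < r' \<longrightarrow> nfK c x = grad S' x + \<beta> x \<and>
     (\<forall>i. \<bar>\<beta> x $ i\<bar> \<le> B * (norm (j x - retr U \<Theta> S (j x)) + norm x ^ Suc k))" by (elim exE conjE)
  define q where "q = min (min d r') (min 1 (r' / 3))"
  have q: "q > 0" using d(1) r'(1) by (simp add: q_def)
  have small: "\<bar>t\<bar> < d" "\<bar>t\<bar> \<le> 1" "norm (g1 t) < r'" "norm (g2 t) < r'" "g1 t \<in> C7" "g2 t \<in> C7" if "\<bar>t\<bar> < q" for t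
    using that norm_g2_less[OF r'(1), of t] by (auto simp: q_def C7_def)
  have eq2: "nfK c (g2 t) = grad S' (g2 t) + \<beta> (g2 t)" and eq1: "nfK c (g1 t) = grad S' (g1 t) + \<beta> (g1 t)" if "\<bar>t\<bar> < q" for t
    using small[OF that] r'(4) by blast+
  have b2: "jet m (\<lambda>t. \<beta> (g2 t) $ i) 0" for i
  proof (rule jetI[OF q])
    fix t :: real assume t: "\<bar>t\<bar> < q"
    have "norm (g2 t) ^ Suc k \<le> (3 * \<bar>t\<bar>^3) ^ Suc k" by (intro power_mono norm_g2_le small[OF t]) auto
    also have "\<dots> = 3 ^ Suc k * \<bar>t\<bar> ^ (3 * Suc k)" by (simp only: power_mult_distrib power_mult)
    also have "\<dots> \<le> 3 ^ Suc k * \<bar>t\<bar> ^ m" using small(2)[OF t] m by (intro mult_left_mono power_decreasing) auto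
    finally have "norm (j (g2 t) - retr U \<Theta> S (j (g2 t))) + norm (g2 t) ^ Suc k \<le> (C2 + 3 ^ Suc k) * \<bar>t\<bar> ^ m"
      unfolding distrib_right by (intro add_mono d small[OF t])
    from mult_left_mono[OF this r'(3)]
    have "\<bar>\<beta> (g2 t) $ i\<bar> \<le> B * ((C2 + 3 ^ Suc k) * \<bar>t\<bar> ^ m)"
      using r'(4) small[OF t] by (meson order_trans)
    then show "\<bar>\<beta> (g2 t) $ i - poly 0 t\<bar> \<le> B * (C2 + 3 ^ Suc k) * \<bar>t\<bar> ^ m" by (simp add: mult.assoc)
  qed
  have b1: "jet l (\<lambda>t. \<beta> (g1 t) $ i) 0" for i
  proof (rule jetI[OF q])
    fix t :: real assume t: "\<bar>t\<bar> < q"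
    have "norm (g1 t) ^ Suc k \<le> \<bar>t\<bar> ^ l" unfolding norm_g1 using small(2)[OF t] m by (intro power_decreasing) auto
    then have "norm (j (g1 t) - retr U \<Theta> S (j (g1 t))) + norm (g1 t) ^ Suc k \<le> C1 * \<bar>t\<bar> ^ l + \<bar>t\<bar> ^ l"
      by (intro add_mono d small[OF t])
    also have "\<dots> = (C1 + 1) * \<bar>t\<bar> ^ l" by (simp add: distrib_right)
    finally have "norm (j (g1 t) - retr U \<Theta> S (j (g1 t))) + norm (g1 t) ^ Suc k \<le> (C1 + 1) * \<bar>t\<bar> ^ l" .
    from mult_left_mono[OF this r'(3)]
    have "\<bar>\<beta> (g1 t) $ i\<bar> \<le> B * ((C1 + 1) * \<bar>t\<bar> ^ l)"
      using r'(4) small[OF t] by (meson order_trans)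
    then show "\<bar>\<beta> (g1 t) $ i - poly 0 t\<bar> \<le> B * (C1 + 1) * \<bar>t\<bar> ^ l" by (simp add: mult.assoc)
  qed
  show ?thesis
    unfolding vanishing_pattern_def
    using nfK_vanish[OF r'(2,1) q eq2 b2] nfK_vanish_both[OF r'(2,1) q eq2 b2 eq1 b1] by blast
qed

text \<open>Supplies a bound of order 0 along a branch that need not lie in the submanifold.\<close>

lemma slice_retract_small:
  assumes \<Theta>: "diffeo_germ U (\<Theta> :: real^'m \<Rightarrow> real^'m)"
  shows "\<exists>d>0. \<forall>z. norm z < d \<longrightarrow> norm (z - retr U \<Theta> S z) \<le> 1"
proof -
  note U = \<Theta>[unfolded diffeo_germ_def]
  have "(1/2 :: real) > 0" by simp
  from smooth_small[of U \<Theta>, OF _ _ _ _ this] U obtain d1 where d1: "d1 > 0" "\<forall>x. norm x < d1 \<longrightarrow> norm (\<Theta> x) < 1/2" by blast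
  from diffeo_germ_inv_small[OF \<Theta> d1(1)] obtain d2 where d2: "d2 > 0" "\<forall>z. norm z < d2 \<longrightarrow> norm (inv_into U \<Theta> z) < d1" by blast
  have "norm (z - retr U \<Theta> S z) \<le> 1" if "norm z < min d2 (1/2)" for z
  proof -
    have "norm (cproj S (inv_into U \<Theta> z)) < d1"
      using norm_cproj_le[of S "inv_into U \<Theta> z"] d2(2) that by (smt (verit))
    then have "norm (retr U \<Theta> S z) < 1/2" using d1(2) by blast
    moreover have "norm (z - retr U \<Theta> S z) \<le> norm z + norm (retr U \<Theta> S z)" by (rule norm_triangle_ineq4)
    ultimately show ?thesis using that by simp
  qed
  then show ?thesis using d2(1) by (intro exI[of _ "min d2 (1/2)"]) auto
qed

lemma slice_retract_id:
  assumes "slice_chart U \<Theta> S M"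
  shows "\<exists>d>0. \<forall>z\<in>M. norm z < d \<longrightarrow> retr U \<Theta> S z = z"
proof -
  have \<Theta>: "inj_on \<Theta> U" using assms by (simp add: slice_chart_def diffeo_germ_def)
  obtain d where d: "d > 0" "\<forall>z. norm z < d \<longrightarrow> (z \<in> M \<longleftrightarrow> z \<in> \<Theta> ` (coord_subspace S \<inter> U))"
    using assms unfolding slice_chart_def germ_eq_iff by blast
  have "retr U \<Theta> S z = z" if z: "z \<in> M" "norm z < d" for z
  proof -
    obtain y where y: "y \<in> coord_subspace S" "y \<in> U" "z = \<Theta> y" using d(2) z by blast
    then show ?thesis using inv_into_f_f[OF \<Theta> y(2)] cproj_id[OF y(1)] by simp
  qed
  then show ?thesis using d(1) by blast
qed

lemma form_bound_of_order:
  assumes \<Theta>: "diffeo_germ U (\<Theta> :: real^'m \<Rightarrow> real^'m)" and k: "enat k \<le> form_order e \<Theta> S"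
  shows "form_bound e \<Theta> S k"
proof -
  note U = \<Theta>[unfolded diffeo_germ_def]
  obtain r where r: "r > 0" "ball 0 r \<subseteq> U" using U open_contains_ball by metis
  have s: "smooth_on (ball 0 r) \<Theta>" using U r(2) smooth_on_subset by blast
  have D: "(\<lambda>j. axis j 1) ` S \<subseteq> (Basis :: (real^'m) set)" by (auto simp: axis_in_Basis_iff)
  have "\<exists>M. \<forall>y. y \<in> coord_subspace S \<and> norm y < r / 2 \<longrightarrow> (if fst p \<in> S \<and> snd p \<in> S then \<bar>form_coeff e \<Theta> (fst p) (snd p) y\<bar> else 0) \<le> M * norm y ^ k" for p
  proof (cases "fst p \<in> S \<and> snd p \<in> S")
    case True
    have f: "smooth_on (ball 0 r) (form_coeff e \<Theta> (fst p) (snd p))"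
      unfolding form_coeff_def by (intro smooth_on_om open_ball smooth_on_fd s)
    have "form_order e \<Theta> S \<le> vanishing_order ((\<lambda>j. axis j 1) ` S) (form_coeff e \<Theta> (fst p) (snd p))"
      unfolding form_order_def using True by (meson INF_lower order_trans)
    then have v: "enat k \<le> vanishing_order ((\<lambda>j. axis j 1) ` S) (form_coeff e \<Theta> (fst p) (snd p))" using k by (rule order_trans[rotated])
    obtain C where C: "\<forall>y. norm y < r / 2 \<longrightarrow> (\<forall>b\<in>Basis - (\<lambda>j. axis j 1) ` S. y \<bullet> b = 0) \<longrightarrow> \<bar>form_coeff e \<Theta> (fst p) (snd p) y\<bar> \<le> C * norm y ^ k"
      using bound_of_vanishing_order[OF f r(1) D v] by blast
    have "\<forall>b\<in>Basis - (\<lambda>j. axis j 1) ` S. y \<bullet> b = 0" if "y \<in> coord_subspace S" for y :: "real^'m"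
      using that by (auto simp: Basis_vec_def inner_axis coord_subspace_def)
    with C have "\<forall>y. y \<in> coord_subspace S \<and> norm y < r / 2 \<longrightarrow> \<bar>form_coeff e \<Theta> (fst p) (snd p) y\<bar> \<le> C * norm y ^ k" by blast
    then show ?thesis using True by (intro exI[of _ C]) auto
  qed (auto intro: exI[of _ 0])
  from uniform_bound_finite[of "\<lambda>y. y \<in> coord_subspace S \<and> norm y < r / 2"
    "\<lambda>p y. if fst p \<in> S \<and> snd p \<in> S then \<bar>form_coeff e \<Theta> (fst p) (snd p) y\<bar> else 0" "\<lambda>y. norm y ^ k", OF this]
  obtain M where M: "\<forall>p y. y \<in> coord_subspace S \<and> norm y < r / 2 \<longrightarrow> (if fst p \<in> S \<and> snd p \<in> S then \<bar>form_coeff e \<Theta> (fst p) (snd p) y\<bar> else 0) \<le> M * norm y ^ k"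
    by auto
  have "\<bar>form_coeff e \<Theta> a b y\<bar> \<le> M * norm y ^ k" if "y \<in> coord_subspace S" "norm y < r / 2" "a \<in> S" "b \<in> S" for y a b
    using M[rule_format, of y "(a, b)"] that by simp
  then show ?thesis unfolding form_bound_def using r(1) by (intro exI[of _ "r/2"]) auto
qed

lemma form_bound_lagrangian:
  assumes "diffeo_germ U (\<Theta> :: real^'m \<Rightarrow> real^'m)" "\<forall>y \<in> coord_subspace S \<inter> U. \<forall>a\<in>S. \<forall>b\<in>S. form_coeff e \<Theta> a b y = 0"
  shows "form_bound e \<Theta> S k"
proof -
  obtain \<delta> where \<delta>: "\<delta> > 0" "ball 0 \<delta> \<subseteq> U" using assms(1) unfolding diffeo_germ_def using open_contains_ball by blast
  then show ?thesis
    unfolding form_bound_def using assms(2) by (intro exI[of _ \<delta>] conjI exI[of _ 0] ballI impI) auto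
qed

text \<open>For \<open>l = 0\<close> nothing is asked of the smooth branch. This is the case of a
  submanifold that contains only the singular branch.\<close>

lemma pattern_of_submanifold:
  fixes j :: "real^3 \<Rightarrow> real^'m"
  assumes M: "slice_chart U \<Theta> S M"
    and fb: "form_bound e \<Theta> S k"
    and j: "smooth_on (ball 0 r) j" "j 0 = 0" "r > 0" and c: "cohom r (lam j) (nfK c)"
    and d: "d > 0" "\<And>t. \<bar>t\<bar> < d \<Longrightarrow> j (g2 t) \<in> M" "\<And>t. l > 0 \<Longrightarrow> \<bar>t\<bar> < d \<Longrightarrow> j (g1 t) \<in> M" and l: "l \<le> Suc k"
  shows "vanishing_pattern (3 * Suc k) l c"
proof -
  have \<Theta>: "diffeo_germ U \<Theta>" using M by (simp add: slice_chart_def)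
  from slice_retract_id[OF M] obtain d1 where d1: "d1 > 0" "\<forall>z\<in>M. norm z < d1 \<longrightarrow> retr U \<Theta> S z = z" by blast
  from slice_retract_small[OF \<Theta>, of S] obtain d2 where d2: "d2 > 0" "\<forall>z. norm z < d2 \<longrightarrow> norm (z - retr U \<Theta> S z) \<le> 1" by blast
  have "min d1 d2 > 0" "(0::real^3) \<in> ball 0 r" using d1 d2 j(3) by auto
  from smooth_small[OF j(1) open_ball this(2) j(2) this(1)] obtain q where q: "q > 0" "\<forall>x. norm x < q \<longrightarrow> norm (j x) < min d1 d2" by blast
  define p where "p = min (min d q) (min 1 (q / 3))"
  have p: "p > 0" using d(1) q(1) by (simp add: p_def)
  have small: "\<bar>t\<bar> < d" "norm (j (g1 t)) < min d1 d2" "norm (j (g2 t)) < min d1 d2" if "\<bar>t\<bar> < p" for t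
    using that q(2) norm_g2_less[OF q(1), of t] by (auto simp: p_def)
  show ?thesis
  proof (rule pattern_of_core[OF \<Theta> fb j c p])
    show "norm (j (g2 t) - retr U \<Theta> S (j (g2 t))) \<le> 0 * \<bar>t\<bar> ^ (3 * Suc k)" if "\<bar>t\<bar> < p" for t
      using d1(2) d(2)[OF small(1)[OF that]] small(3)[OF that] by simp
    show "norm (j (g1 t) - retr U \<Theta> S (j (g1 t))) \<le> (if l > 0 then 0 else 1) * \<bar>t\<bar> ^ l" if "\<bar>t\<bar> < p" for t
    proof (cases "l > 0")
      case True
      then show ?thesis using d1(2) d(3)[OF True small(1)[OF that]] small(2)[OF that] by simp
    next
      case False
      then show ?thesis using d2(2) small(2)[OF that] by simp
    qed
  qed (use l in auto)
qed

text \<open>The equations complete the coordinates along the submanifold to a chart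
  \<open>F\<close>. They vanish on the submanifold, so the images under \<open>F\<close> of a point
  and of its projection differ just by the values of the equations; the inverse chart and
  \<open>\<Theta>\<close> are Lipschitz.\<close>

lemma lagrangian_retract_bound:
  assumes L: "slice_chart U (\<Theta> :: real^'m \<Rightarrow> real^'m) S L" "card S = n" and H: "regular_equations n H L"
  shows "\<exists>C\<ge>0. \<exists>d>0. \<forall>z. norm z < d \<longrightarrow> norm (z - retr U \<Theta> S z) \<le> C * (\<Sum>i = 1..n. \<bar>H i z\<bar>)"
proof -
  have \<Theta>: "diffeo_germ U \<Theta>" using L by (simp add: slice_chart_def)
  note U = \<Theta>[unfolded diffeo_germ_def]
  obtain V where V: "open V" "0 \<in> V" "\<And>i. i \<in> {1..n} \<Longrightarrow> smooth_on V (H i)"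
    using H unfolding regular_equations_def by blast
  obtain dV where dV: "dV > 0" "ball 0 dV \<subseteq> V" using V open_contains_ball by blast
  obtain d0 where d0: "d0 > 0" "\<forall>z. norm z < d0 \<longrightarrow> (z \<in> L \<longleftrightarrow> (\<forall>i\<in>{1..n}. H i z = 0))"
    using H unfolding regular_equations_def germ_eq_iff by blast
  obtain d1 where d1: "d1 > 0" "\<forall>z. norm z < d1 \<longrightarrow> (z \<in> L \<longleftrightarrow> z \<in> \<Theta> ` (coord_subspace S \<inter> U))"
    using L unfolding slice_chart_def germ_eq_iff by blast
  have sm\<Theta>: "smooth_on U \<Theta>" "open U" "0 \<in> U" "\<Theta> 0 = 0" using U by auto
  have "min dV (min d0 d1) > 0" using dV d0 d1 by simp
  from smooth_small[OF sm\<Theta> this] obtain r where r: "r > 0" "ball 0 r \<subseteq> U" "\<forall>y. norm y < r \<longrightarrow> norm (\<Theta> y) < min dV (min d0 d1)" by blast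
  have s\<Theta>: "smooth_on (ball 0 r) \<Theta>" by (rule smooth_on_subset[OF sm\<Theta>(1) r(2)])
  define K where "K i y = H i (\<Theta> y)" for i y
  have K: "smooth_on (ball 0 r) (K i)" if "i \<in> {1..n}" for i
    unfolding K_def by (rule smooth_on_compose[OF open_ball V(1) V(3)[OF that] s\<Theta>]) (use r dV in auto)
  have K0: "K i y = 0" if "i \<in> {1..n}" "y \<in> coord_subspace S" "norm y < r" for i y
  proof -
    have "\<Theta> y \<in> L" using d1(2) r that by auto
    then show ?thesis using d0(2) r that unfolding K_def by auto
  qed
  have "card (- S) = n" using L(2) card_m by (simp add: Compl_eq_Diff_UNIV card_Diff_subset)
  then obtain b where b: "bij_betw b {1..n} (- S)" using finite_same_card_bij[of "{1..n}" "- S"] by auto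
  define F where "F y = cproj S y + (\<Sum>i = 1..n. K i y *\<^sub>R axis (b i) 1)" for y
  have F: "smooth_on (ball 0 r) F"
    unfolding F_def by (intro smooth_on_add smooth_on_sum smooth_on_scaleR smooth_on_const smooth_on_bounded_linear bounded_linear_cproj open_ball K)
  have z: "0 \<in> ball (0::real^'m) r" using r by simp
  have zS: "0 \<in> coord_subspace S" by (simp add: coord_subspace_def)
  have F0: "F 0 = 0" using K0[OF _ zS] r by (simp add: F_def)
  have fdF: "fd F 0 v = cproj S v + (\<Sum>i = 1..n. fd (K i) 0 v *\<^sub>R axis (b i) 1)" for v
  proof -
    have "(F has_derivative (\<lambda>v. cproj S v + (\<Sum>i = 1..n. fd (K i) 0 v *\<^sub>R axis (b i) 1))) (at 0)"
      unfolding F_def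
      by (intro has_derivative_add has_derivative_sum has_derivative_scaleR_left bounded_linear_imp_has_derivative bounded_linear_cproj
          smooth_on_has_derivative[OF K z])
    from fd_eq[OF this] show ?thesis by simp
  qed
  have Fnth: "fd F 0 v $ b k = fd (K k) 0 v" if "k \<in> {1..n}" for v k
  proof -
    have nS: "b k \<notin> S" using bij_betwE[OF b, THEN bspec, OF that] by simp
    have "(\<Sum>i = 1..n. fd (K i) 0 v * axis (b i) 1 $ b k) = (\<Sum>i = 1..n. if i = k then fd (K i) 0 v else 0)"

    proof (rule sum.cong[OF refl])
      fix i assume "i \<in> {1..n}"
      then have "b i = b k \<longleftrightarrow> i = k" using b that by (meson bij_betw_imp_inj_on inj_on_eq_iff)
      then show "fd (K i) 0 v * axis (b i) 1 $ b k = (if i = k then fd (K i) 0 v else 0)" by (auto simp: axis_def)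
    qed
    also have "\<dots> = fd (K k) 0 v" using that by simp
    finally show ?thesis using nS unfolding fdF by (simp add: sum_component)
  qed
  have FnthS: "fd F 0 v $ a = v $ a" if "a \<in> S" for v a
  proof -
    have "axis (b i) 1 $ a = (0::real)" if "i \<in> {1..n}" for i

    proof -
      have "b i \<in> - S" using b that by (rule bij_betwE[THEN bspec])
      then have "b i \<noteq> a" using \<open>a \<in> S\<close> by blast
      then show ?thesis by (simp add: axis_def)
    qed
    then show ?thesis using that unfolding fdF by (simp add: sum_component)
  qed
  have lin: "linear (fd F 0)" by (rule linear_fd[OF F z])
  have dK: "fd (K i) 0 v = fd (H i) 0 (fd \<Theta> 0 v)" if "i \<in> {1..n}" for i v
  proof -
    have "(K i has_derivative (\<lambda>v. fd (H i) 0 (fd \<Theta> 0 v))) (at 0)"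
      unfolding K_def
      by (rule has_derivative_compose[OF smooth_on_has_derivative[OF s\<Theta> z]])
         (use smooth_on_has_derivative[OF V(3)[OF that] V(2)] sm\<Theta>(4) in simp)
    from fd_eq[OF this] show ?thesis by simp
  qed
  have dKS: "fd (K i) 0 (axis a 1) = 0" if i: "i \<in> {1..n}" and a: "a \<in> S" for i a
  proof -
    have k: "(K i has_derivative fd (K i) 0) (at (0 *\<^sub>R axis a 1))"
      using smooth_on_has_derivative[OF K[OF i] z] by simp
    have "((\<lambda>t. t *\<^sub>R axis a 1) has_derivative (\<lambda>t. t *\<^sub>R (axis a 1 :: real^'m))) (at (0::real))"
      by (rule bounded_linear_imp_has_derivative[OF bounded_linear_scaleR_left])
    from has_derivative_compose[OF this k]
    have "((\<lambda>t. K i (t *\<^sub>R axis a 1)) has_derivative (\<lambda>t. fd (K i) 0 (t *\<^sub>R axis a 1))) (at 0)" .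
    moreover have "((\<lambda>t. K i (t *\<^sub>R axis a 1)) has_derivative (\<lambda>t::real. 0)) (at 0)"
    proof (rule has_derivative_transform_within_open[of "\<lambda>_. 0" _ _ _ "ball 0 r"])
      show "0 = K i (t *\<^sub>R axis a 1)" if "t \<in> ball 0 r" for t

      proof (rule K0[OF i, symmetric])
        show "t *\<^sub>R axis a 1 \<in> coord_subspace S" using a by (auto simp: coord_subspace_def axis_def)
        show "norm (t *\<^sub>R axis a 1 :: real^'m) < r" using that by simp
      qed
    qed (use r in auto)
    ultimately have "(\<lambda>t. fd (K i) 0 (t *\<^sub>R axis a 1)) = (\<lambda>t. 0)" by (rule has_derivative_unique)
    from fun_cong[OF this, of 1] show ?thesis by simp
  qed
  \<comment> \<open>A vector orthogonal to the range has no components in \<open>S\<close>, and its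
    remaining components form a linear relation between the differentials of the \<open>H i\<close>,
    which regularity excludes.\<close>
  have surj: "surj (fd F 0)"
  proof (rule ccontr)
    assume "\<not> surj (fd F 0)"
    moreover have sp: "span (range (fd F 0)) = range (fd F 0)" by (simp only: span_eq_iff linear_subspace_image[OF lin subspace_UNIV])
    ultimately have "span (range (fd F 0)) \<noteq> UNIV" by (metis sp)
    from span_not_UNIV_orthogonal[OF this] obtain a where a: "a \<noteq> 0" "\<forall>x\<in>span (range (fd F 0)). a \<bullet> x = 0" by blast
    then have av: "a \<bullet> fd F 0 v = 0" for v by (auto intro: span_base)
    have ex: "a \<bullet> w = (\<Sum>i\<in>S. a $ i * w $ i) + (\<Sum>k = 1..n. a $ b k * w $ b k)" for w
    proof -
      have "a \<bullet> w = (\<Sum>i\<in>S \<union> - S. a $ i * w $ i)" by (simp add: inner_vec_def)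
      also have "\<dots> = (\<Sum>i\<in>S. a $ i * w $ i) + (\<Sum>i\<in>- S. a $ i * w $ i)" by (rule sum.union_disjoint) auto
      also have "(\<Sum>i\<in>- S. a $ i * w $ i) = (\<Sum>k = 1..n. a $ b k * w $ b k)"
        by (rule sum.reindex_bij_betw[OF b, symmetric])
      finally show ?thesis .
    qed
    have aS: "a $ i = 0" if "i \<in> S" for i
    proof -
      have "0 = (\<Sum>k\<in>S. a $ k * axis i 1 $ k)"
        using av[of "axis i 1"] unfolding ex by (simp add: FnthS Fnth dKS[OF _ that])
      also have "\<dots> = (\<Sum>k\<in>S. if k = i then a $ k else 0)" by (rule sum.cong) (auto simp: axis_def)
      also have "\<dots> = a $ i" using that by simp
      finally show ?thesis by simp
    qed
    have "(\<Sum>k = 1..n. a $ b k * fd (H k) 0 w) = 0" for w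
    proof -
      obtain v where v: "w = fd \<Theta> 0 v" using diffeo_germ_inv_fd(2)[OF \<Theta> sm\<Theta>(3)] by metis
      show ?thesis using av[of v] unfolding ex v by (simp add: aS Fnth dK)
    qed
    then have ab: "\<forall>k\<in>{1..n}. a $ b k = 0" using H unfolding regular_equations_def by (elim conjE allE[of _ "\<lambda>k. a $ b k"]) auto
    have "a $ i = 0" for i
    proof (cases "i \<in> S")
      case False
      then obtain k where "k \<in> {1..n}" "i = b k" using b unfolding bij_betw_def by blast
      then show ?thesis using ab by simp
    qed (rule aS)
    then show False using a(1) by (simp add: vec_eq_iff)
  qed
  have inj: "inj (fd F 0)" by (rule linear_surjective_imp_injective[OF lin surj]) simp
  from diffeo_germI[OF open_ball z F F0 inj] obtain U' where U': "U' \<subseteq> ball 0 r" "diffeo_germ U' F" by blast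
  note U'd = U'(2)[unfolded diffeo_germ_def]
  have oFU': "open (F ` U')" "0 \<in> F ` U'" using U'd by (auto intro: image_eqI[of _ _ 0])
  obtain q1 where q1: "q1 > 0" "ball 0 q1 \<subseteq> F ` U'" using oFU' open_contains_ball by blast
  have si: "smooth_on (ball 0 q1) (inv_into U' F)" using U'd smooth_on_subset q1(2) by blast
  from smooth_lipschitz[OF si q1(1)] obtain C1 where C1: "C1 \<ge> 0"
    "\<forall>x y. norm x < q1 / 2 \<longrightarrow> norm y < q1 / 2 \<longrightarrow> norm (inv_into U' F x - inv_into U' F y) \<le> C1 * norm (x - y)" by blast
  from smooth_lipschitz[OF s\<Theta> r(1)] obtain C2 where C2: "C2 \<ge> 0"
    "\<forall>x y. norm x < r / 2 \<longrightarrow> norm y < r / 2 \<longrightarrow> norm (\<Theta> x - \<Theta> y) \<le> C2 * norm (x - y)" by blast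
  have q1h: "q1 / 2 > 0" using q1 by simp
  have "open U'" "0 \<in> U'" "F 0 = 0" "smooth_on U' F" using U'd by auto
  from smooth_small[OF this(4,1,2,3) q1h] obtain q2 where q2: "q2 > 0" "ball 0 q2 \<subseteq> U'" "\<forall>x. norm x < q2 \<longrightarrow> norm (F x) < q1 / 2" by blast
  have "min q2 (r / 2) > 0" using q2 r by simp
  from diffeo_germ_inv_small[OF \<Theta> this] obtain d where d: "d > 0"
    "\<forall>z. norm z < d \<longrightarrow> z \<in> \<Theta> ` U \<and> norm (inv_into U \<Theta> z) < min q2 (r / 2) \<and> \<Theta> (inv_into U \<Theta> z) = z" by blast
  have "norm (z - retr U \<Theta> S z) \<le> C2 * C1 * (\<Sum>i = 1..n. \<bar>H i z\<bar>)" if "norm z < d" for z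
  proof -
    define y where "y = inv_into U \<Theta> z"
    have y: "norm y < q2" "norm y < r / 2" "\<Theta> y = z" using d(2) that by (auto simp: y_def)
    have py: "norm (cproj S y) < q2" "norm (cproj S y) < r / 2" using norm_cproj_le[of S y] y by auto
    have inv: "inv_into U' F (F x) = x" if "norm x < q2" for x
      using U'd q2(2) that by (intro inv_into_f_f) auto
    have "F y - F (cproj S y) = (\<Sum>i = 1..n. K i y *\<^sub>R axis (b i) 1)"
      using K0[OF _ cproj_in, of _ y] py(2) r(1) by (simp add: F_def cproj_id[OF cproj_in])
    also have "norm \<dots> \<le> (\<Sum>i = 1..n. \<bar>H i z\<bar>)"
      by (rule order_trans[OF norm_sum]) (simp add: K_def y(3))
    finally have f: "norm (F y - F (cproj S y)) \<le> (\<Sum>i = 1..n. \<bar>H i z\<bar>)" .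
    have "norm (y - cproj S y) \<le> C1 * norm (F y - F (cproj S y))"
      using C1(2)[rule_format, of "F y" "F (cproj S y)"] q2(3) y py inv by simp
    also have "\<dots> \<le> C1 * (\<Sum>i = 1..n. \<bar>H i z\<bar>)" using f C1(1) by (rule mult_left_mono)
    finally have g: "norm (y - cproj S y) \<le> C1 * (\<Sum>i = 1..n. \<bar>H i z\<bar>)" .
    have "norm (z - \<Theta> (cproj S y)) \<le> C2 * norm (y - cproj S y)" using C2(2) y py by metis
    also have "\<dots> \<le> C2 * (C1 * (\<Sum>i = 1..n. \<bar>H i z\<bar>))" using g C2(1) by (rule mult_left_mono)
    finally show ?thesis by (simp add: y_def mult.assoc)
  qed
  then show ?thesis using d(1) C1(1) C2(1) by (intro exI[of _ "C2 * C1"] conjI exI[of _ d]) auto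
qed

text \<open>On a Lagrangian submanifold the form vanishes identically, so the distance to the
  retraction, which is bounded by the equations, is the only source of error.\<close>

lemma pattern_of_equations:
  fixes j :: "real^3 \<Rightarrow> real^'m"
  assumes H: "lagrangian_equations e H"
    and j: "smooth_on (ball 0 r) j" "j 0 = 0" "r > 0" and c: "cohom r (lam j) (nfK c)"
    and d: "d > 0" "\<And>t i. \<bar>t\<bar> < d \<Longrightarrow> i \<in> {1..n} \<Longrightarrow> \<bar>H i (j (g2 t))\<bar> \<le> C2 * \<bar>t\<bar> ^ m"
      "\<And>t i. \<bar>t\<bar> < d \<Longrightarrow> i \<in> {1..n} \<Longrightarrow> \<bar>H i (j (g1 t))\<bar> \<le> C1 * \<bar>t\<bar> ^ l"
  shows "vanishing_pattern m l c"
proof -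
  have n2: "CARD('m) div 2 = n" using card_m by simp
  obtain L U \<Theta> S where L: "slice_chart U \<Theta> S L" "card S = n"
    "\<forall>y \<in> coord_subspace S \<inter> U. \<forall>a\<in>S. \<forall>b\<in>S. form_coeff e \<Theta> a b y = 0" and reg: "regular_equations n H L"
    using H unfolding lagrangian_equations_def lagrangian_germ_def n2 by blast
  have \<Theta>: "diffeo_germ U \<Theta>" using L by (simp add: slice_chart_def)
  from lagrangian_retract_bound[OF L(1,2) reg] obtain B q where B: "B \<ge> 0" "q > 0"
    "\<forall>z. norm z < q \<longrightarrow> norm (z - retr U \<Theta> S z) \<le> B * (\<Sum>i = 1..n. \<bar>H i z\<bar>)" by blast
  have "(0::real^3) \<in> ball 0 r" using j(3) by simp
  from smooth_small[OF j(1) open_ball this j(2) B(2)] obtain p where p: "p > 0" "\<forall>x. norm x < p \<longrightarrow> norm (j x) < q" by blast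
  define w where "w = min (min d p) (min 1 (p / 3))"
  have w: "w > 0" using d(1) p(1) by (simp add: w_def)
  have small: "\<bar>t\<bar> < d" "norm (j (g1 t)) < q" "norm (j (g2 t)) < q" if "\<bar>t\<bar> < w" for t
    using that p(2) norm_g2_less[OF p(1), of t] by (auto simp: w_def)
  have bnd: "norm (z - retr U \<Theta> S z) \<le> B * real n * C * T" if "norm z < q" "\<And>i. i \<in> {1..n} \<Longrightarrow> \<bar>H i z\<bar> \<le> C * T" for z C T
  proof -
    have "(\<Sum>i = 1..n. \<bar>H i z\<bar>) \<le> (\<Sum>i = 1..n. C * T)" by (rule sum_mono) (rule that(2))
    then have "(\<Sum>i = 1..n. \<bar>H i z\<bar>) \<le> real n * (C * T)" by simp
    from mult_left_mono[OF this B(1)] have "B * (\<Sum>i = 1..n. \<bar>H i z\<bar>) \<le> B * real n * C * T" by (simp add: mult.assoc)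
    with B(3) that(1) show ?thesis by (meson order_trans)
  qed
  \<comment> \<open>Every order is available for the form; \<open>m + l\<close> meets both caps of
    \<open>pattern_of_core\<close>.\<close>
  show ?thesis
  proof (rule pattern_of_core[OF \<Theta> form_bound_lagrangian[OF \<Theta> L(3), of "m + l"] j c w])
    show "norm (j (g2 t) - retr U \<Theta> S (j (g2 t))) \<le> B * real n * C2 * \<bar>t\<bar> ^ m" if "\<bar>t\<bar> < w" for t
      by (rule bnd) (use small[OF that] d(2) in auto)
    show "norm (j (g1 t) - retr U \<Theta> S (j (g1 t))) \<le> B * real n * C1 * \<bar>t\<bar> ^ l" if "\<bar>t\<bar> < w" for t
      by (rule bnd) (use small[OF that] d(3) in auto)
  qed auto
qed

end

section \<open>Lagrangian germs from shears\<close>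

context symplectic_coords
begin

text \<open>The first three momenta. For \<open>n = 2\<close> the missing third one is set to 0, so
  that shears in both dimensions are given by maps of R^3.\<close>

definition pp :: "real^'m \<Rightarrow> real^3" where
  "pp z = vector [z $ e 1, z $ e 3, if n \<ge> 3 then z $ e 5 else 0]"

definition qq :: "real^3 \<Rightarrow> real^'m" where
  "qq a = a$1 *\<^sub>R E 2 + a$2 *\<^sub>R E 4 + (if n \<ge> 3 then a$3 else 0) *\<^sub>R E 6"

definition shear :: "(real^3 \<Rightarrow> real^3) \<Rightarrow> real^'m \<Rightarrow> real^'m" where
  "shear A z = z + qq (A (pp z))"

lemma pp_nth [simp]: "pp z $ 1 = z $ e 1" "pp z $ 2 = z $ e 3" "pp z $ 3 = (if n \<ge> 3 then z $ e 5 else 0)"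
  by (simp_all add: pp_def)

lemma bounded_linear_pp: "bounded_linear pp"
  unfolding linear_conv_bounded_linear[symmetric] by (rule linearI) (simp_all add: vec3_eq_iff)

lemma bounded_linear_qq: "bounded_linear qq"
  unfolding linear_conv_bounded_linear[symmetric] by (rule linearI) (simp_all add: qq_def algebra_simps scaleR_add_left)

lemma qq_0 [simp]: "qq 0 = 0"
  by (simp add: qq_def)

lemma qq_minus: "qq (- a) = - qq a"
  by (simp add: qq_def algebra_simps)

lemma qq_odd: "i \<in> {1..n} \<Longrightarrow> qq a $ e (2*i - 1) = 0"
proof -
  assume i: "i \<in> {1..n}"
  have "e (2*i-1) \<noteq> e (2*k)" if "k \<in> {1..n}" for k
    using i that e_eq_iff[of "2*i-1" "2*k"] by auto presburger
  from this[of 1] this[of 2] this[of 3] show ?thesis using n_ge unfolding qq_def by (auto simp: axis_def)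
qed

lemma qq_even: "i \<in> {1..n} \<Longrightarrow> qq a $ e (2*i) = (if i = 1 then a$1 else if i = 2 then a$2 else if i = 3 then a$3 else 0)"
proof -
  assume i: "i \<in> {1..n}"
  have "e (2*i) = e (2*k) \<longleftrightarrow> i = k" if "k \<in> {1..n}" for k
    using i that e_eq_iff[of "2*i" "2*k"] by auto
  from this[of 1] this[of 2] this[of 3] show ?thesis using n_ge i unfolding qq_def by (auto simp: axis_def)
qed

lemma pp_qq [simp]: "pp (qq a) = 0"
  using qq_odd[of 1 a] qq_odd[of 2 a] qq_odd[of 3 a] n_ge by (simp add: vec3_eq_iff)

lemma pp_add: "pp (u + v) = pp u + pp v"
  by (simp add: vec3_eq_iff)

lemma pp_diff: "pp (u - v) = pp u - pp v"
  by (simp add: vec3_eq_iff)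

lemma om_qq: "om u (qq a) = pp u \<bullet> a"
  using om_E4(2,4)[of u] om_E6(2)[of u] by (simp add: qq_def om_simps inner_vec_def sum_3)

lemma pp_shear [simp]: "pp (shear A z) = pp z"
  by (simp add: shear_def pp_add)

lemma shear_inverse: "shear (\<lambda>x. - A x) (shear A z) = z" "shear A (shear (\<lambda>x. - A x) z) = z"
  by (simp_all add: shear_def[of A] shear_def[of "\<lambda>x. - A x"] pp_add pp_diff qq_minus)

lemma smooth_on_shear:
  assumes "smooth_on UNIV A" "open U" shows "smooth_on U (shear A)"
proof -
  have "smooth_on U (\<lambda>z. A (pp z))"
    by (rule smooth_on_compose[OF assms(2) open_UNIV assms(1) smooth_on_bounded_linear[OF bounded_linear_pp]]) auto
  then show ?thesis
    unfolding shear_def[abs_def]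
    by (intro smooth_on_add smooth_on_ident smooth_on_bounded_linear_compose[OF bounded_linear_qq] assms(2))
qed

lemma fd_shear:
  assumes "smooth_on UNIV A"
  shows "fd (shear A) z v = v + qq (fd A (pp z) (pp v))"
proof -
  have "((\<lambda>z. A (pp z)) has_derivative (\<lambda>v. fd A (pp z) (pp v))) (at z)"
    by (rule has_derivative_compose[OF bounded_linear_imp_has_derivative[OF bounded_linear_pp] smooth_on_has_derivative[OF assms UNIV_I]])
  then have "(shear A has_derivative (\<lambda>v. v + qq (fd A (pp z) (pp v)))) (at z)"
    unfolding shear_def[abs_def]
    by (intro has_derivative_add has_derivative_ident bounded_linear.has_derivative[OF bounded_linear_qq])
  from fd_eq[OF this] show ?thesis by simp
qed

text \<open>The form changes by the antisymmetric part of the derivative of \<open>A\<close>. A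
  shear by a gradient is therefore symplectic, and any other shear measures the form on the sheared
  plane of momenta.\<close>

lemma om_fd_shear:
  assumes "smooth_on UNIV A"
  shows "om (fd (shear A) z u) (fd (shear A) z v) = om u v + pp u \<bullet> fd A (pp z) (pp v) - pp v \<bullet> fd A (pp z) (pp u)"
proof -
  have "om (qq a) v = - (pp v \<bullet> a)" for a v using om_swap[of "qq a" v] om_qq[of v a] by simp
  then show ?thesis unfolding fd_shear[OF assms] by (simp add: om_simps om_qq pp_add)
qed

lemma diffeo_germ_shear:
  assumes A: "smooth_on UNIV A" "A 0 = 0"
  shows "diffeo_germ UNIV (shear A)" "inv_into UNIV (shear A) = shear (\<lambda>x. - A x)"
proof -
  have bij: "bij (shear A)" by (rule o_bij[of "shear (\<lambda>x. - A x)"]) (auto simp: shear_inverse)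
  show i: "inv_into UNIV (shear A) = shear (\<lambda>x. - A x)"
    by (rule inv_equality) (simp_all add: shear_inverse)
  have "pp 0 = 0" by (simp add: vec3_eq_iff)
  then have "shear A 0 = 0" by (simp add: shear_def A(2))
  then show "diffeo_germ UNIV (shear A)"
    unfolding diffeo_germ_def i using bij by (auto simp: bij_def A intro!: smooth_on_shear smooth_on_minus)
qed

text \<open>As \<open>\<Gamma>\<close> preserves the form, the coefficients in the composed chart
  are those of the shear alone.\<close>

lemma shear_chart:
  assumes G: "symplecto_germ e W \<Gamma>" and A: "smooth_on UNIV A" "A 0 = 0"
  shows "diffeo_germ (shear A -` W) (\<lambda>z. \<Gamma> (shear A z))"
    and "shear A z \<in> W \<Longrightarrow> form_coeff e (\<lambda>z. \<Gamma> (shear A z)) a b z = om (axis a 1) (axis b 1)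
       + pp (axis a 1) \<bullet> fd A (pp z) (pp (axis b 1)) - pp (axis b 1) \<bullet> fd A (pp z) (pp (axis a 1))"
    and "y \<in> W \<Longrightarrow> inv_into (shear A -` W) (\<lambda>z. \<Gamma> (shear A z)) (\<Gamma> y) = shear (\<lambda>x. - A x) y"
proof -
  have dG: "diffeo_germ W \<Gamma>" using G by (simp add: symplecto_germ_def)
  then have W: "open W" "0 \<in> W" "inj_on \<Gamma> W" "smooth_on W \<Gamma>" by (auto simp: diffeo_germ_def)
  note dS = diffeo_germ_shear(1)[OF A]
  have s0: "shear A 0 = 0" using dS by (simp add: diffeo_germ_def)
  have o: "open (shear A -` W)"
    using continuous_open_vimage[OF W(1), of "shear A"] smooth_on_continuous[OF smooth_on_shear[OF A(1) open_UNIV]]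
    by (simp add: continuous_on_eq_continuous_at)
  have z: "0 \<in> shear A -` W" using W(2) s0 by simp
  have "diffeo_germ (UNIV \<inter> (shear A -` W)) (shear A)" by (rule diffeo_germ_shrink[OF dS o z])
  then show d: "diffeo_germ (shear A -` W) (\<lambda>z. \<Gamma> (shear A z))"
    using diffeo_germ_compose[OF _ dG] by auto
  show "form_coeff e (\<lambda>z. \<Gamma> (shear A z)) a b z = om (axis a 1) (axis b 1)
       + pp (axis a 1) \<bullet> fd A (pp z) (pp (axis b 1)) - pp (axis b 1) \<bullet> fd A (pp z) (pp (axis a 1))" if zW: "shear A z \<in> W"
  proof -
    have "((\<lambda>z. \<Gamma> (shear A z)) has_derivative (\<lambda>v. fd \<Gamma> (shear A z) (fd (shear A) z v))) (at z)"
      by (rule has_derivative_compose[OF smooth_on_has_derivative[OF smooth_on_shear[OF A(1) open_UNIV] UNIV_I] smooth_on_has_derivative[OF W(4) zW]])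
    then have "fd (\<lambda>z. \<Gamma> (shear A z)) z v = fd \<Gamma> (shear A z) (fd (shear A) z v)" for v by (simp add: fd_eq)
    then have "form_coeff e (\<lambda>z. \<Gamma> (shear A z)) a b z = om (fd (shear A) z (axis a 1)) (fd (shear A) z (axis b 1))"
      using G zW by (simp add: form_coeff_def symplecto_germ_def)
    then show ?thesis by (simp add: om_fd_shear[OF A(1)])
  qed
  show "inv_into (shear A -` W) (\<lambda>z. \<Gamma> (shear A z)) (\<Gamma> y) = shear (\<lambda>x. - A x) y" if "y \<in> W"
  proof (rule inv_into_f_eq)
    show "inj_on (\<lambda>z. \<Gamma> (shear A z)) (shear A -` W)" using d by (simp add: diffeo_germ_def)
  qed (use that in \<open>auto simp: shear_inverse\<close>)
qed

text \<open>\<open>P\<close> is the set of \<open>i\<close> for which the equation \<open>p\<^sub>i = 0\<close> is used instead of \<open>q\<^sub>i = 0\<close>.\<close>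
definition coord_choice :: "nat set \<Rightarrow> nat \<Rightarrow> nat" where
  "coord_choice P i = (if i \<in> P then 2*i - 1 else 2*i)"

text \<open>A plane on which one coordinate of each canonical pair vanishes is Lagrangian, and both
  \<open>\<Gamma>\<close> and a shear with symmetric derivative preserve this. The transported
  coordinates are regular equations, evaluated at \<open>\<Gamma> y\<close> by the inverse
  shear.\<close>

lemma coord_choice_lagrangian:
  fixes P :: "nat set"
  assumes G: "symplecto_germ e W \<Gamma>" and A: "smooth_on UNIV A" "A 0 = 0"
    and sym: "\<And>x u v. u \<bullet> fd A x v = v \<bullet> fd A x u"
  defines "H \<equiv> \<lambda>i z. inv_into (shear A -` W) (\<lambda>z. \<Gamma> (shear A z)) z $ e (coord_choice P i)"
    and "L \<equiv> (\<lambda>z. \<Gamma> (shear A z)) ` ({z. \<forall>i\<in>{1..n}. z $ e (coord_choice P i) = 0} \<inter> (shear A -` W))"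
  shows "lagrangian_germ e L" "lagrangian_equations e H" "smooth_on (\<Gamma> ` W) (H i)"
    "y \<in> W \<Longrightarrow> H i (\<Gamma> y) = shear (\<lambda>x. - A x) y $ e (coord_choice P i)"
    "y \<in> W \<Longrightarrow> (\<forall>i\<in>{1..n}. shear (\<lambda>x. - A x) y $ e (coord_choice P i) = 0) \<Longrightarrow> \<Gamma> y \<in> L"
proof -
  let ?U = "shear A -` W" and ?\<Theta> = "\<lambda>z. \<Gamma> (shear A z)"
  let ?g = "coord_choice P"
  define S where "S = UNIV - (\<lambda>i. e (?g i)) ` {1..n}"
  note d = shear_chart(1)[OF G A]
  note dd = d[unfolded diffeo_germ_def]
  have im: "?\<Theta> ` ?U = \<Gamma> ` W"
  proof -
    have "shear A ` ?U = W"
    proof (intro equalityI subsetI)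
      fix y assume "y \<in> W"
      then show "y \<in> shear A ` ?U" by (intro image_eqI[of _ _ "shear (\<lambda>x. - A x) y"]) (auto simp: shear_inverse)
    qed auto
    then show ?thesis by (metis image_image)
  qed
  have g: "?g i \<in> {1..2*n}" if "i \<in> {1..n}" for i using that by (auto simp: coord_choice_def)
  have ginj: "?g i = ?g k \<longleftrightarrow> i = k" if "i \<in> {1..n}" "k \<in> {1..n}" for i k
    using that unfolding coord_choice_def by (auto split: if_splits; presburger)
  have einj: "e (?g i) = e (?g k) \<longleftrightarrow> i = k" if "i \<in> {1..n}" "k \<in> {1..n}" for i k
    using e_eq_iff[OF g g] ginj that by simp
  have "card ((\<lambda>i. e (?g i)) ` {1..n}) = n"
    using card_image[of "\<lambda>i. e (?g i)" "{1..n}"] einj by (simp add: inj_on_def)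
  then have cS: "card S = n" unfolding S_def using card_m by (simp add: card_Diff_subset)
  have Lc: "coord_subspace S = {z. \<forall>i\<in>{1..n}. z $ e (?g i) = 0}" by (auto simp: coord_subspace_def S_def)
  have iso: "om (axis a 1) (axis b 1) = 0" if "a \<in> S" "b \<in> S" for a b
  proof -
    have "axis a 1 $ e (?g i) = (0::real) \<and> axis b 1 $ e (?g i) = (0::real)" if "i \<in> {1..n}" for i
      using \<open>a \<in> S\<close> \<open>b \<in> S\<close> that by (auto simp: S_def axis_def)
    then show ?thesis unfolding om_def coord_choice_def by (intro sum.neutral) (force split: if_splits)
  qed
  have sl: "slice_chart ?U ?\<Theta> S L"
    unfolding slice_chart_def L_def Lc[symmetric] using d by (simp add: germ_eq_def)
  show lag: "lagrangian_germ e L"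
    unfolding lagrangian_germ_def
  proof (intro exI conjI ballI)
    show "card S = CARD('m) div 2" using cS card_m by simp
    show "form_coeff e ?\<Theta> a b y = 0" if "y \<in> coord_subspace S \<inter> ?U" "a \<in> S" "b \<in> S" for y a b
      using shear_chart(2)[OF G A, of y a b] that iso[OF that(2,3)] sym[of "pp (axis a 1)" "pp y" "pp (axis b 1)"] by simp
  qed (rule sl)
  have sH: "smooth_on (\<Gamma> ` W) (H i)" for i
    unfolding H_def by (rule smooth_on_nth) (use dd im in auto)
  show "smooth_on (\<Gamma> ` W) (H i)" by (rule sH)
  show "H i (\<Gamma> y) = shear (\<lambda>x. - A x) y $ e (coord_choice P i)" if "y \<in> W"
    unfolding H_def shear_chart(3)[OF G A that] by simp
  show "\<Gamma> y \<in> L" if "y \<in> W" "\<forall>i\<in>{1..n}. shear (\<lambda>x. - A x) y $ e (coord_choice P i) = 0"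
    unfolding L_def by (rule image_eqI[of _ _ "shear (\<lambda>x. - A x) y"]) (use that in \<open>auto simp: shear_inverse\<close>)
  have "regular_equations n H L"
    unfolding regular_equations_def
  proof (intro conjI allI impI)
    have "open (\<Gamma> ` W)" "0 \<in> \<Gamma> ` W" using G by (auto simp: symplecto_germ_def diffeo_germ_def intro: image_eqI[of _ _ 0])
    then show "\<exists>U. open U \<and> 0 \<in> U \<and> (\<forall>i\<in>{1..n}. smooth_on U (H i))" using sH by blast
    have inj: "inj_on ?\<Theta> ?U" using dd by simp
    from diffeo_germ_inv_small[OF d, of 1] obtain q where q: "q > 0" "\<forall>z. norm z < q \<longrightarrow> z \<in> ?\<Theta> ` ?U" by auto
    have "z \<in> L \<longleftrightarrow> (\<forall>i\<in>{1..n}. H i z = 0)" if z: "norm z < q" for z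
    proof -
      obtain y where y: "y \<in> ?U" "z = ?\<Theta> y" using q(2) z by blast
      have "z \<in> L \<longleftrightarrow> y \<in> coord_subspace S"
        unfolding L_def Lc using y inj by (auto simp: inj_on_def)
      also have "\<dots> \<longleftrightarrow> (\<forall>i\<in>{1..n}. H i z = 0)" unfolding H_def Lc y(2) inv_into_f_f[OF inj y(1)] by simp
      finally show ?thesis .
    qed
    then show "germ_eq L {x. \<forall>i\<in>{1..n}. H i x = 0}" unfolding germ_eq_iff using q(1) by auto
    fix c :: "nat \<Rightarrow> real" assume c: "\<forall>v. (\<Sum>i = 1..n. c i * fd (H i) 0 v) = 0"
    have z: "0 \<in> ?U" "?\<Theta> 0 = 0" using dd by auto
    have fdH: "fd (H i) 0 (fd ?\<Theta> 0 w) = w $ e (?g i)" for i w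
    proof -
      have i0: "0 \<in> ?\<Theta> ` ?U" using z by (auto intro: image_eqI[of _ _ 0])
      have "(H i has_derivative (\<lambda>v. fd (inv_into ?U ?\<Theta>) 0 v $ e (?g i))) (at 0)"
        unfolding H_def using dd i0
        by (intro bounded_linear.has_derivative[OF bounded_linear_vec_nth] smooth_on_has_derivative[of "?\<Theta> ` ?U"]) auto
      then show ?thesis using diffeo_germ_inv_fd(1)[OF d z(1), of w] z(2) by (simp add: fd_eq)
    qed
    show "\<forall>i\<in>{1..n}. c i = 0"
    proof
      fix k assume k: "k \<in> {1..n}"
      have "0 = (\<Sum>i = 1..n. c i * axis (e (?g k)) 1 $ e (?g i))" using c[rule_format, of "fd ?\<Theta> 0 (axis (e (?g k)) 1)"] by (simp add: fdH)
      also have "\<dots> = (\<Sum>i = 1..n. if i = k then c k else 0)"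
        using einj k by (intro sum.cong) (auto simp: axis_def)
      finally show "c k = 0" using k by simp
    qed
  qed
  then show "lagrangian_equations e H" using lag card_m unfolding lagrangian_equations_def by auto
qed

end

section \<open>The invariants of the normal forms\<close>

lemma smooth_on_g1: "open U \<Longrightarrow> smooth_on U g1"
proof (rule smooth_on_vec, assumption)
  show "smooth_on U (\<lambda>t. g1 t $ i)" if "open U" for i
    using exhaust_3[of i] smooth_on_ident[of U] by auto
qed

lemma smooth_on_g2: "open U \<Longrightarrow> smooth_on U g2"
proof (rule smooth_on_vec, assumption)
  show "smooth_on U (\<lambda>t. g2 t $ i)" if "open U" for i
    using exhaust_3[of i] smooth_on_power[OF that smooth_on_ident] smooth_on_minus[OF that smooth_on_power[OF that smooth_on_ident]] by auto
qed

lemma g1_0 [simp]: "g1 0 = 0" and g2_0 [simp]: "g2 0 = 0"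
  by (simp_all add: vec3_eq_iff)

context symplectic_coords
begin

lemma symp_equiv_sym:
  assumes "symp_equiv e N M"
  shows "symp_equiv e M N"
proof -
  obtain U \<Psi> where U: "symplecto_germ e U \<Psi>" "germ_eq (\<Psi> ` (N \<inter> U)) M" using assms unfolding symp_equiv_def by blast
  have df: "diffeo_germ U \<Psi>" using U(1) by (simp add: symplecto_germ_def)
  note dd = df[unfolded diffeo_germ_def]
  obtain d where d: "d > 0" "\<forall>z. norm z < d \<longrightarrow> (z \<in> \<Psi> ` (N \<inter> U) \<longleftrightarrow> z \<in> M)" using U(2) unfolding germ_eq_iff by blast
  from smooth_small[of U \<Psi>, OF _ _ _ _ d(1)] dd obtain q where q: "q > 0" "ball 0 q \<subseteq> U" "\<forall>z. norm z < q \<longrightarrow> norm (\<Psi> z) < d" by blast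
  have "z \<in> inv_into U \<Psi> ` (M \<inter> \<Psi> ` U) \<longleftrightarrow> z \<in> N" if "norm z < q" for z
  proof -
    have zU: "z \<in> U" "norm (\<Psi> z) < d" using q that by auto
    have "z \<in> inv_into U \<Psi> ` (M \<inter> \<Psi> ` U) \<longleftrightarrow> \<Psi> z \<in> M"
    proof
      assume "z \<in> inv_into U \<Psi> ` (M \<inter> \<Psi> ` U)"
      then show "\<Psi> z \<in> M" by (auto simp: f_inv_into_f)
    next
      assume "\<Psi> z \<in> M"
      then show "z \<in> inv_into U \<Psi> ` (M \<inter> \<Psi> ` U)" using zU dd by (intro image_eqI[of _ _ "\<Psi> z"]) auto
    qed
    also have "\<dots> \<longleftrightarrow> \<Psi> z \<in> \<Psi> ` (N \<inter> U)" using d(2) zU by blast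
    also have "\<dots> \<longleftrightarrow> z \<in> N" using dd zU by (auto simp: inj_on_def)
    finally show ?thesis .
  qed
  then show ?thesis
    unfolding symp_equiv_def germ_eq_iff using symplecto_germ_inv[OF U(1)] q(1) by blast
qed

text \<open>A symplectic \<open>\<Gamma>\<close> leaves the curl of the primitive unchanged, so the
  transported embedding has the same coefficients as the model.\<close>

lemma transport_nf:
  assumes G: "symplecto_germ e W \<Gamma>" and i: "min_dim i \<le> 2 * n" and s: "s = 1 \<or> s = -1"
    and r: "r > 0" "\<And>x. norm x < r \<Longrightarrow> nfJ i s c1 c2 x \<in> W"
  shows "smooth_on (ball 0 r) (\<lambda>x. \<Gamma> (nfJ i s c1 c2 x))" "\<Gamma> (nfJ i s c1 c2 0) = 0"
    "inj (fd (\<lambda>x. \<Gamma> (nfJ i s c1 c2 x)) 0)" "cohom r (lam (\<lambda>x. \<Gamma> (nfJ i s c1 c2 x))) (nfK (nfc i s c1 c2))"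
proof -
  let ?J = "nfJ i s c1 c2"
  have df: "diffeo_germ W \<Gamma>" using G by (simp add: symplecto_germ_def)
  note dd = df[unfolded diffeo_germ_def]
  have W: "open W" "smooth_on W \<Gamma>" "\<Gamma> 0 = 0" "0 \<in> W" using dd by auto
  have sJ: "smooth_on (ball 0 r) ?J" by (rule smooth_on_nfJ[OF open_ball])
  show sj: "smooth_on (ball 0 r) (\<lambda>x. \<Gamma> (?J x))"
    by (rule smooth_on_compose[OF open_ball W(1,2) sJ]) (use r in auto)
  show "\<Gamma> (?J 0) = 0" by (simp add: nfJ_0 W(3))
  have ch: "fd (\<lambda>x. \<Gamma> (?J x)) x v = fd \<Gamma> (?J x) (fd ?J x v)" if "norm x < r" for x v
  proof -
    have "((\<lambda>x. \<Gamma> (?J x)) has_derivative (\<lambda>v. fd \<Gamma> (?J x) (fd ?J x v))) (at x)"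
      by (rule has_derivative_compose[OF smooth_on_has_derivative[OF sJ] smooth_on_has_derivative[OF W(2) r(2)[OF that]]])
         (use that in simp)
    then show ?thesis by (simp add: fd_eq)
  qed
  show "inj (fd (\<lambda>x. \<Gamma> (?J x)) 0)"
  proof (rule injI)
    fix u v assume "fd (\<lambda>x. \<Gamma> (?J x)) 0 u = fd (\<lambda>x. \<Gamma> (?J x)) 0 v"
    then have "fd \<Gamma> 0 (fd ?J 0 u) = fd \<Gamma> 0 (fd ?J 0 v)" using ch[of 0] r(1) by (simp add: nfJ_0)
    then have "fd ?J 0 u = fd ?J 0 v" using diffeo_germ_inv_fd(1)[OF df W(4)] by metis
    then show "u = v" using inj_fd_nfJ[OF i s] by (auto dest: injD)
  qed
  have "cohom r (lam (\<lambda>x. \<Gamma> (?J x))) (lam ?J)"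
  proof (rule cohom_of_closed)
    fix x :: "real^3" and a b :: 3 assume x: "x \<in> ball 0 r"
    have "om (fd (\<lambda>x. \<Gamma> (?J x)) x u) (fd (\<lambda>x. \<Gamma> (?J x)) x v) = om (fd ?J x u) (fd ?J x v)" for u v
      using ch x G r(2)[of x] by (simp add: symplecto_germ_def)
    then show "fd (lam (\<lambda>x. \<Gamma> (?J x))) x (axis b 1) $ a - fd (lam (\<lambda>x. \<Gamma> (?J x))) x (axis a 1) $ b
      = fd (lam ?J) x (axis b 1) $ a - fd (lam ?J) x (axis a 1) $ b"
      unfolding lam_curl[OF open_ball x sj] lam_curl[OF open_ball x sJ] by simp
  qed (intro smooth_on_lam open_ball sj sJ)+
  then show "cohom r (lam (\<lambda>x. \<Gamma> (?J x))) (nfK (nfc i s c1 c2))" by (rule cohom_trans[OF _ cohom_nfJ[OF i]])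
qed

end

text \<open>Two parametrizations of the same germ: \<open>k\<close>, from which the branches are
  defined, and the model embedding followed by \<open>\<Gamma>\<close>, whose coefficients are
  known. \<open>jk1\<close> and \<open>jk2\<close> carry an assumed tangency over to the model and
  serve the upper bounds; \<open>kj1\<close> and \<open>kj2\<close> carry a computed tangency back
  and serve the lower bounds.\<close>

locale normalized_branches = symplectic_coords e n for e :: "nat \<Rightarrow> 'm::finite" and n +
  fixes N B2 :: "(real^'m) set" and f1 f2 :: "real \<Rightarrow> real^'m" and i :: U7_type and s c1 c2 :: real
    and W :: "(real^'m) set" and \<Gamma> :: "real^'m \<Rightarrow> real^'m" and r :: real and k :: "real^3 \<Rightarrow> real^'m" and d C :: real
  assumes dim: "min_dim i \<le> 2 * n" and sign: "s = 1 \<or> s = -1"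
    and G: "symplecto_germ e W \<Gamma>" and r: "r > 0"
    and JW: "\<And>x. norm x < r \<Longrightarrow> nfJ i s c1 c2 x \<in> W"
    and k: "smooth_on (ball 0 r) k" "k 0 = 0"
    and d: "d > 0" and C: "C \<ge> 1"
    and kj1: "\<And>t. \<bar>t\<bar> < d \<Longrightarrow> \<exists>t'. \<bar>t'\<bar> \<le> C * \<bar>t\<bar> \<and> k (g1 t) = \<Gamma> (nfJ i s c1 c2 (g1 t'))"
    and kj2: "\<And>t. \<bar>t\<bar> < d \<Longrightarrow> \<exists>t'. \<bar>t'\<bar> \<le> C * \<bar>t\<bar> \<and> k (g2 t) = \<Gamma> (nfJ i s c1 c2 (g2 t'))"
    and jk1: "\<And>t. \<bar>t\<bar> < d \<Longrightarrow> \<exists>t'. \<bar>t'\<bar> \<le> C * \<bar>t\<bar> \<and> \<Gamma> (nfJ i s c1 c2 (g1 t)) = k (g1 t')"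
    and jk2: "\<And>t. \<bar>t\<bar> < d \<Longrightarrow> \<exists>t'. \<bar>t'\<bar> \<le> C * \<bar>t\<bar> \<and> \<Gamma> (nfJ i s c1 c2 (g2 t)) = k (g2 t')"
    and f1: "\<And>t. \<bar>t\<bar> < d \<Longrightarrow> f1 t = k (g1 t)" and f2: "\<And>t. \<bar>t\<bar> < d \<Longrightarrow> f2 t = k (g2 t)"
    and small: "\<And>t. \<bar>t\<bar> < d \<Longrightarrow> norm (g1 t) < r \<and> norm (g2 t) < r"
    and sub: "\<And>t. \<bar>t\<bar> < d \<Longrightarrow> \<Gamma> (nfJ i s c1 c2 (g1 t)) \<in> N" "\<And>t. \<bar>t\<bar> < d \<Longrightarrow> \<Gamma> (nfJ i s c1 c2 (g2 t)) \<in> N"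
      "\<And>t. \<bar>t\<bar> < d \<Longrightarrow> \<Gamma> (nfJ i s c1 c2 (g2 t)) \<in> B2"
    and supN: "\<And>z. z \<in> N \<Longrightarrow> norm z < d \<Longrightarrow> \<exists>x\<in>C7. norm x < r \<and> z = \<Gamma> (nfJ i s c1 c2 x)"
    and supB2: "\<And>z. z \<in> B2 \<Longrightarrow> norm z < d \<Longrightarrow> \<exists>t. norm (g2 t) < r \<and> z = \<Gamma> (nfJ i s c1 c2 (g2 t))"

lemma (in symplectic_coords) normalized_branches_exists:
  assumes i: "min_dim i \<le> 2 * n" and s: "s = 1 \<or> s = -1" and eq: "symp_equiv e N (normal_form e i s c1 c2)"
    and br: "U7_branches e N B1 f1 B2 f2"
  shows "\<exists>W \<Gamma> r k d C. normalized_branches e n N B2 f1 f2 i s c1 c2 W \<Gamma> r k d C"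
proof -
  let ?J = "nfJ i s c1 c2"
  obtain W \<Gamma> where G: "symplecto_germ e W \<Gamma>" "germ_eq (\<Gamma> ` (normal_form e i s c1 c2 \<inter> W)) N"
    using symp_equiv_sym[OF eq] unfolding symp_equiv_def by blast
  let ?j = "\<lambda>x. \<Gamma> (?J x)"
  have dG: "diffeo_germ W \<Gamma>" using G by (simp add: symplecto_germ_def)
  then have W: "open W" "0 \<in> W" by (auto simp: diffeo_germ_def)
  obtain w where w: "w > 0" "ball 0 w \<subseteq> W" using W open_contains_ball by blast
  from smooth_small[OF smooth_on_nfJ[OF open_UNIV] open_UNIV UNIV_I nfJ_0 w(1), of i s c1 c2]
  obtain r1 where r1: "r1 > 0" "\<forall>x. norm x < r1 \<longrightarrow> norm (?J x) < w" by (elim exE conjE)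
  have JW: "?J x \<in> W" if "norm x < r1" for x using that w r1(2) by auto
  have pj: "param ?j N" by (rule param_transport[OF dG G(2) param_nfJ[OF i s] nfJ_0 smooth_on_nfJ[OF open_UNIV]])
  obtain U \<Phi> where U: "diffeo_germ U \<Phi>" "germ_eq N (\<Phi> ` (U7 e \<inter> U))" "germ_eq B2 (\<Phi> ` (range (U7_branch2 e) \<inter> U))"
     "\<forall>\<^sub>F t in nhds 0. f1 t = \<Phi> (U7_branch1 e t)" "\<forall>\<^sub>F t in nhds 0. f2 t = \<Phi> (U7_branch2 e t)"
    using br unfolding U7_branches_def by blast
  let ?k = "\<lambda>x. \<Phi> (emb x)"
  have br: "U7_branch1 e t = emb (g1 t)" "U7_branch2 e t = emb (g2 t)" for t
    by (simp_all add: U7_branch1_def U7_branch2_def emb_def)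
  obtain r2 where r2: "r2 > 0" "smooth_on (ball 0 r2) ?k" "?k 0 = 0" "inj (fd ?k 0)" "param ?k N" "\<forall>x. norm x < r2 \<longrightarrow> emb x \<in> U"
    by (rule param_diffeo[OF U(1,2)]) blast
  define r where "r = min r1 r2"
  have r: "r > 0" using r1 r2 by (simp add: r_def)
  have JW': "?J x \<in> W" if "norm x < r" for x using JW that by (simp add: r_def)
  have ks: "smooth_on (ball 0 r) ?k" by (rule smooth_on_subset[OF r2(2)]) (auto simp: r_def)
  note tj = transport_nf[OF G(1) i s r JW']
  from reparametrize[OF ks r2(3,4) tj(1,2,3) r r2(5) pj] obtain a A where a: "a > 0" "A \<ge> 1"
    "\<forall>t. \<bar>t\<bar> < a \<longrightarrow> (\<exists>t'. \<bar>t'\<bar> \<le> A * \<bar>t\<bar> \<and> ?k (g1 t) = ?j (g1 t')) \<and> (\<exists>t'. \<bar>t'\<bar> \<le> A * \<bar>t\<bar> \<and> ?k (g2 t) = ?j (g2 t'))" by blast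
  from reparametrize[OF tj(1,2,3) ks r2(3,4) r pj r2(5)] obtain b B where b: "b > 0" "B \<ge> 1"
    "\<forall>t. \<bar>t\<bar> < b \<longrightarrow> (\<exists>t'. \<bar>t'\<bar> \<le> B * \<bar>t\<bar> \<and> ?j (g1 t) = ?k (g1 t')) \<and> (\<exists>t'. \<bar>t'\<bar> \<le> B * \<bar>t\<bar> \<and> ?j (g2 t) = ?k (g2 t'))" by blast
  define C where "C = max A B"
  have C: "C \<ge> 1" "A \<le> C" "B \<le> C" using a b by (auto simp: C_def)
  obtain q1 where q1: "q1 > 0" "\<And>t. \<bar>t\<bar> < q1 \<Longrightarrow> f1 t = ?k (g1 t)" using U(4) unfolding eventually_nhds_metric br by (auto simp: dist_norm)
  obtain q2 where q2: "q2 > 0" "\<And>t. \<bar>t\<bar> < q2 \<Longrightarrow> f2 t = ?k (g2 t)" using U(5) unfolding eventually_nhds_metric br by (auto simp: dist_norm)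
  obtain pN where pN: "pN > 0" "\<forall>x\<in>C7. norm x < pN \<longrightarrow> ?j x \<in> N" using paramD1[OF pj] by blast
  obtain dN where dN: "dN > 0" "\<forall>z\<in>N. norm z < dN \<longrightarrow> (\<exists>x\<in>C7. norm x < r \<and> ?j x = z)" using paramD2[OF pj r] by blast
  obtain dB where dB: "dB > 0" "\<forall>z. norm z < dB \<longrightarrow> (z \<in> B2 \<longleftrightarrow> z \<in> \<Phi> ` (range (U7_branch2 e) \<inter> U))"
    using U(3) unfolding germ_eq_iff by blast
  have "(0::real^3) \<in> ball 0 r" using r by simp
  from smooth_small[OF ks open_ball this r2(3) dB(1)] obtain p where p: "p > 0" "ball 0 p \<subseteq> ball (0::real^3) r" "\<forall>x. norm x < p \<longrightarrow> norm (?k x) < dB" by (elim exE conjE)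
  define \<epsilon> where "\<epsilon> = min (min 1 (r / 3)) (min 1 (min p pN / 3))"
  have \<epsilon>: "\<epsilon> > 0" using r p pN by (simp add: \<epsilon>_def)
  have small2: "norm (g1 t) < r \<and> norm (g2 t) < r \<and> norm (g1 t) < p \<and> norm (g2 t) < p \<and> norm (g1 t) < pN \<and> norm (g2 t) < pN" if "\<bar>t\<bar> < \<epsilon>" for t
  proof -
    have "norm (g2 t) < r" "norm (g2 t) < min p pN" using that p pN r by (auto simp: \<epsilon>_def intro!: norm_g2_less)
    moreover have "\<bar>t\<bar> < r" "\<bar>t\<bar> < p" "\<bar>t\<bar> < pN" using that r p pN by (auto simp: \<epsilon>_def)
    ultimately show ?thesis by simp
  qed
  have CC: "\<bar>t\<bar> < \<epsilon> / C \<Longrightarrow> \<bar>t'\<bar> \<le> C * \<bar>t\<bar> \<Longrightarrow> \<bar>t'\<bar> < \<epsilon>" for t t'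
    using C(1) by (simp add: field_simps)
  have eC: "\<epsilon> / C > 0" "\<epsilon> / C \<le> \<epsilon>" using \<epsilon> C(1) by (auto simp: field_simps)
  define \<tau> where "\<tau> = min a (\<epsilon> / C)"
  have \<tau>: "\<tau> > 0" using a eC by (simp add: \<tau>_def)
  \<comment> \<open>The 3 is the constant of \<open>norm_le_emb\<close>. With
    \<open>norm_g2_ge\<close> the bound says that a point of \<open>B2\<close> near 0 has a
    parameter below \<open>\<tau>\<close> in absolute value.\<close>
  have "(\<tau>^3) / 3 > 0" using \<tau> by simp
  from diffeo_germ_inv_small[OF U(1) this] obtain l where l: "l > 0" "\<forall>z. norm z < l \<longrightarrow> norm (inv_into U \<Phi> z) < \<tau>^3 / 3" by blast
  define d where "d = min (min (min a b) (min q1 q2)) (min (min dN dB) (min l (\<epsilon> / C)))"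
  have d: "d > 0" using a b q1 q2 dN dB l eC by (simp add: d_def)
  have AC: "A * \<bar>t\<bar> \<le> C * \<bar>t\<bar>" "B * \<bar>t\<bar> \<le> C * \<bar>t\<bar>" for t using C by (auto intro: mult_right_mono)
  have gC: "g1 t \<in> C7" "g2 t \<in> C7" for t by (auto simp: C7_def)
  have td: "\<bar>t\<bar> < a \<and> \<bar>t\<bar> < b \<and> \<bar>t\<bar> < \<epsilon> / C \<and> \<bar>t\<bar> < \<epsilon> \<and> \<bar>t\<bar> < q1 \<and> \<bar>t\<bar> < q2" if "\<bar>t\<bar> < d" for t
  proof -
    have "\<bar>t\<bar> < \<epsilon> / C" using that unfolding d_def by simp
    then show ?thesis using that eC(2) unfolding d_def by simp
  qed
  have F3: "?j (g2 t) \<in> B2" if t: "\<bar>t\<bar> < d" for t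
  proof -
    obtain t' where t': "\<bar>t'\<bar> \<le> C * \<bar>t\<bar>" "?j (g2 t) = ?k (g2 t')" using b(3) td[OF t] AC(2)[of t] by (meson order_trans)
    have n: "norm (g2 t') < r" "norm (g2 t') < p" using small2[OF CC[OF _ t'(1)]] td[OF t] by auto
    then have "emb (g2 t') \<in> U" using r2(6) by (simp add: r_def)
    then have "?k (g2 t') \<in> \<Phi> ` (range (U7_branch2 e) \<inter> U)" using br(2) by (metis IntI imageI rangeI)
    then show ?thesis using dB(2) p(3) n t'(2) by metis
  qed
  have F4: "\<exists>x\<in>C7. norm x < r \<and> z = ?j x" if "z \<in> N" "norm z < d" for z
  proof -
    have "norm z < dN" using that(2) unfolding d_def by simp
    then show ?thesis using dN(2) that(1) by blast
  qed
  have F5: "\<exists>t. norm (g2 t) < r \<and> z = ?j (g2 t)" if z: "z \<in> B2" "norm z < d" for z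
  proof -
    have zl: "norm z < dB" "norm z < l" using z(2) unfolding d_def by simp_all
    then obtain t where t: "emb (g2 t) \<in> U" "z = ?k (g2 t)" using dB(2) z(1) unfolding br by blast
    have "inv_into U \<Phi> z = emb (g2 t)" using U(1) t by (simp add: diffeo_germ_def)
    then have "norm (emb (g2 t)) < \<tau>^3 / 3" using l(2) zl(2) by metis
    then have "\<bar>t\<bar>^3 < \<tau>^3" using norm_g2_ge[of t] norm_le_emb[of "g2 t"] by simp
    then have tt: "\<bar>t\<bar> < a" "\<bar>t\<bar> < \<epsilon> / C" using \<tau>(1) power_less_imp_less_base[of "\<bar>t\<bar>" 3 \<tau>] unfolding \<tau>_def by simp_all
    then obtain t' where t': "\<bar>t'\<bar> \<le> C * \<bar>t\<bar>" "?k (g2 t) = ?j (g2 t')" using a(3) AC(1)[of t] by (meson order_trans)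
    have "norm (g2 t') < r" using small2[OF CC[OF tt(2) t'(1)]] by simp
    then show ?thesis using t t' by auto
  qed
  have "normalized_branches e n N B2 f1 f2 i s c1 c2 W \<Gamma> r ?k d C"
  proof (unfold_locales)
    show "\<exists>t'. \<bar>t'\<bar> \<le> C * \<bar>t\<bar> \<and> ?k (g1 t) = ?j (g1 t')" "\<exists>t'. \<bar>t'\<bar> \<le> C * \<bar>t\<bar> \<and> ?k (g2 t) = ?j (g2 t')" if "\<bar>t\<bar> < d" for t
      using a(3) td[OF that] AC(1)[of t] by (meson order_trans)+
    show "\<exists>t'. \<bar>t'\<bar> \<le> C * \<bar>t\<bar> \<and> ?j (g1 t) = ?k (g1 t')" "\<exists>t'. \<bar>t'\<bar> \<le> C * \<bar>t\<bar> \<and> ?j (g2 t) = ?k (g2 t')" if "\<bar>t\<bar> < d" for t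
      using b(3) td[OF that] AC(2)[of t] by (meson order_trans)+
    show "f1 t = ?k (g1 t)" "f2 t = ?k (g2 t)" if "\<bar>t\<bar> < d" for t using q1(2) q2(2) td[OF that] by blast+
    show "norm (g1 t) < r \<and> norm (g2 t) < r" if "\<bar>t\<bar> < d" for t using small2 td[OF that] by blast
    show "?j (g1 t) \<in> N" "?j (g2 t) \<in> N" if "\<bar>t\<bar> < d" for t using small2 td[OF that] pN(2) gC by blast+
  qed (fact i s G(1) r JW' ks r2(3) d C(1) F3 F4 F5)+
  then show ?thesis by blast
qed

definition of_order :: "nat \<Rightarrow> (real \<Rightarrow> real) \<Rightarrow> bool" where
  "of_order m f \<longleftrightarrow> (\<exists>B. \<forall>t. \<bar>t\<bar> < 1 \<longrightarrow> \<bar>f t\<bar> \<le> B * \<bar>t\<bar> ^ m)"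

lemma of_orderI:
  assumes "\<And>t. f t = t ^ m * h t" "continuous_on UNIV h"
  shows "of_order m f"
proof -
  have "compact (h ` {-1..1})" by (intro compact_continuous_image continuous_on_subset[OF assms(2)]) auto
  then obtain B where B: "\<forall>x\<in>h ` {-1..1}. norm x \<le> B" using compact_imp_bounded bounded_iff by blast
  have "\<bar>f t\<bar> \<le> B * \<bar>t\<bar> ^ m" if "\<bar>t\<bar> < 1" for t
  proof -
    have "h t \<in> h ` {-1..1}" using that by (intro imageI) auto
    then have "\<bar>h t\<bar> \<le> B" using B by (metis real_norm_def)
    from mult_left_mono[OF this, of "\<bar>t\<bar> ^ m"] show ?thesis unfolding assms(1) by (simp add: abs_mult power_abs mult.commute)
  qed
  then show ?thesis unfolding of_order_def by blast
qed

lemma of_order_0: "(\<And>t. f t = 0) \<Longrightarrow> of_order m f"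
  by (rule of_orderI[of _ _ "\<lambda>_. 0"]) auto

context symplectic_coords
begin

lemma n_def: "CARD('m) div 2 = n"
  using card_m by simp

lemma tangency_order_cong:
  assumes "q > 0" "\<And>t. \<bar>t\<bar> < q \<Longrightarrow> f t = g t"
  shows "tangency_order f H = tangency_order (g :: real \<Rightarrow> real^'m) H"
proof -
  have "\<forall>\<^sub>F t in nhds 0. H i (f t) = H i (g t)" for i
    unfolding eventually_nhds_metric using assms by (auto simp: dist_norm)
  then show ?thesis unfolding tangency_order_def by (intro INF_cong refl vanishing_order_cong)
qed

lemma bound_of_tangency_order:
  assumes H: "lagrangian_equations e H" and g: "smooth_on (ball 0 q) g" "q > 0" "g 0 = 0"
    and m: "enat m \<le> tangency_order (g :: real \<Rightarrow> real^'m) H"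
  shows "\<exists>\<delta>>0. \<exists>B\<ge>0. \<forall>t i. \<bar>t\<bar> < \<delta> \<longrightarrow> i \<in> {1..n} \<longrightarrow> \<bar>H i (g t)\<bar> \<le> B * \<bar>t\<bar> ^ m"
proof -
  obtain V where V: "open V" "0 \<in> V" "\<forall>i\<in>{1..n}. smooth_on V (H i)"
    using H unfolding lagrangian_equations_def regular_equations_def n_def by blast
  obtain v where v: "v > 0" "ball 0 v \<subseteq> V" using V open_contains_ball by blast
  have "(0::real) \<in> ball 0 q" using g(2) by simp
  from smooth_small[OF g(1) open_ball this g(3) v(1)] obtain p where p: "p > 0" "ball 0 p \<subseteq> ball (0::real) q" "\<forall>t. norm t < p \<longrightarrow> norm (g t) < v" by (elim exE conjE)
  have sg: "smooth_on (ball 0 p) g" by (rule smooth_on_subset[OF g(1) p(2)])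
  have "\<exists>B\<ge>0. \<forall>t. \<bar>t\<bar> < p / 2 \<longrightarrow> \<bar>H i (g t)\<bar> \<le> B * \<bar>t\<bar> ^ m" if i: "i \<in> {1..n}" for i
  proof -
    have s: "smooth_on (ball 0 p) (\<lambda>t. H i (g t))"
      by (rule smooth_on_compose[OF open_ball V(1) V(3)[rule_format, OF i] sg]) (use p v in auto)
    have "enat m \<le> vanishing_order {1} (\<lambda>t. H i (g t))"
      using m i unfolding tangency_order_def n_def le_INF_iff by blast
    from bound_of_vanishing_order[OF s p(1) _ this] show ?thesis by auto
  qed
  then have "\<forall>i\<in>{1..n}. \<exists>B\<ge>0. \<forall>t. \<bar>t\<bar> < p / 2 \<longrightarrow> \<bar>H i (g t)\<bar> \<le> B * \<bar>t\<bar> ^ m" by blast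
  from bchoice[OF this] obtain B where B: "\<forall>i\<in>{1..n}. B i \<ge> 0 \<and> (\<forall>t. \<bar>t\<bar> < p / 2 \<longrightarrow> \<bar>H i (g t)\<bar> \<le> B i * \<bar>t\<bar> ^ m)" by blast
  have "\<bar>H i (g t)\<bar> \<le> (\<Sum>i=1..n. B i) * \<bar>t\<bar> ^ m" if "\<bar>t\<bar> < p / 2" "i \<in> {1..n}" for t i
  proof -
    have "B i \<le> (\<Sum>i=1..n. B i)" using B that by (intro member_le_sum) auto
    then have "B i * \<bar>t\<bar> ^ m \<le> (\<Sum>i=1..n. B i) * \<bar>t\<bar> ^ m" by (rule mult_right_mono) simp
    then show ?thesis using B that by (meson order_trans)
  qed
  moreover have "(\<Sum>i=1..n. B i) \<ge> 0" using B by (intro sum_nonneg) auto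
  ultimately show ?thesis using p(1) by (intro exI[of _ "p/2"] conjI exI[of _ "\<Sum>i=1..n. B i"]) auto
qed

text \<open>If some order is at least \<open>K\<close> and none is at least \<open>K + 1\<close>,
  then \<open>K\<close> is attained, so the maximum exists and the greatest-element operator is well
  defined.\<close>

lemma isotropy_index_eqI:
  assumes "\<And>L. lagrangian_germ e L \<Longrightarrow> germ_subset N L \<Longrightarrow> False"
    and "\<exists>M U \<Theta> S. slice_chart U \<Theta> S M \<and> germ_subset N M \<and> enat K \<le> form_order e \<Theta> S"
    and "\<And>M U \<Theta> S. slice_chart U \<Theta> S M \<Longrightarrow> germ_subset N M \<Longrightarrow> enat (Suc K) \<le> form_order e \<Theta> S \<Longrightarrow> False"
  shows "isotropy_index e N = enat K"
proof -
  have le: "x \<le> enat K" if "\<not> enat (Suc K) \<le> x" for x using that by (metis eSuc_enat ileI1 not_le)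
  have "(GREATEST k. \<exists>M U \<Theta> S. slice_chart U \<Theta> S M \<and> germ_subset N M \<and> k = form_order e \<Theta> S) = enat K"
  proof (rule Greatest_equality)
    obtain M U \<Theta> S where M: "slice_chart U \<Theta> S M" "germ_subset N M" "enat K \<le> form_order e \<Theta> S" using assms(2) by blast
    then have "enat K = form_order e \<Theta> S" using le assms(3) by (meson order_antisym)
    then show "\<exists>M U \<Theta> S. slice_chart U \<Theta> S M \<and> germ_subset N M \<and> enat K = form_order e \<Theta> S" using M by blast
    show "y \<le> enat K" if "\<exists>M U \<Theta> S. slice_chart U \<Theta> S M \<and> germ_subset N M \<and> y = form_order e \<Theta> S" for y
      using that le assms(3) by blast
  qed
  then show ?thesis unfolding isotropy_index_def using assms(1) by auto
qed

text \<open>The whole space contains every germ, which is the witness needed for an index of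
  0.\<close>

lemma form_order_trivial:
  "\<exists>M U \<Theta> S. slice_chart U \<Theta> S (M :: (real^'m) set) \<and> germ_subset N M \<and> enat 0 \<le> form_order e \<Theta> S"
proof -
  have "diffeo_germ UNIV (\<lambda>x :: real^'m. x)" using symplecto_germ_linear[of "\<lambda>x. x"] by (simp add: symplecto_germ_def linear_id[unfolded id_def])
  then have "slice_chart UNIV (\<lambda>x :: real^'m. x) UNIV UNIV" unfolding slice_chart_def by (auto simp: germ_eq_def coord_subspace_def)
  moreover have "germ_subset N UNIV" by (simp add: germ_subset_def)
  moreover have "enat 0 \<le> form_order e (\<lambda>x. x) UNIV" by (simp add: zero_enat_def[symmetric])
  ultimately show ?thesis by blast
qed

lemma coords_nth:
  assumes "length xs \<le> 2 * n" "k \<in> {1..2*n}"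
  shows "coords e xs $ e k = (if k \<le> length xs then xs ! (k - 1) else 0)"
proof -
  have "coords e xs $ e k = (\<Sum>l<length xs. if l = k - 1 then xs ! l else 0)"
    unfolding coords_def sum_component
  proof (rule sum.cong[OF refl])
    fix l assume "l \<in> {..<length xs}"
    then have "e (Suc l) = e k \<longleftrightarrow> l = k - 1" using e_eq_iff[of "Suc l" k] assms by auto
    then show "((xs ! l) *\<^sub>R axis (e (Suc l)) 1) $ e k = (if l = k - 1 then xs ! l else 0)" by (auto simp: axis_def)
  qed
  then show ?thesis using assms by auto
qed

lemma shear_nth_odd: "i \<in> {1..n} \<Longrightarrow> shear A z $ e (2*i - 1) = z $ e (2*i - 1)"
  by (simp add: shear_def qq_odd[simplified])

lemma shear_nth_even: "i \<in> {1..n} \<Longrightarrow> shear A z $ e (2*i) = z $ e (2*i) +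
    (if i = 1 then A (pp z) $ 1 else if i = 2 then A (pp z) $ 2 else if i = 3 then A (pp z) $ 3 else 0)"
  by (simp add: shear_def qq_even)

end

context normalized_branches
begin

abbreviation "J \<equiv> nfJ i s c1 c2"
abbreviation "c \<equiv> nfc i s c1 c2"

lemmas j_facts = transport_nf[OF G dim sign r JW]

lemma k_curves: "smooth_on (ball 0 d) (\<lambda>t. k (g1 t))" "smooth_on (ball 0 d) (\<lambda>t. k (g2 t))"
  by (rule smooth_on_compose[OF open_ball open_ball k(1)]; (intro smooth_on_g1 smooth_on_g2 open_ball)?; use small in auto)+

text \<open>Since the parameters are comparable, the tangency orders of the given branches hold for
  the model branches as well, up to constants.\<close>

lemma tangency_pattern:
  assumes H: "lagrangian_equations e H" and m: "enat m \<le> tangency_order f2 H" and l: "enat l \<le> tangency_order f1 H"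
  shows "vanishing_pattern m l c"
proof -
  have "enat m \<le> tangency_order (\<lambda>t. k (g2 t)) H" using m tangency_order_cong[OF d f2] by simp
  from bound_of_tangency_order[OF H k_curves(2) d _ this] obtain q2 B2 where q2: "q2 > 0" "B2 \<ge> 0"
    "\<forall>t i. \<bar>t\<bar> < q2 \<longrightarrow> i \<in> {1..n} \<longrightarrow> \<bar>H i (k (g2 t))\<bar> \<le> B2 * \<bar>t\<bar> ^ m" using k(2) by auto
  have "enat l \<le> tangency_order (\<lambda>t. k (g1 t)) H" using l tangency_order_cong[OF d f1] by simp
  from bound_of_tangency_order[OF H k_curves(1) d _ this] obtain q1 B1 where q1: "q1 > 0" "B1 \<ge> 0"
    "\<forall>t i. \<bar>t\<bar> < q1 \<longrightarrow> i \<in> {1..n} \<longrightarrow> \<bar>H i (k (g1 t))\<bar> \<le> B1 * \<bar>t\<bar> ^ l" using k(2) by auto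
  define q where "q = min d (min q1 q2 / C)"
  have q: "q > 0" using d q1 q2 C by (simp add: q_def)
  have small: "\<bar>t\<bar> < d" "\<bar>t'\<bar> < q1" "\<bar>t'\<bar> < q2" if "\<bar>t\<bar> < q" "\<bar>t'\<bar> \<le> C * \<bar>t\<bar>" for t t'
  proof -
    have "C * \<bar>t\<bar> < C * (min q1 q2 / C)" using that(1) C unfolding q_def by (intro mult_strict_left_mono) auto
    then have "\<bar>t'\<bar> < min q1 q2" using that(2) C by simp
    then show "\<bar>t\<bar> < d" "\<bar>t'\<bar> < q1" "\<bar>t'\<bar> < q2" using that(1) by (auto simp: q_def)
  qed
  have pw: "B * \<bar>t'\<bar> ^ a \<le> B * C ^ a * \<bar>t\<bar> ^ a" if "\<bar>t'\<bar> \<le> C * \<bar>t\<bar>" "B \<ge> 0" for B t t' a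
  proof -
    have "\<bar>t'\<bar> ^ a \<le> (C * \<bar>t\<bar>) ^ a" using that(1) by (rule power_mono) simp
    from mult_left_mono[OF this that(2)] show ?thesis by (simp add: power_mult_distrib mult.assoc)
  qed
  show ?thesis
  proof (rule pattern_of_equations[OF H j_facts(1,2) r j_facts(4) q])
    fix t :: real and i' assume t: "\<bar>t\<bar> < q" and i': "i' \<in> {1..n}"
    have td: "\<bar>t\<bar> < d" using t by (simp add: q_def)
    obtain t' where "\<bar>t'\<bar> \<le> C * \<bar>t\<bar>" "\<Gamma> (J (g2 t)) = k (g2 t')" using jk2[OF td] by blast
    then show "\<bar>H i' (\<Gamma> (J (g2 t)))\<bar> \<le> B2 * C ^ m * \<bar>t\<bar> ^ m" using q2(3) i' small(3)[OF t] pw[OF _ q2(2)] by (metis order_trans)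
    obtain t' where "\<bar>t'\<bar> \<le> C * \<bar>t\<bar>" "\<Gamma> (J (g1 t)) = k (g1 t')" using jk1[OF td] by blast
    then show "\<bar>H i' (\<Gamma> (J (g1 t)))\<bar> \<le> B1 * C ^ l * \<bar>t\<bar> ^ l" using q1(3) i' small(2)[OF t] pw[OF _ q1(2)] by (metis order_trans)
  qed
qed

lemma submanifold_pattern:
  assumes M: "slice_chart U \<Theta> S M" and fb: "form_bound e \<Theta> S K"
    and X: "X = N \<or> X = B2 \<and> l = 0" and XM: "germ_subset X M" and l: "l \<le> Suc K"
  shows "vanishing_pattern (3 * Suc K) l c"
proof -
  obtain a where a: "a > 0" "\<forall>z. norm z < a \<longrightarrow> z \<in> X \<longrightarrow> z \<in> M"
    using XM unfolding germ_subset_def eventually_nhds_metric by (auto simp: dist_norm)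
  have "(0::real^3) \<in> ball 0 r" using r by simp
  from smooth_small[OF j_facts(1) open_ball this j_facts(2) a(1)] obtain p where p: "p > 0" "\<forall>x. norm x < p \<longrightarrow> norm (\<Gamma> (J x)) < a" by blast
  define q where "q = min (min d p) (min 1 (p / 3))"
  have q: "q > 0" using d p by (simp add: q_def)
  have sm: "\<bar>t\<bar> < d" "norm (\<Gamma> (J (g1 t))) < a" "norm (\<Gamma> (J (g2 t))) < a" if "\<bar>t\<bar> < q" for t
    using that p(2) norm_g2_less[OF p(1), of t] by (auto simp: q_def)
  show ?thesis
  proof (rule pattern_of_submanifold[OF M fb j_facts(1,2) r j_facts(4) q])
    show "\<Gamma> (J (g2 t)) \<in> M" if "\<bar>t\<bar> < q" for t using a(2) sm[OF that] sub(2,3)[of t] X by auto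
    show "\<Gamma> (J (g1 t)) \<in> M" if "l > 0" "\<bar>t\<bar> < q" for t using a(2) sm[OF that(2)] sub(1)[of t] X that(1) by auto
  qed (use l in auto)
qed

text \<open>Vanishing to order \<open>K + 1\<close> leaves an error of order \<open>K + 2\<close>,
  hence \<open>3 (K + 2)\<close> along the singular branch. A Lagrangian submanifold meets this
  bound too, so the failure of one pattern excludes both the value infinity and larger finite
  values.\<close>

lemma index_eqI:
  assumes X: "X = N \<or> X = B2 \<and> l = 0" and l: "l \<le> Suc (Suc K)"
    and low: "\<exists>M U \<Theta> S. slice_chart U \<Theta> S M \<and> germ_subset X M \<and> enat K \<le> form_order e \<Theta> S"
    and up: "\<not> vanishing_pattern (3 * Suc (Suc K)) l c"
  shows "isotropy_index e X = enat K"
proof (rule isotropy_index_eqI[OF _ low])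
  fix L assume L: "lagrangian_germ e L" "germ_subset X L"
  obtain U \<Theta> S where S: "slice_chart U \<Theta> S L" "\<forall>y \<in> coord_subspace S \<inter> U. \<forall>a\<in>S. \<forall>b\<in>S. form_coeff e \<Theta> a b y = 0"
    using L(1) unfolding lagrangian_germ_def by blast
  have "form_bound e \<Theta> S (Suc K)" by (rule form_bound_lagrangian[OF _ S(2)]) (use S(1) in \<open>simp add: slice_chart_def\<close>)
  from submanifold_pattern[OF S(1) this X L(2) l] up show False by blast
next
  fix M U \<Theta> S assume M: "slice_chart U \<Theta> S M" "germ_subset X M" "enat (Suc K) \<le> form_order e \<Theta> S"
  have "diffeo_germ U \<Theta>" using M(1) by (simp add: slice_chart_def)
  then have "form_bound e \<Theta> S (Suc K)" by (rule form_bound_of_order[OF _ M(3)])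
  from submanifold_pattern[OF M(1) this X M(2) l] up show False by blast
qed

text \<open>For \<open>N\<close> the smooth branch is used to the full order \<open>K + 2\<close>;
  for \<open>B2\<close> it need not lie in the submanifold, so \<open>l = 0\<close>.\<close>

lemmas ind_eqI = index_eqI[OF disjI1[OF refl] order_refl]
  and ind2_eqI = index_eqI[OF disjI2[OF conjI[OF refl refl]] le0]

lemma enat_le_of_not: "\<not> enat (Suc K) \<le> x \<Longrightarrow> x \<le> enat K"
  by (metis eSuc_enat ileI1 not_le)

lemma Lt_eqI:
  assumes "\<exists>H. lagrangian_equations e H \<and> enat K \<le> tangency_order f2 H \<and> enat K \<le> tangency_order f1 H"
    and "\<not> vanishing_pattern (Suc K) (Suc K) c"
  shows "Lt_order e f1 f2 = enat K"
proof -
  have up: "min (tangency_order f1 H) (tangency_order f2 H) \<le> enat K" if "lagrangian_equations e H" for H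
    using tangency_pattern[OF that, of "Suc K" "Suc K"] assms(2) by (intro enat_le_of_not) auto
  show ?thesis
    unfolding Lt_order_def
  proof (rule Greatest_equality)
    obtain H where H: "lagrangian_equations e H" "enat K \<le> tangency_order f2 H" "enat K \<le> tangency_order f1 H" using assms(1) by blast
    then have "enat K = min (tangency_order f1 H) (tangency_order f2 H)" using up[OF H(1)] by (intro order_antisym) auto
    then show "\<exists>H. lagrangian_equations e H \<and> enat K = min (tangency_order f1 H) (tangency_order f2 H)" using H by blast
  qed (use up in blast)
qed

lemma L2_eqI:
  assumes "\<exists>H. lagrangian_equations e H \<and> enat K \<le> tangency_order f2 H"
    and "\<not> vanishing_pattern (Suc K) 0 c"
  shows "L_order e f2 = enat K"
proof -
  have up: "tangency_order f2 H \<le> enat K" if "lagrangian_equations e H" for H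
    using tangency_pattern[OF that, of "Suc K" 0] assms(2) by (intro enat_le_of_not) (auto simp: zero_enat_def[symmetric])
  show ?thesis
    unfolding L_order_def
  proof (rule Greatest_equality)
    obtain H where H: "lagrangian_equations e H" "enat K \<le> tangency_order f2 H" using assms(1) by blast
    then have "enat K = tangency_order f2 H" using up[OF H(1)] by (intro order_antisym) auto
    then show "\<exists>H. lagrangian_equations e H \<and> enat K = tangency_order f2 H" using H by blast
  qed (use up in blast)
qed

definition ent :: "nat \<Rightarrow> real^3 \<Rightarrow> real" where
  "ent a x = (if a \<le> length (nfL i s c1 c2 x) then nfL i s c1 c2 x ! (a - 1) else 0)"

definition pent :: "real^3 \<Rightarrow> real^3" where
  "pent x = vector [ent 1 x, ent 3 x, ent 5 x]"

lemma length_nfL: "length (nfL i s c1 c2 x) = min_dim i"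
  by (cases i) auto

lemma min_dim_le: "min_dim i \<le> 6"
  by (cases i) auto

lemma J_nth: "a \<in> {1..2*n} \<Longrightarrow> J x $ e a = ent a x"
  using coords_nth[of "nfL i s c1 c2 x" a] dim by (simp add: nfJ_def ent_def length_nfL)

lemma pp_J: "pp (J x) = pent x"
proof -
  have "ent 5 x = 0" if "\<not> n \<ge> 3" using dim that n_ge unfolding ent_def length_nfL by (cases i) auto
  then show ?thesis
    using J_nth[of 1 x] J_nth[of 3 x] J_nth[of 5 x] n_ge by (simp add: vec3_eq_iff pent_def del: One_nat_def)
qed

text \<open>Equation number \<open>a\<close> of the sheared coordinate plane, pulled back to R^3 by
  the model embedding; \<open>shear_J\<close> makes the connection.\<close>

definition eqn :: "(real^3 \<Rightarrow> real^3) \<Rightarrow> nat set \<Rightarrow> nat \<Rightarrow> real^3 \<Rightarrow> real" where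
  "eqn A P a x = (if a \<in> P then ent (2*a - 1) x
     else ent (2*a) x - (if a = 1 then A (pent x) $ 1 else if a = 2 then A (pent x) $ 2 else if a = 3 then A (pent x) $ 3 else 0))"

lemma shear_J: "a \<in> {1..n} \<Longrightarrow> shear (\<lambda>x. - A x) (J x) $ e (coord_choice P a) = eqn A P a x"
proof -
  assume a: "a \<in> {1..n}"
  then have "2*a - 1 \<in> {1..2*n}" "2*a \<in> {1..2*n}" by auto
  from J_nth[OF this(1), of x] J_nth[OF this(2), of x] shear_nth_odd[OF a, of "\<lambda>x. - A x" "J x"] shear_nth_even[OF a, of "\<lambda>x. - A x" "J x"]
  show ?thesis unfolding eqn_def coord_choice_def pp_J by (cases "a \<in> P") auto
qed

lemma eqn_high: "a > 3 \<Longrightarrow> eqn A P a x = 0"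
  using min_dim_le unfolding eqn_def ent_def length_nfL by auto

text \<open>The hypotheses list the components \<open>1, 2, 3\<close>; all others vanish identically.\<close>
lemma tangency_lower:
  assumes A: "smooth_on UNIV A" "A 0 = 0" and sym: "\<And>x u v. u \<bullet> fd A x v = v \<bullet> fd A x u"
  shows "\<exists>H L. lagrangian_equations e H \<and> lagrangian_germ e L \<and>
    (\<forall>m. (\<forall>a\<in>{1,2,3}. of_order m (\<lambda>t. eqn A P a (g2 t))) \<longrightarrow> enat m \<le> tangency_order f2 H) \<and>
    (\<forall>m. (\<forall>a\<in>{1,2,3}. of_order m (\<lambda>t. eqn A P a (g1 t))) \<longrightarrow> enat m \<le> tangency_order f1 H) \<and>
    ((\<forall>a\<in>{1,2,3}. \<forall>t. eqn A P a (g2 t) = 0) \<longrightarrow> germ_subset B2 L) \<and>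
    ((\<forall>a\<in>{1,2,3}. \<forall>x\<in>C7. eqn A P a x = 0) \<longrightarrow> germ_subset N L)"
proof -
  have all: "\<forall>a\<in>{1..n}. Q a" if "\<forall>a\<in>{1,2,3}. Q a" "\<And>a. a > 3 \<Longrightarrow> Q a" for Q :: "nat \<Rightarrow> bool"
  proof
    fix a assume "a \<in> {1..n}"
    then have "a \<in> {1,2,3} \<or> a > 3" by auto
    then show "Q a" using that by blast
  qed
  define H where "H i z = inv_into (shear A -` W) (\<lambda>z. \<Gamma> (shear A z)) z $ e (coord_choice P i)" for i z
  define L where "L = (\<lambda>z. \<Gamma> (shear A z)) ` ({z. \<forall>i\<in>{1..n}. z $ e (coord_choice P i) = 0} \<inter> (shear A -` W))"
  note cc = coord_choice_lagrangian[where P = P, OF G A sym, folded H_def L_def]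
  have oG: "open (\<Gamma> ` W)" "0 \<in> \<Gamma> ` W" using G by (auto simp: symplecto_germ_def diffeo_germ_def intro: image_eqI[of _ _ 0])
  obtain w where w: "w > 0" "ball 0 w \<subseteq> \<Gamma> ` W" using oG open_contains_ball by blast
  have low: "enat m \<le> tangency_order f H"
    if f: "\<And>t. \<bar>t\<bar> < d \<Longrightarrow> f t = k (g t)" and sk: "smooth_on (ball 0 d) (\<lambda>t. k (g t))" and g0: "g 0 = 0"
      and gr: "\<And>t. \<bar>t\<bar> < d \<Longrightarrow> norm (g t) < r"
      and kj: "\<And>t. \<bar>t\<bar> < d \<Longrightarrow> \<exists>t'. \<bar>t'\<bar> \<le> C * \<bar>t\<bar> \<and> k (g t) = \<Gamma> (J (g t'))"
      and o: "\<forall>a\<in>{1,2,3}. of_order m (\<lambda>t. eqn A P a (g t))" for f g m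
  proof -
    have "enat m \<le> vanishing_order {1} (\<lambda>t. H i' (k (g t)))" if i': "i' \<in> {1..n}" for i'
    proof -
    have "\<forall>a\<in>{1..n}. of_order m (\<lambda>t. eqn A P a (g t))" by (rule all[OF o]) (simp add: eqn_high of_order_0)
    then obtain B where B: "\<forall>t. \<bar>t\<bar> < 1 \<longrightarrow> \<bar>eqn A P i' (g t)\<bar> \<le> B * \<bar>t\<bar> ^ m" using i' unfolding of_order_def by blast
    have "(0::real) \<in> ball 0 d" "k (g 0) = 0" using d g0 k(2) by auto
    from smooth_small[OF sk open_ball this w(1)] obtain p where p: "p > 0" "ball 0 p \<subseteq> ball (0::real) d" "\<forall>t. norm t < p \<longrightarrow> norm (k (g t)) < w" by (elim exE conjE)
    define q where "q = min (min p d) (min 1 d / C)"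
    have q: "q > 0" using p d C by (simp add: q_def)
    show ?thesis
    proof (rule vanishing_order_of_bound[of q _ "\<bar>B\<bar> * C ^ m"])
      have s: "smooth_on (ball 0 q) (\<lambda>t. k (g t))" by (rule smooth_on_subset[OF sk]) (auto simp: q_def)
      show "smooth_on (ball 0 q) (\<lambda>t. H i' (k (g t)))"
        by (rule smooth_on_compose[OF open_ball oG(1) cc(3) s]) (use p w in \<open>auto simp: q_def\<close>)
      fix t assume t: "\<bar>t\<bar> < q"
      then have td: "\<bar>t\<bar> < d" by (simp add: q_def)
      obtain t' where t': "\<bar>t'\<bar> \<le> C * \<bar>t\<bar>" "k (g t) = \<Gamma> (J (g t'))" using kj[OF td] by blast
      have "C * \<bar>t\<bar> < C * (min 1 d / C)" using t C unfolding q_def by (intro mult_strict_left_mono) auto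
      then have "\<bar>t'\<bar> < min 1 d" using t'(1) C by simp
      then have t'd: "\<bar>t'\<bar> < 1" "\<bar>t'\<bar> < d" by auto
      have "H i' (k (g t)) = eqn A P i' (g t')"
        unfolding t'(2) by (simp only: cc(4)[OF JW[OF gr[OF t'd(2)]]] shear_J[OF i'])
      then have "\<bar>H i' (k (g t))\<bar> \<le> B * \<bar>t'\<bar> ^ m" using B t'd(1) by simp
      also have "\<dots> \<le> \<bar>B\<bar> * \<bar>t'\<bar> ^ m" by (intro mult_right_mono) auto
      also have "\<dots> \<le> \<bar>B\<bar> * (C * \<bar>t\<bar>) ^ m" using t'(1) by (intro mult_left_mono power_mono) auto
      finally show "\<bar>H i' (k (g t))\<bar> \<le> \<bar>B\<bar> * C ^ m * \<bar>t\<bar> ^ m" by (simp add: power_mult_distrib mult.assoc)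
    qed (rule q)
    qed
    then have "enat m \<le> tangency_order (\<lambda>t. k (g t)) H" unfolding tangency_order_def n_def le_INF_iff by blast
    then show ?thesis using tangency_order_cong[OF d f, where H = H] by simp
  qed
  have L: "\<Gamma> (J x) \<in> L" if x: "norm x < r" and z: "\<forall>a\<in>{1,2,3}. eqn A P a x = 0" for x
  proof (rule cc(5)[OF JW[OF x]])
    have "\<forall>a\<in>{1..n}. eqn A P a x = 0" by (rule all[OF z]) (simp add: eqn_high)
    then show "\<forall>i\<in>{1..n}. shear (\<lambda>x. - A x) (J x) $ e (coord_choice P i) = 0" by (simp add: shear_J)
  qed
  have "germ_subset B2 L" if "\<forall>a\<in>{1,2,3}. \<forall>t. eqn A P a (g2 t) = 0"
    unfolding germ_subset_def eventually_nhds_metric using d supB2 L that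
    by (intro exI[of _ d] conjI allI impI; simp add: dist_norm; blast)
  moreover have "germ_subset N L" if "\<forall>a\<in>{1,2,3}. \<forall>x\<in>C7. eqn A P a x = 0"
    unfolding germ_subset_def eventually_nhds_metric using d supN L that
    by (intro exI[of _ d] conjI allI impI; simp add: dist_norm; blast)
  ultimately show ?thesis
    using cc(1,2) low[OF f2 k_curves(2) g2_0 _ kj2] low[OF f1 k_curves(1) g1_0 _ kj1] small
    by (intro exI[of _ H] exI[of _ L]) auto
qed

end

section \<open>Submanifolds on which the form vanishes to order 1 or 2\<close>

lemma bound_of_homogeneous:
  fixes F :: "real^3 \<Rightarrow> real"
  assumes F: "continuous_on UNIV F" "\<And>u y. F (u *\<^sub>R y) = u ^ m * F y"
  shows "\<exists>K. \<forall>x. \<bar>F x\<bar> \<le> K * norm x ^ m"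
proof -
  have "compact (F ` cball 0 1)" by (intro compact_continuous_image continuous_on_subset[OF F(1)]) auto
  then obtain K where K: "\<forall>x\<in>F ` cball 0 1. norm x \<le> K" using compact_imp_bounded bounded_iff by blast
  have "\<bar>F x\<bar> \<le> K * norm x ^ m" for x
  proof -
    define y where "y = (if x = 0 then 0 else (1 / norm x) *\<^sub>R x)"
    have x: "x = norm x *\<^sub>R y" by (simp add: y_def)
    have "norm y \<le> 1" by (simp add: y_def)
    then have "\<bar>F y\<bar> \<le> K" using K by (metis image_eqI mem_cball_0 real_norm_def)
    from mult_left_mono[OF this, of "norm x ^ m"] show ?thesis by (subst x, subst F(2)) (simp add: abs_mult mult.commute)
  qed
  then show ?thesis by blast
qed

context symplectic_coords
begin

lemma norm_pp_le: "norm (pp z) \<le> 3 * norm z"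
proof -
  have "norm (pp z) \<le> (\<Sum>i\<in>UNIV. \<bar>pp z $ i\<bar>)" by (rule norm_le_l1_cart)
  also have "\<dots> \<le> 3 * norm z"
    using component_le_norm_cart[of z "e 1"] component_le_norm_cart[of z "e 3"] component_le_norm_cart[of z "e 5"]
    unfolding sum_3 pp_nth by (smt (verit) norm_ge_zero)
  finally show ?thesis .
qed

text \<open>The plane of the first three momenta is isotropic. After the shear, the form on it is
  the antisymmetric part of the derivative of \<open>A\<close>, which is of size
  \<open>|x|^m\<close>.\<close>

lemma shear_form_order:
  fixes A :: "real^3 \<Rightarrow> real^3"
  assumes G: "symplecto_germ e W \<Gamma>" and A: "smooth_on UNIV A" "A 0 = 0" and n3: "n \<ge> 3" and m: "m = 1 \<or> m = 2"
    and flat: "\<And>a b. \<exists>K. \<forall>x. norm x < 1 \<longrightarrow> \<bar>fd A x (axis a 1) $ b\<bar> \<le> K * norm x ^ m"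
  shows "enat m \<le> form_order e (\<lambda>z. \<Gamma> (shear A z)) {e 1, e 3, e 5}"
proof -
  have dG: "diffeo_germ (shear A -` W) (\<lambda>z. \<Gamma> (shear A z))" by (rule shear_chart(1)[OF G A])
  then obtain w where w: "w > 0" "ball 0 w \<subseteq> shear A -` W" unfolding diffeo_germ_def using open_contains_ball by metis
  have "enat m \<le> vanishing_order D (form_coeff e (\<lambda>z. \<Gamma> (shear A z)) a b)" if ab: "a \<in> {e 1, e 3, e 5}" "b \<in> {e 1, e 3, e 5}" for a b D
  proof -
    have p: "\<exists>l. pp (axis a 1) = axis l 1" if "a \<in> {e 1, e 3, e 5}" for a
    proof -
      have ax: "(axis l 1 :: real^3) $ k = (if k = l then 1 else 0)" for k l by (simp add: axis_def)
      have "pp (E 1) = axis 1 1" "pp (E 3) = axis 2 1" "pp (E 5) = axis 3 1"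
        using n3 by (simp_all add: vec3_eq_iff E_nth6 ax del: One_nat_def)
      then show ?thesis using that by blast
    qed
    obtain a' b' where ab': "pp (axis a 1) = axis a' 1" "pp (axis b 1) = axis b' 1" using p ab by meson
    have o: "om (axis a 1) (axis b 1) = 0"
      using ab n3 by (auto simp: om_E4 om_E6 E_nth6 simp del: One_nat_def)
    obtain K where K: "\<forall>x. norm x < 1 \<longrightarrow> \<bar>fd A x (axis b' 1) $ a'\<bar> \<le> K * norm x ^ m" using flat by blast
    obtain K' where K': "\<forall>x. norm x < 1 \<longrightarrow> \<bar>fd A x (axis a' 1) $ b'\<bar> \<le> K' * norm x ^ m" using flat by blast
    show ?thesis
    proof (rule vanishing_order_of_bound2[OF _ _ m])
      show "min w (1/3) > 0" using w by simp
      fix y :: "real^'m" assume y: "norm y < min w (1/3)"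
      then have yW: "shear A y \<in> W" using w(2) by auto
      have py: "norm (pp y) < 1" using norm_pp_le[of y] y by simp
      have pm: "norm (pp y) ^ m \<le> 3 ^ m * norm y ^ m"
        using power_mono[OF norm_pp_le, of y m] by (simp add: power_mult_distrib)
      have b: "L * norm (pp y) ^ m \<le> \<bar>L\<bar> * 3 ^ m * norm y ^ m" for L
      proof -
        have "L * norm (pp y) ^ m \<le> \<bar>L\<bar> * norm (pp y) ^ m" by (intro mult_right_mono) auto
        also have "\<dots> \<le> \<bar>L\<bar> * (3 ^ m * norm y ^ m)" using pm by (intro mult_left_mono) auto
        finally show ?thesis by (simp add: mult.assoc)
      qed
      have "form_coeff e (\<lambda>z. \<Gamma> (shear A z)) a b y = fd A (pp y) (axis b' 1) $ a' - fd A (pp y) (axis a' 1) $ b'"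
        unfolding shear_chart(2)[OF G A yW] ab' o by (simp add: inner_axis')
      then have "\<bar>form_coeff e (\<lambda>z. \<Gamma> (shear A z)) a b y\<bar> \<le> K * norm (pp y) ^ m + K' * norm (pp y) ^ m"
        using K[rule_format, OF py] K'[rule_format, OF py] by linarith
      also have "\<dots> \<le> (\<bar>K\<bar> * 3 ^ m + \<bar>K'\<bar> * 3 ^ m) * norm y ^ m" using b[of K] b[of K'] by (simp add: distrib_right)
      finally show "\<bar>form_coeff e (\<lambda>z. \<Gamma> (shear A z)) a b y\<bar> \<le> (\<bar>K\<bar> * 3 ^ m + \<bar>K'\<bar> * 3 ^ m) * norm y ^ m" .
    qed
  qed
  then show ?thesis unfolding form_order_def by (intro INF_greatest) blast
qed

end

context normalized_branches
begin

text \<open>The model embedding is a graph \<open>q = A p\<close> over the first three momenta, so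
  its whole image lies in the sheared plane, a submanifold of dimension 3.\<close>

lemma shear_submanifold:
  fixes A :: "real^3 \<Rightarrow> real^3"
  assumes A: "smooth_on UNIV A" "A 0 = 0" and n3: "n \<ge> 3" and m: "m = 1 \<or> m = 2"
    and flat: "\<And>a b. \<exists>K. \<forall>x. norm x < 1 \<longrightarrow> \<bar>fd A x (axis a 1) $ b\<bar> \<le> K * norm x ^ m"
    and JA: "\<And>x. J x = coords e [x$1, A x $ 1, x$2, A x $ 2, x$3, A x $ 3]"
  shows "\<exists>M U \<Theta> S. slice_chart U \<Theta> S M \<and> germ_subset N M \<and> enat m \<le> form_order e \<Theta> S"
    "\<exists>M U \<Theta> S. slice_chart U \<Theta> S M \<and> germ_subset B2 M \<and> enat m \<le> form_order e \<Theta> S"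
proof -
  let ?S = "{e 1, e 3, e 5}" and ?U = "shear A -` W" and ?\<Theta> = "\<lambda>z. \<Gamma> (shear A z)"
  let ?M = "?\<Theta> ` (coord_subspace ?S \<inter> ?U)"
  have sl: "slice_chart ?U ?\<Theta> ?S ?M"
    unfolding slice_chart_def using shear_chart(1)[OF G A] by (simp add: germ_eq_def)
  have fo: "enat m \<le> form_order e ?\<Theta> ?S" by (rule shear_form_order[OF G A n3 m flat])
  have JM: "\<Gamma> (J x) \<in> ?M" if "norm x < r" for x
  proof (rule image_eqI)
    define y where "y = coords e [x$1, 0, x$2, 0, x$3, 0]"
    have "pp y = x" using n3 by (simp add: y_def vec3_eq_iff coords6_nth del: One_nat_def)
    then have s: "shear A y = J x" using n3 by (simp add: shear_def qq_def JA y_def coords6 algebra_simps)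
    then show "\<Gamma> (J x) = ?\<Theta> y" by simp
    have "y $ a = 0" if "a \<notin> ?S" for a using that unfolding y_def coords6 by (auto simp: axis_def)
    then show "y \<in> coord_subspace ?S \<inter> ?U" using JW[OF that] s by (simp add: coord_subspace_def)
  qed
  have sub: "germ_subset X ?M" if X: "\<And>z. z \<in> X \<Longrightarrow> norm z < d \<Longrightarrow> \<exists>x. norm x < r \<and> z = \<Gamma> (J x)" for X
  proof -
    have "z \<in> ?M" if z: "z \<in> X" "norm z < d" for z
    proof -
      obtain x where "norm x < r" "z = \<Gamma> (J x)" using X[OF z] by blast
      then show ?thesis using JM by simp
    qed
    then show ?thesis unfolding germ_subset_def eventually_nhds_metric using d by (auto simp: dist_norm)
  qed
  have "germ_subset N ?M" by (rule sub) (use supN in blast)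
  then show "\<exists>M U \<Theta> S. slice_chart U \<Theta> S M \<and> germ_subset N M \<and> enat m \<le> form_order e \<Theta> S" using sl fo by blast
  have "germ_subset B2 ?M" by (rule sub) (use supB2 in blast)
  then show "\<exists>M U \<Theta> S. slice_chart U \<Theta> S M \<and> germ_subset B2 M \<and> enat m \<le> form_order e \<Theta> S" using sl fo by blast
qed

end

lemma flat_of_fd_zero:
  fixes A :: "real^3 \<Rightarrow> real^3"
  assumes "smooth_on UNIV A" "\<And>v. fd A 0 v = 0"
  shows "\<exists>K. \<forall>x. norm x < 1 \<longrightarrow> \<bar>fd A x (axis a 1) $ b\<bar> \<le> K * norm x ^ 1"
proof -
  have "smooth_on (ball 0 2) (\<lambda>x. fd A x (axis a 1))" using smooth_on_fd[OF assms(1)] smooth_on_subset by blast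
  then obtain K where "\<And>x. norm x \<le> 2 / 2 \<Longrightarrow> norm (fd A x (axis a 1) - fd A 0 (axis a 1)) \<le> K * norm x"
    by (rule taylor1) (auto intro: that)
  then have "\<bar>fd A x (axis a 1) $ b\<bar> \<le> K * norm x ^ 1" if "norm x < 1" for x
    using that assms(2) component_le_norm_cart[of "fd A x (axis a 1)" b] by (force intro: order_trans)
  then show ?thesis by blast
qed

lemma flat_of_homogeneous:
  fixes A :: "real^3 \<Rightarrow> real^3"
  assumes "smooth_on UNIV A" "\<And>u y v. fd A (u *\<^sub>R y) v = u ^ m *\<^sub>R fd A y v"
  shows "\<exists>K. \<forall>x. norm x < 1 \<longrightarrow> \<bar>fd A x (axis a 1) $ b\<bar> \<le> K * norm x ^ m"
proof -
  have "continuous_on UNIV (\<lambda>x. fd A x (axis a 1) $ b)"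
    by (rule smooth_on_continuous[OF smooth_on_nth[OF open_UNIV smooth_on_fd[OF assms(1)]]])
  from bound_of_homogeneous[OF this] assms(2) show ?thesis by (metis vector_scaleR_component real_scaleR_def)
qed

lemma enat_all_le: "(\<And>m. enat m \<le> x) \<Longrightarrow> x = \<infinity>"
proof (cases x)
  case (enat k)
  assume "\<And>m. enat m \<le> x"
  from this[of "Suc k"] show ?thesis by (simp add: enat)
qed simp

definition cubic :: "real \<Rightarrow> real \<Rightarrow> real \<Rightarrow> real^3 \<Rightarrow> real^3" where
  "cubic u a w p = vector [u * (2 * p$3^3 + 2 * p$1 * p$2) + 2 * a * p$1 * p$3^2 + w * p$2^2,
     u * (p$2 * p$3 + p$1^2) + 2 * w * p$3^3 + 2 * w * p$1 * p$2,
     u * (6 * p$1 * p$3^2 + p$2^2 / 2) + 2 * a * p$1^2 * p$3 + 6 * w * p$2 * p$3^2]"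

lemma smooth_cubic: "smooth_on UNIV (cubic u a w)"
  unfolding cubic_def[abs_def] by (intro smooth_on_vector3 smooth_intros open_UNIV)

lemma cubic_0: "cubic u a w 0 = 0"
  by (simp add: cubic_def vec3_eq_iff)

text \<open>\<open>cubic\<close> is the gradient of
  \<open>u (2 p\<^sub>1 p\<^sub>3\<^sup>3 + p\<^sub>2\<^sup>2 p\<^sub>3 / 2 + p\<^sub>1\<^sup>2 p\<^sub>2) + a p\<^sub>1\<^sup>2 p\<^sub>3\<^sup>2 + w (2 p\<^sub>2 p\<^sub>3\<^sup>3 + p\<^sub>1 p\<^sub>2\<^sup>2)\<close>.\<close>
lemma cubic_symmetric: "x \<bullet> fd (cubic u a w) p v = v \<bullet> fd (cubic u a w) p x"
proof -
  have "(cubic u a w has_derivative (\<lambda>v. vector [u * (6 * p$3^2 * v$3 + 2 * v$1 * p$2 + 2 * p$1 * v$2) + 2 * a * (v$1 * p$3^2 + 2 * p$1 * p$3 * v$3) + 2 * w * p$2 * v$2,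
     u * (v$2 * p$3 + p$2 * v$3 + 2 * p$1 * v$1) + 6 * w * p$3^2 * v$3 + 2 * w * (v$1 * p$2 + p$1 * v$2),
     u * (6 * v$1 * p$3^2 + 12 * p$1 * p$3 * v$3 + p$2 * v$2) + 2 * a * (2 * p$1 * v$1 * p$3 + p$1^2 * v$3) + 6 * w * (v$2 * p$3^2 + 2 * p$2 * p$3 * v$3)])) (at p)"
    unfolding cubic_def[abs_def]
    by (intro has_derivative_vector3)
      (rule derivative_eq_intros has_derivative_nth_ident refl | simp add: fun_eq_iff algebra_simps power2_eq_square)+
  then show ?thesis by (simp add: fd_eq inner_vec_def sum_3) (simp add: algebra_simps)
qed

section \<open>Values of the invariants, family by family\<close>

context normalized_branches
begin

lemma Lt_low:
  assumes A: "smooth_on UNIV A" "A 0 = 0" "\<And>x u v. u \<bullet> fd A x v = v \<bullet> fd A x u"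
    and h: "\<And>t. eqn A P 1 (g2 t) = t ^ m * h1 t" "\<And>t. eqn A P 2 (g2 t) = t ^ m * h2 t" "\<And>t. eqn A P 3 (g2 t) = t ^ m * h3 t"
    and c: "continuous_on UNIV h1" "continuous_on UNIV h2" "continuous_on UNIV h3"
    and z: "\<And>t. eqn A P 1 (g1 t) = 0" "\<And>t. eqn A P 2 (g1 t) = 0" "\<And>t. eqn A P 3 (g1 t) = 0"
  shows "\<exists>H. lagrangian_equations e H \<and> enat m \<le> tangency_order f2 H \<and> enat m \<le> tangency_order f1 H"
proof -
  have "\<forall>a\<in>{1,2,3}. of_order m (\<lambda>t. eqn A P a (g2 t))"
    using of_orderI[OF h(1) c(1)] of_orderI[OF h(2) c(2)] of_orderI[OF h(3) c(3)] by blast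
  moreover have "\<forall>a\<in>{1,2,3}. of_order m (\<lambda>t. eqn A P a (g1 t))"
    by (simp add: z of_order_0 del: One_nat_def)
  ultimately show ?thesis using tangency_lower[OF A, of P] by blast
qed

lemma L2_low:
  assumes A: "smooth_on UNIV A" "A 0 = 0" "\<And>x u v. u \<bullet> fd A x v = v \<bullet> fd A x u"
    and h: "\<And>t. eqn A P 1 (g2 t) = t ^ m * h1 t" "\<And>t. eqn A P 2 (g2 t) = t ^ m * h2 t" "\<And>t. eqn A P 3 (g2 t) = t ^ m * h3 t"
    and c: "continuous_on UNIV h1" "continuous_on UNIV h2" "continuous_on UNIV h3"
  shows "\<exists>H. lagrangian_equations e H \<and> enat m \<le> tangency_order f2 H"
proof -
  have "\<forall>a\<in>{1,2,3}. of_order m (\<lambda>t. eqn A P a (g2 t))"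
    using of_orderI[OF h(1) c(1)] of_orderI[OF h(2) c(2)] of_orderI[OF h(3) c(3)] by blast
  then show ?thesis using tangency_lower[OF A, of P] by blast
qed

lemma L2_infinite:
  assumes A: "smooth_on UNIV A" "A 0 = 0" "\<And>x u v. u \<bullet> fd A x v = v \<bullet> fd A x u"
    and z: "\<forall>a\<in>{1,2,3}. \<forall>t. eqn A P a (g2 t) = 0"
  shows "L_order e f2 = \<infinity>" "isotropy_index e B2 = \<infinity>"
proof -
  have o: "\<forall>a\<in>{1,2,3}. of_order m (\<lambda>t. eqn A P a (g2 t))" for m using z by (auto intro: of_order_0)
  obtain H L where HL: "lagrangian_equations e H" "lagrangian_germ e L" "\<forall>m. enat m \<le> tangency_order f2 H" "germ_subset B2 L"
    using tangency_lower[OF A, of P] z o by blast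
  then have "tangency_order f2 H = \<infinity>" by (blast intro: enat_all_le)
  then show "L_order e f2 = \<infinity>" unfolding L_order_def using HL(1) by (intro Greatest_equality) (metis, simp)
  show "isotropy_index e B2 = \<infinity>" unfolding isotropy_index_def using HL by auto
qed

lemma zero_shear: "smooth_on UNIV (\<lambda>_::real^3. 0::real^3)" "(\<lambda>_. 0::real^3) (0::real^3) = 0"
    "u \<bullet> fd (\<lambda>_::real^3. 0::real^3) x v = v \<bullet> fd (\<lambda>_. 0) x u"
  by simp_all

lemma invariants_0:
  assumes i: "i = U7_0"
  shows "isotropy_index e N = enat 0" "isotropy_index e B2 = enat 0" "L_order e f2 = enat 4"
    "Lt_order e f1 f2 = enat (if c1 \<noteq> 0 then 3 else 4)"
proof -
  note ev = eqn_def[unfolded ent_def pent_def, unfolded i] power_numeral_reduce algebra_simps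
  show "isotropy_index e N = enat 0" by (rule ind_eqI[OF form_order_trivial]) (simp add: vanishing_pattern_def i)
  show "isotropy_index e B2 = enat 0" by (rule ind2_eqI[OF form_order_trivial]) (simp add: vanishing_pattern_def i)
  \<comment> \<open>The plane \<open>p1 = p2 = 0\<close>: along the singular branch the equations
    are \<open>t^4\<close> and \<open>t^5\<close>.\<close>
  show "L_order e f2 = enat 4"
    by (rule L2_eqI[OF L2_low[OF zero_shear, of "{1,2}" 4 "\<lambda>t. 1" "\<lambda>t. t" "\<lambda>t. 0"]])
    (simp_all add: ev i vanishing_pattern_def continuous_intros)
  show "Lt_order e f1 f2 = enat (if c1 \<noteq> 0 then 3 else 4)"
  proof (cases "c1 = 0")
    case False
    \<comment> \<open>The smooth branch is the \<open>p2\<close>-axis, so the equation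
      \<open>p2 = 0\<close> would spoil its contact. With \<open>q1 = q2 = 0\<close> the order is 3;
      for \<open>c1 = 0\<close> the plane \<open>p1 = q2 = 0\<close> improves it to 4.\<close>
    have "Lt_order e f1 f2 = enat 3"
      by (rule Lt_eqI[OF Lt_low[OF zero_shear, of "{}" 3 "\<lambda>t. -1" "\<lambda>t. - c1 - c2 * t" "\<lambda>t. 0"]])
      (simp_all add: ev i vanishing_pattern_def continuous_intros False)
    then show ?thesis using False by simp
  next
    case True
    note ev0 = ev[unfolded True]
    have "Lt_order e f1 f2 = enat 4"
      by (rule Lt_eqI[OF Lt_low[OF zero_shear, of "{1}" 4 "\<lambda>t. 1" "\<lambda>t. - c2" "\<lambda>t. 0"]])
      (simp_all add: ev0 i True vanishing_pattern_def continuous_intros)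
    then show ?thesis using True by simp
  qed
qed

lemma invariants_1:
  assumes i: "i = U7_1"
  shows "isotropy_index e N = enat 0" "isotropy_index e B2 = enat 0" "Lt_order e f1 f2 = enat 3" "L_order e f2 = enat 5"
proof -
  note ev = eqn_def[unfolded ent_def pent_def, unfolded i] power_numeral_reduce algebra_simps
  have s0: "s \<noteq> 0" using sign by auto
  show "isotropy_index e N = enat 0" by (rule ind_eqI[OF form_order_trivial]) (simp add: vanishing_pattern_def i s0)
  show "isotropy_index e B2 = enat 0" by (rule ind2_eqI[OF form_order_trivial]) (simp add: vanishing_pattern_def i s0)
  \<comment> \<open>In the plane \<open>p1 = q2 = 0\<close> both equations have order at least 5
    along the singular branch.\<close>
  show "L_order e f2 = enat 5"
    by (rule L2_eqI[OF L2_low[OF zero_shear, of "{1}" 5 "\<lambda>t. 1" "\<lambda>t. c1 + c2 / 2 * t" "\<lambda>t. 0"]])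
    (simp_all add: ev i vanishing_pattern_def continuous_intros s0)
  \<comment> \<open>The shear straightens the smooth branch to the \<open>p1\<close>-axis:
    \<open>q2 - c1 p1\<close> vanishes on it. The first entry \<open>c1 p2\<close> is forced by
    symmetry of the derivative.\<close>
  let ?A = "\<lambda>p::real^3. vector [c1 * p$2, c1 * p$1, 0] :: real^3"
  have A: "smooth_on UNIV ?A" by (intro smooth_on_vector3 smooth_intros open_UNIV)
  have A0: "?A 0 = 0" by (simp add: vec3_eq_iff)
  have D: "(?A has_derivative (\<lambda>v. vector [c1 * v$2, c1 * v$1, 0])) (at x)" for x
    by (intro has_derivative_vector3 has_derivative_mult_right has_derivative_nth_ident has_derivative_const)
  have sym: "u \<bullet> fd ?A x v = v \<bullet> fd ?A x u" for u v x unfolding fd_eq[OF D] by (simp add: inner_vec_def sum_3)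
  show "Lt_order e f1 f2 = enat 3"
    by (rule Lt_eqI[OF Lt_low[OF A A0 sym, of "{}" 3 "\<lambda>t. - s - c1 * t" "\<lambda>t. c2 / 2 * t^3" "\<lambda>t. 0"]])
    (simp_all add: ev i vanishing_pattern_def continuous_intros s0)
qed

lemma invariants_2:
  assumes i: "i = U7_2"
  shows "isotropy_index e N = enat 0" "isotropy_index e B2 = enat 0" "Lt_order e f1 f2 = enat 4" "L_order e f2 = enat 5"
proof -
  note ev = eqn_def[unfolded ent_def pent_def, unfolded i] power_numeral_reduce algebra_simps
  show "isotropy_index e N = enat 0" by (rule ind_eqI[OF form_order_trivial]) (simp add: vanishing_pattern_def i)
  show "isotropy_index e B2 = enat 0" by (rule ind2_eqI[OF form_order_trivial]) (simp add: vanishing_pattern_def i)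
  show "L_order e f2 = enat 5"
    by (rule L2_eqI[OF L2_low[OF zero_shear, of "{2}" 5 "\<lambda>t. 1" "\<lambda>t. - c1 * t^2 + c2 / 2 * t^3" "\<lambda>t. 0"]])
    (simp_all add: ev i vanishing_pattern_def continuous_intros)
  \<comment> \<open>The smooth branch is the \<open>q1\<close>-axis, so the equation
    \<open>q1 = 0\<close>, which gave order 5 above, has to be replaced by
    \<open>p1 = 0\<close>.\<close>
  show "Lt_order e f1 f2 = enat 4"
    by (rule Lt_eqI[OF Lt_low[OF zero_shear, of "{1,2}" 4 "\<lambda>t. 1" "\<lambda>t. - c1 * t^3 + c2 / 2 * t^4" "\<lambda>t. 0"]])
    (simp_all add: ev i vanishing_pattern_def continuous_intros)
qed

lemma invariants_3:
  assumes i: "i = U7_3"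
  shows "isotropy_index e N = enat 1" "isotropy_index e B2 = enat 1" "Lt_order e f1 f2 = enat 7" "L_order e f2 = enat 7"
proof -
  note ev = eqn_def[unfolded ent_def pent_def, unfolded i] power_numeral_reduce algebra_simps
  have s0: "s \<noteq> 0" using sign by auto
  have n3: "n \<ge> 3" using dim i by simp
  let ?A = "\<lambda>x::real^3. vector [c1 * x$1 * x$3, 0, - s * x$1 * x$3] :: real^3"
  have A: "smooth_on UNIV ?A" "?A 0 = 0" by (intro smooth_on_vector3 smooth_intros open_UNIV) (simp add: vec3_eq_iff)
  have D: "(?A has_derivative (\<lambda>v. vector [c1 * (v$1 * x$3 + x$1 * v$3), 0, - s * (v$1 * x$3 + x$1 * v$3)])) (at x)" for x
    by (intro has_derivative_vector3) (rule derivative_eq_intros has_derivative_nth_ident refl | simp add: fun_eq_iff algebra_simps)+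
  have "fd ?A 0 v = 0" for v unfolding fd_eq[OF D] by (simp add: vec3_eq_iff)
  note sub = shear_submanifold[OF A n3 disjI1[OF refl] flat_of_fd_zero[OF A(1) this]]
  show "isotropy_index e N = enat 1" by (rule ind_eqI[OF sub(1)]) (simp_all add: vanishing_pattern_def i s0 nfJ_def)
  show "isotropy_index e B2 = enat 1" by (rule ind2_eqI[OF sub(2)]) (simp_all add: vanishing_pattern_def i s0 nfJ_def)
  \<comment> \<open>The plane where all \<open>q\<close> vanish contains the smooth branch, the
    \<open>p2\<close>-axis, so the same plane serves for both tangency orders.\<close>
  show "Lt_order e f1 f2 = enat 7"
    by (rule Lt_eqI[OF Lt_low[OF zero_shear, of "{}" 7 "\<lambda>t. - c1" "\<lambda>t. 0" "\<lambda>t. s"]])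
    (simp_all add: ev i vanishing_pattern_def continuous_intros s0)
  show "L_order e f2 = enat 7"
    by (rule L2_eqI[OF L2_low[OF zero_shear, of "{}" 7 "\<lambda>t. - c1" "\<lambda>t. 0" "\<lambda>t. s"]])
    (simp_all add: ev i vanishing_pattern_def continuous_intros s0)
qed

lemma invariants_4:
  assumes i: "i = U7_4"
  shows "isotropy_index e N = enat 1" "isotropy_index e B2 = enat 1" "Lt_order e f1 f2 = enat 8" "L_order e f2 = enat 8"
proof -
  note ev = eqn_def[unfolded ent_def pent_def, unfolded i] power_numeral_reduce algebra_simps
  have n3: "n \<ge> 3" using dim i by simp
  let ?A = "\<lambda>x::real^3. vector [c1 / 3 * x$3^3, 0, - (1/2) * x$1^2] :: real^3"
  have A: "smooth_on UNIV ?A" "?A 0 = 0" by (intro smooth_on_vector3 smooth_intros open_UNIV) (simp add: vec3_eq_iff)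
  have D: "(?A has_derivative (\<lambda>v. vector [c1 * x$3^2 * v$3, 0, - x$1 * v$1])) (at x)" for x
    by (intro has_derivative_vector3) (rule derivative_eq_intros has_derivative_nth_ident refl | simp add: fun_eq_iff algebra_simps)+
  have "fd ?A 0 v = 0" for v unfolding fd_eq[OF D] by (simp add: vec3_eq_iff)
  note sub = shear_submanifold[OF A n3 disjI1[OF refl] flat_of_fd_zero[OF A(1) this]]
  show "isotropy_index e N = enat 1" by (rule ind_eqI[OF sub(1)]) (simp_all add: vanishing_pattern_def i nfJ_def)
  show "isotropy_index e B2 = enat 1" by (rule ind2_eqI[OF sub(2)]) (simp_all add: vanishing_pattern_def i nfJ_def)
  show "Lt_order e f1 f2 = enat 8"
    by (rule Lt_eqI[OF Lt_low[OF zero_shear, of "{}" 8 "\<lambda>t. - c1 / 3 * t" "\<lambda>t. 0" "\<lambda>t. - 1/2"]])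
    (simp_all add: ev i vanishing_pattern_def continuous_intros)
  show "L_order e f2 = enat 8"
    by (rule L2_eqI[OF L2_low[OF zero_shear, of "{}" 8 "\<lambda>t. - c1 / 3 * t" "\<lambda>t. 0" "\<lambda>t. - 1/2"]])
    (simp_all add: ev i vanishing_pattern_def continuous_intros)
qed

lemma invariants_5:
  assumes i: "i = U7_5"
  shows "isotropy_index e N = enat 2" "isotropy_index e B2 = \<infinity>" "Lt_order e f1 f2 = enat 10" "L_order e f2 = \<infinity>"
proof -
  note ev = eqn_def[unfolded ent_def pent_def, unfolded i] power_numeral_reduce algebra_simps
  have n3: "n \<ge> 3" using dim i by simp
  let ?A = "\<lambda>x::real^3. vector [- (c1 / 2) * x$1 * x$3^2, 0, - x$1 * x$3^2] :: real^3"
  have A: "smooth_on UNIV ?A" "?A 0 = 0" by (intro smooth_on_vector3 smooth_intros open_UNIV) (simp add: vec3_eq_iff)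
  have D: "(?A has_derivative (\<lambda>v. vector [- (c1 / 2) * (v$1 * x$3^2 + 2 * x$1 * x$3 * v$3), 0, - (v$1 * x$3^2 + 2 * x$1 * x$3 * v$3)])) (at x)" for x
    by (intro has_derivative_vector3) (rule derivative_eq_intros has_derivative_nth_ident refl | simp add: fun_eq_iff algebra_simps)+
  have "fd ?A (u *\<^sub>R y) v = u ^ 2 *\<^sub>R fd ?A y v" for u y v
    unfolding fd_eq[OF D] by (simp add: vec3_eq_iff power2_eq_square algebra_simps)
  note sub = shear_submanifold[OF A n3 disjI2[OF refl] flat_of_homogeneous[OF A(1) this]]
  show "isotropy_index e N = enat 2" by (rule ind_eqI[OF sub(1)]) (simp_all add: vanishing_pattern_def i nfJ_def)
  \<comment> \<open>Along \<open>g2\<close> the components of \<open>cubic u a w\<close> are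
    \<open>(2 a + w) t^10\<close>, \<open>0\<close> and
    \<open>(13/2) u t^10 + (6 w - 2 a) t^11\<close>. Matching them with the \<open>q\<close>
    coordinates \<open>- (c1/2) t^10\<close>, \<open>0\<close>, \<open>- t^10\<close> of the
    singular branch determines the constants. Along \<open>g1\<close> they are \<open>w t^2\<close>,
    \<open>0\<close> and \<open>u t^2 / 2\<close>, so this Lagrangian submanifold does not contain
    the smooth branch.\<close>
  have "\<forall>a\<in>{1,2,3}. \<forall>t. eqn (cubic (-2/13) (-3*c1/14) (-c1/14)) {} a (g2 t) = 0"
    by (simp add: ev i cubic_def)
  note inf = L2_infinite[OF smooth_cubic cubic_0 cubic_symmetric this]
  show "isotropy_index e B2 = \<infinity>" "L_order e f2 = \<infinity>" by (rule inf)+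
  show "Lt_order e f1 f2 = enat 10"
    by (rule Lt_eqI[OF Lt_low[OF zero_shear, of "{}" 10 "\<lambda>t. - c1 / 2" "\<lambda>t. 0" "\<lambda>t. - 1"]])
    (simp_all add: ev i vanishing_pattern_def continuous_intros)
qed

lemma invariants_6:
  assumes i: "i = U7_6"
  shows "isotropy_index e N = enat 2" "isotropy_index e B2 = \<infinity>" "Lt_order e f1 f2 = enat 11" "L_order e f2 = \<infinity>"
proof -
  note ev = eqn_def[unfolded ent_def pent_def, unfolded i] power_numeral_reduce algebra_simps
  have s0: "s \<noteq> 0" using sign by auto
  have n3: "n \<ge> 3" using dim i by simp
  let ?A = "\<lambda>x::real^3. vector [0, 0, - (s / 2) * x$1^2 * x$3] :: real^3"
  have A: "smooth_on UNIV ?A" "?A 0 = 0" by (intro smooth_on_vector3 smooth_intros open_UNIV) (simp add: vec3_eq_iff)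
  have D: "(?A has_derivative (\<lambda>v. vector [0, 0, - (s / 2) * (2 * x$1 * v$1 * x$3 + x$1^2 * v$3)])) (at x)" for x
    by (intro has_derivative_vector3) (rule derivative_eq_intros has_derivative_nth_ident refl | simp add: fun_eq_iff algebra_simps)+
  have "fd ?A (u *\<^sub>R y) v = u ^ 2 *\<^sub>R fd ?A y v" for u y v
    unfolding fd_eq[OF D] by (simp add: vec3_eq_iff power2_eq_square algebra_simps)
  note sub = shear_submanifold[OF A n3 disjI2[OF refl] flat_of_homogeneous[OF A(1) this]]
  show "isotropy_index e N = enat 2" by (rule ind_eqI[OF sub(1)]) (simp_all add: vanishing_pattern_def i s0 nfJ_def)
  \<comment> \<open>The same comparison with \<open>q\<close> coordinates \<open>0\<close>,
    \<open>0\<close>, \<open>(s/2) t^11\<close>: \<open>u = 0\<close>, \<open>2 a + w = 0\<close>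
    and \<open>6 w - 2 a = s / 2\<close>.\<close>
  have "\<forall>a\<in>{1,2,3}. \<forall>t. eqn (cubic 0 (-s/28) (s/14)) {} a (g2 t) = 0"
    by (simp add: ev i cubic_def)
  note inf = L2_infinite[OF smooth_cubic cubic_0 cubic_symmetric this]
  show "isotropy_index e B2 = \<infinity>" "L_order e f2 = \<infinity>" by (rule inf)+
  show "Lt_order e f1 f2 = enat 11"
    by (rule Lt_eqI[OF Lt_low[OF zero_shear, of "{}" 11 "\<lambda>t. 0" "\<lambda>t. 0" "\<lambda>t. s / 2"]])
    (simp_all add: ev i vanishing_pattern_def continuous_intros s0)
qed

lemma invariants_7:
  assumes i: "i = U7_7"
  shows "isotropy_index e N = \<infinity>" "isotropy_index e B2 = \<infinity>" "Lt_order e f1 f2 = \<infinity>" "L_order e f2 = \<infinity>"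
proof -
  note ev = eqn_def[unfolded ent_def pent_def, unfolded i] power_numeral_reduce algebra_simps
  have z: "\<forall>a\<in>{1,2,3}. \<forall>x. eqn (\<lambda>_. 0) {} a x = 0" by (simp add: ev i)
  then have z2: "\<forall>a\<in>{1,2,3}. \<forall>t. eqn (\<lambda>_. 0) {} a (g2 t) = 0" by blast
  note inf = L2_infinite[OF zero_shear z2]
  show "isotropy_index e B2 = \<infinity>" "L_order e f2 = \<infinity>" by (rule inf)+
  have o: "\<forall>a\<in>{1,2,3}. of_order m (\<lambda>t. eqn (\<lambda>_. 0) {} a (g2 t))" "\<forall>a\<in>{1,2,3}. of_order m (\<lambda>t. eqn (\<lambda>_. 0) {} a (g1 t))" for m
    using z by (auto intro: of_order_0)
  obtain H L where HL: "lagrangian_equations e H" "lagrangian_germ e L" "\<forall>m. enat m \<le> tangency_order f2 H" "\<forall>m. enat m \<le> tangency_order f1 H" "germ_subset N L"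
    using tangency_lower[OF zero_shear, of "{}"] z o by blast
  then have "tangency_order f2 H = \<infinity>" "tangency_order f1 H = \<infinity>" by (blast intro: enat_all_le)+
  then have "min (tangency_order f1 H) (tangency_order f2 H) = \<infinity>" by simp
  then show "Lt_order e f1 f2 = \<infinity>" unfolding Lt_order_def using HL(1) by (intro Greatest_equality) (metis, simp)
  show "isotropy_index e N = \<infinity>" unfolding isotropy_index_def using HL by auto
qed

end

section \<open>Separation of the families and the classification\<close>

definition U7_invariants :: "U7_type \<Rightarrow> real \<Rightarrow> enat \<Rightarrow> enat \<Rightarrow> enat \<Rightarrow> enat \<Rightarrow> bool" where
  "U7_invariants i c1 ind ind2 Lt L2 \<longleftrightarrow> (case i of
      U7_0 \<Rightarrow> ind = 0 \<and> ind2 = 0 \<and> L2 = 4 \<and> Lt = (if c1 \<noteq> 0 then 3 else 4)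
    | U7_1 \<Rightarrow> ind = 0 \<and> ind2 = 0 \<and> Lt = 3 \<and> L2 = 5
    | U7_2 \<Rightarrow> ind = 0 \<and> ind2 = 0 \<and> Lt = 4 \<and> L2 = 5
    | U7_3 \<Rightarrow> ind = 1 \<and> ind2 = 1 \<and> Lt = 7 \<and> L2 = 7
    | U7_4 \<Rightarrow> ind = 1 \<and> ind2 = 1 \<and> Lt = 8 \<and> L2 = 8
    | U7_5 \<Rightarrow> ind = 2 \<and> ind2 = \<infinity> \<and> Lt = 10 \<and> L2 = \<infinity>
    | U7_6 \<Rightarrow> ind = 2 \<and> ind2 = \<infinity> \<and> Lt = 11 \<and> L2 = \<infinity>
    | U7_7 \<Rightarrow> ind = \<infinity> \<and> ind2 = \<infinity> \<and> Lt = \<infinity> \<and> L2 = \<infinity>)"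

text \<open>The pair of \<open>Lt\<close> and \<open>L2\<close> already decides: \<open>U7_0\<close>
  is the only family with \<open>L2 = 4\<close>, and the seven others have pairwise different
  values, independent of the parameters.\<close>

lemma U7_invariants_determine:
  assumes "U7_invariants i c1 ind ind2 Lt L2" "U7_invariants i' c1' ind ind2 Lt L2"
  shows "i = i'"
  using assms unfolding U7_invariants_def by (cases i; cases i'; simp split: if_splits)

lemma (in normalized_branches) invariants:
  "U7_invariants i c1 (isotropy_index e N) (isotropy_index e B2) (Lt_order e f1 f2) (L_order e f2)"
  unfolding U7_invariants_def
  by (cases i)
    (use invariants_0 invariants_1 invariants_2 invariants_3 invariants_4 invariants_5 invariants_6 invariants_7
      in \<open>simp_all add: numeral_eq_enat zero_enat_def one_enat_def\<close>)

theorem theorem3p2: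
  fixes n :: nat and e :: "nat \<Rightarrow> 'm::finite" and N :: "(real ^ 'm) set"
  assumes "CARD('m) = 2 * n" and "2 * n \<ge> 4"
    and "bij_betw e {1..2 * n} (UNIV :: 'm set)"
    and "in_U7_class e N"
  shows "(\<exists>!i. min_dim i \<le> 2 * n \<and>
             (\<exists>s\<in>{1, -1}. \<exists>c1 c2. symp_equiv e N (normal_form e i s c1 c2))) \<and>
         (\<forall>i. \<forall>s\<in>{1, -1}. \<forall>c1 c2 B1 f1 B2 f2.
             min_dim i \<le> 2 * n \<longrightarrow>
             symp_equiv e N (normal_form e i s c1 c2) \<longrightarrow>
             U7_branches e N B1 f1 B2 f2 \<longrightarrow>
             (let ind = isotropy_index e N; ind2 = isotropy_index e B2;
                  Lt = Lt_order e f1 f2; L2 = L_order e f2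
              in case i of
                U7_0 \<Rightarrow> ind = 0 \<and> ind2 = 0 \<and> L2 = 4 \<and> Lt = (if c1 \<noteq> 0 then 3 else 4)
              | U7_1 \<Rightarrow> ind = 0 \<and> ind2 = 0 \<and> Lt = 3 \<and> L2 = 5
              | U7_2 \<Rightarrow> ind = 0 \<and> ind2 = 0 \<and> Lt = 4 \<and> L2 = 5
              | U7_3 \<Rightarrow> ind = 1 \<and> ind2 = 1 \<and> Lt = 7 \<and> L2 = 7
              | U7_4 \<Rightarrow> ind = 1 \<and> ind2 = 1 \<and> Lt = 8 \<and> L2 = 8
              | U7_5 \<Rightarrow> ind = 2 \<and> ind2 = \<infinity> \<and> Lt = 10 \<and> L2 = \<infinity>
              | U7_6 \<Rightarrow> ind = 2 \<and> ind2 = \<infinity> \<and> Lt = 11 \<and> L2 = \<infinity>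
              | U7_7 \<Rightarrow> ind = \<infinity> \<and> ind2 = \<infinity> \<and> Lt = \<infinity> \<and> L2 = \<infinity>))"
proof -
  interpret symplectic_coords e n
    by unfold_locales (use assms in auto)
  have inv: "U7_invariants i c1 (isotropy_index e N) (isotropy_index e B2) (Lt_order e f1 f2) (L_order e f2)"
    if "min_dim i \<le> 2 * n" "s \<in> {1, -1}" "symp_equiv e N (normal_form e i s c1 c2)" "U7_branches e N B1 f1 B2 f2"
    for i s c1 c2 B1 f1 B2 f2
  proof -
    have "s = 1 \<or> s = -1" using that(2) by simp
    from normalized_branches_exists[OF that(1) this that(3,4)] show ?thesis
      using normalized_branches.invariants by blast
  qed
  obtain U \<Phi> where U: "diffeo_germ U \<Phi>" "germ_eq N (\<Phi> ` (U7 e \<inter> U))" using assms(4) unfolding in_U7_class_def by blast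
  \<comment> \<open>One fixed choice of branches for both families in the uniqueness proof, so that
    their invariants are values of the same quantities.\<close>
  have br: "U7_branches e N (\<Phi> ` (range (U7_branch1 e) \<inter> U)) (\<lambda>t. \<Phi> (U7_branch1 e t))
    (\<Phi> ` (range (U7_branch2 e) \<inter> U)) (\<lambda>t. \<Phi> (U7_branch2 e t))"
    unfolding U7_branches_def using U by (intro exI[of _ U] exI[of _ \<Phi>]) (simp add: germ_eq_def)
  have "\<exists>!i. min_dim i \<le> 2 * n \<and> (\<exists>s\<in>{1, -1}. \<exists>c1 c2. symp_equiv e N (normal_form e i s c1 c2))"
  proof (rule ex_ex1I)
    show "\<exists>i. min_dim i \<le> 2 * n \<and> (\<exists>s\<in>{1, -1}. \<exists>c1 c2. symp_equiv e N (normal_form e i s c1 c2))"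
      using normal_form_exists[OF assms(4)] by blast
    have c: "\<exists>c1. U7_invariants i c1 (isotropy_index e N) (isotropy_index e (\<Phi> ` (range (U7_branch2 e) \<inter> U)))
        (Lt_order e (\<lambda>t. \<Phi> (U7_branch1 e t)) (\<lambda>t. \<Phi> (U7_branch2 e t))) (L_order e (\<lambda>t. \<Phi> (U7_branch2 e t)))"
      if h: "min_dim i \<le> 2 * n \<and> (\<exists>s\<in>{1, -1}. \<exists>c1 c2. symp_equiv e N (normal_form e i s c1 c2))" for i
    proof -
      obtain s c1 c2 where s: "s \<in> {1, -1}" "symp_equiv e N (normal_form e i s c1 c2)"
        using conjunct2[OF h] by (elim bexE exE)
      show ?thesis by (rule exI[of _ c1]) (rule inv[OF conjunct1[OF h] s br])
    qed
    fix i i' assume "min_dim i \<le> 2 * n \<and> (\<exists>s\<in>{1, -1}. \<exists>c1 c2. symp_equiv e N (normal_form e i s c1 c2))"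
      "min_dim i' \<le> 2 * n \<and> (\<exists>s\<in>{1, -1}. \<exists>c1 c2. symp_equiv e N (normal_form e i' s c1 c2))"
    from c[OF this(1)] c[OF this(2)] show "i = i'" by (elim exE) (rule U7_invariants_determine)
  qed
  moreover have "\<forall>i. \<forall>s\<in>{1, -1}. \<forall>c1 c2 B1 f1 B2 f2. min_dim i \<le> 2 * n \<longrightarrow>
      symp_equiv e N (normal_form e i s c1 c2) \<longrightarrow> U7_branches e N B1 f1 B2 f2 \<longrightarrow>
      U7_invariants i c1 (isotropy_index e N) (isotropy_index e B2) (Lt_order e f1 f2) (L_order e f2)"
    by (intro allI ballI impI) (rule inv)
  ultimately show ?thesis unfolding U7_invariants_def Let_def by (rule conjI)
qed

end
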